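(* Let $k$ be a field, $A$ a $k$-algebra, $R=\sum R^1\otimes R^2\in A\otimes A$ a unitary invertible solution of the pentagon equation $R^{12}R^{13}R^{23}=R^{23}R^{12}$, and let $P=P(A,R)=R_{(l)}$, $H=H(A,R)=R_{(r)}$ be the subspaces of left, respectively right, coefficients of $R$. Then: 1) $P$ and $H$ are subalgebras of $A$ and Hopf algebras with comultiplications given by $$\Delta_P:P\to P\otimes P,\quad \Delta_P(x)=R^{-1}(1_A\otimes x)R,\qquad \Delta_H:H\to H\otimes H,\quad \Delta_H(y)=R(y\otimes 1_A)R^{-1}$$ for all $x\in P$, $y\in H$. Furthermore, the subalgebra $A_R$ of $A$ generated by $H$ and $P$ is finite dimensional and $\dim(A_R)\le l(R)^2$. 2) The $k$-linear map $f:P^*\to H$, $f(p^* )=\sum\langle p^*,R^1\rangle R^2$, is an isomorphism of Hopf algebras. 3) The $k$-linear map $F:\mathcal{H}(P)\to A$, $F(p\# p^* )=\sum\langle p^*,R^1\rangle R^2p$, is an algebra map and $R=(F\otimes F)(\mathcal{R})$, where $\mathcal{R}\in\mathcal{H}(P)\otimes\mathcal{H}(P)$ is the canonical element associated to the Heisenberg double $\mathcal{H}(P)$. 4) The multiplication on $A$ defines isomorphisms $$A^{R,r}\otimes P\cong A\qquad(\text{resp. } H\otimes A^{R,l}\cong A)$$ of right $P$-modules (resp. left $H$-modules). In particular, $A$ is free as a right $P$-module and as a left $H$-module and, if $A$ is finite dimensional, $$\dim(P)=\dim(H)=\frac{\dim(A)}{\dim(A^{R,l})}=\frac{\dim(A)}{\dim(A^{R,r})}.$$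 5) If $f:A\to B$ is an algebra isomorphism and $S=(f\otimes f)(R)$, then the Hopf algebras $P(A,R)$ and $P(B,S)$ are isomorphic. Consequently, there exists a Hopf algebra isomorphism $P(A,R)\cong P(A,{}^uR)$ for any invertible $u\in A$, where ${}^uR=(u\otimes u)R(u\otimes u)^{-1}$.
   Context: All vector spaces, algebras (associative, unital), Hopf algebras and tensor products are over the field $k$; algebra maps are unital. For $R=\sum R^1\otimes R^2\in A\otimes A$, $R^{12}=\sum R^1\otimes R^2\otimes 1_A$, $R^{13}=\sum R^1\otimes 1_A\otimes R^2$, $R^{23}=\sum 1_A\otimes R^1\otimes R^2$ in $A\otimes A\otimes A$. For $0\ne R\in A\otimes A$: $R_{(l)}=\{\sum\langle a^*,R^2\rangle R^1\mid a^*\in A^*\}$ and $R_{(r)}=\{\sum\langle a^*,R^1\rangle R^2\mid a^*\in A^*\}$. The length $l(R)$ is the smallest $m$ such that $R=\sum_{i=1}^m a_i\otimes b_i$ (then $\{a_i\}$, $\{b_i\}$ are bases of $R_{(l)}$, $R_{(r)}$, so $R\in R_{(l)}\otimes R_{(r)}$ and expressions such as $\langle p^*,R^1\rangle$ for $p^*\in R_{(l)}^*$ make sense). $R$ is called unitary if $1_A\in R_{(l)}\cap R_{(r)}$. $A^{R,l}=\{a\in A\mid R(a\otimes 1_A)=a\otimes 1_A\}$ and $A^{R,r}=\{a\in A\mid(1_A\otimes a)R=1_A\otimes a\}$. $A^{R,r}\otimes P$ is a right $P$-module via $(a\otimes x)\cdot y=a\otimes xy$, and $H\otimes A^{R,l}$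 is a left $H$-module via multiplication on the first factor. For a finite dimensional Hopf algebra $L$, $L^*$ is the dual Hopf algebra (convolution product), and $L$ acts on $L^*$ by $\langle h\cdot g^*,h'\rangle=\langle g^*,h'h\rangle$. The Heisenberg double $\mathcal{H}(L)=L\#L^*$ is $L\otimes L^*$ as a vector space, with multiplication $(h\#h^* )(g\#g^* )=h_{(2)}g\#h^*(h_{(1)}\cdot g^* )$ (Sweedler notation $\Delta(h)=h_{(1)}\otimes h_{(2)}$) and unit $1_L\#\varepsilon_L$. Its canonical element is $\mathcal{R}=\sum_i(e_i\#\varepsilon_L)\otimes(1_L\#e_i^* )\in\mathcal{H}(L)\otimes\mathcal{H}(L)$, where $\{e_i\}$ is a basis of $L$ with dual basis $\{e_i^*\}$ of $L^*$ (independent of the choice of basis). *)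

theory Defs
  imports Complex_Main "HOL-Algebra.Group" "HOL-Library.Function_Algebras"
begin

section \<open>Vector spaces and algebras over a field\<close>

text \<open>
  The ground field is the type \<open>'k\<close>. A vector space is a subspace \<open>carrier V\<close> of an ambient vector
  space which is a whole type, so that linear subspaces, duals and tensor products of such spaces
  are again of this form. Addition and zero are those of the ambient type; all other operations
  are meaningful on the carrier only.
\<close>

record ('k, 'v) kspace = "'v partial_object" +
  scl :: "'k \<Rightarrow> 'v \<Rightarrow> 'v"

record ('k, 'v) kalg = "('k, 'v) kspace" +
  mul :: "'v \<Rightarrow> 'v \<Rightarrow> 'v"
  unity :: 'v

locale k_space =
  fixes V :: "('k::field, 'v::ab_group_add, 'm) kspace_scheme"
  assumes vector_space: "vector_space (scl V)"
    and subspace: "module.subspace (scl V) (carrier V)"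

definition linear_on ::
  "('k::field, 'v::ab_group_add, 'm) kspace_scheme \<Rightarrow> ('k, 'w::ab_group_add, 'n) kspace_scheme \<Rightarrow>
    ('v \<Rightarrow> 'w) \<Rightarrow> bool" where
  "linear_on V W f \<longleftrightarrow> f \<in> carrier V \<rightarrow> carrier W \<and>
     (\<forall>x\<in>carrier V. \<forall>y\<in>carrier V. f (x + y) = f x + f y) \<and>
     (\<forall>c. \<forall>x\<in>carrier V. f (scl V c x) = scl W c (f x))"

definition bilinear_on ::
  "('k::field, 'v::ab_group_add, 'm) kspace_scheme \<Rightarrow> ('k, 'w::ab_group_add, 'n) kspace_scheme \<Rightarrow>
    ('k, 'u::ab_group_add, 'o) kspace_scheme \<Rightarrow> ('v \<Rightarrow> 'w \<Rightarrow> 'u) \<Rightarrow> bool" where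
  "bilinear_on V W U \<beta> \<longleftrightarrow>
     (\<forall>v\<in>carrier V. linear_on W U (\<beta> v)) \<and> (\<forall>w\<in>carrier W. linear_on V U (\<lambda>v. \<beta> v w))"

definition ground :: "('k::field, 'k) kalg" where
  "ground = \<lparr>carrier = UNIV, scl = (*), mul = (*), unity = 1\<rparr>"

definition is_basis :: "('k::field, 'v::ab_group_add, 'm) kspace_scheme \<Rightarrow> 'v set \<Rightarrow> bool" where
  "is_basis V B \<longleftrightarrow> B \<subseteq> carrier V \<and> \<not> module.dependent (scl V) B \<and>
     module.span (scl V) B = carrier V"

definition fin_dim :: "('k::field, 'v::ab_group_add, 'm) kspace_scheme \<Rightarrow> bool" where
  "fin_dim V \<longleftrightarrow> (\<exists>B. finite B \<and> B \<subseteq> carrier V \<and> module.span (scl V) B = carrier V)"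

definition kdim :: "('k::field, 'v::ab_group_add, 'm) kspace_scheme \<Rightarrow> nat" where
  "kdim V = vector_space.dim (scl V) (carrier V)"

abbreviation mult_monoid :: "('k, 'v, 'm) kalg_scheme \<Rightarrow> 'v monoid" where
  "mult_monoid A \<equiv> \<lparr>carrier = carrier A, monoid.mult = mul A, one = unity A\<rparr>"

locale k_algebra = k_space A for A :: "('k::field, 'v::ab_group_add, 'm) kalg_scheme" +
  assumes monoid: "monoid (mult_monoid A)"
    and bilinear: "bilinear_on A A A (mul A)"

definition subalgebra :: "('k::field, 'v::ab_group_add, 'm) kalg_scheme \<Rightarrow> 'v set \<Rightarrow> bool" where
  "subalgebra A S \<longleftrightarrow> S \<subseteq> carrier A \<and> module.subspace (scl A) S \<and> unity A \<in> S \<and>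
     (\<forall>x\<in>S. \<forall>y\<in>S. mul A x y \<in> S)"

definition alg_hom ::
  "('k::field, 'v::ab_group_add, 'm) kalg_scheme \<Rightarrow> ('k, 'w::ab_group_add, 'n) kalg_scheme \<Rightarrow>
    ('v \<Rightarrow> 'w) \<Rightarrow> bool" where
  "alg_hom A B f \<longleftrightarrow> linear_on A B f \<and> f (unity A) = unity B \<and>
     (\<forall>x\<in>carrier A. \<forall>y\<in>carrier A. f (mul A x y) = mul B (f x) (f y))"

definition alg_iso ::
  "('k::field, 'v::ab_group_add, 'm) kalg_scheme \<Rightarrow> ('k, 'w::ab_group_add, 'n) kalg_scheme \<Rightarrow>
    ('v \<Rightarrow> 'w) \<Rightarrow> bool" where
  "alg_iso A B f \<longleftrightarrow> alg_hom A B f \<and> bij_betw f (carrier A) (carrier B)"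


section \<open>Dual spaces and tensor products\<close>

definition fun_scl :: "'k::field \<Rightarrow> ('x \<Rightarrow> 'k) \<Rightarrow> 'x \<Rightarrow> 'k" where
  "fun_scl c \<phi> = (\<lambda>x. c * \<phi> x)"

text \<open>Functionals on \<open>V\<close> are normalised to be zero off the carrier, so that equal functionals are
  equal functions.\<close>

definition dual :: "('k::field, 'v::ab_group_add, 'm) kspace_scheme \<Rightarrow> ('k, 'v \<Rightarrow> 'k) kspace" where
  "dual V = \<lparr>carrier = {\<phi>. linear_on V (ground :: ('k, 'k) kalg) \<phi> \<and> (\<forall>x. x \<notin> carrier V \<longrightarrow> \<phi> x = 0)},
     scl = fun_scl\<rparr>"

text \<open>
  The tensor \<open>v \<otimes> w\<close> is modelled as evaluation of bilinear forms at \<open>(v, w)\<close>, and \<open>V \<otimes> W\<close> as the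
  span of these. The forms are taken on the ambient spaces, so for subspaces \<open>V' \<le> V\<close>, \<open>W' \<le> W\<close>
  the space \<open>V' \<otimes> W'\<close> is literally a subspace of \<open>V \<otimes> W\<close>. That this is the tensor product is
  shown below: \<open>bilinear_on_tensor\<close> and \<open>tensor_universal\<close>.
\<close>

definition tensor ::
  "('k::field, 'v::ab_group_add, 'm) kspace_scheme \<Rightarrow> ('k, 'w::ab_group_add, 'n) kspace_scheme \<Rightarrow>
    'v \<Rightarrow> 'w \<Rightarrow> ('v \<Rightarrow> 'w \<Rightarrow> 'k) \<Rightarrow> 'k" where
  "tensor V W v w = (\<lambda>\<beta>.
     if bilinear_on (V\<lparr>carrier := UNIV\<rparr>) (W\<lparr>carrier := UNIV\<rparr>) (ground :: ('k, 'k) kalg) \<beta>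
     then \<beta> v w else 0)"

definition tensor_space ::
  "('k::field, 'v::ab_group_add, 'm) kspace_scheme \<Rightarrow> ('k, 'w::ab_group_add, 'n) kspace_scheme \<Rightarrow>
    ('k, ('v \<Rightarrow> 'w \<Rightarrow> 'k) \<Rightarrow> 'k) kspace" where
  "tensor_space V W =
     \<lparr>carrier = module.span fun_scl {tensor V W v w | v w. v \<in> carrier V \<and> w \<in> carrier W},
      scl = fun_scl\<rparr>"

text \<open>\<open>tensor_lift V W \<beta>\<close> is the linear map on \<open>V \<otimes> W\<close> induced by the bilinear map \<open>\<beta>\<close>:
  \<open>T = \<Sum> T\<^sup>1 \<otimes> T\<^sup>2\<close> is sent to \<open>\<Sum> \<beta> T\<^sup>1 T\<^sup>2\<close>.\<close>

definition tensor_lift ::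
  "('k::field, 'v::ab_group_add, 'm) kspace_scheme \<Rightarrow> ('k, 'w::ab_group_add, 'n) kspace_scheme \<Rightarrow>
    ('v \<Rightarrow> 'w \<Rightarrow> 'u::ab_group_add) \<Rightarrow> (('v \<Rightarrow> 'w \<Rightarrow> 'k) \<Rightarrow> 'k) \<Rightarrow> 'u" where
  "tensor_lift V W \<beta> T = (THE u. \<exists>ts. set ts \<subseteq> carrier V \<times> carrier W \<and>
     T = (\<Sum>(v, w)\<leftarrow>ts. tensor V W v w) \<and> u = (\<Sum>(v, w)\<leftarrow>ts. \<beta> v w))"

definition tensor_map ::
  "('k::field, 'v::ab_group_add, 'm) kspace_scheme \<Rightarrow> ('k, 'w::ab_group_add, 'n) kspace_scheme \<Rightarrow>
    ('k, 'v'::ab_group_add, 'm') kspace_scheme \<Rightarrow> ('k, 'w'::ab_group_add, 'n') kspace_scheme \<Rightarrow>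
    ('v \<Rightarrow> 'v') \<Rightarrow> ('w \<Rightarrow> 'w') \<Rightarrow> (('v \<Rightarrow> 'w \<Rightarrow> 'k) \<Rightarrow> 'k) \<Rightarrow> ('v' \<Rightarrow> 'w' \<Rightarrow> 'k) \<Rightarrow> 'k" where
  "tensor_map V W V' W' f g = tensor_lift V W (\<lambda>v w. tensor V' W' (f v) (g w))"

definition tensor_alg ::
  "('k::field, 'v::ab_group_add, 'm) kalg_scheme \<Rightarrow> ('k, 'w::ab_group_add, 'n) kalg_scheme \<Rightarrow>
    ('k, ('v \<Rightarrow> 'w \<Rightarrow> 'k) \<Rightarrow> 'k) kalg" where
  "tensor_alg A B =
     \<lparr>carrier = carrier (tensor_space A B), scl = scl (tensor_space A B),
      mul = (\<lambda>X Y. tensor_lift A B (\<lambda>a b. tensor_lift A B (\<lambda>c d.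
               tensor A B (mul A a c) (mul B b d)) Y) X),
      unity = tensor A B (unity A) (unity B)\<rparr>"

lemma vector_space_ground: "vector_space (scl (ground :: ('k::field, 'k) kalg))"
  by unfold_locales (simp_all add: ground_def algebra_simps)

lemma vector_space_fun_scl: "vector_space (fun_scl :: 'k::field \<Rightarrow> ('x \<Rightarrow> 'k) \<Rightarrow> _)"
  by unfold_locales (simp_all add: fun_scl_def plus_fun_def algebra_simps)

lemma k_space_tensor_space:
  fixes V :: "('k::field, 'v::ab_group_add, 'm) kspace_scheme"
    and W :: "('k, 'w::ab_group_add, 'n) kspace_scheme"
  shows "k_space (tensor_space V W)"
proof -
  interpret vector_space "fun_scl :: 'k \<Rightarrow> (('v \<Rightarrow> 'w \<Rightarrow> 'k) \<Rightarrow> 'k) \<Rightarrow> _"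
    by (rule vector_space_fun_scl)
  show ?thesis
    unfolding k_space_def by (auto simp: tensor_space_def intro: vector_space_axioms)
qed

lemma bilinear_on_tensor:
  fixes V :: "('k::field, 'v::ab_group_add, 'm) kspace_scheme"
    and W :: "('k, 'w::ab_group_add, 'n) kspace_scheme"
  shows "bilinear_on V W (tensor_space V W) (tensor V W)"
proof -
  interpret vector_space "fun_scl :: 'k \<Rightarrow> (('v \<Rightarrow> 'w \<Rightarrow> 'k) \<Rightarrow> 'k) \<Rightarrow> _"
    by (rule vector_space_fun_scl)
  have "tensor V W v w \<in> carrier (tensor_space V W)"
    if "v \<in> carrier V" "w \<in> carrier W" for v w
    using that by (auto simp: tensor_space_def intro: span_base)
  then show ?thesis
    unfolding bilinear_on_def linear_on_def
    by (auto simp: tensor_def fun_eq_iff plus_fun_def tensor_space_def fun_scl_def ground_def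
        bilinear_on_def linear_on_def)
qed

lemma tensor_space_sum:
  fixes V :: "('k::field, 'v::ab_group_add, 'm) kspace_scheme"
    and W :: "('k, 'w::ab_group_add, 'n) kspace_scheme"
  assumes V: "k_space V" and T: "T \<in> carrier (tensor_space V W)"
  obtains ts where "set ts \<subseteq> carrier V \<times> carrier W" "T = (\<Sum>(v, w)\<leftarrow>ts. tensor V W v w)"
proof -
  interpret vector_space "fun_scl :: 'k \<Rightarrow> (('v \<Rightarrow> 'w \<Rightarrow> 'k) \<Rightarrow> 'k) \<Rightarrow> _"
    by (rule vector_space_fun_scl)
  interpret V: vector_space "scl V"
    using V by (rule k_space.vector_space)
  have "\<exists>ts. set ts \<subseteq> carrier V \<times> carrier W \<and> T = (\<Sum>(v, w)\<leftarrow>ts. tensor V W v w)"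
    using T unfolding tensor_space_def kspace.simps partial_object.simps
  proof (induction T rule: span_induct_alt)
    case base
    then show ?case by (intro exI[of _ "[]"]) simp
  next
    case (step c x y)
    then obtain ts v w where ts: "set ts \<subseteq> carrier V \<times> carrier W"
      "y = (\<Sum>(v, w)\<leftarrow>ts. tensor V W v w)" and vw: "x = tensor V W v w"
      "v \<in> carrier V" "w \<in> carrier W"
      by auto
    have "fun_scl c x = tensor V W (scl V c v) w"
      using bilinear_on_tensor[of V W] vw
      by (auto simp: bilinear_on_def linear_on_def tensor_space_def)
    then show ?case
      using ts vw V.subspace_scale[OF k_space.subspace[OF V]]
      by (intro exI[of _ "(scl V c v, w) # ts"]) auto
  qed
  with that show thesis by blast
qed

lemma k_space_projection:
  assumes V: "k_space V"
  obtains p where "linear_on (V\<lparr>carrier := UNIV\<rparr>) V p" "\<And>x. x \<in> carrier V \<Longrightarrow> p x = x"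
proof -
  interpret V: vector_space "scl V"
    using V by (rule k_space.vector_space)
  interpret vector_space_pair "scl V" "scl V" ..
  obtain B where B: "B \<subseteq> carrier V" "V.independent B" "carrier V \<subseteq> V.span B"
    by (rule V.maximal_independent_subset)
  have span: "V.span B = carrier V"
    using B V.span_minimal[OF _ k_space.subspace[OF V]] by blast
  obtain p where p: "Vector_Spaces.linear (scl V) (scl V) p" "\<forall>x\<in>B. p x = id x"
    "range p = V.span (id ` B)"
    using linear_independent_extend_subspace[OF B(2), of id] by blast
  interpret p: Vector_Spaces.linear "scl V" "scl V" p by fact
  have "p x = x" if "x \<in> carrier V" for x
  proof -
    have "x \<in> V.span B" using that span by simp
    then show ?thesis
      using p(2) by (induction rule: V.span_induct_alt) (auto simp: p.add p.scale)
  qed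
  moreover have "linear_on (V\<lparr>carrier := UNIV\<rparr>) V p"
    using p(3) span by (auto simp: linear_on_def p.add p.scale)
  ultimately show thesis by (rule that[rotated])
qed

lemma separating_functional:
  fixes s :: "'k::field \<Rightarrow> 'u::ab_group_add \<Rightarrow> 'u"
  assumes "vector_space s" "u \<noteq> 0"
  obtains \<phi> where "Vector_Spaces.linear s (*) \<phi>" "\<phi> u = 1"
proof -
  interpret s: vector_space s by fact
  interpret k: vector_space "(*) :: 'k \<Rightarrow> 'k \<Rightarrow> 'k"
    by unfold_locales (simp_all add: algebra_simps)
  interpret vector_space_pair s "(*) :: 'k \<Rightarrow> 'k \<Rightarrow> 'k" ..
  show thesis
    using linear_independent_extend[of "{u}" "\<lambda>_. 1"] assms(2) that by auto
qed

lemma linear_on_sum_list: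
  assumes "linear_on V W f" "k_space V" "vector_space (scl W)" "set xs \<subseteq> carrier V"
  shows "sum_list xs \<in> carrier V \<and> f (sum_list xs) = sum_list (map f xs)"
proof -
  interpret V: vector_space "scl V" using assms(2) by (rule k_space.vector_space)
  interpret W: vector_space "scl W" by fact
  note sub = k_space.subspace[OF assms(2)]
  have "f (scl V 0 0) = scl W 0 (f 0)"
    using assms(1) V.subspace_0[OF sub] unfolding linear_on_def by blast
  then have "f 0 = 0" by simp
  then show ?thesis
    using assms(4) assms(1)
    by (induction xs) (auto simp: V.subspace_0[OF sub] V.subspace_add[OF sub] linear_on_def)
qed

text \<open>\<open>tensor_lift\<close> does not depend on the chosen representation.\<close>

lemma tensor_lift_sum_list:
  fixes V :: "('k::field, 'v::ab_group_add, 'm) kspace_scheme"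
    and W :: "('k, 'w::ab_group_add, 'n) kspace_scheme"
    and U :: "('k, 'u::ab_group_add, 'o) kspace_scheme"
  assumes V: "k_space V" and W: "k_space W" and U: "k_space U"
    and \<beta>: "bilinear_on V W U \<beta>" and ts: "set ts \<subseteq> carrier V \<times> carrier W"
  shows "tensor_lift V W \<beta> (\<Sum>(v, w)\<leftarrow>ts. tensor V W v w) = (\<Sum>(v, w)\<leftarrow>ts. \<beta> v w)"
proof -
  interpret U: vector_space "scl U" using U by (rule k_space.vector_space)
  have uniq: "(\<Sum>(v, w)\<leftarrow>ts. \<beta> v w) = (\<Sum>(v, w)\<leftarrow>ss. \<beta> v w)"
    if eq: "(\<Sum>(v, w)\<leftarrow>ts. tensor V W v w) = (\<Sum>(v, w)\<leftarrow>ss. tensor V W v w)"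
      and ss: "set ss \<subseteq> carrier V \<times> carrier W" for ss
  proof (rule ccontr)
    let ?u = "(\<Sum>(v, w)\<leftarrow>ts. \<beta> v w) - (\<Sum>(v, w)\<leftarrow>ss. \<beta> v w)"
    assume "(\<Sum>(v, w)\<leftarrow>ts. \<beta> v w) \<noteq> (\<Sum>(v, w)\<leftarrow>ss. \<beta> v w)"
    then have "?u \<noteq> 0" by simp
    with U.vector_space_axioms obtain \<phi>
      where \<phi>: "Vector_Spaces.linear (scl U) (*) \<phi>" "\<phi> ?u = 1"
      by (rule separating_functional)
    interpret \<phi>: Vector_Spaces.linear "scl U" "(*)" \<phi> by fact
    obtain p where p: "linear_on (V\<lparr>carrier := UNIV\<rparr>) V p" "\<And>x. x \<in> carrier V \<Longrightarrow> p x = x"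
      using k_space_projection[OF V] by blast
    obtain q where q: "linear_on (W\<lparr>carrier := UNIV\<rparr>) W q" "\<And>x. x \<in> carrier W \<Longrightarrow> q x = x"
      using k_space_projection[OF W] by blast
    define \<gamma> where "\<gamma> = (\<lambda>v w. \<phi> (\<beta> (p v) (q w)))"
    have bil: "bilinear_on (V\<lparr>carrier := UNIV\<rparr>) (W\<lparr>carrier := UNIV\<rparr>) (ground :: ('k, 'k) kalg) \<gamma>"
      using p(1) q(1) \<beta>
      by (auto simp: bilinear_on_def linear_on_def \<gamma>_def ground_def \<phi>.add \<phi>.scale Pi_iff)
    have \<gamma>_eq: "\<gamma> v w = \<phi> (\<beta> v w)" if "v \<in> carrier V" "w \<in> carrier W" for v w
      using that by (simp add: \<gamma>_def p(2) q(2))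
    have eval: "(\<Sum>(v, w)\<leftarrow>rs. tensor V W v w) \<gamma> = \<phi> (\<Sum>(v, w)\<leftarrow>rs. \<beta> v w)"
      if "set rs \<subseteq> carrier V \<times> carrier W" for rs
      using that
      by (induction rs) (auto simp: tensor_def bil \<gamma>_eq \<phi>.add)
    have "\<phi> ?u = 0"
      using eval[OF ts] eval[OF ss] eq by (simp add: \<phi>.diff)
    with \<phi>(2) show False by simp
  qed
  show ?thesis
    unfolding tensor_lift_def
  proof (rule the_equality, goal_cases)
    case 1
    show ?case using ts by blast
  next
    case (2 u)
    then show ?case using uniq by metis
  qed
qed

theorem tensor_universal:
  fixes V :: "('k::field, 'v::ab_group_add, 'm) kspace_scheme"
    and W :: "('k, 'w::ab_group_add, 'n) kspace_scheme"
    and U :: "('k, 'u::ab_group_add, 'o) kspace_scheme"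
  assumes V: "k_space V" and W: "k_space W" and U: "k_space U" and \<beta>: "bilinear_on V W U \<beta>"
  shows "linear_on (tensor_space V W) U (tensor_lift V W \<beta>)"
    and "\<And>v w. v \<in> carrier V \<Longrightarrow> w \<in> carrier W \<Longrightarrow> tensor_lift V W \<beta> (tensor V W v w) = \<beta> v w"
    and "\<And>g T. linear_on (tensor_space V W) U g \<Longrightarrow>
      (\<And>v w. v \<in> carrier V \<Longrightarrow> w \<in> carrier W \<Longrightarrow> g (tensor V W v w) = \<beta> v w) \<Longrightarrow>
      T \<in> carrier (tensor_space V W) \<Longrightarrow> g T = tensor_lift V W \<beta> T"
proof -
  interpret T: vector_space "fun_scl :: 'k \<Rightarrow> (('v \<Rightarrow> 'w \<Rightarrow> 'k) \<Rightarrow> 'k) \<Rightarrow> _"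
    by (rule vector_space_fun_scl)
  interpret V: vector_space "scl V" using V by (rule k_space.vector_space)
  interpret U: vector_space "scl U" using U by (rule k_space.vector_space)
  note lift = tensor_lift_sum_list[OF V W U \<beta>]
  have tensor_in: "tensor V W v w \<in> carrier (tensor_space V W)"
    if "v \<in> carrier V" "w \<in> carrier W" for v w
    using bilinear_on_tensor[of V W] that by (auto simp: bilinear_on_def linear_on_def)
  show "tensor_lift V W \<beta> (tensor V W v w) = \<beta> v w" if "v \<in> carrier V" "w \<in> carrier W" for v w
    using lift[of "[(v, w)]"] that by simp
  show "linear_on (tensor_space V W) U (tensor_lift V W \<beta>)"
    unfolding linear_on_def
  proof (intro conjI ballI allI funcsetI)
    fix X assume "X \<in> carrier (tensor_space V W)"
    then obtain xs where xs: "set xs \<subseteq> carrier V \<times> carrier W" "X = (\<Sum>(v, w)\<leftarrow>xs. tensor V W v w)"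
      by (rule tensor_space_sum[OF V])
    have "(\<Sum>(v, w)\<leftarrow>xs. \<beta> v w) \<in> carrier U"
      using xs(1) \<beta> U.subspace_0[OF k_space.subspace[OF U]] U.subspace_add[OF k_space.subspace[OF U]]
      by (induction xs) (auto simp: bilinear_on_def linear_on_def Pi_iff)
    then show "tensor_lift V W \<beta> X \<in> carrier U"
      using lift[OF xs(1)] xs(2) by simp
    show "tensor_lift V W \<beta> (X + Y) = tensor_lift V W \<beta> X + tensor_lift V W \<beta> Y"
      if Y: "Y \<in> carrier (tensor_space V W)" for Y
    proof -
      obtain ys where ys: "set ys \<subseteq> carrier V \<times> carrier W" "Y = (\<Sum>(v, w)\<leftarrow>ys. tensor V W v w)"
        using Y by (rule tensor_space_sum[OF V])
      show ?thesis
        using lift[of "xs @ ys"] lift[of xs] lift[of ys] xs ys by simp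
    qed
    show "tensor_lift V W \<beta> (scl (tensor_space V W) c X) = scl U c (tensor_lift V W \<beta> X)" for c
    proof -
      let ?xs = "map (\<lambda>(v, w). (scl V c v, w)) xs"
      have sub: "set ?xs \<subseteq> carrier V \<times> carrier W"
        using xs(1) V.subspace_scale[OF k_space.subspace[OF V]] by auto
      have scale: "scl (tensor_space V W) c X = (\<Sum>(v, w)\<leftarrow>?xs. tensor V W v w)"
        using xs(1) unfolding xs(2)
      proof (induction xs)
        case Nil
        show ?case by (simp add: tensor_space_def fun_scl_def fun_eq_iff)
      next
        case (Cons a xs)
        then show ?case
          using bilinear_on_tensor[of V W]
          by (auto simp: tensor_space_def bilinear_on_def linear_on_def fun_scl_def fun_eq_iff
                distrib_left)
      qed
      have \<beta>_scale: "(\<Sum>(v, w)\<leftarrow>?xs. \<beta> v w) = scl U c (\<Sum>(v, w)\<leftarrow>xs. \<beta> v w)"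
        using xs(1)
      proof (induction xs)
        case Nil
        show ?case by simp
      next
        case (Cons a xs)
        then show ?case
          using \<beta> by (auto simp: U.scale_right_distrib bilinear_on_def linear_on_def)
      qed
      show ?thesis
        unfolding scale lift[OF sub] \<beta>_scale unfolding xs(2) lift[OF xs(1)] ..
    qed
  qed
  show "g T = tensor_lift V W \<beta> T"
    if g: "linear_on (tensor_space V W) U g"
      "\<And>v w. v \<in> carrier V \<Longrightarrow> w \<in> carrier W \<Longrightarrow> g (tensor V W v w) = \<beta> v w"
      and T: "T \<in> carrier (tensor_space V W)" for g T
  proof -
    obtain ts where ts: "set ts \<subseteq> carrier V \<times> carrier W" "T = (\<Sum>(v, w)\<leftarrow>ts. tensor V W v w)"
      using T by (rule tensor_space_sum[OF V])
    have sub: "set (map (\<lambda>(v, w). tensor V W v w) ts) \<subseteq> carrier (tensor_space V W)"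
      using tensor_in ts(1) by fastforce
    have "g T = sum_list (map g (map (\<lambda>(v, w). tensor V W v w) ts))"
      using linear_on_sum_list[OF g(1) k_space_tensor_space U.vector_space_axioms sub] ts(2) by simp
    also have "map g (map (\<lambda>(v, w). tensor V W v w) ts) = map (\<lambda>(v, w). \<beta> v w) ts"
      using ts(1) g(2) by auto
    finally show ?thesis
      using lift[OF ts(1)] ts(2) by simp
  qed
qed


section \<open>Hopf algebras\<close>

record ('k, 'v) khopf = "('k, 'v) kalg" +
  comul :: "'v \<Rightarrow> ('v \<Rightarrow> 'v \<Rightarrow> 'k) \<Rightarrow> 'k"
  counit :: "'v \<Rightarrow> 'k"
  antipode :: "'v \<Rightarrow> 'v"

definition coassociative ::
  "('k::field, 'v::ab_group_add, 'm) kspace_scheme \<Rightarrow> ('v \<Rightarrow> ('v \<Rightarrow> 'v \<Rightarrow> 'k) \<Rightarrow> 'k) \<Rightarrow> bool" where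
  "coassociative C \<Delta> \<longleftrightarrow> (\<forall>x\<in>carrier C.
     tensor_lift C C (\<lambda>a b. tensor_lift C C
       (\<lambda>c d. tensor C (tensor_space C C) c (tensor C C d b)) (\<Delta> a)) (\<Delta> x) =
     tensor_lift C C (\<lambda>a b. tensor C (tensor_space C C) a (\<Delta> b)) (\<Delta> x))"

definition is_counit ::
  "('k::field, 'v::ab_group_add, 'm) kspace_scheme \<Rightarrow> ('v \<Rightarrow> ('v \<Rightarrow> 'v \<Rightarrow> 'k) \<Rightarrow> 'k) \<Rightarrow>
    ('v \<Rightarrow> 'k) \<Rightarrow> bool" where
  "is_counit C \<Delta> e \<longleftrightarrow> e \<in> carrier (dual C) \<and>
     (\<forall>x\<in>carrier C. tensor_lift C C (\<lambda>a b. scl C (e a) b) (\<Delta> x) = x \<and>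
                    tensor_lift C C (\<lambda>a b. scl C (e b) a) (\<Delta> x) = x)"

definition is_antipode ::
  "('k::field, 'v::ab_group_add, 'm) kalg_scheme \<Rightarrow> ('v \<Rightarrow> ('v \<Rightarrow> 'v \<Rightarrow> 'k) \<Rightarrow> 'k) \<Rightarrow>
    ('v \<Rightarrow> 'k) \<Rightarrow> ('v \<Rightarrow> 'v) \<Rightarrow> bool" where
  "is_antipode L \<Delta> e S \<longleftrightarrow> linear_on L L S \<and> (\<forall>x. x \<notin> carrier L \<longrightarrow> S x = 0) \<and>
     (\<forall>x\<in>carrier L. tensor_lift L L (\<lambda>a b. mul L (S a) b) (\<Delta> x) = scl L (e x) (unity L) \<and>
                    tensor_lift L L (\<lambda>a b. mul L a (S b)) (\<Delta> x) = scl L (e x) (unity L))"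

locale hopf_algebra = k_algebra L for L :: "('k::field, 'v::ab_group_add, 'm) khopf_scheme" +
  assumes coassociative: "coassociative L (comul L)"
    and counit: "is_counit L (comul L) (counit L)"
    and comul_hom: "alg_hom L (tensor_alg L L) (comul L)"
    and counit_hom: "alg_hom L (ground :: ('k, 'k) kalg) (counit L)"
    and antipode: "is_antipode L (comul L) (counit L) (antipode L)"

definition hopf_hom ::
  "('k::field, 'v::ab_group_add, 'm) khopf_scheme \<Rightarrow> ('k, 'w::ab_group_add, 'n) khopf_scheme \<Rightarrow>
    ('v \<Rightarrow> 'w) \<Rightarrow> bool" where
  "hopf_hom K L f \<longleftrightarrow> alg_hom K L f \<and>
     (\<forall>x\<in>carrier K. comul L (f x) = tensor_map K K L L f f (comul K x) \<and>
        counit L (f x) = counit K x \<and> antipode L (f x) = f (antipode K x))"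

definition hopf_iso ::
  "('k::field, 'v::ab_group_add, 'm) khopf_scheme \<Rightarrow> ('k, 'w::ab_group_add, 'n) khopf_scheme \<Rightarrow>
    ('v \<Rightarrow> 'w) \<Rightarrow> bool" where
  "hopf_iso K L f \<longleftrightarrow> hopf_algebra K \<and> hopf_algebra L \<and> hopf_hom K L f \<and>
     bij_betw f (carrier K) (carrier L)"

definition hopf_isomorphic ::
  "('k::field, 'v::ab_group_add, 'm) khopf_scheme \<Rightarrow> ('k, 'w::ab_group_add, 'n) khopf_scheme \<Rightarrow>
    bool" where
  "hopf_isomorphic K L \<longleftrightarrow> (\<exists>f. hopf_iso K L f)"

text \<open>A counit of a comultiplication and an antipode of a bialgebra are unique if they exist, so the
  algebra and the comultiplication determine the Hopf algebra.\<close>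

definition hopf_of ::
  "('k::field, 'v::ab_group_add) kalg \<Rightarrow> ('v \<Rightarrow> ('v \<Rightarrow> 'v \<Rightarrow> 'k) \<Rightarrow> 'k) \<Rightarrow> ('k, 'v) khopf" where
  "hopf_of A \<Delta> =
     (let e = (THE e. is_counit A \<Delta> e) in
      \<lparr>carrier = carrier A, scl = scl A, mul = mul A, unity = unity A,
       comul = \<Delta>, counit = e, antipode = (THE S. is_antipode A \<Delta> e S)\<rparr>)"

text \<open>The dual of a finite dimensional Hopf algebra. Its comultiplication is the transpose of the
  multiplication under the identification of \<open>(L \<otimes> L)\<^sup>*\<close> with \<open>L\<^sup>* \<otimes> L\<^sup>*\<close>.\<close>

definition dual_hopf ::
  "('k::field, 'v::ab_group_add, 'm) khopf_scheme \<Rightarrow> ('k, 'v \<Rightarrow> 'k) khopf" where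
  "dual_hopf L =
     \<lparr>carrier = carrier (dual L), scl = scl (dual L),
      mul = (\<lambda>\<phi> \<psi> x. if x \<in> carrier L
               then tensor_lift L L (\<lambda>a b. \<phi> a * \<psi> b) (comul L x) else 0),
      unity = (\<lambda>x. if x \<in> carrier L then counit L x else 0),
      comul = (\<lambda>\<phi>. THE T. T \<in> carrier (tensor_space (dual L) (dual L)) \<and>
                (\<forall>x\<in>carrier L. \<forall>y\<in>carrier L.
                   tensor_lift (dual L) (dual L) (\<lambda>\<psi> \<chi>. \<psi> x * \<chi> y) T = \<phi> (mul L x y))),
      counit = (\<lambda>\<phi>. if \<phi> \<in> carrier (dual L) then \<phi> (unity L) else 0),
      antipode = (\<lambda>\<phi>. if \<phi> \<in> carrier (dual L)
                    then (\<lambda>x. if x \<in> carrier L then \<phi> (antipode L x) else 0) else 0)\<rparr>"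


section \<open>The Heisenberg double\<close>

text \<open>\<open>\<langle>h \<cdot> \<phi>, h'\<rangle> = \<langle>\<phi>, h' h\<rangle>\<close>\<close>

definition dual_act ::
  "('k::field, 'v::ab_group_add, 'm) khopf_scheme \<Rightarrow> 'v \<Rightarrow> ('v \<Rightarrow> 'k) \<Rightarrow> 'v \<Rightarrow> 'k" where
  "dual_act L h \<phi> = (\<lambda>x. if x \<in> carrier L then \<phi> (mul L x h) else 0)"

text \<open>\<open>h # \<phi>\<close> is \<open>tensor L (dual_hopf L) h \<phi>\<close>, and
  \<open>(h # \<phi>) (g # \<psi>) = h\<^sub>2 g # \<phi> (h\<^sub>1 \<cdot> \<psi>)\<close>.\<close>

definition heisenberg ::
  "('k::field, 'v::ab_group_add, 'm) khopf_scheme \<Rightarrow>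
    ('k, ('v \<Rightarrow> ('v \<Rightarrow> 'k) \<Rightarrow> 'k) \<Rightarrow> 'k) kalg" where
  "heisenberg L =
     (let D = dual_hopf L in
      \<lparr>carrier = carrier (tensor_space L D), scl = scl (tensor_space L D),
       mul = (\<lambda>X Y. tensor_lift L D (\<lambda>h \<phi>. tensor_lift L D (\<lambda>g \<psi>. tensor_lift L L
                (\<lambda>h1 h2. tensor L D (mul L h2 g) (mul D \<phi> (dual_act L h1 \<psi>)))
                (comul L h)) Y) X),
       unity = tensor L D (unity L) (unity D)\<rparr>)"

definition dual_basis ::
  "('k::field, 'v::ab_group_add, 'm) kspace_scheme \<Rightarrow> 'v set \<Rightarrow> 'v \<Rightarrow> 'v \<Rightarrow> 'k" where
  "dual_basis V B e = (\<lambda>x. if x \<in> carrier V then module.representation (scl V) B x e else 0)"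

definition heisenberg_canonical ::
  "('k::field, 'v::ab_group_add, 'm) khopf_scheme \<Rightarrow> 'v set \<Rightarrow> _" where
  "heisenberg_canonical L B =
     (let D = dual_hopf L in
      \<Sum>e\<in>B. tensor (heisenberg L) (heisenberg L)
        (tensor L D e (unity D)) (tensor L D (unity L) (dual_basis L B e)))"


section \<open>Modules over an algebra\<close>

definition right_module ::
  "('k::field, 'v::ab_group_add, 'm) kalg_scheme \<Rightarrow> ('k, 'w::ab_group_add, 'n) kspace_scheme \<Rightarrow>
    ('w \<Rightarrow> 'v \<Rightarrow> 'w) \<Rightarrow> bool" where
  "right_module P M act \<longleftrightarrow> k_algebra P \<and> k_space M \<and> bilinear_on M P M act \<and>
     (\<forall>m\<in>carrier M. act m (unity P) = m \<and>
        (\<forall>x\<in>carrier P. \<forall>y\<in>carrier P. act m (mul P x y) = act (act m x) y))"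

definition left_module ::
  "('k::field, 'v::ab_group_add, 'm) kalg_scheme \<Rightarrow> ('k, 'w::ab_group_add, 'n) kspace_scheme \<Rightarrow>
    ('v \<Rightarrow> 'w \<Rightarrow> 'w) \<Rightarrow> bool" where
  "left_module H M act \<longleftrightarrow> k_algebra H \<and> k_space M \<and> bilinear_on H M M act \<and>
     (\<forall>m\<in>carrier M. act (unity H) m = m \<and>
        (\<forall>x\<in>carrier H. \<forall>y\<in>carrier H. act (mul H x y) m = act x (act y m)))"

definition right_module_iso where
  "right_module_iso P M act N act' f \<longleftrightarrow> right_module P M act \<and> right_module P N act' \<and>
     linear_on M N f \<and> bij_betw f (carrier M) (carrier N) \<and>
     (\<forall>m\<in>carrier M. \<forall>x\<in>carrier P. f (act m x) = act' (f m) x)"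

definition left_module_iso where
  "left_module_iso H M act N act' f \<longleftrightarrow> left_module H M act \<and> left_module H N act' \<and>
     linear_on M N f \<and> bij_betw f (carrier M) (carrier N) \<and>
     (\<forall>m\<in>carrier M. \<forall>x\<in>carrier H. f (act x m) = act' x (f m))"

definition free_right_module where
  "free_right_module P M act \<longleftrightarrow> right_module P M act \<and>
     (\<exists>B\<subseteq>carrier M. \<forall>m\<in>carrier M. \<exists>!c. (\<forall>b\<in>B. c b \<in> carrier P) \<and> (\<forall>b. b \<notin> B \<longrightarrow> c b = 0) \<and>
        finite {b. c b \<noteq> 0} \<and> m = (\<Sum>b | c b \<noteq> 0. act b (c b)))"

definition free_left_module where
  "free_left_module H M act \<longleftrightarrow> left_module H M act \<and>
     (\<exists>B\<subseteq>carrier M. \<forall>m\<in>carrier M. \<exists>!c. (\<forall>b\<in>B. c b \<in> carrier H) \<and> (\<forall>b. b \<notin> B \<longrightarrow> c b = 0) \<and>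
        finite {b. c b \<noteq> 0} \<and> m = (\<Sum>b | c b \<noteq> 0. act (c b) b))"


section \<open>Solutions of the pentagon equation\<close>

type_synonym ('k, 'a) tens2 = "('a \<Rightarrow> 'a \<Rightarrow> 'k) \<Rightarrow> 'k"

text \<open>\<open>A \<otimes> A \<otimes> A\<close> is realised as \<open>A \<otimes> (A \<otimes> A)\<close>.\<close>

definition leg12 where
  "leg12 A R = tensor_lift A A (\<lambda>a b. tensor A (tensor_alg A A) a (tensor A A b (unity A))) R"

definition leg13 where
  "leg13 A R = tensor_lift A A (\<lambda>a b. tensor A (tensor_alg A A) a (tensor A A (unity A) b)) R"

definition leg23 where
  "leg23 A R = tensor A (tensor_alg A A) (unity A) R"

definition pentagon :: "('k::field, 'a::ab_group_add) kalg \<Rightarrow> ('k, 'a) tens2 \<Rightarrow> bool" where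
  "pentagon A R \<longleftrightarrow>
     (let A3 = tensor_alg A (tensor_alg A A) in
      mul A3 (mul A3 (leg12 A R) (leg13 A R)) (leg23 A R) = mul A3 (leg23 A R) (leg12 A R))"

definition left_coeff :: "('k::field, 'a::ab_group_add) kalg \<Rightarrow> ('k, 'a) tens2 \<Rightarrow> 'a set" where
  "left_coeff A R = {tensor_lift A A (\<lambda>a b. scl A (\<phi> b) a) R | \<phi>. \<phi> \<in> carrier (dual A)}"

definition right_coeff :: "('k::field, 'a::ab_group_add) kalg \<Rightarrow> ('k, 'a) tens2 \<Rightarrow> 'a set" where
  "right_coeff A R = {tensor_lift A A (\<lambda>a b. scl A (\<phi> a) b) R | \<phi>. \<phi> \<in> carrier (dual A)}"

definition tensor_length :: "('k::field, 'a::ab_group_add) kalg \<Rightarrow> ('k, 'a) tens2 \<Rightarrow> nat" where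
  "tensor_length A R = (LEAST m. \<exists>ts. length ts = m \<and> set ts \<subseteq> carrier A \<times> carrier A \<and>
     R = (\<Sum>(a, b)\<leftarrow>ts. tensor A A a b))"

definition unitary :: "('k::field, 'a::ab_group_add) kalg \<Rightarrow> ('k, 'a) tens2 \<Rightarrow> bool" where
  "unitary A R \<longleftrightarrow> unity A \<in> left_coeff A R \<inter> right_coeff A R"

definition tens_inv :: "('k::field, 'a::ab_group_add) kalg \<Rightarrow> ('k, 'a) tens2 \<Rightarrow> ('k, 'a) tens2" where
  "tens_inv A R = inv\<^bsub>mult_monoid (tensor_alg A A)\<^esub> R"

definition alg_P :: "('k::field, 'a::ab_group_add) kalg \<Rightarrow> ('k, 'a) tens2 \<Rightarrow> ('k, 'a) kalg" where
  "alg_P A R = A\<lparr>carrier := left_coeff A R\<rparr>"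

definition alg_H :: "('k::field, 'a::ab_group_add) kalg \<Rightarrow> ('k, 'a) tens2 \<Rightarrow> ('k, 'a) kalg" where
  "alg_H A R = A\<lparr>carrier := right_coeff A R\<rparr>"

definition comul_P ::
  "('k::field, 'a::ab_group_add) kalg \<Rightarrow> ('k, 'a) tens2 \<Rightarrow> 'a \<Rightarrow> ('k, 'a) tens2" where
  "comul_P A R x =
     (let A2 = tensor_alg A A in mul A2 (mul A2 (tens_inv A R) (tensor A A (unity A) x)) R)"

definition comul_H ::
  "('k::field, 'a::ab_group_add) kalg \<Rightarrow> ('k, 'a) tens2 \<Rightarrow> 'a \<Rightarrow> ('k, 'a) tens2" where
  "comul_H A R y =
     (let A2 = tensor_alg A A in mul A2 (mul A2 R (tensor A A y (unity A))) (tens_inv A R))"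

definition hopf_P :: "('k::field, 'a::ab_group_add) kalg \<Rightarrow> ('k, 'a) tens2 \<Rightarrow> ('k, 'a) khopf" where
  "hopf_P A R = hopf_of (alg_P A R) (comul_P A R)"

definition hopf_H :: "('k::field, 'a::ab_group_add) kalg \<Rightarrow> ('k, 'a) tens2 \<Rightarrow> ('k, 'a) khopf" where
  "hopf_H A R = hopf_of (alg_H A R) (comul_H A R)"

definition generated_PH ::
  "('k::field, 'a::ab_group_add) kalg \<Rightarrow> ('k, 'a) tens2 \<Rightarrow> ('k, 'a) kalg" where
  "generated_PH A R = A\<lparr>carrier := (subalgebra A) hull (right_coeff A R \<union> left_coeff A R)\<rparr>"

text \<open>A functional on \<open>P\<close> cannot be paired with an arbitrary representation of \<open>R\<close> over \<open>A\<close>, so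
  \<open>R\<close> is decomposed inside \<open>P \<otimes> H\<close> here.\<close>

definition coeff_map ::
  "('k::field, 'a::ab_group_add) kalg \<Rightarrow> ('k, 'a) tens2 \<Rightarrow> ('a \<Rightarrow> 'k) \<Rightarrow> 'a" where
  "coeff_map A R p = tensor_lift (alg_P A R) (alg_H A R) (\<lambda>a b. scl A (p a) b) R"

definition heisenberg_map ::
  "('k::field, 'a::ab_group_add) kalg \<Rightarrow> ('k, 'a) tens2 \<Rightarrow> (('a \<Rightarrow> ('a \<Rightarrow> 'k) \<Rightarrow> 'k) \<Rightarrow> 'k) \<Rightarrow> 'a" where
  "heisenberg_map A R =
     tensor_lift (hopf_P A R) (dual_hopf (hopf_P A R)) (\<lambda>x p. tensor_lift (alg_P A R) (alg_H A R)
       (\<lambda>a b. scl A (p a) (mul A b x)) R)"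

definition left_invariants ::
  "('k::field, 'a::ab_group_add) kalg \<Rightarrow> ('k, 'a) tens2 \<Rightarrow> ('k, 'a) kspace" where
  "left_invariants A R = \<lparr>carrier = {a \<in> carrier A.
     mul (tensor_alg A A) R (tensor A A a (unity A)) = tensor A A a (unity A)}, scl = scl A\<rparr>"

definition right_invariants ::
  "('k::field, 'a::ab_group_add) kalg \<Rightarrow> ('k, 'a) tens2 \<Rightarrow> ('k, 'a) kspace" where
  "right_invariants A R = \<lparr>carrier = {a \<in> carrier A.
     mul (tensor_alg A A) (tensor A A (unity A) a) R = tensor A A (unity A) a}, scl = scl A\<rparr>"

definition conj_tens ::
  "('k::field, 'a::ab_group_add) kalg \<Rightarrow> 'a \<Rightarrow> ('k, 'a) tens2 \<Rightarrow> ('k, 'a) tens2" where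
  "conj_tens A u R =
     (let A2 = tensor_alg A A; U = tensor A A u u in mul A2 (mul A2 U R) (tens_inv A U))"

end

theory Submission
  imports Defs
begin

text \<open>
  Write \<open>R = \<Sum>\<^sub>i a\<^sub>i \<otimes> b\<^sub>i\<close> with \<open>a\<close> and \<open>b\<close> linearly independent. Applying functionals to two of the
  three legs of the pentagon equation gives scalars \<open>n\<close> and \<open>m\<close> with \<open>a\<^sub>i a\<^sub>j = \<Sum>\<^sub>l n\<^sub>i\<^sub>j\<^sub>l a\<^sub>l\<close>,
  \<open>b\<^sub>j b\<^sub>k = \<Sum>\<^sub>l m\<^sub>j\<^sub>k\<^sub>l b\<^sub>l\<close> and \<open>a\<^sub>l b\<^sub>p = \<Sum>\<^sub>i\<^sub>j\<^sub>k m\<^sub>j\<^sub>k\<^sub>l n\<^sub>i\<^sub>j\<^sub>p b\<^sub>i a\<^sub>k\<close>, so that \<open>n\<close> and \<open>m\<close> are the structure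
  constants of a pair of dual bialgebras \<open>P\<close> and \<open>H\<close>. The inverse of \<open>R\<close> lies in \<open>P \<otimes> H\<close> and its
  coordinates are those of the antipode; as \<open>R\<close> is the inverse of \<open>R\<^sup>-\<^sup>1 \<in> P \<otimes> S(H)\<close>, the antipode is
  bijective.

  The element \<open>\<omega> = \<Sum>\<^sub>i b\<^sub>i S\<^sup>-\<^sup>1(a\<^sub>i)\<close> satisfies \<open>\<omega> b = \<epsilon>(b) \<omega>\<close> for \<open>b \<in> H\<close>, \<open>a \<omega> = \<epsilon>(a) \<omega>\<close> for \<open>a \<in> P\<close>, and
  \<open>\<Sum>\<^sub>j b\<^sub>j \<omega> a\<^sub>j = 1\<close>. Thus the elements \<open>b\<^sub>i \<omega> a\<^sub>j\<close> are matrix units, the invariants are \<open>A \<omega>\<close> and \<open>\<omega> A\<close>, and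
  \<open>A\<close> is free over \<open>P\<close> and over \<open>H\<close>. The \<open>b\<^sub>j a\<^sub>i\<close> have the same span as the matrix units and are therefore
  independent, which makes \<open>F\<close> injective; the Heisenberg double inherits its associativity from \<open>A\<close>.
\<close>

section \<open>Linear algebra on carriers\<close>

text \<open>The obstacle is that coproducts, duals and the Heisenberg double are nested tensor lifts
  over different carriers. Everything is therefore reduced to scalars over one finite index set
  \<open>I\<close>. Since \<open>a\<close> and \<open>b\<close> share \<open>I\<close>, the pairing
  of P with H is the identity matrix, and the isomorphism of the dual of P with H becomes an
  equality of structure constants. The scalars \<open>n\<close> and \<open>m\<close> arise as
  coordinates of \<open>R (b_l \<otimes> 1) R^-1\<close> and
  \<open>R^-1 (1 \<otimes> a_l) R\<close>, which is why the product of P is dual to the coproduct of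
  H and conversely. Likewise the counit of P is the coordinate vector \<open>e\<close> of 1 in H,
  and the counit of H is the coordinate vector \<open>u\<close> of 1 in P. Passing to the opposite
  algebra exchanges \<open>a\<close> with \<open>b\<close> and \<open>n\<close> with
  \<open>m\<close>, so several symmetric claims are proved once and then instantiated. The inverse
  of the antipode enters because moving \<open>a_l\<close> past \<open>b_p\<close> leaves the two
  factors of the coproduct of \<open>a_l\<close> in reversed order, and it is S^-1, not S, that
  satisfies the antipode equations in that order.\<close>

sublocale k_space \<subseteq> vs: vector_space "scl V"
  by (rule vector_space)

context k_space
begin

lemma zero_closed [simp]: "0 \<in> carrier V"
  using vs.subspace_0[OF subspace] .

lemma add_closed [simp]: "x \<in> carrier V \<Longrightarrow> y \<in> carrier V \<Longrightarrow> x + y \<in> carrier V"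
  using vs.subspace_add[OF subspace] .

lemma scl_closed [simp]: "x \<in> carrier V \<Longrightarrow> scl V c x \<in> carrier V"
  using vs.subspace_scale[OF subspace] .

lemma sum_closed [simp]: "(\<And>i. i \<in> I \<Longrightarrow> f i \<in> carrier V) \<Longrightarrow> sum f I \<in> carrier V"
  using vs.subspace_sum[OF subspace] .

lemma diff_closed [simp]: "x \<in> carrier V \<Longrightarrow> y \<in> carrier V \<Longrightarrow> x - y \<in> carrier V"
  using vs.subspace_diff[OF subspace] .

end

lemma linear_onD:
  assumes "linear_on V W f"
  shows "x \<in> carrier V \<Longrightarrow> f x \<in> carrier W"
    and "x \<in> carrier V \<Longrightarrow> y \<in> carrier V \<Longrightarrow> f (x + y) = f x + f y"
    and "x \<in> carrier V \<Longrightarrow> f (scl V c x) = scl W c (f x)"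
  using assms by (auto simp: linear_on_def)

lemma linear_onI:
  assumes "\<And>x. x \<in> carrier V \<Longrightarrow> f x \<in> carrier W"
    and "\<And>x y. x \<in> carrier V \<Longrightarrow> y \<in> carrier V \<Longrightarrow> f (x + y) = f x + f y"
    and "\<And>c x. x \<in> carrier V \<Longrightarrow> f (scl V c x) = scl W c (f x)"
  shows "linear_on V W f"
  using assms by (auto simp: linear_on_def)

lemma bilinear_onD:
  assumes "bilinear_on V W U \<beta>"
  shows "x \<in> carrier V \<Longrightarrow> linear_on W U (\<beta> x)"
    and "y \<in> carrier W \<Longrightarrow> linear_on V U (\<lambda>x. \<beta> x y)"
  using assms by (auto simp: bilinear_on_def)

lemma bilinear_onI:
  assumes "\<And>x. x \<in> carrier V \<Longrightarrow> linear_on W U (\<beta> x)"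
    and "\<And>y. y \<in> carrier W \<Longrightarrow> linear_on V U (\<lambda>x. \<beta> x y)"
  shows "bilinear_on V W U \<beta>"
  using assms by (auto simp: bilinear_on_def)

lemma linear_on_sum:
  assumes "linear_on V W f" "k_space V" "k_space W" "\<And>i. i \<in> I \<Longrightarrow> x i \<in> carrier V"
  shows "f (\<Sum>i\<in>I. x i) = (\<Sum>i\<in>I. f (x i))"
proof -
  interpret V: k_space V by fact
  interpret W: k_space W by fact
  have "f (scl V 0 0) = scl W 0 (f 0)"
    using assms(1) V.zero_closed by (rule linear_onD(3))
  then have "f 0 = 0" by simp
  with assms(4) show ?thesis
    by (induction I rule: infinite_finite_induct) (simp_all add: linear_onD(2)[OF assms(1)])
qed

lemma linear_on_zero:
  assumes "linear_on V W f" "k_space V" "k_space W"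
  shows "f 0 = 0"
  using linear_on_sum[OF assms, of "{}"] by simp

lemma linear_on_lincomb:
  assumes "linear_on V W f" "k_space V" "k_space W" "\<And>i. i \<in> I \<Longrightarrow> x i \<in> carrier V"
  shows "f (\<Sum>i\<in>I. scl V (c i) (x i)) = (\<Sum>i\<in>I. scl W (c i) (f (x i)))"
proof -
  interpret V: k_space V by fact
  show ?thesis
    using assms(4)
    by (subst linear_on_sum[OF assms(1-3)]) (simp_all add: linear_onD(3)[OF assms(1)])
qed

lemma linear_on_diff:
  assumes "linear_on V W f" "k_space V" "k_space W" "x \<in> carrier V" "y \<in> carrier V"
  shows "f (x - y) = f x - f y"
proof -
  interpret V: k_space V by fact
  have "f ((x - y) + y) = f (x - y) + f y"
    using assms by (intro linear_onD(2)[OF assms(1)]) auto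
  then show ?thesis by simp
qed

lemma linear_on_comp:
  assumes "linear_on V W f" "linear_on W U g"
  shows "linear_on V U (\<lambda>x. g (f x))"
  using assms by (auto simp: linear_on_def Pi_iff)

lemma linear_on_zero_fun:
  assumes "k_space W"
  shows "linear_on V W (\<lambda>_. 0)"
proof -
  interpret W: k_space W by fact
  show ?thesis by (simp add: linear_on_def)
qed

lemma linear_on_add_fun:
  assumes "linear_on V W f" "linear_on V W g" "k_space W"
  shows "linear_on V W (\<lambda>x. f x + g x)"
proof -
  interpret W: k_space W by fact
  show ?thesis
    using assms by (auto simp: linear_on_def Pi_iff W.vs.scale_right_distrib)
qed

lemma linear_on_sum_fun:
  assumes "\<And>i. i \<in> I \<Longrightarrow> linear_on V W (f i)" "k_space W"
  shows "linear_on V W (\<lambda>x. \<Sum>i\<in>I. f i x)"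
  using assms(1)
  by (induction I rule: infinite_finite_induct)
    (auto simp: linear_on_zero_fun assms(2) intro!: linear_on_add_fun assms(2))

lemma ground_simps [simp]:
  "carrier ground = UNIV" "scl ground = (*)" "mul ground = (*)" "unity ground = 1"
  by (simp_all add: ground_def)

lemma k_space_ground: "k_space (ground :: ('k::field, 'k) kalg)"
proof -
  interpret vector_space "scl (ground :: ('k, 'k) kalg)"
    by (rule vector_space_ground)
  show ?thesis
    by unfold_locales (use subspace_UNIV in simp)
qed

text \<open>Indexed families instead of sets as in \<open>is_basis\<close>: bases of P, H and the
  dual of P share one index set, and coefficients are compared index by index.\<close>

definition indep_fam :: "('k::field, 'v::ab_group_add, 'm) kspace_scheme \<Rightarrow> 'i set \<Rightarrow> ('i \<Rightarrow> 'v) \<Rightarrow> bool"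
  where "indep_fam V I v \<longleftrightarrow> (\<forall>c. (\<Sum>i\<in>I. scl V (c i) (v i)) = 0 \<longrightarrow> (\<forall>i\<in>I. c i = 0))"

definition basis_fam :: "('k::field, 'v::ab_group_add, 'm) kspace_scheme \<Rightarrow> 'i set \<Rightarrow> ('i \<Rightarrow> 'v) \<Rightarrow> bool"
  where "basis_fam V I v \<longleftrightarrow> finite I \<and> v ` I \<subseteq> carrier V \<and> indep_fam V I v \<and>
    (\<forall>x\<in>carrier V. \<exists>c. x = (\<Sum>i\<in>I. scl V (c i) (v i)))"


lemma indep_famD: "indep_fam V I v \<Longrightarrow> (\<Sum>i\<in>I. scl V (c i) (v i)) = 0 \<Longrightarrow> i \<in> I \<Longrightarrow> c i = 0"
  unfolding indep_fam_def by blast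

context k_space
begin

lemma indep_fam_eqD:
  assumes "indep_fam V I v" "(\<Sum>i\<in>I. scl V (c i) (v i)) = (\<Sum>i\<in>I. scl V (d i) (v i))" "i \<in> I"
  shows "c i = d i"
proof -
  have "(\<Sum>i\<in>I. scl V (c i - d i) (v i)) = 0"
    using assms(2) by (simp add: vs.scale_left_diff_distrib sum_subtractf)
  from indep_famD[OF assms(1) this assms(3)] show ?thesis by simp
qed

lemma indep_fam_iff:
  assumes "finite I"
  shows "indep_fam V I v \<longleftrightarrow> inj_on v I \<and> vs.independent (v ` I)"
proof
  assume v: "indep_fam V I v"
  have inj: "inj_on v I"
  proof (rule inj_onI)
    fix i j assume ij: "i \<in> I" "j \<in> I" "v i = v j"
    have "scl V (if k = i then 1 else 0) (v k) = (if k = i then v k else 0)" for k by simp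
    then have "(\<Sum>k\<in>I. scl V (if k = i then 1 else 0) (v k)) = (\<Sum>k\<in>I. scl V (if k = j then 1 else 0) (v k))"
      using assms ij by (simp add: if_distrib[where f = "\<lambda>c. scl V c _"] cong: if_cong)
    from indep_fam_eqD[OF v this ij(1)] show "i = j" by (simp split: if_splits)
  qed
  have "u x = 0" if "(\<Sum>x\<in>v ` I. scl V (u x) x) = 0" "x \<in> v ` I" for u x
    using that inj indep_famD[OF v, of "\<lambda>i. u (v i)"] by (auto simp: sum.reindex o_def)
  with inj show "inj_on v I \<and> vs.independent (v ` I)"
    using assms by (auto simp: vs.dependent_finite)
next
  assume v: "inj_on v I \<and> vs.independent (v ` I)"
  show "indep_fam V I v"
    unfolding indep_fam_def
  proof (intro allI impI ballI)
    fix c i assume c: "(\<Sum>i\<in>I. scl V (c i) (v i)) = 0" "i \<in> I"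
    have "(\<Sum>x\<in>v ` I. scl V (c (the_inv_into I v x)) x) = 0"
      using c v by (simp add: sum.reindex the_inv_into_f_f)
    from vs.independentD[OF conjunct2[OF v] _ subset_refl this, of "v i"]
    have "c (the_inv_into I v (v i)) = 0"
      using c(2) assms by simp
    then show "c i = 0" using c v by (simp add: the_inv_into_f_f)
  qed
qed

end

lemma dual_functionals:
  fixes V :: "('k::field, 'v::ab_group_add, 'm) kspace_scheme"
  assumes "k_space V" "finite I" "indep_fam V I v"
  obtains \<phi> where "\<And>i. \<phi> i \<in> carrier (dual V)"
    "\<And>i j. i \<in> I \<Longrightarrow> j \<in> I \<Longrightarrow> v j \<in> carrier V \<Longrightarrow> \<phi> i (v j) = (if i = j then 1 else 0)"
proof -
  interpret k_space V by fact
  interpret g: vector_space "(*) :: 'k \<Rightarrow> 'k \<Rightarrow> 'k"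
    by unfold_locales (simp_all add: algebra_simps)
  interpret vp: vector_space_pair "scl V" "(*) :: 'k \<Rightarrow> 'k \<Rightarrow> 'k" ..
  have iv: "inj_on v I" "vs.independent (v ` I)"
    using assms indep_fam_iff by auto
  have "\<exists>f. Vector_Spaces.linear (scl V) (*) f \<and> (\<forall>x\<in>v ` I. f x = (if x = v i then 1 else 0))" for i
    using vp.linear_independent_extend[OF iv(2), of "\<lambda>x. if x = v i then 1 else 0"] by simp
  then obtain f where f: "\<And>i. Vector_Spaces.linear (scl V) (*) (f i)"
    "\<And>i x. x \<in> v ` I \<Longrightarrow> f i x = (if x = v i then 1 else 0)"
    by metis
  \<comment> \<open>Members of \<open>dual V\<close> vanish off the carrier, hence the truncation;
    it is also why the second property asks for \<open>v j \<in> carrier V\<close>.\<close>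
  define \<phi> where "\<phi> i x = (if x \<in> carrier V then f i x else 0)" for i x
  have "\<phi> i \<in> carrier (dual V)" for i
  proof -
    interpret fi: Vector_Spaces.linear "scl V" "(*)" "f i" by (rule f)
    show ?thesis by (simp add: dual_def linear_on_def \<phi>_def fi.add fi.scale)
  qed
  moreover have "\<phi> i (v j) = (if i = j then 1 else 0)" if "i \<in> I" "j \<in> I" "v j \<in> carrier V" for i j
    using f(2)[of "v j" i] that iv(1) by (auto simp: \<phi>_def inj_on_eq_iff)
  ultimately show thesis by (rule that)
qed

context k_space
begin

lemma basis_fam_coord:
  assumes "basis_fam V I v" "x \<in> carrier V"
  obtains c where "x = (\<Sum>i\<in>I. scl V (c i) (v i))"
  using assms unfolding basis_fam_def by blast

lemma basis_fam_iff:
  assumes "finite I"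
  shows "basis_fam V I v \<longleftrightarrow> inj_on v I \<and> is_basis V (v ` I)"
proof -
  have sp: "vs.span (v ` I) = {x. \<exists>c. x = (\<Sum>i\<in>I. scl V (c i) (v i))}" if "inj_on v I"
  proof -
    have "(\<exists>u. y = (\<Sum>x\<in>v ` I. scl V (u x) x)) \<longleftrightarrow> (\<exists>c. y = (\<Sum>i\<in>I. scl V (c i) (v i)))" for y
    proof
      assume "\<exists>c. y = (\<Sum>i\<in>I. scl V (c i) (v i))"
      then obtain c where "y = (\<Sum>i\<in>I. scl V (c i) (v i))" by blast
      then have "y = (\<Sum>x\<in>v ` I. scl V (c (the_inv_into I v x)) x)"
        using that by (simp add: sum.reindex the_inv_into_f_f)
      then show "\<exists>u. y = (\<Sum>x\<in>v ` I. scl V (u x) x)"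
        by (rule exI[of _ "\<lambda>x. c (the_inv_into I v x)"])
    qed (use that in \<open>auto simp: sum.reindex\<close>)
    then show ?thesis
      using assms by (simp add: vs.span_finite set_eq_iff image_iff)
  qed
  have sub: "(\<Sum>i\<in>I. scl V (c i) (v i)) \<in> carrier V" if "v ` I \<subseteq> carrier V" for c
    using that by (intro sum_closed scl_closed) auto
  show ?thesis
    using assms sp sub unfolding basis_fam_def is_basis_def indep_fam_iff[OF assms] by auto
qed

lemma kdim_basis_fam:
  assumes "basis_fam V I v"
  shows "kdim V = card I" "fin_dim V"
proof -
  have I: "finite I" using assms by (simp add: basis_fam_def)
  then have b: "inj_on v I" "is_basis V (v ` I)"
    using assms basis_fam_iff by auto
  have "card (v ` I) = vs.dim (carrier V)"
    using b(2) unfolding is_basis_def by (intro vs.basis_card_eq_dim) auto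
  then show "kdim V = card I"
    using b(1) by (simp add: kdim_def card_image)
  show "fin_dim V"
    using b(2) I unfolding fin_dim_def is_basis_def by blast
qed

lemma exists_basis: "\<exists>B. is_basis V B"
proof -
  obtain B where "B \<subseteq> carrier V" "vs.independent B" "carrier V \<subseteq> vs.span B"
    by (rule vs.maximal_independent_subset)
  then show ?thesis
    using vs.span_minimal[OF _ subspace, of B] unfolding is_basis_def by blast
qed

lemma finite_independent:
  assumes "fin_dim V" "B \<subseteq> carrier V" "vs.independent B"
  shows "finite B" "card B \<le> kdim V"
proof -
  obtain T where T: "finite T" "T \<subseteq> carrier V" "vs.span T = carrier V"
    using assms(1) unfolding fin_dim_def by blast
  then show fB: "finite B"
    using vs.independent_span_bound[of T B] assms by auto
  obtain C where C: "is_basis V C" using exists_basis by blast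
  then have "finite C"
    using vs.independent_span_bound[of T C] T unfolding is_basis_def by auto
  moreover have "kdim V = card C"
    using C vs.basis_card_eq_dim[of C "carrier V"] unfolding is_basis_def kdim_def by auto
  ultimately show "card B \<le> kdim V"
    using vs.independent_span_bound[of C B] C assms unfolding is_basis_def by auto
qed

lemma fin_dim_basis_fam:
  assumes "fin_dim V"
  obtains B where "basis_fam V B (\<lambda>b. b)"
proof -
  obtain B where B: "is_basis V B" using exists_basis by blast
  then have "finite B"
    using finite_independent(1)[OF assms] unfolding is_basis_def by auto
  then have "basis_fam V B (\<lambda>b. b)"
    using B basis_fam_iff[of B "\<lambda>b. b"] by simp
  then show thesis by (rule that)
qed

text \<open>The image of a basis is independent; a vector outside its span would enlarge it to more
  independent vectors than the dimension allows.\<close>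

lemma injective_imp_surjective:
  assumes fd: "fin_dim V" and g: "linear_on V V g"
    and inj: "\<And>x. x \<in> carrier V \<Longrightarrow> g x = 0 \<Longrightarrow> x = 0"
    and y: "y \<in> carrier V"
  obtains x where "x \<in> carrier V" "g x = y"
proof -
  obtain B where B: "basis_fam V B (\<lambda>b. b)"
    using fd by (rule fin_dim_basis_fam)
  then have fB: "finite B" "B \<subseteq> carrier V" by (auto simp: basis_fam_def)
  have ind: "indep_fam V B g"
    unfolding indep_fam_def
  proof (intro allI impI)
    fix c assume c: "(\<Sum>b\<in>B. scl V (c b) (g b)) = 0"
    have g0: "g (\<Sum>b\<in>B. scl V (c b) b) = 0"
      using c fB(2) by (subst linear_on_lincomb[OF g k_space_axioms k_space_axioms]) auto
    have "(\<Sum>b\<in>B. scl V (c b) b) \<in> carrier V"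
      using fB(2) by (intro sum_closed scl_closed) blast
    from inj[OF this g0] have "(\<Sum>b\<in>B. scl V (c b) b) = 0" .
    then show "\<forall>b\<in>B. c b = 0"
      using B unfolding basis_fam_def indep_fam_def by blast
  qed
  have gB: "inj_on g B" "vs.independent (g ` B)"
    using ind indep_fam_iff[OF fB(1)] by auto
  have sub: "g ` B \<subseteq> carrier V"
    using fB linear_onD(1)[OF g] by auto
  have "y \<in> vs.span (g ` B)"
  proof (rule ccontr)
    assume ny: "y \<notin> vs.span (g ` B)"
    then have "vs.independent (insert y (g ` B))" "y \<notin> g ` B"
      using gB(2) vs.independent_insert[of y "g ` B"] vs.span_base by auto
    moreover have "card (insert y (g ` B)) \<le> card B"
      using finite_independent(2)[OF fd, of "insert y (g ` B)"] calculation sub y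
        kdim_basis_fam(1)[OF B] by auto
    ultimately show False
      using fB gB(1) by (simp add: card_image)
  qed
  then obtain u where "y = (\<Sum>x\<in>g ` B. scl V (u x) x)"
    using fB by (auto simp: vs.span_finite)
  also have "\<dots> = (\<Sum>b\<in>B. scl V (u (g b)) (g b))"
    using gB(1) by (simp add: sum.reindex)
  also have "\<dots> = g (\<Sum>b\<in>B. scl V (u (g b)) b)"
    using fB(2) by (subst linear_on_lincomb[OF g k_space_axioms k_space_axioms]) auto
  finally show thesis
    using fB by (intro that[of "\<Sum>b\<in>B. scl V (u (g b)) b"] sum_closed scl_closed) auto
qed

end

lemma linear_on_eq_basis:
  assumes "linear_on V W f" "linear_on V W g" "k_space V" "k_space W" "basis_fam V I v"
    and "\<And>i. i \<in> I \<Longrightarrow> f (v i) = g (v i)" and "x \<in> carrier V"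
  shows "f x = g x"
proof -
  obtain c where x: "x = (\<Sum>i\<in>I. scl V (c i) (v i))"
    using k_space.basis_fam_coord[OF assms(3,5,7)] by blast
  have v: "v i \<in> carrier V" if "i \<in> I" for i
    using assms(5) that by (auto simp: basis_fam_def)
  show ?thesis
    unfolding x using assms v by (simp add: linear_on_lincomb)
qed

text \<open>The value 0 off the carrier is the normalisation demanded by \<open>dual\<close> and
  \<open>is_antipode\<close>, so that counits and antipodes can be equal as functions.\<close>

lemma linear_extension:
  assumes "k_space V" "k_space W" "basis_fam V I v" "\<And>i. i \<in> I \<Longrightarrow> w i \<in> carrier W"
  obtains f where "linear_on V W f" "\<And>i. i \<in> I \<Longrightarrow> f (v i) = w i" "\<And>x. x \<notin> carrier V \<Longrightarrow> f x = 0"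
proof -
  interpret V: k_space V by fact
  interpret W: k_space W by fact
  have I: "finite I" "indep_fam V I v" "\<And>i. i \<in> I \<Longrightarrow> v i \<in> carrier V"
    using assms(3) by (auto simp: basis_fam_def)
  obtain \<phi> where \<phi>: "\<And>i. \<phi> i \<in> carrier (dual V)"
    "\<And>i j. i \<in> I \<Longrightarrow> j \<in> I \<Longrightarrow> v j \<in> carrier V \<Longrightarrow> \<phi> i (v j) = (if i = j then 1 else 0)"
    using dual_functionals[OF assms(1) I(1,2)] by blast
  define f where "f x = (\<Sum>i\<in>I. scl W (\<phi> i x) (w i))" for x
  have "linear_on V W (\<lambda>x. scl W (\<phi> i x) (w i))" if "i \<in> I" for i
    using \<phi>(1)[of i] assms(4)[OF that]
    by (auto simp: dual_def linear_on_def W.vs.scale_left_distrib)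
  then have "linear_on V W f"
    unfolding f_def by (intro linear_on_sum_fun assms)
  moreover have "f (v j) = w j" if "j \<in> I" for j
    using that I by (simp add: f_def \<phi>(2) if_distrib[where f = "\<lambda>c. scl W c _"] cong: if_cong)
  moreover have "f x = 0" if "x \<notin> carrier V" for x
    using that \<phi>(1) by (simp add: f_def dual_def)
  ultimately show thesis by (rule that)
qed

section \<open>Tensor products\<close>

lemma tensor_space_simps [simp]: "scl (tensor_space V W) = fun_scl"
  by (simp add: tensor_space_def)

lemma tensor_alg_simps [simp]:
  "carrier (tensor_alg A B) = carrier (tensor_space A B)" "scl (tensor_alg A B) = fun_scl"
  "unity (tensor_alg A B) = tensor A B (unity A) (unity B)"
  by (simp_all add: tensor_alg_def)

interpretation fs: vector_space "fun_scl :: 'k::field \<Rightarrow> ('x \<Rightarrow> 'k) \<Rightarrow> _"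
  by (rule vector_space_fun_scl)

text \<open>Pure tensors are evaluations of forms on the ambient spaces, so carriers do not enter.
  This is what allows \<open>R\<close> to be read in \<open>A \<otimes> A\<close> and in
  \<open>P \<otimes> H\<close> without any embedding.\<close>

lemma tensor_cong: "scl V = scl V' \<Longrightarrow> scl W = scl W' \<Longrightarrow> tensor V W = tensor V' W'"
  by (simp add: fun_eq_iff tensor_def bilinear_on_def linear_on_def)

lemma tensor_space_cong:
  assumes "scl V = scl V'" "scl W = scl W'" "carrier V = carrier V'" "carrier W = carrier W'"
  shows "tensor_space V W = tensor_space V' W'"
  using assms tensor_cong[OF assms(1,2)] by (simp add: tensor_space_def)

text \<open>The lift only sees values of the bilinear map on the carriers. It transfers lifts
  between records that share carrier and scalars, such as \<open>alg_P\<close> and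
  \<open>hopf_P\<close>.\<close>

lemma tensor_lift_cong:
  assumes "scl V = scl V'" "scl W = scl W'" "carrier V = carrier V'" "carrier W = carrier W'"
    "\<And>v w. v \<in> carrier V \<Longrightarrow> w \<in> carrier W \<Longrightarrow> \<beta> v w = \<beta>' v w"
  shows "tensor_lift V W \<beta> = tensor_lift V' W' \<beta>'"
proof -
  have "(\<Sum>(v, w)\<leftarrow>ts. \<beta> v w) = (\<Sum>(v, w)\<leftarrow>ts. \<beta>' v w)" if "set ts \<subseteq> carrier V \<times> carrier W" for ts
    using that assms(5) by (intro arg_cong[where f = sum_list] map_cong) auto
  then have "(\<exists>ts. set ts \<subseteq> carrier V \<times> carrier W \<and> T = (\<Sum>(v, w)\<leftarrow>ts. tensor V W v w) \<and> u = (\<Sum>(v, w)\<leftarrow>ts. \<beta> v w)) \<longleftrightarrow>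
      (\<exists>ts. set ts \<subseteq> carrier V' \<times> carrier W' \<and> T = (\<Sum>(v, w)\<leftarrow>ts. tensor V' W' v w) \<and> u = (\<Sum>(v, w)\<leftarrow>ts. \<beta>' v w))" for T u
    using assms(3,4) tensor_cong[OF assms(1,2)] by metis
  then show ?thesis
    unfolding tensor_lift_def fun_eq_iff by simp
qed

lemma tensor_add_left: "tensor V W (x + y) w = tensor V W x w + tensor V W y w"
  and tensor_add_right: "tensor V W v (x' + y') = tensor V W v x' + tensor V W v y'"
  and tensor_scl_left: "tensor V W (scl V c x) w = fun_scl c (tensor V W x w)"
  and tensor_scl_right: "tensor V W v (scl W c x') = fun_scl c (tensor V W v x')"
  by (auto simp: tensor_def fun_eq_iff plus_fun_def fun_scl_def bilinear_on_def linear_on_def)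

lemma tensor_zero_left: "tensor V W 0 w = 0"
  using tensor_add_left[of V W 0 0 w] by simp

lemma tensor_zero_right: "tensor V W v 0 = 0"
  using tensor_add_right[of V W v 0 0] by simp

lemma tensor_sum_left: "tensor V W (\<Sum>i\<in>I. x i) w = (\<Sum>i\<in>I. tensor V W (x i) w)"
  by (induction I rule: infinite_finite_induct) (simp_all add: tensor_zero_left tensor_add_left)

lemma tensor_sum_right: "tensor V W v (\<Sum>i\<in>I. x i) = (\<Sum>i\<in>I. tensor V W v (x i))"
  by (induction I rule: infinite_finite_induct) (simp_all add: tensor_zero_right tensor_add_right)

lemma tensor_diff_left: "tensor V W (x - y) w = tensor V W x w - tensor V W y w"
  using tensor_add_left[of V W "x - y" y w] by simp

lemma tensor_diff_right: "tensor V W v (x - y) = tensor V W v x - tensor V W v y"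
  using tensor_add_right[of V W v "x - y" y] by simp

lemma tensor_closed [simp]:
  "v \<in> carrier V \<Longrightarrow> w \<in> carrier W \<Longrightarrow> tensor V W v w \<in> carrier (tensor_space V W)"
  using bilinear_on_tensor[of V W] by (auto simp: bilinear_on_def linear_on_def)

lemma k_space_tensor_alg: "k_space (tensor_alg A B)"
  using k_space_tensor_space[of A B] by (simp add: k_space_def)

lemma tensor_sum_closed [simp]:
  fixes V :: "('k::field, 'v::ab_group_add, 'm) kspace_scheme"
    and W :: "('k, 'w::ab_group_add, 'n) kspace_scheme"
    and X :: "'i \<Rightarrow> ('v \<Rightarrow> 'w \<Rightarrow> 'k) \<Rightarrow> 'k"
  shows "(\<And>i. i \<in> I \<Longrightarrow> X i \<in> carrier (tensor_space V W)) \<Longrightarrow> (\<Sum>i\<in>I. X i) \<in> carrier (tensor_space V W)"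
  by (rule k_space.sum_closed[OF k_space_tensor_space])

lemma tensor_space_scl_closed [simp]:
  fixes V :: "('k::field, 'v::ab_group_add, 'm) kspace_scheme"
    and W :: "('k, 'w::ab_group_add, 'n) kspace_scheme"
    and X :: "('v \<Rightarrow> 'w \<Rightarrow> 'k) \<Rightarrow> 'k"
  shows "X \<in> carrier (tensor_space V W) \<Longrightarrow> fun_scl c X \<in> carrier (tensor_space V W)"
  using k_space.scl_closed[OF k_space_tensor_space, of X V W c] by simp

lemma tensor_space_add_closed [simp]:
  fixes V :: "('k::field, 'v::ab_group_add, 'm) kspace_scheme"
    and W :: "('k, 'w::ab_group_add, 'n) kspace_scheme"
    and X :: "('v \<Rightarrow> 'w \<Rightarrow> 'k) \<Rightarrow> 'k"
  shows "X \<in> carrier (tensor_space V W) \<Longrightarrow> Y \<in> carrier (tensor_space V W) \<Longrightarrow> X + Y \<in> carrier (tensor_space V W)"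
  by (rule k_space.add_closed[OF k_space_tensor_space])

lemma tensor_space_zero_closed [simp]: "0 \<in> carrier (tensor_space V W)"
  by (rule k_space.zero_closed[OF k_space_tensor_space])

text \<open>No case for scalar multiples arises, because \<open>tensor_space_sum\<close> absorbs
  coefficients into the left factor.\<close>

lemma tensor_induct [consumes 2, case_names zero tensor add]:
  fixes V :: "('k::field, 'v::ab_group_add, 'm) kspace_scheme"
    and W :: "('k, 'w::ab_group_add, 'n) kspace_scheme"
    and P :: "(('v \<Rightarrow> 'w \<Rightarrow> 'k) \<Rightarrow> 'k) \<Rightarrow> bool"
  assumes T: "T \<in> carrier (tensor_space V W)" and V: "k_space V"
    and zero: "P 0" and tensor: "\<And>v w. v \<in> carrier V \<Longrightarrow> w \<in> carrier W \<Longrightarrow> P (tensor V W v w)"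
    and add: "\<And>X Y. X \<in> carrier (tensor_space V W) \<Longrightarrow> Y \<in> carrier (tensor_space V W) \<Longrightarrow>
      P X \<Longrightarrow> P Y \<Longrightarrow> P (X + Y)"
  shows "P T"
proof -
  obtain ts where ts: "set ts \<subseteq> carrier V \<times> carrier W" "T = (\<Sum>(v, w)\<leftarrow>ts. tensor V W v w)"
    using T by (rule tensor_space_sum[OF V])
  have "P (\<Sum>(v, w)\<leftarrow>ts. tensor V W v w) \<and> (\<Sum>(v, w)\<leftarrow>ts. tensor V W v w) \<in> carrier (tensor_space V W)"
    using ts(1) by (induction ts) (auto simp: zero tensor intro!: add)
  with ts(2) show ?thesis by simp
qed

lemma linear_on_tensor_eq:
  assumes "linear_on (tensor_space V W) U f" "linear_on (tensor_space V W) U g" "k_space V" "k_space U"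
    and "\<And>v w. v \<in> carrier V \<Longrightarrow> w \<in> carrier W \<Longrightarrow> f (tensor V W v w) = g (tensor V W v w)"
    and "T \<in> carrier (tensor_space V W)"
  shows "f T = g T"
  using assms(6,3)
proof (induction T rule: tensor_induct)
  case zero
  show ?case
    unfolding linear_on_zero[OF assms(1) k_space_tensor_space assms(4)]
      linear_on_zero[OF assms(2) k_space_tensor_space assms(4)] ..
next
  case (add X Y)
  show ?case
    unfolding linear_onD(2)[OF assms(1) add(1,2)] linear_onD(2)[OF assms(2) add(1,2)] add(3,4) ..
qed (use assms in auto)

lemma tensor_sum_family:
  assumes "T \<in> carrier (tensor_space V W)" "k_space V"
  obtains N :: nat and x y where "\<And>i. i < N \<Longrightarrow> x i \<in> carrier V" "\<And>i. i < N \<Longrightarrow> y i \<in> carrier W"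
    "T = (\<Sum>i<N. tensor V W (x i) (y i))"
proof -
  obtain ts where ts: "set ts \<subseteq> carrier V \<times> carrier W" "T = (\<Sum>(v, w)\<leftarrow>ts. tensor V W v w)"
    by (rule tensor_space_sum[OF assms(2,1)])
  show thesis
  proof (rule that[of "length ts" "\<lambda>i. fst (ts ! i)" "\<lambda>i. snd (ts ! i)"])
    show "T = (\<Sum>i<length ts. tensor V W (fst (ts ! i)) (snd (ts ! i)))"
      by (simp add: ts(2) sum_list_sum_nth atLeast0LessThan case_prod_beta)
  qed (use ts(1) nth_mem in fastforce)+
qed

lemmas linear_on_tensor_lift = tensor_universal(1)
lemmas tensor_lift_tensor = tensor_universal(2)

lemma tensor_lift_closed:
  assumes "k_space V" "k_space W" "k_space U" "bilinear_on V W U \<beta>" "T \<in> carrier (tensor_space V W)"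
  shows "tensor_lift V W \<beta> T \<in> carrier U"
  using linear_onD(1)[OF linear_on_tensor_lift] assms by blast

lemma tensor_lift_scl:
  assumes "k_space V" "k_space W" "k_space U" "bilinear_on V W U \<beta>"
    "X \<in> carrier (tensor_space V W)"
  shows "tensor_lift V W \<beta> (fun_scl c X) = scl U c (tensor_lift V W \<beta> X)"
  using linear_onD(3)[OF linear_on_tensor_lift[OF assms(1-4)], of X c] assms by simp

lemma tensor_lift_sum:
  assumes "k_space V" "k_space W" "k_space U" "bilinear_on V W U \<beta>"
    "\<And>i. i \<in> I \<Longrightarrow> X i \<in> carrier (tensor_space V W)"
  shows "tensor_lift V W \<beta> (\<Sum>i\<in>I. X i) = (\<Sum>i\<in>I. tensor_lift V W \<beta> (X i))"
  using linear_on_sum[OF linear_on_tensor_lift] assms k_space_tensor_space by blast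

lemma tensor_lift_sum_tensor:
  assumes "k_space V" "k_space W" "k_space U" "bilinear_on V W U \<beta>"
    "\<And>i. i \<in> I \<Longrightarrow> x i \<in> carrier V" "\<And>i. i \<in> I \<Longrightarrow> y i \<in> carrier W"
  shows "tensor_lift V W \<beta> (\<Sum>i\<in>I. tensor V W (x i) (y i)) = (\<Sum>i\<in>I. \<beta> (x i) (y i))"
  using assms by (subst tensor_lift_sum[OF assms(1-4)]) (auto intro!: sum.cong tensor_lift_tensor)

lemma bilinear_on_subspace:
  assumes "bilinear_on V W U \<beta>" "carrier V' \<subseteq> carrier V" "carrier W' \<subseteq> carrier W"
    "scl V' = scl V" "scl W' = scl W"
  shows "bilinear_on V' W' U \<beta>"
  using assms unfolding bilinear_on_def linear_on_def by (auto simp: subset_iff Pi_iff)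

lemma dualD:
  assumes "\<phi> \<in> carrier (dual V)"
  shows "linear_on V ground \<phi>" "\<And>x. x \<notin> carrier V \<Longrightarrow> \<phi> x = 0"
  using assms by (auto simp: dual_def)

lemma bilinear_on_slice_left:
  assumes "\<phi> \<in> carrier (dual V)" "k_space W"
  shows "bilinear_on V W W (\<lambda>v w. scl W (\<phi> v) w)"
proof -
  interpret W: k_space W by fact
  show ?thesis
    using linear_onD[OF dualD(1)[OF assms(1)]]
    by (auto intro!: bilinear_onI linear_onI simp: W.vs.scale_left_distrib W.vs.scale_right_distrib mult.commute)
qed

lemma bilinear_on_slice_right:
  assumes "\<phi> \<in> carrier (dual W)" "k_space V"
  shows "bilinear_on V W V (\<lambda>v w. scl V (\<phi> w) v)"
proof -
  interpret V: k_space V by fact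
  show ?thesis
    using linear_onD[OF dualD(1)[OF assms(1)]]
    by (auto intro!: bilinear_onI linear_onI simp: V.vs.scale_left_distrib V.vs.scale_right_distrib mult.commute)
qed

text \<open>Pairing the left leg with the functional dual to \<open>v j\<close> isolates the right
  leg of the \<open>j\<close>-th term. This is the coefficient comparison used throughout.\<close>

lemma tensor_indep_left:
  assumes "k_space V" "k_space W" "finite I" "indep_fam V I v" "\<And>i. i \<in> I \<Longrightarrow> v i \<in> carrier V"
    "\<And>i. i \<in> I \<Longrightarrow> x i \<in> carrier W" "\<And>i. i \<in> I \<Longrightarrow> y i \<in> carrier W"
    "(\<Sum>i\<in>I. tensor V W (v i) (x i)) = (\<Sum>i\<in>I. tensor V W (v i) (y i))" "j \<in> I"
  shows "x j = y j"
proof -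
  interpret W: k_space W by fact
  obtain \<phi> where \<phi>: "\<And>i. \<phi> i \<in> carrier (dual V)"
    "\<And>i j. i \<in> I \<Longrightarrow> j \<in> I \<Longrightarrow> v j \<in> carrier V \<Longrightarrow> \<phi> i (v j) = (if i = j then 1 else 0)"
    using dual_functionals[OF assms(1,3,4)] by blast
  have "tensor_lift V W (\<lambda>v w. scl W (\<phi> j v) w) (\<Sum>i\<in>I. tensor V W (v i) (z i)) = z j"
    if "\<And>i. i \<in> I \<Longrightarrow> z i \<in> carrier W" for z
    using that assms(3,9,5)
    by (subst tensor_lift_sum_tensor[OF assms(1,2,2) bilinear_on_slice_left[OF \<phi>(1) assms(2)]])
      (simp_all add: \<phi>(2) if_distrib[where f = "\<lambda>c. scl W c _"] cong: if_cong)
  from this[of x, OF assms(6)] this[of y, OF assms(7)] show ?thesis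
    using assms(8) by simp
qed

lemma tensor_indep_right:
  assumes "k_space V" "k_space W" "finite I" "indep_fam W I v" "\<And>i. i \<in> I \<Longrightarrow> v i \<in> carrier W"
    "\<And>i. i \<in> I \<Longrightarrow> x i \<in> carrier V" "\<And>i. i \<in> I \<Longrightarrow> y i \<in> carrier V"
    "(\<Sum>i\<in>I. tensor V W (x i) (v i)) = (\<Sum>i\<in>I. tensor V W (y i) (v i))" "j \<in> I"
  shows "x j = y j"
proof -
  interpret V: k_space V by fact
  obtain \<phi> where \<phi>: "\<And>i. \<phi> i \<in> carrier (dual W)"
    "\<And>i j. i \<in> I \<Longrightarrow> j \<in> I \<Longrightarrow> v j \<in> carrier W \<Longrightarrow> \<phi> i (v j) = (if i = j then 1 else 0)"
    using dual_functionals[OF assms(2,3,4)] by blast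
  have "tensor_lift V W (\<lambda>v w. scl V (\<phi> j w) v) (\<Sum>i\<in>I. tensor V W (z i) (v i)) = z j"
    if "\<And>i. i \<in> I \<Longrightarrow> z i \<in> carrier V" for z
    using that assms(3,9,5)
    by (subst tensor_lift_sum_tensor[OF assms(1,2,1) bilinear_on_slice_right[OF \<phi>(1) assms(1)]])
      (simp_all add: \<phi>(2) if_distrib[where f = "\<lambda>c. scl V c _"] cong: if_cong)
  from this[of x, OF assms(6)] this[of y, OF assms(7)] show ?thesis
    using assms(8) by simp
qed

lemma tensor_indep:
  assumes "k_space V" "k_space W" "finite I" "finite J" "indep_fam V I v" "indep_fam W J w"
    "\<And>i. i \<in> I \<Longrightarrow> v i \<in> carrier V" "\<And>j. j \<in> J \<Longrightarrow> w j \<in> carrier W"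
    "(\<Sum>i\<in>I. \<Sum>j\<in>J. fun_scl (c i j) (tensor V W (v i) (w j))) =
     (\<Sum>i\<in>I. \<Sum>j\<in>J. fun_scl (d i j) (tensor V W (v i) (w j)))" "i \<in> I" "j \<in> J"
  shows "c i j = d i j"
proof -
  interpret W: k_space W by fact
  have "(\<Sum>j\<in>J. scl W (c i j) (w j)) = (\<Sum>j\<in>J. scl W (d i j) (w j))"
    using assms(8,9)
    by (intro tensor_indep_left[OF assms(1-3,5,7) _ _ _ assms(10)] W.sum_closed W.scl_closed)
      (simp_all add: tensor_sum_right tensor_scl_right)
  from W.indep_fam_eqD[OF assms(6) this assms(11)] show ?thesis .
qed

lemma tensor_basis_decomp_left:
  assumes "k_space V" "k_space W" "basis_fam V I v" "T \<in> carrier (tensor_space V W)"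
  obtains x where "\<And>i. i \<in> I \<Longrightarrow> x i \<in> carrier W" "T = (\<Sum>i\<in>I. tensor V W (v i) (x i))"
proof -
  interpret V: k_space V by fact
  interpret W: k_space W by fact
  have "\<exists>x. (\<forall>i\<in>I. x i \<in> carrier W) \<and> T = (\<Sum>i\<in>I. tensor V W (v i) (x i))"
    using assms(4,1)
  proof (induction T rule: tensor_induct)
    case zero
    show ?case by (rule exI[of _ "\<lambda>_. 0"]) (simp add: tensor_zero_right)
  next
    case (tensor a b)
    obtain c where "a = (\<Sum>i\<in>I. scl V (c i) (v i))"
      using V.basis_fam_coord[OF assms(3) tensor(1)] by blast
    then show ?case
      using tensor(2)
      by (intro exI[of _ "\<lambda>i. scl W (c i) b"]) (simp add: tensor_sum_left tensor_scl_left tensor_scl_right)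
  next
    case (add X Y)
    then obtain x y where xy: "\<forall>i\<in>I. x i \<in> carrier W" "\<forall>i\<in>I. y i \<in> carrier W"
      "X = (\<Sum>i\<in>I. tensor V W (v i) (x i))" "Y = (\<Sum>i\<in>I. tensor V W (v i) (y i))" by blast
    have "X + Y = (\<Sum>i\<in>I. tensor V W (v i) (x i + y i))"
      unfolding xy(3,4) tensor_add_right sum.distrib ..
    moreover have "\<forall>i\<in>I. x i + y i \<in> carrier W"
      using xy(1,2) by simp
    ultimately show ?case by (intro exI[of _ "\<lambda>i. x i + y i"] conjI)
  qed
  then show thesis using that by blast
qed

lemma tensor_basis_decomp_right:
  assumes "k_space V" "k_space W" "basis_fam W I v" "T \<in> carrier (tensor_space V W)"
  obtains x where "\<And>i. i \<in> I \<Longrightarrow> x i \<in> carrier V" "T = (\<Sum>i\<in>I. tensor V W (x i) (v i))"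
proof -
  interpret V: k_space V by fact
  interpret W: k_space W by fact
  have "\<exists>x. (\<forall>i\<in>I. x i \<in> carrier V) \<and> T = (\<Sum>i\<in>I. tensor V W (x i) (v i))"
    using assms(4,1)
  proof (induction T rule: tensor_induct)
    case zero
    show ?case by (rule exI[of _ "\<lambda>_. 0"]) (simp add: tensor_zero_left)
  next
    case (tensor a b)
    obtain c where "b = (\<Sum>i\<in>I. scl W (c i) (v i))"
      using W.basis_fam_coord[OF assms(3) tensor(2)] by blast
    then show ?case
      using tensor(1)
      by (intro exI[of _ "\<lambda>i. scl V (c i) a"]) (simp add: tensor_sum_right tensor_scl_left tensor_scl_right)
  next
    case (add X Y)
    then obtain x y where xy: "\<forall>i\<in>I. x i \<in> carrier V" "\<forall>i\<in>I. y i \<in> carrier V"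
      "X = (\<Sum>i\<in>I. tensor V W (x i) (v i))" "Y = (\<Sum>i\<in>I. tensor V W (y i) (v i))" by blast
    have "X + Y = (\<Sum>i\<in>I. tensor V W (x i + y i) (v i))"
      unfolding xy(3,4) tensor_add_left sum.distrib ..
    moreover have "\<forall>i\<in>I. x i + y i \<in> carrier V"
      using xy(1,2) by simp
    ultimately show ?case by (intro exI[of _ "\<lambda>i. x i + y i"] conjI)
  qed
  then show thesis using that by blast
qed

lemma basis_fam_tensor:
  assumes V: "k_space V" and W: "k_space W" and v: "basis_fam V I v" and w: "basis_fam W J w"
  shows "basis_fam (tensor_space V W) (I \<times> J) (\<lambda>(i, j). tensor V W (v i) (w j))"
proof -
  interpret W: k_space W by fact
  have fin: "finite I" "finite J" "indep_fam V I v" "indep_fam W J w"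
    and vw: "\<And>i. i \<in> I \<Longrightarrow> v i \<in> carrier V" "\<And>j. j \<in> J \<Longrightarrow> w j \<in> carrier W"
    using v w by (auto simp: basis_fam_def)
  have "\<exists>c. T = (\<Sum>p\<in>I \<times> J. fun_scl (c p) (case p of (i, j) \<Rightarrow> tensor V W (v i) (w j)))"
    if T: "T \<in> carrier (tensor_space V W)" for T
  proof -
    obtain x where x: "\<And>i. i \<in> I \<Longrightarrow> x i \<in> carrier W" "T = (\<Sum>i\<in>I. tensor V W (v i) (x i))"
      using tensor_basis_decomp_left[OF V W v T] by blast
    have "\<forall>i. \<exists>c. i \<in> I \<longrightarrow> x i = (\<Sum>j\<in>J. scl W (c j) (w j))"
      using W.basis_fam_coord[OF w x(1)] by metis
    then obtain c where c: "\<And>i. i \<in> I \<Longrightarrow> x i = (\<Sum>j\<in>J. scl W (c i j) (w j))" by metis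
    have "T = (\<Sum>i\<in>I. \<Sum>j\<in>J. fun_scl (c i j) (tensor V W (v i) (w j)))"
      unfolding x(2) by (intro sum.cong refl) (simp add: c tensor_sum_right tensor_scl_right)
    then show ?thesis
      by (intro exI[of _ "\<lambda>(i, j). c i j"]) (simp add: sum.cartesian_product case_prod_beta)
  qed
  moreover have "c (i, j) = 0"
    if "(\<Sum>p\<in>I \<times> J. fun_scl (c p) (case p of (i, j) \<Rightarrow> tensor V W (v i) (w j))) = 0" "i \<in> I" "j \<in> J" for c i j
  proof -
    have "(\<Sum>i\<in>I. \<Sum>j\<in>J. fun_scl (c (i, j)) (tensor V W (v i) (w j))) =
        (\<Sum>i\<in>I. \<Sum>j\<in>J. fun_scl 0 (tensor V W (v i) (w j)))"
      using that(1) by (simp add: sum.cartesian_product case_prod_beta)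
    from tensor_indep[OF V W fin vw this that(2,3)] show ?thesis .
  qed
  ultimately show ?thesis
    using fin vw by (auto simp: basis_fam_def indep_fam_def)
qed

section \<open>Algebras\<close>

context k_algebra
begin

lemma mul_closed [simp]: "x \<in> carrier A \<Longrightarrow> y \<in> carrier A \<Longrightarrow> mul A x y \<in> carrier A"
  using monoid.m_closed[OF monoid] by simp

lemma unity_closed [simp]: "unity A \<in> carrier A"
  using monoid.one_closed[OF monoid] by simp

lemma mul_assoc:
  "x \<in> carrier A \<Longrightarrow> y \<in> carrier A \<Longrightarrow> z \<in> carrier A \<Longrightarrow> mul A (mul A x y) z = mul A x (mul A y z)"
  using monoid.m_assoc[OF monoid] by simp

lemma mul_unity_left [simp]: "x \<in> carrier A \<Longrightarrow> mul A (unity A) x = x"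
  using monoid.l_one[OF monoid] by simp

lemma mul_unity_right [simp]: "x \<in> carrier A \<Longrightarrow> mul A x (unity A) = x"
  using monoid.r_one[OF monoid] by simp

lemma linear_mul_left: "x \<in> carrier A \<Longrightarrow> linear_on A A (mul A x)"
  and linear_mul_right: "y \<in> carrier A \<Longrightarrow> linear_on A A (\<lambda>x. mul A x y)"
  using bilinear by (auto simp: bilinear_on_def)

lemma mul_scl_right: "x \<in> carrier A \<Longrightarrow> y \<in> carrier A \<Longrightarrow> mul A x (scl A c y) = scl A c (mul A x y)"
  using linear_onD(3)[OF linear_mul_left] by blast

lemma mul_scl_left: "x \<in> carrier A \<Longrightarrow> y \<in> carrier A \<Longrightarrow> mul A (scl A c x) y = scl A c (mul A x y)"
  using linear_onD(3)[OF linear_mul_right, of y x c] by blast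

lemma mul_add_right:
  "x \<in> carrier A \<Longrightarrow> y \<in> carrier A \<Longrightarrow> z \<in> carrier A \<Longrightarrow> mul A x (y + z) = mul A x y + mul A x z"
  using linear_onD(2)[OF linear_mul_left] by blast

lemma mul_add_left:
  "x \<in> carrier A \<Longrightarrow> y \<in> carrier A \<Longrightarrow> z \<in> carrier A \<Longrightarrow> mul A (y + z) x = mul A y x + mul A z x"
  using linear_onD(2)[OF linear_mul_right, of x y z] by blast

lemma mul_sum_right:
  "x \<in> carrier A \<Longrightarrow> (\<And>i. i \<in> I \<Longrightarrow> f i \<in> carrier A) \<Longrightarrow> mul A x (\<Sum>i\<in>I. f i) = (\<Sum>i\<in>I. mul A x (f i))"
  using linear_on_sum[OF linear_mul_left k_space_axioms k_space_axioms] by blast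

lemma mul_sum_left:
  "x \<in> carrier A \<Longrightarrow> (\<And>i. i \<in> I \<Longrightarrow> f i \<in> carrier A) \<Longrightarrow> mul A (\<Sum>i\<in>I. f i) x = (\<Sum>i\<in>I. mul A (f i) x)"
  using linear_on_sum[OF linear_mul_right k_space_axioms k_space_axioms, of x I f] by blast

lemma mul_zero_left [simp]: "x \<in> carrier A \<Longrightarrow> mul A 0 x = 0"
  using mul_sum_left[of x "{}"] by simp

lemma mul_zero_right [simp]: "x \<in> carrier A \<Longrightarrow> mul A x 0 = 0"
  using mul_sum_right[of x "{}"] by simp

lemma subalgebra_k_algebra:
  assumes "subalgebra A S" "carrier B = S" "scl B = scl A" "mul B = mul A" "unity B = unity A"
  shows "k_algebra B"
proof -
  have "vector_space (scl B)" "module.subspace (scl B) (carrier B)"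
    using vector_space assms by (simp_all add: subalgebra_def)
  then have B: "k_space B" by (rule k_space.intro)
  have S: "S \<subseteq> carrier A" "unity A \<in> S" "\<And>x y. x \<in> S \<Longrightarrow> y \<in> S \<Longrightarrow> mul A x y \<in> S"
    using assms(1) by (auto simp: subalgebra_def)
  have "monoid (mult_monoid B)"
    using S assms(2-) by unfold_locales (auto intro!: mul_assoc)
  moreover have "bilinear_on B B B (mul B)"
    using S bilinear unfolding bilinear_on_def linear_on_def by (auto simp: assms Pi_iff subset_iff)
  ultimately show ?thesis
    using B by (simp add: k_algebra_def k_algebra_axioms_def)
qed

end

lemma k_algebraI:
  assumes "k_space A" "\<And>x y. x \<in> carrier A \<Longrightarrow> y \<in> carrier A \<Longrightarrow> mul A x y \<in> carrier A"
    "unity A \<in> carrier A"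
    "\<And>x y z. x \<in> carrier A \<Longrightarrow> y \<in> carrier A \<Longrightarrow> z \<in> carrier A \<Longrightarrow> mul A (mul A x y) z = mul A x (mul A y z)"
    "\<And>x. x \<in> carrier A \<Longrightarrow> mul A (unity A) x = x" "\<And>x. x \<in> carrier A \<Longrightarrow> mul A x (unity A) = x"
    "bilinear_on A A A (mul A)"
  shows "k_algebra A"
  unfolding k_algebra_def k_algebra_axioms_def
  using assms by (auto intro!: monoidI)

section \<open>The tensor product of two algebras\<close>

locale algebra_pair = A: k_algebra A + B: k_algebra B
  for A :: "('k::field, 'a::ab_group_add, 'm) kalg_scheme"
    and B :: "('k, 'b::ab_group_add, 'n) kalg_scheme"
begin

lemma bilinear_inner:
  assumes "a \<in> carrier A" "b \<in> carrier B"
  shows "bilinear_on A B (tensor_space A B) (\<lambda>c d. tensor A B (mul A a c) (mul B b d))"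
  using assms
  by (auto intro!: bilinear_onI linear_onI simp: A.mul_add_right B.mul_add_right A.mul_scl_right
      B.mul_scl_right tensor_add_left tensor_add_right tensor_scl_left tensor_scl_right)

lemma lift_inner:
  assumes "a \<in> carrier A" "b \<in> carrier B"
  shows "linear_on (tensor_space A B) (tensor_space A B)
      (tensor_lift A B (\<lambda>c d. tensor A B (mul A a c) (mul B b d)))"
    and "c \<in> carrier A \<Longrightarrow> d \<in> carrier B \<Longrightarrow>
      tensor_lift A B (\<lambda>c d. tensor A B (mul A a c) (mul B b d)) (tensor A B c d) =
      tensor A B (mul A a c) (mul B b d)"
  using linear_on_tensor_lift[OF A.k_space_axioms B.k_space_axioms k_space_tensor_space bilinear_inner[OF assms]]
    tensor_lift_tensor[OF A.k_space_axioms B.k_space_axioms k_space_tensor_space bilinear_inner[OF assms]]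
  by blast+

text \<open>A decomposition of \<open>Y\<close>, chosen independently of \<open>a\<close> and
  \<open>b\<close>, turns the inner lift into a finite sum that is visibly bilinear.\<close>

lemma bilinear_outer:
  assumes "Y \<in> carrier (tensor_space A B)"
  shows "bilinear_on A B (tensor_space A B)
    (\<lambda>a b. tensor_lift A B (\<lambda>c d. tensor A B (mul A a c) (mul B b d)) Y)"
proof -
  obtain N :: nat and x y where Y: "\<And>i. i < N \<Longrightarrow> x i \<in> carrier A" "\<And>i. i < N \<Longrightarrow> y i \<in> carrier B"
    "Y = (\<Sum>i<N. tensor A B (x i) (y i))"
    using tensor_sum_family[OF assms A.k_space_axioms] by blast
  have "tensor_lift A B (\<lambda>c d. tensor A B (mul A a c) (mul B b d)) Y =
      (\<Sum>i<N. tensor A B (mul A a (x i)) (mul B b (y i)))" if "a \<in> carrier A" "b \<in> carrier B" for a b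
    unfolding Y(3) using Y(1,2)
    by (intro tensor_lift_sum_tensor[OF A.k_space_axioms B.k_space_axioms k_space_tensor_space bilinear_inner[OF that]]) auto
  then show ?thesis
    using Y(1,2)
    by (auto intro!: bilinear_onI linear_onI tensor_sum_closed simp: A.mul_add_left B.mul_add_left A.mul_scl_left sum.distrib
        B.mul_scl_left tensor_add_left tensor_add_right tensor_scl_left tensor_scl_right fs.scale_sum_right)
qed

lemma tensor_alg_mul:
  assumes "a \<in> carrier A" "b \<in> carrier B" "c \<in> carrier A" "d \<in> carrier B"
  shows "mul (tensor_alg A B) (tensor A B a b) (tensor A B c d) = tensor A B (mul A a c) (mul B b d)"
  using assms
  by (simp add: tensor_alg_def lift_inner(2)
    tensor_lift_tensor[OF A.k_space_axioms B.k_space_axioms k_space_tensor_space bilinear_outer])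

lemma bilinear_tensor_alg:
  "bilinear_on (tensor_space A B) (tensor_space A B) (tensor_space A B) (mul (tensor_alg A B))"
proof (rule bilinear_onI)
  show "linear_on (tensor_space A B) (tensor_space A B) (\<lambda>X. mul (tensor_alg A B) X Y)"
    if "Y \<in> carrier (tensor_space A B)" for Y
    using linear_on_tensor_lift[OF A.k_space_axioms B.k_space_axioms k_space_tensor_space bilinear_outer[OF that]]
    by (simp add: tensor_alg_def)
next
  fix X assume "X \<in> carrier (tensor_space A B)"
  then obtain N :: nat and x y where X: "\<And>i. i < N \<Longrightarrow> x i \<in> carrier A" "\<And>i. i < N \<Longrightarrow> y i \<in> carrier B"
    "X = (\<Sum>i<N. tensor A B (x i) (y i))"
    using tensor_sum_family[OF _ A.k_space_axioms] by blast
  have "mul (tensor_alg A B) X Y =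
      (\<Sum>i<N. tensor_lift A B (\<lambda>c d. tensor A B (mul A (x i) c) (mul B (y i) d)) Y)"
    if "Y \<in> carrier (tensor_space A B)" for Y
    unfolding X(3) tensor_alg_def kalg.simps using X(1,2)
    by (intro tensor_lift_sum_tensor[OF A.k_space_axioms B.k_space_axioms k_space_tensor_space bilinear_outer[OF that]]) auto
  moreover have "linear_on (tensor_space A B) (tensor_space A B)
      (\<lambda>Y. \<Sum>i<N. tensor_lift A B (\<lambda>c d. tensor A B (mul A (x i) c) (mul B (y i) d)) Y)"
    using X by (intro linear_on_sum_fun lift_inner(1) k_space_tensor_space) auto
  ultimately show "linear_on (tensor_space A B) (tensor_space A B) (mul (tensor_alg A B) X)"
    by (simp add: linear_on_def Pi_iff)
qed

lemma tensor_alg_mul_closed: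
  assumes "X \<in> carrier (tensor_space A B)" "Y \<in> carrier (tensor_space A B)"
  shows "mul (tensor_alg A B) X Y \<in> carrier (tensor_space A B)"
  using linear_onD(1)[OF bilinear_onD(1)[OF bilinear_tensor_alg]] assms by blast

lemmas add_left = linear_onD(2)[OF bilinear_onD(2)[OF bilinear_tensor_alg]]
lemmas add_right = linear_onD(2)[OF bilinear_onD(1)[OF bilinear_tensor_alg]]

lemmas zero_left = linear_on_zero[OF bilinear_onD(2)[OF bilinear_tensor_alg] k_space_tensor_space k_space_tensor_space]
lemmas zero_right = linear_on_zero[OF bilinear_onD(1)[OF bilinear_tensor_alg] k_space_tensor_space k_space_tensor_space]

text \<open>Associativity is extended from pure tensors one argument at a time: first
  \<open>Z\<close>, then \<open>Y\<close>, then \<open>X\<close>.\<close>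

lemma k_algebra_tensor_alg: "k_algebra (tensor_alg A B)"
proof (rule k_algebraI)
  show "k_space (tensor_alg A B)" by (rule k_space_tensor_alg)
  show "bilinear_on (tensor_alg A B) (tensor_alg A B) (tensor_alg A B) (mul (tensor_alg A B))"
    using bilinear_tensor_alg by (simp add: bilinear_on_def linear_on_def)
  fix X assume X: "X \<in> carrier (tensor_alg A B)"
  have X': "X \<in> carrier (tensor_space A B)" using X by simp
  show "mul (tensor_alg A B) (unity (tensor_alg A B)) X = X"
    using X' A.k_space_axioms
    by (rule tensor_induct[where P = "\<lambda>X. mul (tensor_alg A B) (unity (tensor_alg A B)) X = X"]) (simp_all add: tensor_alg_mul zero_right add_right)
  show "mul (tensor_alg A B) X (unity (tensor_alg A B)) = X"
    using X' A.k_space_axioms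
    by (rule tensor_induct[where P = "\<lambda>X. mul (tensor_alg A B) X (unity (tensor_alg A B)) = X"]) (simp_all add: tensor_alg_mul zero_left add_left)
  fix Y assume Y: "Y \<in> carrier (tensor_alg A B)"
  then have Y': "Y \<in> carrier (tensor_space A B)" by simp
  show "mul (tensor_alg A B) X Y \<in> carrier (tensor_alg A B)"
    using X Y by (simp add: tensor_alg_mul_closed)
  fix Z assume "Z \<in> carrier (tensor_alg A B)"
  then have Z': "Z \<in> carrier (tensor_space A B)" by simp
  have pure: "mul (tensor_alg A B) (mul (tensor_alg A B) (tensor A B a b) (tensor A B c d)) Z =
      mul (tensor_alg A B) (tensor A B a b) (mul (tensor_alg A B) (tensor A B c d) Z)"
    if "a \<in> carrier A" "b \<in> carrier B" "c \<in> carrier A" "d \<in> carrier B" for a b c d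
    using Z' A.k_space_axioms
    by (rule tensor_induct[where P = "\<lambda>Z. mul (tensor_alg A B) (mul (tensor_alg A B) (tensor A B a b) (tensor A B c d)) Z =
          mul (tensor_alg A B) (tensor A B a b) (mul (tensor_alg A B) (tensor A B c d) Z)"])
      (use that in \<open>simp_all add: tensor_alg_mul zero_right add_right tensor_alg_mul_closed A.mul_assoc B.mul_assoc\<close>)
  have pure': "mul (tensor_alg A B) (mul (tensor_alg A B) (tensor A B a b) Y) Z =
      mul (tensor_alg A B) (tensor A B a b) (mul (tensor_alg A B) Y Z)"
    if "a \<in> carrier A" "b \<in> carrier B" for a b
    using Y' A.k_space_axioms
    by (rule tensor_induct[where P = "\<lambda>Y. mul (tensor_alg A B) (mul (tensor_alg A B) (tensor A B a b) Y) Z =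
          mul (tensor_alg A B) (tensor A B a b) (mul (tensor_alg A B) Y Z)"])
      (use that Z' in \<open>simp_all add: pure zero_left zero_right add_left add_right tensor_alg_mul_closed\<close>)
  show "mul (tensor_alg A B) (mul (tensor_alg A B) X Y) Z = mul (tensor_alg A B) X (mul (tensor_alg A B) Y Z)"
    using X' A.k_space_axioms
    by (rule tensor_induct[where P = "\<lambda>X. mul (tensor_alg A B) (mul (tensor_alg A B) X Y) Z =
          mul (tensor_alg A B) X (mul (tensor_alg A B) Y Z)"])
      (use Y' Z' in \<open>simp_all add: pure' zero_left add_left tensor_alg_mul_closed\<close>)
qed simp

end

section \<open>Hopf algebras in coordinates\<close>

lemma bilinear_eq_basis:
  assumes "\<And>y. y \<in> carrier W \<Longrightarrow> linear_on V U (\<lambda>x. f x y)" "\<And>x. x \<in> carrier V \<Longrightarrow> linear_on W U (f x)"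
    and "\<And>y. y \<in> carrier W \<Longrightarrow> linear_on V U (\<lambda>x. g x y)" "\<And>x. x \<in> carrier V \<Longrightarrow> linear_on W U (g x)"
    and V: "k_space V" and W: "k_space W" and U: "k_space U" and v: "basis_fam V I v" and w: "basis_fam W J w"
    and eq: "\<And>i j. i \<in> I \<Longrightarrow> j \<in> J \<Longrightarrow> f (v i) (w j) = g (v i) (w j)"
    and x: "x \<in> carrier V" and y: "y \<in> carrier W"
  shows "f x y = g x y"
proof -
  have "f (v i) y = g (v i) y" if "i \<in> I" for i
  proof -
    have vi: "v i \<in> carrier V" using v that by (auto simp: basis_fam_def)
    show ?thesis
      by (rule linear_on_eq_basis[OF assms(2)[OF vi] assms(4)[OF vi] W U w eq[OF that] y])
  qed
  then show ?thesis
    using linear_on_eq_basis[OF assms(1)[OF y] assms(3)[OF y] V U v _ x] by blast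
qed

lemma linear_tensor_lift:
  assumes "k_space V" "k_space W" "k_space U" "k_space U'" "bilinear_on V W U \<beta>" "linear_on U U' g"
    "T \<in> carrier (tensor_space V W)"
  shows "g (tensor_lift V W \<beta> T) = tensor_lift V W (\<lambda>v w. g (\<beta> v w)) T"
proof -
  have b: "bilinear_on V W U' (\<lambda>v w. g (\<beta> v w))"
    using assms(5) by (auto intro!: bilinear_onI linear_on_comp[OF _ assms(6)] simp: bilinear_on_def)
  show ?thesis
    by (rule linear_on_tensor_eq[where f = "\<lambda>T. g (tensor_lift V W \<beta> T)" and g = "tensor_lift V W (\<lambda>v w. g (\<beta> v w))",
          OF linear_on_comp[OF linear_on_tensor_lift[OF assms(1-3,5)] assms(6)]
          linear_on_tensor_lift[OF assms(1,2,4) b] assms(1,4) _ assms(7)])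
      (simp add: tensor_lift_tensor[OF assms(1-3,5)] tensor_lift_tensor[OF assms(1,2,4) b])
qed

text \<open>Apply both counits to the two legs of \<open>\<Delta> x\<close>: collapsing the left leg
  first gives \<open>e' x\<close>, collapsing the right leg first gives \<open>e x\<close>.\<close>

lemma counit_unique:
  assumes C: "k_space C" and \<Delta>: "\<And>x. x \<in> carrier C \<Longrightarrow> \<Delta> x \<in> carrier (tensor_space C C)"
    and e: "is_counit C \<Delta> e" and e': "is_counit C \<Delta> e'"
  shows "e = e'"
proof
  fix x
  have d: "e \<in> carrier (dual C)" "e' \<in> carrier (dual C)"
    using e e' by (auto simp: is_counit_def)
  show "e x = e' x"
  proof (cases "x \<in> carrier C")
    case True
    have "e' (tensor_lift C C (\<lambda>a b. scl C (e a) b) (\<Delta> x)) = tensor_lift C C (\<lambda>a b. e' (scl C (e a) b)) (\<Delta> x)"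
      by (rule linear_tensor_lift[OF C C C k_space_ground bilinear_on_slice_left[OF d(1) C] dualD(1)[OF d(2)] \<Delta>[OF True]])
    moreover have "e (tensor_lift C C (\<lambda>a b. scl C (e' b) a) (\<Delta> x)) = tensor_lift C C (\<lambda>a b. e (scl C (e' b) a)) (\<Delta> x)"
      by (rule linear_tensor_lift[OF C C C k_space_ground bilinear_on_slice_right[OF d(2) C] dualD(1)[OF d(1)] \<Delta>[OF True]])
    moreover have "tensor_lift C C (\<lambda>a b. e' (scl C (e a) b)) = tensor_lift C C (\<lambda>a b. e (scl C (e' b) a))"
      using linear_onD(3)[OF dualD(1)[OF d(1)]] linear_onD(3)[OF dualD(1)[OF d(2)]]
      by (intro tensor_lift_cong) (auto simp: mult.commute)
    moreover have "tensor_lift C C (\<lambda>a b. scl C (e a) b) (\<Delta> x) = x" "tensor_lift C C (\<lambda>a b. scl C (e' b) a) (\<Delta> x) = x"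
      using e e' True by (auto simp: is_counit_def)
    ultimately show ?thesis by simp
  qed (use dualD(2)[OF d(1)] dualD(2)[OF d(2)] in simp)
qed

lemma sum_rotate3: "(\<Sum>i\<in>A. \<Sum>j\<in>B. \<Sum>k\<in>C. f i j k) = (\<Sum>j\<in>B. \<Sum>k\<in>C. \<Sum>i\<in>A. f i j k)"
  by (subst sum.swap, rule sum.cong[OF refl], rule sum.swap)

lemma sum_rotate4: "(\<Sum>i\<in>A. \<Sum>j\<in>B. \<Sum>k\<in>C. \<Sum>l\<in>D. f i j k l) = (\<Sum>j\<in>B. \<Sum>k\<in>C. \<Sum>l\<in>D. \<Sum>i\<in>A. f i j k l)"
  by (subst sum.swap, rule sum.cong[OF refl], rule sum_rotate3)

lemma sum_rotate5: "(\<Sum>i\<in>A. \<Sum>j\<in>B. \<Sum>k\<in>C. \<Sum>l\<in>D. \<Sum>p\<in>E. f i j k l p) =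
    (\<Sum>j\<in>B. \<Sum>k\<in>C. \<Sum>l\<in>D. \<Sum>p\<in>E. \<Sum>i\<in>A. f i j k l p)"
  by (subst sum.swap, rule sum.cong[OF refl], rule sum_rotate4)

text \<open>Structure constants: \<open>v\<^sub>i v\<^sub>j = \<Sum>\<^sub>l n i j l v\<^sub>l\<close>, \<open>\<Delta> v\<^sub>l = \<Sum>\<^sub>j\<^sub>k m j k l v\<^sub>j \<otimes> v\<^sub>k\<close>, \<open>1 = \<Sum>\<^sub>i u i v\<^sub>i\<close>,
  \<open>\<epsilon> v\<^sub>i = e i\<close> and \<open>S v\<^sub>i = \<Sum>\<^sub>k s k i v\<^sub>k\<close>. In this form duality exchanges \<open>n\<close> with \<open>m\<close> and \<open>u\<close> with
  \<open>e\<close> and transposes \<open>s\<close>.\<close>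

locale hopf_datum =
  fixes I :: "'i set" and n m :: "'i \<Rightarrow> 'i \<Rightarrow> 'i \<Rightarrow> 'k::field" and u e :: "'i \<Rightarrow> 'k"
    and s :: "'i \<Rightarrow> 'i \<Rightarrow> 'k"
  assumes fin: "finite I"
    and n_assoc: "\<lbrakk>i \<in> I; j \<in> I; k \<in> I; l \<in> I\<rbrakk> \<Longrightarrow> (\<Sum>p\<in>I. n i j p * n p k l) = (\<Sum>p\<in>I. n j k p * n i p l)"
    and m_assoc: "\<lbrakk>i \<in> I; j \<in> I; k \<in> I; l \<in> I\<rbrakk> \<Longrightarrow> (\<Sum>p\<in>I. m i j p * m p k l) = (\<Sum>p\<in>I. m j k p * m i p l)"
    and n_unit: "\<lbrakk>j \<in> I; l \<in> I\<rbrakk> \<Longrightarrow> (\<Sum>i\<in>I. u i * n i j l) = (if j = l then 1 else 0)"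
      "\<lbrakk>j \<in> I; l \<in> I\<rbrakk> \<Longrightarrow> (\<Sum>i\<in>I. u i * n j i l) = (if j = l then 1 else 0)"
    and m_unit: "\<lbrakk>j \<in> I; l \<in> I\<rbrakk> \<Longrightarrow> (\<Sum>i\<in>I. e i * m i j l) = (if j = l then 1 else 0)"
      "\<lbrakk>j \<in> I; l \<in> I\<rbrakk> \<Longrightarrow> (\<Sum>i\<in>I. e i * m j i l) = (if j = l then 1 else 0)"
    and compat: "\<lbrakk>i \<in> I; j \<in> I; p \<in> I; q \<in> I\<rbrakk> \<Longrightarrow> (\<Sum>l\<in>I. n i j l * m p q l) =
      (\<Sum>x\<in>I. \<Sum>y\<in>I. \<Sum>z\<in>I. \<Sum>w\<in>I. m x y i * m z w j * n x z p * n y w q)"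
    and e_mult: "\<lbrakk>i \<in> I; j \<in> I\<rbrakk> \<Longrightarrow> (\<Sum>l\<in>I. n i j l * e l) = e i * e j"
    and u_mult: "\<lbrakk>i \<in> I; j \<in> I\<rbrakk> \<Longrightarrow> (\<Sum>l\<in>I. m i j l * u l) = u i * u j"
    and u_e: "(\<Sum>i\<in>I. u i * e i) = 1"
    and s_left: "\<lbrakk>l \<in> I; q \<in> I\<rbrakk> \<Longrightarrow> (\<Sum>j\<in>I. \<Sum>k\<in>I. \<Sum>i\<in>I. m j k l * s i j * n i k q) = e l * u q"
    and s_right: "\<lbrakk>l \<in> I; q \<in> I\<rbrakk> \<Longrightarrow> (\<Sum>j\<in>I. \<Sum>k\<in>I. \<Sum>i\<in>I. m j k l * s i k * n j i q) = e l * u q"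

text \<open>All axioms come in dual pairs except \<open>compat\<close> and \<open>u_e\<close>. The
  former becomes its own dual once the two middle summation indices are swapped; the antipode sums
  only need their indices renamed.\<close>

lemma (in hopf_datum) dual_datum: "hopf_datum I m n e u (\<lambda>i j. s j i)"
proof
  fix i j p q assume i: "i \<in> I" "j \<in> I" "p \<in> I" "q \<in> I"
  have "(\<Sum>l\<in>I. m i j l * n p q l) = (\<Sum>l\<in>I. n p q l * m i j l)" by (simp add: mult.commute)
  also have "\<dots> = (\<Sum>x\<in>I. \<Sum>y\<in>I. \<Sum>z\<in>I. \<Sum>w\<in>I. m x y p * m z w q * n x z i * n y w j)"
    using i by (intro compat)
  also have "\<dots> = (\<Sum>x\<in>I. \<Sum>z\<in>I. \<Sum>y\<in>I. \<Sum>w\<in>I. m x y p * m z w q * n x z i * n y w j)"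
    by (rule sum.cong[OF refl], rule sum.swap)
  also have "\<dots> = (\<Sum>x\<in>I. \<Sum>y\<in>I. \<Sum>z\<in>I. \<Sum>w\<in>I. n x y i * n z w j * m x z p * m y w q)"
    by (simp add: mult_ac)
  finally show "(\<Sum>l\<in>I. m i j l * n p q l) =
    (\<Sum>x\<in>I. \<Sum>y\<in>I. \<Sum>z\<in>I. \<Sum>w\<in>I. n x y i * n z w j * m x z p * m y w q)" .
next
  fix l q assume l: "l \<in> I" "q \<in> I"
  have "(\<Sum>j\<in>I. \<Sum>k\<in>I. \<Sum>i\<in>I. n j k l * s j i * m i k q) = (\<Sum>j\<in>I. \<Sum>i\<in>I. \<Sum>k\<in>I. n j k l * s j i * m i k q)"
    by (rule sum.cong[OF refl], rule sum.swap)
  also have "\<dots> = (\<Sum>i\<in>I. \<Sum>k\<in>I. \<Sum>j\<in>I. m i k q * s j i * n j k l)"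
    by (subst sum_rotate3) (simp add: mult_ac)
  also have "\<dots> = u l * e q" using s_left[OF l(2,1)] by (simp add: mult.commute)
  finally show "(\<Sum>j\<in>I. \<Sum>k\<in>I. \<Sum>i\<in>I. n j k l * s j i * m i k q) = u l * e q" .
  have "(\<Sum>j\<in>I. \<Sum>k\<in>I. \<Sum>i\<in>I. n j k l * s k i * m j i q) = (\<Sum>j\<in>I. \<Sum>i\<in>I. \<Sum>k\<in>I. m j i q * s k i * n j k l)"
    by (rule sum.cong[OF refl], subst sum.swap) (simp add: mult_ac)
  also have "\<dots> = u l * e q" using s_right[OF l(2,1)] by (simp add: mult.commute)
  finally show "(\<Sum>j\<in>I. \<Sum>k\<in>I. \<Sum>i\<in>I. n j k l * s k i * m j i q) = u l * e q" .
qed (use fin n_assoc m_assoc n_unit m_unit e_mult u_mult u_e in \<open>auto simp: mult.commute\<close>)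

text \<open>Only linearity and values on a basis are assumed; the Hopf algebra axioms are then
  consequences of the scalar identities. The values of counit and antipode off the carrier are fixed
  so that uniqueness becomes equality of functions.\<close>

locale hopf_coords = hopf_datum I n m u e s
  for I :: "'i set" and n m :: "'i \<Rightarrow> 'i \<Rightarrow> 'i \<Rightarrow> 'k::field" and u e s +
  fixes L :: "('k, 'v::ab_group_add, 'm) khopf_scheme" and v :: "'i \<Rightarrow> 'v"
  assumes space: "k_space L"
    and basis: "basis_fam L I v"
    and mul_bilin: "bilinear_on L L L (mul L)"
    and mul_v: "\<lbrakk>i \<in> I; j \<in> I\<rbrakk> \<Longrightarrow> mul L (v i) (v j) = (\<Sum>l\<in>I. scl L (n i j l) (v l))"
    and unity_v: "unity L = (\<Sum>i\<in>I. scl L (u i) (v i))"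
    and comul_lin: "linear_on L (tensor_space L L) (comul L)"
    and comul_v: "l \<in> I \<Longrightarrow> comul L (v l) = (\<Sum>j\<in>I. \<Sum>k\<in>I. fun_scl (m j k l) (tensor L L (v j) (v k)))"
    and counit_dual: "counit L \<in> carrier (dual L)"
    and counit_v: "i \<in> I \<Longrightarrow> counit L (v i) = e i"
    and antipode_lin: "linear_on L L (antipode L)"
    and antipode_off: "x \<notin> carrier L \<Longrightarrow> antipode L x = 0"
    and antipode_v: "i \<in> I \<Longrightarrow> antipode L (v i) = (\<Sum>k\<in>I. scl L (s k i) (v k))"
begin

sublocale sp: k_space L by (rule space)

lemma v_closed [simp]: "i \<in> I \<Longrightarrow> v i \<in> carrier L"
  using basis by (auto simp: basis_fam_def)

lemma v_indep: "indep_fam L I v"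
  using basis by (auto simp: basis_fam_def)

lemma tensor_lift_comb:
  assumes "k_space U" "bilinear_on L L U \<beta>"
  shows "tensor_lift L L \<beta> (\<Sum>j\<in>I. \<Sum>k\<in>I. fun_scl (c j k) (tensor L L (v j) (v k))) =
    (\<Sum>j\<in>I. \<Sum>k\<in>I. scl U (c j k) (\<beta> (v j) (v k)))"
  by (simp add: tensor_lift_sum[OF space space assms] tensor_lift_scl[OF space space assms]
      tensor_lift_tensor[OF space space assms] cong: sum.cong_simp)

lemma lift_comul:
  assumes "k_space U" "bilinear_on L L U \<beta>" "l \<in> I"
  shows "tensor_lift L L \<beta> (comul L (v l)) = (\<Sum>j\<in>I. \<Sum>k\<in>I. scl U (m j k l) (\<beta> (v j) (v k)))"
  by (simp add: comul_v assms(3) tensor_lift_comb[OF assms(1,2)])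

lemma lin_lift_comul:
  assumes "k_space U" "bilinear_on L L U \<beta>"
  shows "linear_on L U (\<lambda>x. tensor_lift L L \<beta> (comul L x))"
  by (rule linear_on_comp[OF comul_lin linear_on_tensor_lift[OF space space assms]])

lemmas mul_lin_left = bilinear_onD(1)[OF mul_bilin]
lemmas mul_lin_right = bilinear_onD(2)[OF mul_bilin]

lemma mul_comb_left:
  "x \<in> carrier L \<Longrightarrow> mul L (\<Sum>i\<in>I. scl L (c i) (v i)) x = (\<Sum>i\<in>I. scl L (c i) (mul L (v i) x))"
  by (rule linear_on_lincomb[OF mul_lin_right space space]) auto

lemma mul_comb_right:
  "x \<in> carrier L \<Longrightarrow> mul L x (\<Sum>i\<in>I. scl L (c i) (v i)) = (\<Sum>i\<in>I. scl L (c i) (mul L x (v i)))"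
  by (rule linear_on_lincomb[OF mul_lin_left space space]) auto

lemma mulL_closed: "x \<in> carrier L \<Longrightarrow> y \<in> carrier L \<Longrightarrow> mul L x y \<in> carrier L"
  using linear_onD(1)[OF mul_lin_left] by blast

lemma unityL_closed: "unity L \<in> carrier L"
  unfolding unity_v by simp

lemma eq_basis:
  assumes "linear_on L U f" "linear_on L U g" "k_space U" "\<And>i. i \<in> I \<Longrightarrow> f (v i) = g (v i)" "x \<in> carrier L"
  shows "f x = g x"
  using linear_on_eq_basis[OF assms(1,2) space assms(3) basis assms(4,5)] .

lemma swap_comb:
  "(\<Sum>p\<in>J. scl L (c p) (\<Sum>l\<in>K. scl L (d p l) (v l))) = (\<Sum>l\<in>K. scl L (\<Sum>p\<in>J. c p * d p l) (v l))"
  by (simp add: sp.vs.scale_sum_right sp.vs.scale_sum_left) (rule sum.swap)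

lemma delta_comb: "finite K \<Longrightarrow> j \<in> K \<Longrightarrow> (\<Sum>l\<in>K. scl L (if j = l then 1 else 0) (v l)) = v j"
  by (simp add: if_distrib[where f = "\<lambda>c. scl L c _"] cong: if_cong)

text \<open>On basis vectors associativity is \<open>n_assoc\<close>; steps 1, 2 and 3 release one
  argument after the other by linearity.\<close>

lemma is_algebra: "k_algebra L"
proof (rule k_algebraI)
  fix x y z assume xyz: "x \<in> carrier L" "y \<in> carrier L" "z \<in> carrier L"
  have 1: "mul L (mul L (v i) (v j)) (v k) = mul L (v i) (mul L (v j) (v k))" if "i \<in> I" "j \<in> I" "k \<in> I" for i j k
    using that by (simp add: mul_v mul_comb_left mul_comb_right swap_comb n_assoc cong: sum.cong_simp)
  have 2: "mul L (mul L (v i) (v j)) z = mul L (v i) (mul L (v j) z)" if "i \<in> I" "j \<in> I" for i j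
    using that
    by (intro eq_basis[where f = "mul L (mul L (v i) (v j))" and g = "\<lambda>z. mul L (v i) (mul L (v j) z)", OF _ _ space _ xyz(3)]
        linear_on_comp[OF mul_lin_left mul_lin_left] mul_lin_left mulL_closed 1) auto
  have 3: "mul L (mul L (v i) y) z = mul L (v i) (mul L y z)" if "i \<in> I" for i
    using that xyz
    by (intro eq_basis[where f = "\<lambda>y. mul L (mul L (v i) y) z" and g = "\<lambda>y. mul L (v i) (mul L y z)", OF _ _ space _ xyz(2)]
        linear_on_comp[OF mul_lin_left mul_lin_right] linear_on_comp[OF mul_lin_right mul_lin_left] 2) auto
  show "mul L (mul L x y) z = mul L x (mul L y z)"
    using xyz
    by (intro eq_basis[where f = "\<lambda>x. mul L (mul L x y) z" and g = "\<lambda>x. mul L x (mul L y z)", OF _ _ space _ xyz(1)]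
        linear_on_comp[OF mul_lin_right mul_lin_right] mul_lin_right mulL_closed 3) auto
next
  fix x assume x: "x \<in> carrier L"
  have id: "linear_on L L (\<lambda>x. x)" by (auto simp: linear_on_def)
  show "mul L (unity L) x = x"
    by (rule eq_basis[OF mul_lin_left[OF unityL_closed] id space _ x])
      (simp add: unity_v mul_comb_left mul_v swap_comb n_unit delta_comb fin cong: sum.cong_simp)
  show "mul L x (unity L) = x"
    by (rule eq_basis[OF mul_lin_right[OF unityL_closed] id space _ x])
      (simp add: unity_v mul_comb_right mul_v swap_comb n_unit delta_comb fin cong: sum.cong_simp)
qed (auto simp: space mulL_closed unityL_closed mul_bilin)

sublocale alg: k_algebra L by (rule is_algebra)

text \<open>At \<open>v l\<close> both sides expand in the tensors of three basis vectors, and their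
  coefficients are the two sides of \<open>m_assoc\<close>. Most of the proof supplies the
  bilinearity needed to evaluate the nested lifts.\<close>

lemma is_coassociative: "coassociative L (comul L)"
  unfolding coassociative_def
proof
  fix x assume x: "x \<in> carrier L"
  let ?T = "tensor_space L (tensor_space L L)"
  note sT = k_space_tensor_space[of L "tensor_space L L"]
  have b1: "bilinear_on L L ?T (\<lambda>c d. tensor L (tensor_space L L) c (tensor L L d b))" if "b \<in> carrier L" for b
    using that by (auto intro!: bilinear_onI linear_onI simp: tensor_add_left tensor_add_right tensor_scl_left
        tensor_scl_right tensor_scl_right[where W = "tensor_space L L", simplified])
  have b2: "bilinear_on L L ?T (\<lambda>a b. tensor_lift L L
       (\<lambda>c d. tensor L (tensor_space L L) c (tensor L L d b)) (comul L a))"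
  proof (rule bilinear_onI)
    show "linear_on L ?T (\<lambda>a. tensor_lift L L (\<lambda>c d. tensor L (tensor_space L L) c (tensor L L d b)) (comul L a))"
      if "b \<in> carrier L" for b
      by (rule lin_lift_comul[OF sT b1[OF that]])
    fix a assume a: "a \<in> carrier L"
    have ca: "comul L a \<in> carrier (tensor_space L L)"
      by (rule linear_onD(1)[OF comul_lin a])
    obtain N :: nat and x y where X: "\<And>i. i < N \<Longrightarrow> x i \<in> carrier L" "\<And>i. i < N \<Longrightarrow> y i \<in> carrier L"
      "comul L a = (\<Sum>i<N. tensor L L (x i) (y i))"
      using tensor_sum_family[OF ca space] by blast
    have "tensor_lift L L (\<lambda>c d. tensor L (tensor_space L L) c (tensor L L d b)) (comul L a) =
        (\<Sum>i<N. tensor L (tensor_space L L) (x i) (tensor L L (y i) b))" if "b \<in> carrier L" for b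
      unfolding X(3) using X(1,2) by (intro tensor_lift_sum_tensor[OF space space sT b1[OF that]]) auto
    moreover have "linear_on L ?T (\<lambda>b. \<Sum>i<N. tensor L (tensor_space L L) (x i) (tensor L L (y i) b))"
      using X(1,2) by (intro linear_on_sum_fun sT linear_onI)
        (auto simp: tensor_add_right tensor_scl_right tensor_scl_right[where W = "tensor_space L L", simplified])
    ultimately show "linear_on L ?T (\<lambda>b. tensor_lift L L
       (\<lambda>c d. tensor L (tensor_space L L) c (tensor L L d b)) (comul L a))"
      by (simp add: linear_on_def Pi_iff)
  qed
  have b3: "bilinear_on L L ?T (\<lambda>a b. tensor L (tensor_space L L) a (comul L b))"
    using linear_onD[OF comul_lin]
    by (auto intro!: bilinear_onI linear_onI simp: tensor_add_left tensor_add_right tensor_scl_left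
        tensor_scl_right[where W = "tensor_space L L", simplified])
  show "tensor_lift L L (\<lambda>a b. tensor_lift L L
       (\<lambda>c d. tensor L (tensor_space L L) c (tensor L L d b)) (comul L a)) (comul L x) =
     tensor_lift L L (\<lambda>a b. tensor L (tensor_space L L) a (comul L b)) (comul L x)"
  proof (rule eq_basis[OF lin_lift_comul[OF sT b2] lin_lift_comul[OF sT b3] sT _ x])
    fix l assume l: "l \<in> I"
    let ?t = "\<lambda>x y z. tensor L (tensor_space L L) (v x) (tensor L L (v y) (v z))"
    have "(\<Sum>j\<in>I. \<Sum>k\<in>I. fun_scl (m j k l) (\<Sum>x\<in>I. \<Sum>y\<in>I. fun_scl (m x y j) (?t x y k))) =
        (\<Sum>j\<in>I. \<Sum>k\<in>I. \<Sum>x\<in>I. \<Sum>y\<in>I. fun_scl (m x y j * m j k l) (?t x y k))"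
      by (simp add: fs.scale_sum_right mult.commute)
    also have "\<dots> = (\<Sum>x\<in>I. \<Sum>y\<in>I. \<Sum>k\<in>I. fun_scl (\<Sum>j\<in>I. m x y j * m j k l) (?t x y k))"
      unfolding fs.scale_sum_left
      by (subst sum_rotate4, subst sum_rotate3, rule refl)
    also have "\<dots> = (\<Sum>x\<in>I. \<Sum>y\<in>I. \<Sum>k\<in>I. fun_scl (\<Sum>j\<in>I. m y k j * m x j l) (?t x y k))"
      using l by (simp add: m_assoc cong: sum.cong_simp)
    also have "\<dots> = (\<Sum>x\<in>I. \<Sum>j\<in>I. \<Sum>y\<in>I. \<Sum>k\<in>I. fun_scl (m y k j * m x j l) (?t x y k))"
      unfolding fs.scale_sum_left by (rule sum.cong[OF refl], subst sum_rotate3[symmetric], rule refl)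
    also have "\<dots> = (\<Sum>x\<in>I. \<Sum>j\<in>I. fun_scl (m x j l) (tensor L (tensor_space L L) (v x) (comul L (v j))))"
      by (simp add: comul_v fs.scale_sum_right tensor_sum_right mult.commute
          tensor_scl_right[where W = "tensor_space L L", simplified] cong: sum.cong_simp)
    finally show "tensor_lift L L (\<lambda>a b. tensor_lift L L
       (\<lambda>c d. tensor L (tensor_space L L) c (tensor L L d b)) (comul L a)) (comul L (v l)) =
     tensor_lift L L (\<lambda>a b. tensor L (tensor_space L L) a (comul L b)) (comul L (v l))"
      using l by (simp add: lift_comul[OF sT b2] lift_comul[OF sT b3] lift_comul[OF sT b1] cong: sum.cong_simp)
  qed
qed

lemma is_counit: "is_counit L (comul L) (counit L)"
  unfolding is_counit_def
proof (intro conjI ballI)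
  fix x assume x: "x \<in> carrier L"
  have id: "linear_on L L (\<lambda>x. x)" by (auto simp: linear_on_def)
  have d: "(\<Sum>i\<in>I. \<Sum>k\<in>I. scl L (e i * m i k l) (v k)) = v l" "(\<Sum>i\<in>I. \<Sum>k\<in>I. scl L (e i * m k i l) (v k)) = v l"
    if "l \<in> I" for l
  proof -
    have "(\<Sum>i\<in>I. \<Sum>k\<in>I. scl L (e i * m i k l) (v k)) = (\<Sum>k\<in>I. scl L (\<Sum>i\<in>I. e i * m i k l) (v k))"
      unfolding sp.vs.scale_sum_left by (rule sum.swap)
    then show "(\<Sum>i\<in>I. \<Sum>k\<in>I. scl L (e i * m i k l) (v k)) = v l"
      using that by (simp add: m_unit eq_commute[of _ l] delta_comb fin cong: sum.cong_simp)
    have "(\<Sum>i\<in>I. \<Sum>k\<in>I. scl L (e i * m k i l) (v k)) = (\<Sum>k\<in>I. scl L (\<Sum>i\<in>I. e i * m k i l) (v k))"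
      unfolding sp.vs.scale_sum_left by (rule sum.swap)
    then show "(\<Sum>i\<in>I. \<Sum>k\<in>I. scl L (e i * m k i l) (v k)) = v l"
      using that by (simp add: m_unit eq_commute[of _ l] delta_comb fin cong: sum.cong_simp)
  qed
  note b1 = bilinear_on_slice_left[OF counit_dual space] and b2 = bilinear_on_slice_right[OF counit_dual space]
  show "tensor_lift L L (\<lambda>a. scl L (counit L a)) (comul L x) = x"
    by (rule eq_basis[OF lin_lift_comul[OF space b1] id space _ x])
      (simp add: lift_comul[OF space b1] counit_v mult.commute d cong: sum.cong_simp)
  have "(\<Sum>j\<in>I. \<Sum>k\<in>I. scl L (m j k l) (scl L (e k) (v j))) = v l" if "l \<in> I" for l
    by (subst sum.swap) (simp add: that d mult.commute)
  then show "tensor_lift L L (\<lambda>a b. scl L (counit L b) a) (comul L x) = x"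
    by (intro eq_basis[OF lin_lift_comul[OF space b2] id space _ x])
      (simp add: lift_comul[OF space b2] counit_v del: sp.vs.scale_scale cong: sum.cong_simp)
qed (rule counit_dual)

text \<open>A convolution product of two linear maps in terms of their matrices. It serves both
  antipode axioms, with the matrix \<open>s\<close> on one side and the identity matrix on the
  other.\<close>

lemma lift_comul_mul:
  assumes "linear_on L L f" "linear_on L L g" "l \<in> I"
    and "\<And>j. j \<in> I \<Longrightarrow> f (v j) = (\<Sum>i\<in>I. scl L (c i j) (v i))"
    and "\<And>j. j \<in> I \<Longrightarrow> g (v j) = (\<Sum>i\<in>I. scl L (d i j) (v i))"
  shows "tensor_lift L L (\<lambda>a b. mul L (f a) (g b)) (comul L (v l)) =
    (\<Sum>q\<in>I. scl L (\<Sum>j\<in>I. \<Sum>k\<in>I. \<Sum>i\<in>I. \<Sum>p\<in>I. m j k l * c i j * d p k * n i p q) (v q))"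
proof -
  have b: "bilinear_on L L L (\<lambda>a b. mul L (f a) (g b))"
    using linear_onD(1)[OF assms(1)] linear_onD(1)[OF assms(2)]
    by (intro bilinear_onI linear_on_comp[OF assms(2) mul_lin_left] linear_on_comp[OF assms(1) mul_lin_right])
  have "mul L (f (v j)) (g (v k)) = (\<Sum>q\<in>I. scl L (\<Sum>i\<in>I. \<Sum>p\<in>I. c i j * d p k * n i p q) (v q))"
    if "j \<in> I" "k \<in> I" for j k
  proof -
    have "mul L (f (v j)) (g (v k)) = (\<Sum>p\<in>I. \<Sum>i\<in>I. \<Sum>q\<in>I. scl L (c i j * d p k * n i p q) (v q))"
      using that by (simp add: assms(4,5) mul_comb_left mul_comb_right mul_v sp.vs.scale_sum_right mult_ac
          cong: sum.cong_simp)
    also have "\<dots> = (\<Sum>i\<in>I. \<Sum>p\<in>I. \<Sum>q\<in>I. scl L (c i j * d p k * n i p q) (v q))"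
      by (rule sum.swap)
    also have "\<dots> = (\<Sum>q\<in>I. \<Sum>i\<in>I. \<Sum>p\<in>I. scl L (c i j * d p k * n i p q) (v q))"
      by (rule sum_rotate3[symmetric])
    finally show ?thesis by (simp add: sp.vs.scale_sum_left)
  qed
  then have "tensor_lift L L (\<lambda>a b. mul L (f a) (g b)) (comul L (v l)) =
      (\<Sum>j\<in>I. \<Sum>k\<in>I. \<Sum>q\<in>I. scl L (\<Sum>i\<in>I. \<Sum>p\<in>I. m j k l * c i j * d p k * n i p q) (v q))"
    using assms(3) by (simp add: lift_comul[OF space b] sp.vs.scale_sum_right sum_distrib_left mult.assoc
        cong: sum.cong_simp)
  also have "\<dots> = (\<Sum>q\<in>I. \<Sum>j\<in>I. \<Sum>k\<in>I. scl L (\<Sum>i\<in>I. \<Sum>p\<in>I. m j k l * c i j * d p k * n i p q) (v q))"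
    by (rule sum_rotate3[symmetric])
  finally show ?thesis by (simp add: sp.vs.scale_sum_left)
qed

lemma lin_id: "linear_on L L (\<lambda>x. x)"
  by (auto simp: linear_on_def)

lemma v_comb: "j \<in> I \<Longrightarrow> v j = (\<Sum>i\<in>I. scl L (if i = j then 1 else 0) (v i))"
  using delta_comb[OF fin, of j] by (simp add: eq_commute[of j])

lemma bilin_mul_comp:
  assumes "linear_on L L f" "linear_on L L g"
  shows "bilinear_on L L L (\<lambda>a b. mul L (f a) (g b))"
  using linear_onD(1)[OF assms(1)] linear_onD(1)[OF assms(2)]
  by (intro bilinear_onI linear_on_comp[OF assms(2) mul_lin_left] linear_on_comp[OF assms(1) mul_lin_right])

lemma is_antipode: "is_antipode L (comul L) (counit L) (antipode L)"
  unfolding is_antipode_def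
proof (intro conjI ballI allI impI)
  fix x assume x: "x \<in> carrier L"
  have rhs: "linear_on L L (\<lambda>x. scl L (counit L x) (unity L))"
    using linear_onD[OF dualD(1)[OF counit_dual]]
    by (auto intro!: linear_onI simp: unityL_closed sp.vs.scale_left_distrib)
  have rhs_v: "scl L (counit L (v l)) (unity L) = (\<Sum>q\<in>I. scl L (e l * u q) (v q))" if "l \<in> I" for l
    using that by (simp add: counit_v unity_v sp.vs.scale_sum_right)
  show "tensor_lift L L (\<lambda>a b. mul L (antipode L a) b) (comul L x) = scl L (counit L x) (unity L)"
    by (rule eq_basis[OF lin_lift_comul[OF space bilin_mul_comp[OF antipode_lin lin_id]] rhs space _ x])
      (simp add: lift_comul_mul[OF antipode_lin lin_id _ antipode_v v_comb] rhs_v fin s_left[symmetric]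
        if_distrib[where f = "\<lambda>c. _ * c"] if_distrib[where f = "\<lambda>c. c * _"] cong: if_cong sum.cong_simp)
  have "(\<Sum>j\<in>I. \<Sum>k\<in>I. \<Sum>i\<in>I. \<Sum>p\<in>I. m j k l * (if i = j then 1 else 0) * s p k * n i p q) = e l * u q"
    if "l \<in> I" "q \<in> I" for l q
  proof -
    have "(\<Sum>i\<in>I. \<Sum>p\<in>I. m j k l * (if i = j then 1 else 0) * s p k * n i p q) =
        (\<Sum>p\<in>I. m j k l * s p k * n j p q)" if "j \<in> I" for j k
      using that fin by (subst sum.swap)
        (simp add: if_distrib[where f = "\<lambda>c. _ * c"] if_distrib[where f = "\<lambda>c. c * _"] cong: if_cong)
    then show ?thesis using s_right[OF that] by simp
  qed
  then show "tensor_lift L L (\<lambda>a b. mul L a (antipode L b)) (comul L x) = scl L (counit L x) (unity L)"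
    by (intro eq_basis[OF lin_lift_comul[OF space bilin_mul_comp[OF lin_id antipode_lin]] rhs space _ x])
      (simp add: lift_comul_mul[OF lin_id antipode_lin _ v_comb antipode_v] rhs_v cong: sum.cong_simp)
qed (simp_all add: antipode_lin antipode_off)

text \<open>Uniqueness of convolution inverses: the convolution of \<open>T\<close>, the identity
  and the antipode is evaluated at \<open>v l\<close> with both bracketings, which
  \<open>m_assoc\<close> identifies.\<close>

lemma antipode_unique:
  assumes T: "is_antipode L (comul L) (counit L) T"
  shows "T = antipode L"
proof
  fix x
  have T': "linear_on L L T" "\<And>x. x \<notin> carrier L \<Longrightarrow> T x = 0"
    "\<And>x. x \<in> carrier L \<Longrightarrow> tensor_lift L L (\<lambda>a b. mul L (T a) b) (comul L x) = scl L (counit L x) (unity L)"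
    using T by (auto simp: is_antipode_def)
  have Tv: "T (v i) \<in> carrier L" "antipode L (v i) \<in> carrier L" if "i \<in> I" for i
    using that linear_onD(1)[OF T'(1)] linear_onD(1)[OF antipode_lin] by auto
  have 1: "(\<Sum>j\<in>I. \<Sum>k\<in>I. scl L (m j k l) (mul L (T (v j)) (v k))) = scl L (e l) (unity L)" if "l \<in> I" for l
    using T'(3)[of "v l"] lift_comul[OF space bilin_mul_comp[OF T'(1) lin_id] that] that by (simp add: counit_v)
  have 2: "(\<Sum>j\<in>I. \<Sum>k\<in>I. scl L (m j k l) (mul L (v j) (antipode L (v k)))) = scl L (e l) (unity L)" if "l \<in> I" for l
    using is_antipode lift_comul[OF space bilin_mul_comp[OF lin_id antipode_lin] that] that
    by (simp add: counit_v is_antipode_def)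
  have "T (v l) = antipode L (v l)" if l: "l \<in> I" for l
  proof -
    let ?f = "\<lambda>i j k. mul L (mul L (T (v i)) (v j)) (antipode L (v k))"
    have "antipode L (v l) = (\<Sum>k\<in>I. scl L (\<Sum>p\<in>I. e p * m p k l) (antipode L (v k)))"
      using l by (simp add: m_unit if_distrib[where f = "\<lambda>c. scl L c _"] fin cong: if_cong sum.cong_simp)
    also have "\<dots> = (\<Sum>p\<in>I. \<Sum>k\<in>I. scl L (m p k l) (mul L (scl L (e p) (unity L)) (antipode L (v k))))"
      by (subst sum.swap) (simp add: sp.vs.scale_sum_left alg.mul_scl_left Tv mult.commute cong: sum.cong_simp)
    also have "\<dots> = (\<Sum>p\<in>I. \<Sum>k\<in>I. \<Sum>i\<in>I. \<Sum>j\<in>I. scl L (m i j p * m p k l) (?f i j k))"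
      using l by (simp add: 1[symmetric] alg.mul_sum_left alg.mul_scl_left Tv sp.vs.scale_sum_right mult.commute
          cong: sum.cong_simp)
    also have "\<dots> = (\<Sum>i\<in>I. \<Sum>j\<in>I. \<Sum>k\<in>I. scl L (\<Sum>p\<in>I. m i j p * m p k l) (?f i j k))"
      unfolding sp.vs.scale_sum_left by (subst sum_rotate4, subst sum_rotate3, rule refl)
    also have "\<dots> = (\<Sum>i\<in>I. \<Sum>j\<in>I. \<Sum>k\<in>I. scl L (\<Sum>p\<in>I. m j k p * m i p l) (?f i j k))"
      using l by (simp add: m_assoc cong: sum.cong_simp)
    also have "\<dots> = (\<Sum>i\<in>I. \<Sum>p\<in>I. \<Sum>j\<in>I. \<Sum>k\<in>I. scl L (m j k p * m i p l) (?f i j k))"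
      unfolding sp.vs.scale_sum_left by (rule sum.cong[OF refl], subst sum_rotate3[symmetric], rule refl)
    also have "\<dots> = (\<Sum>i\<in>I. \<Sum>p\<in>I. scl L (m i p l) (mul L (T (v i)) (scl L (e p) (unity L))))"
      using l by (simp add: 2[symmetric] alg.mul_sum_right alg.mul_scl_right Tv sp.vs.scale_sum_right mult.commute
          alg.mul_assoc cong: sum.cong_simp)
    also have "\<dots> = (\<Sum>i\<in>I. scl L (\<Sum>p\<in>I. e p * m i p l) (T (v i)))"
      by (simp add: sp.vs.scale_sum_left alg.mul_scl_right Tv mult.commute cong: sum.cong_simp)
    also have "\<dots> = T (v l)"
      using l by (simp add: m_unit if_distrib[where f = "\<lambda>c. scl L c _"] fin cong: if_cong sum.cong_simp)
    finally show ?thesis by simp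
  qed
  then show "T x = antipode L x"
    using eq_basis[OF T'(1) antipode_lin space] T'(2) antipode_off by (cases "x \<in> carrier L") auto
qed

lemma is_comul_hom: "alg_hom L (tensor_alg L L) (comul L)"
proof -
  interpret algebra_pair L L ..
  interpret T: k_algebra "tensor_alg L L" by (rule k_algebra_tensor_alg)
  have lin: "linear_on L (tensor_alg L L) (comul L)"
    using comul_lin by (simp add: linear_on_def)
  have closed: "comul L x \<in> carrier (tensor_space L L)" if "x \<in> carrier L" for x
    by (rule linear_onD(1)[OF comul_lin that])
  have "comul L (unity L) = (\<Sum>l\<in>I. \<Sum>j\<in>I. \<Sum>k\<in>I. fun_scl (u l * m j k l) (tensor L L (v j) (v k)))"
    unfolding unity_v
    by (subst linear_on_lincomb[OF comul_lin space k_space_tensor_space])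
      (simp_all add: comul_v fs.scale_sum_right cong: sum.cong_simp)
  also have "\<dots> = (\<Sum>j\<in>I. \<Sum>k\<in>I. fun_scl (\<Sum>l\<in>I. m j k l * u l) (tensor L L (v j) (v k)))"
    unfolding fs.scale_sum_left by (subst sum_rotate3) (simp add: mult.commute)
  also have "\<dots> = tensor L L (unity L) (unity L)"
    by (subst sum.swap, simp add: u_mult mult.commute[of "u a" "u b" for a b] unity_v tensor_sum_left tensor_sum_right tensor_scl_left tensor_scl_right fs.scale_sum_right
        cong: sum.cong_simp)
  finally have unit: "comul L (unity L) = tensor L L (unity L) (unity L)" .
  have "comul L (mul L (v i) (v j)) = mul (tensor_alg L L) (comul L (v i)) (comul L (v j))"
    if ij: "i \<in> I" "j \<in> I" for i j
  proof -
    let ?t = "\<lambda>p q. tensor L L (v p) (v q)"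
    have "comul L (mul L (v i) (v j)) = (\<Sum>l\<in>I. \<Sum>p\<in>I. \<Sum>q\<in>I. fun_scl (n i j l * m p q l) (?t p q))"
      using ij unfolding mul_v[OF ij]
      by (subst linear_on_lincomb[OF comul_lin space k_space_tensor_space])
        (simp_all add: comul_v fs.scale_sum_right cong: sum.cong_simp)
    also have "\<dots> = (\<Sum>p\<in>I. \<Sum>q\<in>I. fun_scl (\<Sum>l\<in>I. n i j l * m p q l) (?t p q))"
      unfolding fs.scale_sum_left by (rule sum_rotate3)
    also have "\<dots> = (\<Sum>p\<in>I. \<Sum>q\<in>I. \<Sum>x\<in>I. \<Sum>y\<in>I. \<Sum>z\<in>I. \<Sum>w\<in>I. fun_scl (m x y i * m z w j * n x z p * n y w q) (?t p q))"
      using ij by (simp add: compat fs.scale_sum_left cong: sum.cong_simp)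
    \<comment> \<open>The output indices \<open>p\<close> and \<open>q\<close> are moved innermost,
      where summing over them reassembles the products \<open>v x v z\<close> and
      \<open>v y v w\<close>.\<close>
    also have "\<dots> = (\<Sum>q\<in>I. \<Sum>x\<in>I. \<Sum>y\<in>I. \<Sum>z\<in>I. \<Sum>w\<in>I. \<Sum>p\<in>I. fun_scl (m x y i * m z w j * n x z p * n y w q) (?t p q))"
      by (subst sum.swap, rule sum.cong[OF refl], rule sum_rotate5)
    also have "\<dots> = (\<Sum>x\<in>I. \<Sum>y\<in>I. \<Sum>z\<in>I. \<Sum>w\<in>I. \<Sum>q\<in>I. \<Sum>p\<in>I. fun_scl (m x y i * m z w j * n x z p * n y w q) (?t p q))"
      by (rule sum_rotate5)
    also have "\<dots> = (\<Sum>x\<in>I. \<Sum>y\<in>I. \<Sum>z\<in>I. \<Sum>w\<in>I. \<Sum>q\<in>I. \<Sum>p\<in>I. fun_scl (m x y i * (m z w j * (n y w q * n x z p))) (?t p q))"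
      by (simp add: mult_ac)
    also have "\<dots> = (\<Sum>x\<in>I. \<Sum>y\<in>I. \<Sum>z\<in>I. \<Sum>w\<in>I. fun_scl (m x y i * m z w j) (tensor L L (mul L (v x) (v z)) (mul L (v y) (v w))))"
      by (simp add: mul_v tensor_sum_left tensor_sum_right tensor_scl_left tensor_scl_right fs.scale_sum_right mult.assoc
          cong: sum.cong_simp)
    also have "\<dots> = (\<Sum>x\<in>I. \<Sum>y\<in>I. fun_scl (m x y i) (mul (tensor_alg L L) (?t x y) (comul L (v j))))"
      using ij
      by (simp add: comul_v T.mul_sum_right T.mul_scl_right[simplified]
        tensor_alg_mul fs.scale_sum_right cong: sum.cong_simp)
    also have "\<dots> = mul (tensor_alg L L) (comul L (v i)) (comul L (v j))"
      using ij closed[of "v j"]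
      by (simp add: comul_v[of i] T.mul_sum_left T.mul_scl_left[simplified] cong: sum.cong_simp)
    finally show ?thesis .
  qed
  note basis_eq = this
  have "comul L (mul L x y) = mul (tensor_alg L L) (comul L x) (comul L y)"
    if xy: "x \<in> carrier L" "y \<in> carrier L" for x y
  proof (rule bilinear_eq_basis[where f = "\<lambda>x y. comul L (mul L x y)" and g = "\<lambda>x y. mul (tensor_alg L L) (comul L x) (comul L y)"
          and U = "tensor_alg L L", OF _ _ _ _ space space k_space_tensor_alg basis basis basis_eq xy])
    fix z assume z: "z \<in> carrier L"
    show "linear_on L (tensor_alg L L) (\<lambda>x. comul L (mul L x z))"
      by (rule linear_on_comp[OF mul_lin_right[OF z] lin])
    show "linear_on L (tensor_alg L L) (\<lambda>x. comul L (mul L z x))"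
      by (rule linear_on_comp[OF mul_lin_left[OF z] lin])
    show "linear_on L (tensor_alg L L) (\<lambda>x. mul (tensor_alg L L) (comul L x) (comul L z))"
      by (rule linear_on_comp[OF lin T.linear_mul_right]) (simp add: closed z)
    show "linear_on L (tensor_alg L L) (\<lambda>x. mul (tensor_alg L L) (comul L z) (comul L x))"
      by (rule linear_on_comp[OF lin T.linear_mul_left]) (simp add: closed z)
  qed
  with unit show ?thesis by (simp add: alg_hom_def lin)
qed

lemma is_counit_hom: "alg_hom L (ground :: ('k, 'k) kalg) (counit L)"
proof -
  note lin = dualD(1)[OF counit_dual]
  have comb: "counit L (\<Sum>i\<in>I. scl L (c i) (v i)) = (\<Sum>i\<in>I. c i * e i)" for c
    by (subst linear_on_lincomb[OF lin space k_space_ground]) (simp_all add: counit_v cong: sum.cong_simp)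
  have "counit L (mul L x y) = counit L x * counit L y" if xy: "x \<in> carrier L" "y \<in> carrier L" for x y
  proof (rule bilinear_eq_basis[where f = "\<lambda>x y. counit L (mul L x y)" and g = "\<lambda>x y. counit L x * counit L y"
          and U = "ground :: ('k, 'k) kalg", OF _ _ _ _ space space k_space_ground basis basis _ xy])
    fix z assume z: "z \<in> carrier L"
    show "linear_on L (ground :: ('k, 'k) kalg) (\<lambda>x. counit L (mul L x z))"
      by (rule linear_on_comp[OF mul_lin_right[OF z] lin])
    show "linear_on L (ground :: ('k, 'k) kalg) (\<lambda>x. counit L (mul L z x))"
      by (rule linear_on_comp[OF mul_lin_left[OF z] lin])
    show "linear_on L (ground :: ('k, 'k) kalg) (\<lambda>x. counit L x * counit L z)"
      "linear_on L (ground :: ('k, 'k) kalg) (\<lambda>x. counit L z * counit L x)"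
      using linear_onD[OF lin] by (auto simp: linear_on_def algebra_simps)
  qed (simp add: mul_v comb e_mult counit_v)
  then show ?thesis
    by (simp add: alg_hom_def lin unity_v comb u_e)
qed

theorem is_hopf: "hopf_algebra L"
  by unfold_locales (rule is_coassociative is_counit is_comul_hom is_counit_hom is_antipode)+

end

section \<open>Hopf algebras determined by a datum, their duals and their isomorphisms\<close>

lemma sum_fun_apply: "(\<Sum>i\<in>J. f i) x = (\<Sum>i\<in>J. f i x)" for f :: "'i \<Rightarrow> 'b \<Rightarrow> 'd::comm_monoid_add"
  by (induction J rule: infinite_finite_induct) auto

lemma fun_scl_apply [simp]: "fun_scl c \<phi> x = c * \<phi> x"
  by (simp add: fun_scl_def)

lemma dual_cong: "carrier V = carrier W \<Longrightarrow> scl V = scl W \<Longrightarrow> dual V = dual W"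
  by (simp add: dual_def linear_on_def)

text \<open>\<open>hopf_of\<close> picks counit and antipode by definite description. An explicit
  record \<open>L\<close> with linearly extended counit and antipode is shown to be a Hopf algebra,
  and \<open>counit_unique\<close> and \<open>antipode_unique\<close> force the descriptions to pick
  the same maps.\<close>

lemma hopf_of_coords:
  fixes A :: "('k::field, 'v::ab_group_add) kalg" and \<Delta> :: "'v \<Rightarrow> ('v \<Rightarrow> 'v \<Rightarrow> 'k) \<Rightarrow> 'k"
  assumes datum: "hopf_datum I n m u e s"
    and A: "k_space A" and v: "basis_fam A I v" and mul: "bilinear_on A A A (mul A)"
    and mul_v: "\<And>i j. i \<in> I \<Longrightarrow> j \<in> I \<Longrightarrow> mul A (v i) (v j) = (\<Sum>l\<in>I. scl A (n i j l) (v l))"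
    and unity_v: "unity A = (\<Sum>i\<in>I. scl A (u i) (v i))"
    and lin: "linear_on A (tensor_space A A) \<Delta>"
    and \<Delta>_v: "\<And>l. l \<in> I \<Longrightarrow> \<Delta> (v l) = (\<Sum>j\<in>I. \<Sum>k\<in>I. fun_scl (m j k l) (tensor A A (v j) (v k)))"
  shows "hopf_coords I n m u e s (hopf_of A \<Delta>) v"
proof -
  interpret A: k_space A by fact
  have v_in: "v i \<in> carrier A" if "i \<in> I" for i
    using v that by (auto simp: basis_fam_def)
  obtain \<epsilon> where \<epsilon>: "linear_on A (ground :: ('k, 'k) kalg) \<epsilon>" "\<And>i. i \<in> I \<Longrightarrow> \<epsilon> (v i) = e i"
    "\<And>x. x \<notin> carrier A \<Longrightarrow> \<epsilon> x = 0"
    using linear_extension[OF A k_space_ground v, of e] by auto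
  have "(\<Sum>k\<in>I. scl A (s k i) (v k)) \<in> carrier A" for i
    using v_in by simp
  then obtain S where S: "linear_on A A S" "\<And>i. i \<in> I \<Longrightarrow> S (v i) = (\<Sum>k\<in>I. scl A (s k i) (v k))"
    "\<And>x. x \<notin> carrier A \<Longrightarrow> S x = 0"
    using linear_extension[OF A A v, of "\<lambda>i. \<Sum>k\<in>I. scl A (s k i) (v k)"] by blast
  define L where "L = \<lparr>carrier = carrier A, scl = scl A, mul = mul A, unity = unity A,
    comul = \<Delta>, counit = \<epsilon>, antipode = S\<rparr>"
  have L [simp]: "carrier L = carrier A" "scl L = scl A" "mul L = mul A" "unity L = unity A"
    "comul L = \<Delta>" "counit L = \<epsilon>" "antipode L = S"
    by (simp_all add: L_def)
  have t: "tensor L L = tensor A A" "tensor_space L L = tensor_space A A"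
    and tl: "tensor_lift L L \<beta> = tensor_lift A A \<beta>" for \<beta> :: "'v \<Rightarrow> 'v \<Rightarrow> 'v"
    by (auto intro!: tensor_cong tensor_space_cong tensor_lift_cong)
  have d: "dual L = dual A" by (rule dual_cong) simp_all
  have "hopf_coords I n m u e s L v"
    unfolding hopf_coords_def hopf_coords_axioms_def
  proof (intro conjI allI impI)
    show "k_space L" using A by (simp add: k_space_def)
    show "bilinear_on L L L (mul L)" using mul by (simp add: bilinear_on_def linear_on_def)
    show "linear_on L (tensor_space L L) (comul L)" using lin by (simp add: t linear_on_def)
    show "counit L \<in> carrier (dual L)" using \<epsilon> by (simp add: d) (simp add: dual_def)
    show "linear_on L L (antipode L)" using S by (simp add: linear_on_def)
    show "basis_fam L I v" using v by (simp add: basis_fam_def indep_fam_def)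
  qed (use datum mul_v unity_v \<Delta>_v \<epsilon> S in \<open>simp_all add: t\<close>)
  then interpret L: hopf_coords I n m u e s L v .
  have ct: "is_counit A \<Delta> = is_counit L \<Delta>"
    by (rule ext) (simp add: is_counit_def d tl)
  have at: "is_antipode A \<Delta> \<epsilon> = is_antipode L \<Delta> \<epsilon>"
  proof -
    have "linear_on A A = linear_on L L" by (rule ext) (simp add: linear_on_def)
    then show ?thesis by (intro ext) (simp only: is_antipode_def tl L)
  qed
  have "(THE e. is_counit A \<Delta> e) = \<epsilon>"
    unfolding ct using L.is_counit counit_unique[OF L.space, of \<Delta>] linear_onD(1)[OF lin]
    by (intro the_equality) (auto simp: t)
  moreover have "(THE S. is_antipode A \<Delta> \<epsilon> S) = S"
    unfolding at
    by (rule the_equality, rule L.is_antipode[unfolded L], rule L.antipode_unique[unfolded L])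
  ultimately have "hopf_of A \<Delta> = L"
    by (simp add: hopf_of_def L_def)
  then show ?thesis by (simp add: L.hopf_coords_axioms)
qed

lemma k_space_dual: "k_space (dual V)"
proof -
  have "fs.subspace (carrier (dual V))"
    by (rule fs.subspaceI)
      (auto simp: dual_def linear_on_def fun_scl_def algebra_simps)
  then show ?thesis
    using vector_space_fun_scl by (auto simp: k_space_def dual_def)
qed

lemma scl_dual [simp]: "scl (dual V) = fun_scl"
  by (simp add: dual_def)

lemma dual_hopf_simps [simp]: "carrier (dual_hopf L) = carrier (dual L)" "scl (dual_hopf L) = fun_scl"
  by (simp_all add: dual_hopf_def)

lemma tensor_dual_hopf: "tensor (dual_hopf L) (dual_hopf L) = tensor (dual L) (dual L)"
  "tensor_space (dual_hopf L) (dual_hopf L) = tensor_space (dual L) (dual L)"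
  by (auto intro!: tensor_cong tensor_space_cong)

lemma bilinear_on_dual_eval:
  "bilinear_on (dual V) (dual V) (ground :: ('k::field, 'k) kalg) (\<lambda>\<psi> \<chi>. \<psi> x * \<chi> y)"
  by (auto intro!: bilinear_onI linear_onI simp: fun_scl_def algebra_simps)

context hopf_coords
begin

lemma dual_eqI:
  assumes "\<phi> \<in> carrier (dual L)" "\<psi> \<in> carrier (dual L)" "\<And>i. i \<in> I \<Longrightarrow> \<phi> (v i) = \<psi> (v i)"
  shows "\<phi> = \<psi>"
proof
  fix x show "\<phi> x = \<psi> x"
    using eq_basis[OF dualD(1)[OF assms(1)] dualD(1)[OF assms(2)] k_space_ground assms(3)]
      dualD(2)[OF assms(1)] dualD(2)[OF assms(2)] by (cases "x \<in> carrier L") auto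
qed

lemma bilinear_on_dual_product:
  assumes "\<phi> \<in> carrier (dual L)" "\<psi> \<in> carrier (dual L)"
  shows "bilinear_on L L (ground :: ('k, 'k) kalg) (\<lambda>a b. \<phi> a * \<psi> b)"
  using linear_onD[OF dualD(1)[OF assms(1)]] linear_onD[OF dualD(1)[OF assms(2)]]
  by (auto intro!: bilinear_onI linear_onI simp: algebra_simps)

lemma dual_mul_v:
  assumes "\<phi> \<in> carrier (dual L)" "\<psi> \<in> carrier (dual L)" "l \<in> I"
  shows "mul (dual_hopf L) \<phi> \<psi> (v l) = (\<Sum>j\<in>I. \<Sum>k\<in>I. m j k l * (\<phi> (v j) * \<psi> (v k)))"
  using assms by (simp add: dual_hopf_def lift_comul[OF k_space_ground bilinear_on_dual_product])

lemma dual_mul_closed: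
  assumes "\<phi> \<in> carrier (dual L)" "\<psi> \<in> carrier (dual L)"
  shows "mul (dual_hopf L) \<phi> \<psi> \<in> carrier (dual L)"
  using linear_onD[OF lin_lift_comul[OF k_space_ground bilinear_on_dual_product[OF assms]]]
  by (auto simp: dual_def dual_hopf_def linear_on_def)

lemma dual_comb:
  "\<phi> \<in> carrier (dual L) \<Longrightarrow> \<phi> (\<Sum>i\<in>I. scl L (c i) (v i)) = (\<Sum>i\<in>I. c i * \<phi> (v i))"
  by (subst linear_on_lincomb[OF dualD(1) space k_space_ground]) simp_all

lemma dual_add_closed: "\<phi> \<in> carrier (dual L) \<Longrightarrow> \<psi> \<in> carrier (dual L) \<Longrightarrow> \<phi> + \<psi> \<in> carrier (dual L)"
  by (rule k_space.add_closed[OF k_space_dual])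

lemma dual_scl_closed: "\<phi> \<in> carrier (dual L) \<Longrightarrow> fun_scl c \<phi> \<in> carrier (dual L)"
  using k_space.scl_closed[OF k_space_dual, of \<phi> L c] by simp

lemma dual_sum_closed: "(\<And>i. i \<in> J \<Longrightarrow> f i \<in> carrier (dual L)) \<Longrightarrow> sum f J \<in> carrier (dual L)"
  by (rule k_space.sum_closed[OF k_space_dual])

lemma dual_bilinear: "bilinear_on (dual_hopf L) (dual_hopf L) (dual_hopf L) (mul (dual_hopf L))"
  by (rule bilinear_onI; rule linear_onI)
    (auto intro!: dual_eqI dual_mul_closed dual_add_closed dual_scl_closed
      simp: dual_mul_v dual_mul_closed dual_add_closed dual_scl_closed algebra_simps sum.distrib sum_distrib_left)

lemma counit_comp_dual: "\<phi> \<in> carrier (dual L) \<Longrightarrow> antipode (dual_hopf L) \<phi> \<in> carrier (dual L)"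
  using linear_on_comp[OF antipode_lin dualD(1)] by (auto simp: dual_hopf_def dual_def linear_on_def)

end

locale hopf_coords_dual = hopf_coords I n m u e s L v
  for I :: "'i set" and n m :: "'i \<Rightarrow> 'i \<Rightarrow> 'i \<Rightarrow> 'k::field" and u e s
    and L :: "('k, 'v::ab_group_add, 'm) khopf_scheme" and v +
  fixes \<alpha> :: "'i \<Rightarrow> 'v \<Rightarrow> 'k"
  assumes \<alpha>_closed: "i \<in> I \<Longrightarrow> \<alpha> i \<in> carrier (dual L)"
    and \<alpha>_v: "\<lbrakk>i \<in> I; j \<in> I\<rbrakk> \<Longrightarrow> \<alpha> i (v j) = (if i = j then 1 else 0)"
begin

lemma dual_expand:
  assumes "\<phi> \<in> carrier (dual L)"
  shows "\<phi> = (\<Sum>i\<in>I. fun_scl (\<phi> (v i)) (\<alpha> i))"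
  using assms
  by (intro dual_eqI dual_sum_closed dual_scl_closed)
    (auto simp: \<alpha>_closed sum_fun_apply \<alpha>_v fin if_distrib[where f = "\<lambda>c. _ * c"]
      cong: if_cong sum.cong_simp)

lemma basis_dual: "basis_fam (dual L) I \<alpha>"
  unfolding basis_fam_def indep_fam_def
proof (intro conjI allI impI ballI)
  fix c i assume c: "(\<Sum>i\<in>I. scl (dual L) (c i) (\<alpha> i)) = 0" "i \<in> I"
  have "(\<Sum>i\<in>I. fun_scl (c i) (\<alpha> i)) (v i) = c i"
    using c(2) by (simp add: sum_fun_apply \<alpha>_v fin if_distrib[where f = "\<lambda>c. _ * c"]
      cong: if_cong sum.cong_simp)
  then show "c i = 0" using c(1) by simp
qed (use \<alpha>_closed dual_expand fin in \<open>auto intro: exI[of _ "\<lambda>i. _ (v i)"]\<close>)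

text \<open>The coproduct of the dual is a definite description. The displayed tensor has the right
  pairing by bilinearity; any other solution expands in
  \<open>\<alpha> i \<otimes> \<alpha> j\<close>, and pairing with \<open>v p\<close> and
  \<open>v q\<close> reads off its coefficients.\<close>

lemma dual_comul:
  assumes \<phi>: "\<phi> \<in> carrier (dual L)"
  shows "comul (dual_hopf L) \<phi> =
    (\<Sum>i\<in>I. \<Sum>j\<in>I. fun_scl (\<phi> (mul L (v i) (v j))) (tensor (dual L) (dual L) (\<alpha> i) (\<alpha> j)))" (is "_ = ?T")
proof -
  let ?D = "dual L" and ?G = "ground :: ('k, 'k) kalg"
  have lift: "tensor_lift ?D ?D (\<lambda>\<psi> \<chi>. \<psi> x * \<chi> y) (\<Sum>i\<in>I. \<Sum>j\<in>I. fun_scl (c i j) (tensor ?D ?D (\<alpha> i) (\<alpha> j))) =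
      (\<Sum>i\<in>I. \<Sum>j\<in>I. c i j * (\<alpha> i x * \<alpha> j y))" for c x y
    by (simp add: tensor_lift_sum[OF k_space_dual k_space_dual k_space_ground bilinear_on_dual_eval]
      tensor_lift_scl[OF k_space_dual k_space_dual k_space_ground bilinear_on_dual_eval]
      tensor_lift_tensor[OF k_space_dual k_space_dual k_space_ground bilinear_on_dual_eval] \<alpha>_closed cong: sum.cong_simp)
  have lift_v: "tensor_lift ?D ?D (\<lambda>\<psi> \<chi>. \<psi> (v p) * \<chi> (v q)) (\<Sum>i\<in>I. \<Sum>j\<in>I. fun_scl (c i j) (tensor ?D ?D (\<alpha> i) (\<alpha> j))) = c p q"
    if "p \<in> I" "q \<in> I" for c p q
    using that fin by (simp add: lift \<alpha>_v if_distrib[where f = "\<lambda>c. _ * c"] cong: if_cong sum.cong_simp)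
  have T: "?T \<in> carrier (tensor_space ?D ?D)"
    by (simp add: \<alpha>_closed)
  have "tensor_lift ?D ?D (\<lambda>\<psi> \<chi>. \<psi> x * \<chi> y) ?T = \<phi> (mul L x y)" if xy: "x \<in> carrier L" "y \<in> carrier L" for x y
  proof (rule bilinear_eq_basis[where f = "\<lambda>x y. tensor_lift ?D ?D (\<lambda>\<psi> \<chi>. \<psi> x * \<chi> y) ?T" and g = "\<lambda>x y. \<phi> (mul L x y)"
          and U = ?G, OF _ _ _ _ space space k_space_ground basis basis _ xy])
    fix z assume z: "z \<in> carrier L"
    show "linear_on L ?G (\<lambda>x. \<phi> (mul L x z))" "linear_on L ?G (\<lambda>x. \<phi> (mul L z x))"
      by (rule linear_on_comp[OF mul_lin_right[OF z] dualD(1)[OF \<phi>]] linear_on_comp[OF mul_lin_left[OF z] dualD(1)[OF \<phi>]])+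
    have "linear_on L ?G (\<lambda>x. c * (\<alpha> i x * d))" "linear_on L ?G (\<lambda>x. c * (d * \<alpha> i x))" if "i \<in> I" for i c d
      using linear_onD[OF dualD(1)[OF \<alpha>_closed[OF that]]] by (auto intro!: linear_onI simp: algebra_simps)
    then show "linear_on L ?G (\<lambda>x. tensor_lift ?D ?D (\<lambda>\<psi> \<chi>. \<psi> x * \<chi> z) ?T)"
      "linear_on L ?G (\<lambda>x. tensor_lift ?D ?D (\<lambda>\<psi> \<chi>. \<psi> z * \<chi> x) ?T)"
      unfolding lift by (auto intro!: linear_on_sum_fun k_space_ground)
  qed (simp add: lift_v)
  moreover have "T' = ?T" if T': "T' \<in> carrier (tensor_space ?D ?D)"
    "\<forall>x\<in>carrier L. \<forall>y\<in>carrier L. tensor_lift ?D ?D (\<lambda>\<psi> \<chi>. \<psi> x * \<chi> y) T' = \<phi> (mul L x y)" for T'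
  proof -
    obtain c where c: "T' = (\<Sum>p\<in>I \<times> I. fun_scl (c p) (case p of (i, j) \<Rightarrow> tensor ?D ?D (\<alpha> i) (\<alpha> j)))"
      using k_space.basis_fam_coord[OF k_space_tensor_space basis_fam_tensor[OF k_space_dual k_space_dual basis_dual basis_dual] T'(1)]
      by auto
    have c': "T' = (\<Sum>i\<in>I. \<Sum>j\<in>I. fun_scl (c (i, j)) (tensor ?D ?D (\<alpha> i) (\<alpha> j)))"
      by (simp add: c sum.cartesian_product case_prod_beta)
    have "c (i, j) = \<phi> (mul L (v i) (v j))" if "i \<in> I" "j \<in> I" for i j
      using lift_v[OF that, of "\<lambda>i j. c (i, j)"] T'(2) that by (simp add: c')
    then show ?thesis unfolding c' by simp
  qed
  ultimately have "(THE T. T \<in> carrier (tensor_space ?D ?D) \<and> (\<forall>x\<in>carrier L. \<forall>y\<in>carrier L.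
      tensor_lift ?D ?D (\<lambda>\<psi> \<chi>. \<psi> x * \<chi> y) T = \<phi> (mul L x y))) = ?T"
    using T by (intro the_equality conjI ballI) blast+
  then show ?thesis by (simp add: dual_hopf_def)
qed

text \<open>With this, everything proved in \<open>hopf_coords\<close> applies to the dual as
  well.\<close>

theorem dual_coords: "hopf_coords I m n e u (\<lambda>i j. s j i) (dual_hopf L) \<alpha>"
  unfolding hopf_coords_def hopf_coords_axioms_def
proof (intro conjI allI impI)
  show "hopf_datum I m n e u (\<lambda>i j. s j i)" by (rule dual_datum)
  show "k_space (dual_hopf L)" using k_space_dual[of L] by (simp add: k_space_def)
  show "basis_fam (dual_hopf L) I \<alpha>" using basis_dual by (simp add: basis_fam_def indep_fam_def)
  show "bilinear_on (dual_hopf L) (dual_hopf L) (dual_hopf L) (mul (dual_hopf L))" by (rule dual_bilinear)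
  show "mul (dual_hopf L) (\<alpha> i) (\<alpha> j) = (\<Sum>l\<in>I. scl (dual_hopf L) (m i j l) (\<alpha> l))" if ij: "i \<in> I" "j \<in> I" for i j
  proof -
    have "mul (dual_hopf L) (\<alpha> i) (\<alpha> j) (v l) = m i j l" if "l \<in> I" for l
      using that ij fin by (simp add: dual_mul_v \<alpha>_closed \<alpha>_v if_distrib[where f = "\<lambda>c. _ * c"]
        if_distrib[where f = "\<lambda>c. c * _"] cong: if_cong sum.cong_simp)
    then show ?thesis
      using dual_expand[OF dual_mul_closed[OF \<alpha>_closed \<alpha>_closed], OF ij] by simp
  qed
  have un: "unity (dual_hopf L) \<in> carrier (dual L)"
    using counit_dual by (auto simp: dual_hopf_def dual_def linear_on_def)
  show "unity (dual_hopf L) = (\<Sum>i\<in>I. scl (dual_hopf L) (e i) (\<alpha> i))"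
    using dual_expand[OF un] by (simp add: dual_hopf_def counit_v)
  let ?D = "dual L"
  show "linear_on (dual_hopf L) (tensor_space (dual_hopf L) (dual_hopf L)) (comul (dual_hopf L))"
    unfolding tensor_dual_hopf
    by (rule linear_onI)
      (simp_all add: dual_comul \<alpha>_closed dual_add_closed dual_scl_closed fs.scale_left_distrib sum.distrib
        fs.scale_sum_right)
  show "comul (dual_hopf L) (\<alpha> l) = (\<Sum>j\<in>I. \<Sum>k\<in>I. fun_scl (n j k l) (tensor (dual_hopf L) (dual_hopf L) (\<alpha> j) (\<alpha> k)))"
    if "l \<in> I" for l
    using that fin unfolding tensor_dual_hopf
    by (simp add: dual_comul \<alpha>_closed mul_v dual_comb \<alpha>_v if_distrib[where f = "\<lambda>c. _ * c"] cong: if_cong sum.cong_simp)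
  show "counit (dual_hopf L) \<in> carrier (dual (dual_hopf L))"
  proof -
    have "linear_on (dual_hopf L) (ground :: ('k, 'k) kalg) (counit (dual_hopf L))"
      by (rule linear_onI) (simp_all add: dual_hopf_def dual_add_closed dual_scl_closed)
    moreover have "counit (dual_hopf L) \<phi> = 0" if "\<phi> \<notin> carrier (dual_hopf L)" for \<phi>
      using that by (simp add: dual_hopf_def)
    ultimately show ?thesis unfolding dual_def[of "dual_hopf L"] by simp
  qed
  show "counit (dual_hopf L) (\<alpha> i) = u i" if "i \<in> I" for i
    using that fin by (simp add: dual_hopf_def \<alpha>_closed unity_v dual_comb \<alpha>_v if_distrib[where f = "\<lambda>c. _ * c"]
      cong: if_cong sum.cong_simp)
  show "linear_on (dual_hopf L) (dual_hopf L) (antipode (dual_hopf L))"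
    using counit_comp_dual dual_add_closed dual_scl_closed
    by (intro linear_onI) (auto simp: dual_hopf_def fun_eq_iff fun_scl_def)
  show "antipode (dual_hopf L) x = 0" if "x \<notin> carrier (dual_hopf L)" for x
    using that by (simp add: dual_hopf_def)
  show "antipode (dual_hopf L) (\<alpha> i) = (\<Sum>k\<in>I. scl (dual_hopf L) (s i k) (\<alpha> k))" if "i \<in> I" for i
  proof -
    have "antipode (dual_hopf L) (\<alpha> i) (v k) = s i k" if k: "k \<in> I" for k
      using k \<open>i \<in> I\<close> fin
      by (simp add: dual_hopf_def \<alpha>_closed antipode_v dual_comb[OF \<alpha>_closed] \<alpha>_v
        if_distrib[where f = "\<lambda>c. _ * c"] cong: if_cong sum.cong_simp)
    then show ?thesis
      using dual_expand[OF counit_comp_dual[OF \<alpha>_closed[OF that]]] by simp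
  qed
qed

end

text \<open>Both Hopf isomorphisms of the theorem come from here: the dual of P with H, and P with
  its image under an algebra isomorphism. Each is reduced to finding bases with equal structure
  constants.\<close>

lemma hopf_coords_iso:
  assumes K: "hopf_coords I n m u e s K v" and L: "hopf_coords I n m u e s L w"
    and f: "linear_on K L f" "\<And>i. i \<in> I \<Longrightarrow> f (v i) = w i"
  shows "hopf_iso K L f"
proof -
  interpret K: hopf_coords I n m u e s K v by fact
  interpret L: hopf_coords I n m u e s L w by fact
  have f_comb: "f (\<Sum>i\<in>I. scl K (c i) (v i)) = (\<Sum>i\<in>I. scl L (c i) (w i))" for c
    by (subst linear_on_lincomb[OF f(1) K.space L.space]) (simp_all add: f(2))
  have bij: "bij_betw f (carrier K) (carrier L)"
    unfolding bij_betw_def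
  proof
    show "inj_on f (carrier K)"
    proof (rule inj_onI)
      fix x y assume xy: "x \<in> carrier K" "y \<in> carrier K" "f x = f y"
      obtain c d where cd: "x = (\<Sum>i\<in>I. scl K (c i) (v i))" "y = (\<Sum>i\<in>I. scl K (d i) (v i))"
        using K.sp.basis_fam_coord[OF K.basis] xy(1,2) by metis
      have "c i = d i" if "i \<in> I" for i
        using L.sp.indep_fam_eqD[OF L.v_indep _ that] xy(3) by (simp add: cd f_comb)
      then show "x = y" by (simp add: cd)
    qed
    show "f ` carrier K = carrier L"
    proof
      show "f ` carrier K \<subseteq> carrier L" using linear_onD(1)[OF f(1)] by blast
      show "carrier L \<subseteq> f ` carrier K"
      proof
        fix y assume "y \<in> carrier L"
        then obtain c where "y = (\<Sum>i\<in>I. scl L (c i) (w i))"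
          using L.sp.basis_fam_coord[OF L.basis] by blast
        then have "y = f (\<Sum>i\<in>I. scl K (c i) (v i))" by (simp add: f_comb)
        then show "y \<in> f ` carrier K" by simp
      qed
    qed
  qed
  have mul: "f (mul K x y) = mul L (f x) (f y)" if xy: "x \<in> carrier K" "y \<in> carrier K" for x y
  proof (rule bilinear_eq_basis[where f = "\<lambda>x y. f (mul K x y)" and g = "\<lambda>x y. mul L (f x) (f y)" and U = L,
        OF _ _ _ _ K.space K.space L.space K.basis K.basis _ xy])
    fix z assume z: "z \<in> carrier K"
    then have fz: "f z \<in> carrier L" using linear_onD(1)[OF f(1)] by blast
    show "linear_on K L (\<lambda>x. f (mul K x z))" "linear_on K L (\<lambda>x. f (mul K z x))"
      by (rule linear_on_comp[OF K.mul_lin_right[OF z] f(1)] linear_on_comp[OF K.mul_lin_left[OF z] f(1)])+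
    show "linear_on K L (\<lambda>x. mul L (f x) (f z))" "linear_on K L (\<lambda>x. mul L (f z) (f x))"
      by (rule linear_on_comp[OF f(1) L.mul_lin_right[OF fz]] linear_on_comp[OF f(1) L.mul_lin_left[OF fz]])+
  qed (simp add: K.mul_v L.mul_v f_comb f(2))
  have b: "bilinear_on K K (tensor_space L L) (\<lambda>v w. tensor L L (f v) (f w))"
    using linear_onD[OF f(1)]
    by (auto intro!: bilinear_onI linear_onI simp: tensor_add_left tensor_add_right tensor_scl_left tensor_scl_right)
  have comul: "comul L (f x) = tensor_map K K L L f f (comul K x)" if "x \<in> carrier K" for x
    unfolding tensor_map_def
    by (rule K.eq_basis[OF linear_on_comp[OF f(1) L.comul_lin] K.lin_lift_comul[OF k_space_tensor_space b]
          k_space_tensor_space _ that])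
      (simp add: f(2) L.comul_v K.lift_comul[OF k_space_tensor_space b] cong: sum.cong_simp)
  have counit: "counit L (f x) = counit K x" if "x \<in> carrier K" for x
    by (rule K.eq_basis[OF linear_on_comp[OF f(1) dualD(1)[OF L.counit_dual]] dualD(1)[OF K.counit_dual] k_space_ground _ that])
      (simp add: f(2) L.counit_v K.counit_v)
  have antipode: "antipode L (f x) = f (antipode K x)" if "x \<in> carrier K" for x
    by (rule K.eq_basis[OF linear_on_comp[OF f(1) L.antipode_lin] linear_on_comp[OF K.antipode_lin f(1)] L.space _ that])
      (simp add: f(2) L.antipode_v K.antipode_v f_comb)
  show ?thesis
    using K.is_hopf L.is_hopf bij f(1) mul comul counit antipode
    by (auto simp: hopf_iso_def hopf_hom_def alg_hom_def K.unity_v L.unity_v f_comb)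
qed

section \<open>Solutions of the pentagon equation in coordinates\<close>

text \<open>Written as the range of coefficient families, so that membership yields coordinates over
  \<open>I\<close> at once; for finite \<open>I\<close> it is the ordinary span by
  \<open>lspan_eq_span\<close>.\<close>

definition lspan :: "('k::field, 'v::ab_group_add, 'm) kspace_scheme \<Rightarrow> 'i set \<Rightarrow> ('i \<Rightarrow> 'v) \<Rightarrow> 'v set" where
  "lspan V I v = range (\<lambda>c. \<Sum>i\<in>I. scl V (c i) (v i))"

lemma lspanI: "(\<Sum>i\<in>I. scl V (c i) (v i)) \<in> lspan V I v"
  by (simp add: lspan_def)

lemma lspanE:
  assumes "x \<in> lspan V I v"
  obtains c where "x = (\<Sum>i\<in>I. scl V (c i) (v i))"
  using assms by (auto simp: lspan_def)

context k_space
begin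

lemma subspace_lspan: "vs.subspace (lspan V I v)"
proof (rule vs.subspaceI)
  show "0 \<in> lspan V I v" using lspanI[of V "\<lambda>_. 0" v I] by simp
  fix x y assume "x \<in> lspan V I v" "y \<in> lspan V I v"
  then obtain c d where "x = (\<Sum>i\<in>I. scl V (c i) (v i))" "y = (\<Sum>i\<in>I. scl V (d i) (v i))"
    by (auto elim!: lspanE)
  then have "x + y = (\<Sum>i\<in>I. scl V (c i + d i) (v i))"
    by (simp add: vs.scale_left_distrib sum.distrib)
  then show "x + y \<in> lspan V I v" by (simp only: lspanI)
next
  fix k x assume "x \<in> lspan V I v"
  then obtain c where "x = (\<Sum>i\<in>I. scl V (c i) (v i))" by (auto elim!: lspanE)
  then have "scl V k x = (\<Sum>i\<in>I. scl V (k * c i) (v i))"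
    by (simp add: vs.scale_sum_right)
  then show "scl V k x \<in> lspan V I v" by (simp only: lspanI)
qed

lemma lspan_base: "finite I \<Longrightarrow> i \<in> I \<Longrightarrow> v i \<in> lspan V I v"
  using lspanI[of V "\<lambda>j. if j = i then 1 else 0" v I]
  by (simp add: if_distrib[where f = "\<lambda>c. scl V c _"] cong: if_cong)

lemma lspan_subset: "(\<And>i. i \<in> I \<Longrightarrow> v i \<in> carrier V) \<Longrightarrow> lspan V I v \<subseteq> carrier V"
  by (auto elim!: lspanE)

lemma k_space_lspan: "carrier W = lspan V I v \<Longrightarrow> scl W = scl V \<Longrightarrow> k_space W"
  using vector_space subspace_lspan by (simp add: k_space_def)

lemma basis_fam_lspan:
  assumes "carrier W = lspan V I v" "scl W = scl V" "finite I" "indep_fam V I v"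
  shows "basis_fam W I v"
  using assms lspan_base by (auto simp: basis_fam_def indep_fam_def elim!: lspanE)

end

text \<open>The matrices \<open>c\<close> and \<open>s\<close> act on \<open>V\<close> as
  \<open>f\<close> and \<open>g\<close> with \<open>g (f x) = x\<close>. By finite dimension the
  injective \<open>f\<close> is onto, so \<open>f\<close> also inverts \<open>g\<close> from the
  left. Only the index set matters; \<open>V\<close> provides a space on which the matrices can
  act.\<close>

lemma left_inverse_imp_right_inverse:
  fixes c s :: "'i \<Rightarrow> 'i \<Rightarrow> 'k::field" and V :: "('k, 'v::ab_group_add, 'm) kspace_scheme"
  assumes V: "k_space V" and v: "basis_fam V I v"
    and cs: "\<And>i k. i \<in> I \<Longrightarrow> k \<in> I \<Longrightarrow> (\<Sum>j\<in>I. c i j * s j k) = (if i = k then 1 else 0)"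
    and i: "i \<in> I" and k: "k \<in> I"
  shows "(\<Sum>j\<in>I. s i j * c j k) = (if i = k then 1 else 0)"
proof -
  interpret V: k_space V by fact
  have fin: "finite I" and vi: "v i \<in> carrier V" if "i \<in> I" for i
    using v that by (auto simp: basis_fam_def)
  have vc: "(\<Sum>j\<in>I. scl V (x j) (v j)) \<in> carrier V" for x
    using vi by simp
  obtain f where f: "linear_on V V f" "\<And>i. i \<in> I \<Longrightarrow> f (v i) = (\<Sum>j\<in>I. scl V (c i j) (v j))"
    using linear_extension[OF V V v vc] by metis
  obtain g where g: "linear_on V V g" "\<And>i. i \<in> I \<Longrightarrow> g (v i) = (\<Sum>j\<in>I. scl V (s i j) (v j))"
    using linear_extension[OF V V v vc] by metis
  have swap: "(\<Sum>j\<in>I. scl V (x j) (\<Sum>k\<in>I. scl V (y j k) (v k))) = (\<Sum>k\<in>I. scl V (\<Sum>j\<in>I. x j * y j k) (v k))" for x y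
    by (simp add: V.vs.scale_sum_right V.vs.scale_sum_left) (rule sum.swap)
  have delta: "(\<Sum>k\<in>I. scl V (if j = k then 1 else 0) (v k)) = v j" if "j \<in> I" for j
    using that fin[OF i] by (simp add: if_distrib[where f = "\<lambda>c. scl V c _"] cong: if_cong)
  have lid: "linear_on V V (\<lambda>x. x)" by (simp add: linear_on_def)
  have gf: "g (f x) = x" if "x \<in> carrier V" for x
  proof (rule linear_on_eq_basis[OF linear_on_comp[OF f(1) g(1)] lid V V v _ that])
    fix i assume i: "i \<in> I"
    have "g (f (v i)) = (\<Sum>j\<in>I. scl V (c i j) (g (v j)))"
      using i vi by (simp add: f(2) linear_on_lincomb[OF g(1) V V])
    then show "g (f (v i)) = v i"
      using i by (simp add: g(2) swap cs delta cong: sum.cong_simp)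
  qed
  have fd: "fin_dim V" by (rule V.kdim_basis_fam(2)[OF v])
  obtain x where x: "x \<in> carrier V" "f x = v i"
  proof (rule V.injective_imp_surjective[OF fd f(1) _ vi[OF i]])
    fix x assume "x \<in> carrier V" "f x = 0"
    then show "x = 0" using gf linear_on_zero[OF g(1) V V] by metis
  qed
  have "f (g (v i)) = v i" using gf[OF x(1)] x(2) by simp
  moreover have "f (g (v i)) = (\<Sum>j\<in>I. scl V (s i j) (f (v j)))"
    using i vi by (simp add: g(2) linear_on_lincomb[OF f(1) V V])
  ultimately have "(\<Sum>k\<in>I. scl V (\<Sum>j\<in>I. s i j * c j k) (v k)) = (\<Sum>k\<in>I. scl V (if i = k then 1 else 0) (v k))"
    using i by (simp add: f(2) swap delta cong: sum.cong_simp)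
  from V.indep_fam_eqD[OF _ this k] v show ?thesis by (simp add: basis_fam_def)
qed

lemma (in k_algebra) lspan_mul_closed:
  assumes "\<And>i j. i \<in> I \<Longrightarrow> j \<in> I \<Longrightarrow> mul A (v i) (v j) \<in> lspan A I v"
    "\<And>i. i \<in> I \<Longrightarrow> v i \<in> carrier A" "x \<in> lspan A I v" "y \<in> lspan A I v"
  shows "mul A x y \<in> lspan A I v"
proof -
  obtain x' y' where xy: "x = (\<Sum>i\<in>I. scl A (x' i) (v i))" "y = (\<Sum>i\<in>I. scl A (y' i) (v i))"
    using assms(3,4) by (auto elim!: lspanE)
  have "y \<in> carrier A" using assms(2) by (simp add: xy(2))
  then have "mul A x y = (\<Sum>i\<in>I. scl A (x' i) (mul A (v i) y))"
    using assms(2) by (simp add: xy(1) mul_sum_left mul_scl_left cong: sum.cong_simp)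
  also have "\<dots> = (\<Sum>i\<in>I. scl A (x' i) (\<Sum>j\<in>I. scl A (y' j) (mul A (v i) (v j))))"
    using assms(2) by (simp add: xy(2) mul_sum_right mul_scl_right cong: sum.cong_simp)
  also have "\<dots> \<in> lspan A I v"
    using assms(1) by (intro vs.subspace_sum[OF subspace_lspan] vs.subspace_scale[OF subspace_lspan])
  finally show ?thesis .
qed

text \<open>\<open>X\<close> acts injectively, hence surjectively, on \<open>V\<close>, so its inverse is already in \<open>V\<close>.\<close>

lemma (in k_algebra) inverse_in_subspace:
  assumes V: "k_space V" "fin_dim V" "carrier V \<subseteq> carrier A" "scl V = scl A"
    and X: "X \<in> carrier A" and Y: "Y \<in> carrier A" "mul A Y X = unity A"
    and one: "unity A \<in> carrier V" and closed: "\<And>Z. Z \<in> carrier V \<Longrightarrow> mul A X Z \<in> carrier V"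
  shows "Y \<in> carrier V"
proof -
  have lin: "linear_on V V (mul A X)"
    using linear_onD[OF linear_mul_left[OF X]] V(3,4) closed by (auto simp: linear_on_def subset_iff)
  have YXZ: "mul A Y (mul A X Z) = Z" if "Z \<in> carrier V" for Z
    using that V(3) X Y by (simp add: mul_assoc[symmetric] subset_iff)
  obtain Z where Z: "Z \<in> carrier V" "mul A X Z = unity A"
  proof (rule k_space.injective_imp_surjective[OF V(1,2) lin _ one])
    fix Z assume "Z \<in> carrier V" "mul A X Z = 0"
    then show "Z = 0" using YXZ[of Z] Y by simp
  qed
  have "Y = Z" using YXZ[OF Z(1)] Z(2) Y by simp
  then show ?thesis using Z(1) by simp
qed

text \<open>The equation \<open>a_b\<close> is the coefficient of \<open>a\<^sub>p \<otimes> - \<otimes> b\<^sub>l\<close> in the pentagon equation for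
  \<open>R = \<Sum>\<^sub>i a\<^sub>i \<otimes> b\<^sub>i\<close>, and \<open>R\<^sup>-\<^sup>1 = \<Sum>\<^sub>i Sa\<^sub>i \<otimes> b\<^sub>i = \<Sum>\<^sub>i a\<^sub>i \<otimes> Sb\<^sub>i\<close>.\<close>

locale pentagon_coords = k_algebra A
  for A :: "('k::field, 'a::ab_group_add) kalg" +
  fixes I :: "'i set" and a b :: "'i \<Rightarrow> 'a" and n m :: "'i \<Rightarrow> 'i \<Rightarrow> 'i \<Rightarrow> 'k" and u e :: "'i \<Rightarrow> 'k"
    and s :: "'i \<Rightarrow> 'i \<Rightarrow> 'k"
  assumes fin: "finite I"
    and nontrivial: "unity A \<noteq> 0"
    and a_closed [simp]: "i \<in> I \<Longrightarrow> a i \<in> carrier A"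
    and b_closed [simp]: "i \<in> I \<Longrightarrow> b i \<in> carrier A"
    and a_indep: "indep_fam A I a"
    and b_indep: "indep_fam A I b"
    and a_a: "\<lbrakk>i \<in> I; j \<in> I\<rbrakk> \<Longrightarrow> mul A (a i) (a j) = (\<Sum>l\<in>I. scl A (n i j l) (a l))"
    and b_b: "\<lbrakk>i \<in> I; j \<in> I\<rbrakk> \<Longrightarrow> mul A (b i) (b j) = (\<Sum>l\<in>I. scl A (m i j l) (b l))"
    and one_a: "unity A = (\<Sum>i\<in>I. scl A (u i) (a i))"
    and one_b: "unity A = (\<Sum>i\<in>I. scl A (e i) (b i))"
    and a_b: "\<lbrakk>l \<in> I; p \<in> I\<rbrakk> \<Longrightarrow> mul A (a l) (b p) =
      (\<Sum>i\<in>I. \<Sum>j\<in>I. \<Sum>k\<in>I. scl A (m j k l * n i j p) (mul A (b i) (a k)))"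
    and s_left: "\<lbrakk>l \<in> I; q \<in> I\<rbrakk> \<Longrightarrow> (\<Sum>j\<in>I. \<Sum>k\<in>I. \<Sum>i\<in>I. m j k l * s i j * n i k q) = e l * u q"
    and s_right: "\<lbrakk>l \<in> I; q \<in> I\<rbrakk> \<Longrightarrow> (\<Sum>j\<in>I. \<Sum>k\<in>I. \<Sum>i\<in>I. m j k l * s i k * n j i q) = e l * u q"
    and Sa_Sa: "\<lbrakk>i \<in> I; j \<in> I\<rbrakk> \<Longrightarrow> mul A (\<Sum>k\<in>I. scl A (s k j) (a k)) (\<Sum>k\<in>I. scl A (s k i) (a k)) =
      (\<Sum>l\<in>I. scl A (n i j l) (\<Sum>k\<in>I. scl A (s k l) (a k)))"
    and Sb_Sb: "\<lbrakk>i \<in> I; j \<in> I\<rbrakk> \<Longrightarrow> mul A (\<Sum>k\<in>I. scl A (s j k) (b k)) (\<Sum>k\<in>I. scl A (s i k) (b k)) =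
      (\<Sum>l\<in>I. scl A (m i j l) (\<Sum>k\<in>I. scl A (s l k) (b k)))"
begin

definition Sa where "Sa i = (\<Sum>k\<in>I. scl A (s k i) (a k))"
definition Sb where "Sb i = (\<Sum>k\<in>I. scl A (s i k) (b k))"
definition RR where "RR = (\<Sum>i\<in>I. tensor A A (a i) (b i))"
definition UU where "UU = (\<Sum>i\<in>I. tensor A A (Sa i) (b i))"

lemma Sa_closed [simp]: "Sa i \<in> carrier A" and Sb_closed [simp]: "Sb i \<in> carrier A"
  by (simp_all add: Sa_def Sb_def)

lemma UU_eq: "UU = (\<Sum>i\<in>I. tensor A A (a i) (Sb i))"
  unfolding UU_def Sa_def Sb_def
  by (simp add: tensor_sum_left tensor_sum_right tensor_scl_left tensor_scl_right) (rule sum.swap)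

sublocale AA: algebra_pair A A ..

sublocale T: k_algebra "tensor_alg A A"
  by (rule AA.k_algebra_tensor_alg)

lemma swap_comb:
  "(\<Sum>p\<in>J. scl A (c p) (\<Sum>l\<in>K. scl A (d p l) (v l))) = (\<Sum>l\<in>K. scl A (\<Sum>p\<in>J. c p * d p l) (v l))"
  by (simp add: vs.scale_sum_right vs.scale_sum_left) (rule sum.swap)

lemma delta_comb: "j \<in> I \<Longrightarrow> (\<Sum>l\<in>I. scl A (if j = l then 1 else 0) (v l)) = v j"
  by (simp add: fin if_distrib[where f = "\<lambda>c. scl A c _"] cong: if_cong)

text \<open>The scalar laws for \<open>n\<close> are the laws of A for products of the
  \<open>a i\<close>, compared through independence of \<open>a\<close>.\<close>

lemma n_assoc:
  assumes "i \<in> I" "j \<in> I" "k \<in> I" "l \<in> I"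
  shows "(\<Sum>p\<in>I. n i j p * n p k l) = (\<Sum>p\<in>I. n j k p * n i p l)"
proof -
  have "(\<Sum>l\<in>I. scl A (\<Sum>p\<in>I. n i j p * n p k l) (a l)) = mul A (mul A (a i) (a j)) (a k)"
    using assms by (simp add: a_a mul_sum_left mul_scl_left swap_comb cong: sum.cong_simp)
  also have "\<dots> = mul A (a i) (mul A (a j) (a k))"
    using assms by (simp add: mul_assoc)
  also have "\<dots> = (\<Sum>l\<in>I. scl A (\<Sum>p\<in>I. n j k p * n i p l) (a l))"
    using assms by (simp add: a_a mul_sum_right mul_scl_right swap_comb cong: sum.cong_simp)
  finally show ?thesis by (rule indep_fam_eqD[OF a_indep _ assms(4)])
qed

lemma n_unit:
  assumes "j \<in> I" "l \<in> I"
  shows "(\<Sum>i\<in>I. u i * n i j l) = (if j = l then 1 else 0)"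
    and "(\<Sum>i\<in>I. u i * n j i l) = (if j = l then 1 else 0)"
proof -
  have "(\<Sum>l\<in>I. scl A (\<Sum>i\<in>I. u i * n i j l) (a l)) = mul A (unity A) (a j)"
    using assms unfolding one_a by (simp add: a_a mul_sum_left mul_scl_left swap_comb cong: sum.cong_simp)
  also have "\<dots> = (\<Sum>l\<in>I. scl A (if j = l then 1 else 0) (a l))"
    using assms by (simp add: delta_comb)
  finally show "(\<Sum>i\<in>I. u i * n i j l) = (if j = l then 1 else 0)"
    by (rule indep_fam_eqD[OF a_indep _ assms(2)])
  have "(\<Sum>l\<in>I. scl A (\<Sum>i\<in>I. u i * n j i l) (a l)) = mul A (a j) (unity A)"
    using assms unfolding one_a by (simp add: a_a mul_sum_right mul_scl_right swap_comb cong: sum.cong_simp)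
  also have "\<dots> = (\<Sum>l\<in>I. scl A (if j = l then 1 else 0) (a l))"
    using assms by (simp add: delta_comb)
  finally show "(\<Sum>i\<in>I. u i * n j i l) = (if j = l then 1 else 0)"
    by (rule indep_fam_eqD[OF a_indep _ assms(2)])
qed

lemma a_Sa_comb:
  assumes "j \<in> I" "k \<in> I"
  shows "mul A (a j) (Sa k) = (\<Sum>q\<in>I. scl A (\<Sum>i\<in>I. s i k * n j i q) (a q))"
    and Sa_a_comb: "mul A (Sa k) (a j) = (\<Sum>q\<in>I. scl A (\<Sum>i\<in>I. s i k * n i j q) (a q))"
  using assms
  by (simp_all add: Sa_def mul_sum_right mul_sum_left mul_scl_left mul_scl_right a_a swap_comb cong: sum.cong_simp)

text \<open>Since \<open>m j k l\<close> are the coefficients of the coproduct of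
  \<open>a l\<close>, these are the antipode axioms of P at \<open>a l\<close>, with values in
  A.\<close>

lemma a_Sa: "l \<in> I \<Longrightarrow> (\<Sum>j\<in>I. \<Sum>k\<in>I. scl A (m j k l) (mul A (a j) (Sa k))) = scl A (e l) (unity A)"
  and Sa_a: "l \<in> I \<Longrightarrow> (\<Sum>j\<in>I. \<Sum>k\<in>I. scl A (m j k l) (mul A (Sa j) (a k))) = scl A (e l) (unity A)"
proof -
  assume l: "l \<in> I"
  have "(\<Sum>j\<in>I. \<Sum>k\<in>I. scl A (m j k l) (mul A (a j) (Sa k))) =
      (\<Sum>j\<in>I. \<Sum>k\<in>I. \<Sum>q\<in>I. scl A (\<Sum>i\<in>I. m j k l * s i k * n j i q) (a q))"
    using l by (simp add: a_Sa_comb vs.scale_sum_right sum_distrib_left mult.assoc cong: sum.cong_simp)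
  also have "\<dots> = (\<Sum>q\<in>I. scl A (\<Sum>j\<in>I. \<Sum>k\<in>I. \<Sum>i\<in>I. m j k l * s i k * n j i q) (a q))"
    by (subst sum_rotate3[symmetric]) (simp add: vs.scale_sum_left)
  finally show "(\<Sum>j\<in>I. \<Sum>k\<in>I. scl A (m j k l) (mul A (a j) (Sa k))) = scl A (e l) (unity A)"
    using l by (simp add: s_right one_a vs.scale_sum_right cong: sum.cong_simp)
  have "(\<Sum>j\<in>I. \<Sum>k\<in>I. scl A (m j k l) (mul A (Sa j) (a k))) =
      (\<Sum>j\<in>I. \<Sum>k\<in>I. \<Sum>q\<in>I. scl A (\<Sum>i\<in>I. m j k l * s i j * n i k q) (a q))"
    using l by (simp add: Sa_a_comb vs.scale_sum_right sum_distrib_left mult.assoc cong: sum.cong_simp)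
  also have "\<dots> = (\<Sum>q\<in>I. scl A (\<Sum>j\<in>I. \<Sum>k\<in>I. \<Sum>i\<in>I. m j k l * s i j * n i k q) (a q))"
    by (subst sum_rotate3[symmetric]) (simp add: vs.scale_sum_left)
  finally show "(\<Sum>j\<in>I. \<Sum>k\<in>I. scl A (m j k l) (mul A (Sa j) (a k))) = scl A (e l) (unity A)"
    using l by (simp add: s_left one_a vs.scale_sum_right cong: sum.cong_simp)
qed

lemma RR_closed [simp]: "RR \<in> carrier (tensor_space A A)" and UU_closed [simp]: "UU \<in> carrier (tensor_space A A)"
  by (simp_all add: RR_def UU_def)

lemma RR_in [simp]: "RR \<in> carrier (tensor_alg A A)" and UU_in [simp]: "UU \<in> carrier (tensor_alg A A)"
  by simp_all

lemma mul_sum_tensor: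
  assumes "\<And>i. i \<in> J \<Longrightarrow> x i \<in> carrier A" "\<And>i. i \<in> J \<Longrightarrow> y i \<in> carrier A"
    "\<And>i. i \<in> K \<Longrightarrow> z i \<in> carrier A" "\<And>i. i \<in> K \<Longrightarrow> w i \<in> carrier A"
  shows "mul (tensor_alg A A) (\<Sum>i\<in>J. tensor A A (x i) (y i)) (\<Sum>j\<in>K. tensor A A (z j) (w j)) =
    (\<Sum>i\<in>J. \<Sum>j\<in>K. tensor A A (mul A (x i) (z j)) (mul A (y i) (w j)))"
proof -
  have "mul (tensor_alg A A) (\<Sum>i\<in>J. tensor A A (x i) (y i)) (\<Sum>j\<in>K. tensor A A (z j) (w j)) =
      (\<Sum>i\<in>J. mul (tensor_alg A A) (tensor A A (x i) (y i)) (\<Sum>j\<in>K. tensor A A (z j) (w j)))"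
    using assms by (intro T.mul_sum_left) simp_all
  also have "\<dots> = (\<Sum>i\<in>J. \<Sum>j\<in>K. mul (tensor_alg A A) (tensor A A (x i) (y i)) (tensor A A (z j) (w j)))"
    using assms by (intro sum.cong refl T.mul_sum_right) simp_all
  also have "\<dots> = (\<Sum>i\<in>J. \<Sum>j\<in>K. tensor A A (mul A (x i) (z j)) (mul A (y i) (w j)))"
    using assms by (intro sum.cong refl AA.tensor_alg_mul) simp_all
  finally show ?thesis .
qed

text \<open>Multiplying the right legs produces the factor \<open>m j k l\<close> on the left legs:
  this is the mechanism by which the product of H acts as coproduct of P.\<close>

lemma collect_b:
  "(\<Sum>j\<in>I. \<Sum>k\<in>I. tensor A A (x j k) (mul A (b j) (b k))) =
   (\<Sum>l\<in>I. tensor A A (\<Sum>j\<in>I. \<Sum>k\<in>I. scl A (m j k l) (x j k)) (b l))"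
proof -
  have "(\<Sum>j\<in>I. \<Sum>k\<in>I. tensor A A (x j k) (mul A (b j) (b k))) =
      (\<Sum>j\<in>I. \<Sum>k\<in>I. \<Sum>l\<in>I. fun_scl (m j k l) (tensor A A (x j k) (b l)))"
    by (simp add: b_b tensor_sum_right tensor_scl_right cong: sum.cong_simp)
  also have "\<dots> = (\<Sum>l\<in>I. \<Sum>j\<in>I. \<Sum>k\<in>I. fun_scl (m j k l) (tensor A A (x j k) (b l)))"
    by (rule sum_rotate3[symmetric])
  finally show ?thesis by (simp add: tensor_sum_left tensor_scl_left)
qed

lemma collect_a:
  "(\<Sum>j\<in>I. \<Sum>k\<in>I. tensor A A (mul A (a j) (a k)) (x j k)) =
   (\<Sum>l\<in>I. tensor A A (a l) (\<Sum>j\<in>I. \<Sum>k\<in>I. scl A (n j k l) (x j k)))"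
proof -
  have "(\<Sum>j\<in>I. \<Sum>k\<in>I. tensor A A (mul A (a j) (a k)) (x j k)) =
      (\<Sum>j\<in>I. \<Sum>k\<in>I. \<Sum>l\<in>I. fun_scl (n j k l) (tensor A A (a l) (x j k)))"
    by (simp add: a_a tensor_sum_left tensor_scl_left cong: sum.cong_simp)
  also have "\<dots> = (\<Sum>l\<in>I. \<Sum>j\<in>I. \<Sum>k\<in>I. fun_scl (n j k l) (tensor A A (a l) (x j k)))"
    by (rule sum_rotate3[symmetric])
  finally show ?thesis by (simp add: tensor_sum_right tensor_scl_right)
qed

text \<open>After collecting by \<open>b l\<close>, the left leg is an antipode sum and equals
  \<open>e l\<close> times 1; summing \<open>e l\<close> times \<open>b l\<close> gives 1 in the
  right leg.\<close>

lemma RR_UU: "mul (tensor_alg A A) RR UU = tensor A A (unity A) (unity A)"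
  and UU_RR: "mul (tensor_alg A A) UU RR = tensor A A (unity A) (unity A)"
proof -
  have 1: "(\<Sum>l\<in>I. tensor A A (scl A (e l) (unity A)) (b l)) = tensor A A (unity A) (unity A)"
    by (simp add: one_b[THEN arg_cong[where f = "tensor A A (unity A)"]] tensor_sum_right tensor_scl_left tensor_scl_right)
  show "mul (tensor_alg A A) RR UU = tensor A A (unity A) (unity A)"
    unfolding RR_def UU_def by (simp add: mul_sum_tensor collect_b a_Sa 1 cong: sum.cong_simp)
  show "mul (tensor_alg A A) UU RR = tensor A A (unity A) (unity A)"
    unfolding RR_def UU_def by (simp add: mul_sum_tensor collect_b Sa_a 1 cong: sum.cong_simp)
qed

lemma tens_inv_RR: "tens_inv A RR = UU"
  unfolding tens_inv_def
  by (rule monoid.inv_unique'[OF T.monoid, symmetric]) (simp_all add: RR_UU UU_RR)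

text \<open>The coproduct of P carries the multiplication constants of H, that of H those of
  P.\<close>

definition \<Delta>P where "\<Delta>P l = (\<Sum>j\<in>I. \<Sum>k\<in>I. fun_scl (m j k l) (tensor A A (a j) (a k)))"
definition \<Delta>H where "\<Delta>H l = (\<Sum>i\<in>I. \<Sum>j\<in>I. fun_scl (n i j l) (tensor A A (b i) (b j)))"

lemma \<Delta>P_closed [simp]: "\<Delta>P l \<in> carrier (tensor_space A A)" and \<Delta>H_closed [simp]: "\<Delta>H l \<in> carrier (tensor_space A A)"
  by (simp_all add: \<Delta>P_def \<Delta>H_def)

text \<open>Collecting the product with \<open>\<Delta>P l\<close> by \<open>a p\<close> leaves in
  the right leg exactly the right side of \<open>a_b\<close>. Conjugating back by the inverse of R
  yields the formula for the coproduct of P.\<close>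

lemma one_a_RR: "l \<in> I \<Longrightarrow> mul (tensor_alg A A) (tensor A A (unity A) (a l)) RR = mul (tensor_alg A A) RR (\<Delta>P l)"
proof -
  assume l: "l \<in> I"
  have "mul (tensor_alg A A) RR (\<Delta>P l) = (\<Sum>j\<in>I. \<Sum>k\<in>I. fun_scl (m j k l) (mul (tensor_alg A A) RR (tensor A A (a j) (a k))))"
    by (simp add: \<Delta>P_def T.mul_sum_right T.mul_scl_right[simplified] cong: sum.cong_simp)
  also have "\<dots> = (\<Sum>j\<in>I. \<Sum>k\<in>I. \<Sum>i\<in>I. fun_scl (m j k l) (tensor A A (mul A (a i) (a j)) (mul A (b i) (a k))))"
    by (simp add: RR_def T.mul_sum_left AA.tensor_alg_mul fs.scale_sum_right cong: sum.cong_simp)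
  also have "\<dots> = (\<Sum>i\<in>I. \<Sum>j\<in>I. \<Sum>k\<in>I. fun_scl (m j k l) (tensor A A (mul A (a i) (a j)) (mul A (b i) (a k))))"
    by (rule sum_rotate3[symmetric])
  also have "\<dots> = (\<Sum>i\<in>I. \<Sum>j\<in>I. tensor A A (mul A (a i) (a j)) (\<Sum>k\<in>I. scl A (m j k l) (mul A (b i) (a k))))"
    by (simp add: tensor_sum_right tensor_scl_right)
  also have "\<dots> = (\<Sum>p\<in>I. tensor A A (a p) (mul A (a l) (b p)))"
    using l by (simp add: collect_a a_b vs.scale_sum_right mult.commute cong: sum.cong_simp)
  also have "\<dots> = mul (tensor_alg A A) (tensor A A (unity A) (a l)) RR"
    using l by (simp add: RR_def T.mul_sum_right AA.tensor_alg_mul cong: sum.cong_simp)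
  finally show ?thesis by simp
qed

text \<open>The same relation \<open>a_b\<close>, now collected by the right leg, gives the
  coproduct of H.\<close>

lemma RR_b_one: "l \<in> I \<Longrightarrow> mul (tensor_alg A A) RR (tensor A A (b l) (unity A)) = mul (tensor_alg A A) (\<Delta>H l) RR"
proof -
  assume l: "l \<in> I"
  have "mul (tensor_alg A A) (\<Delta>H l) RR = (\<Sum>i\<in>I. \<Sum>j\<in>I. fun_scl (n i j l) (mul (tensor_alg A A) (tensor A A (b i) (b j)) RR))"
    by (simp add: \<Delta>H_def T.mul_sum_left T.mul_scl_left[simplified] cong: sum.cong_simp)
  also have "\<dots> = (\<Sum>i\<in>I. \<Sum>j\<in>I. \<Sum>k\<in>I. fun_scl (n i j l) (tensor A A (mul A (b i) (a k)) (mul A (b j) (b k))))"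
    by (simp add: RR_def T.mul_sum_right AA.tensor_alg_mul fs.scale_sum_right cong: sum.cong_simp)
  also have "\<dots> = (\<Sum>j\<in>I. \<Sum>k\<in>I. \<Sum>i\<in>I. fun_scl (n i j l) (tensor A A (mul A (b i) (a k)) (mul A (b j) (b k))))"
    by (rule sum_rotate3)
  also have "\<dots> = (\<Sum>j\<in>I. \<Sum>k\<in>I. tensor A A (\<Sum>i\<in>I. scl A (n i j l) (mul A (b i) (a k))) (mul A (b j) (b k)))"
    by (simp add: tensor_sum_left tensor_scl_left)
  also have "\<dots> = (\<Sum>p\<in>I. tensor A A (\<Sum>j\<in>I. \<Sum>k\<in>I. \<Sum>i\<in>I. scl A (m j k p * n i j l) (mul A (b i) (a k))) (b p))"
    by (simp add: collect_b vs.scale_sum_right)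
  also have "\<dots> = (\<Sum>p\<in>I. tensor A A (mul A (a p) (b l)) (b p))"
    using l by (subst sum_rotate3[symmetric]) (simp add: a_b cong: sum.cong_simp)
  also have "\<dots> = mul (tensor_alg A A) RR (tensor A A (b l) (unity A))"
    using l by (simp add: RR_def T.mul_sum_left AA.tensor_alg_mul cong: sum.cong_simp)
  finally show ?thesis by simp
qed

lemma conj_cancel:
  assumes "X \<in> carrier (tensor_space A A)" "Y \<in> carrier (tensor_space A A)"
  shows "mul (tensor_alg A A) X RR = mul (tensor_alg A A) RR Y \<Longrightarrow> mul (tensor_alg A A) (mul (tensor_alg A A) UU X) RR = Y"
    and "mul (tensor_alg A A) RR X = mul (tensor_alg A A) Y RR \<Longrightarrow> mul (tensor_alg A A) (mul (tensor_alg A A) RR X) UU = Y"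
proof -
  assume *: "mul (tensor_alg A A) X RR = mul (tensor_alg A A) RR Y"
  have "mul (tensor_alg A A) (mul (tensor_alg A A) UU X) RR = mul (tensor_alg A A) (mul (tensor_alg A A) UU RR) Y"
    using assms T.mul_assoc[of UU X RR] T.mul_assoc[of UU RR Y] * by simp
  then show "mul (tensor_alg A A) (mul (tensor_alg A A) UU X) RR = Y"
    using assms T.mul_unity_left[of Y] by (simp add: UU_RR)
next
  assume *: "mul (tensor_alg A A) RR X = mul (tensor_alg A A) Y RR"
  have "mul (tensor_alg A A) (mul (tensor_alg A A) RR X) UU = mul (tensor_alg A A) Y (mul (tensor_alg A A) RR UU)"
    using assms T.mul_assoc[of Y RR UU] * by simp
  then show "mul (tensor_alg A A) (mul (tensor_alg A A) RR X) UU = Y"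
    using assms T.mul_unity_right[of Y] by (simp add: RR_UU)
qed

lemma comul_P_a: "l \<in> I \<Longrightarrow> comul_P A RR (a l) = \<Delta>P l"
  using conj_cancel(1)[OF _ _ one_a_RR] by (simp add: comul_P_def tens_inv_RR)

lemma comul_H_b: "l \<in> I \<Longrightarrow> comul_H A RR (b l) = \<Delta>H l"
  using conj_cancel(2)[OF _ _ RR_b_one] by (simp add: comul_H_def tens_inv_RR)

lemma linear_tensor_one: "linear_on A (tensor_alg A A) (tensor A A (unity A))"
  "linear_on A (tensor_alg A A) (\<lambda>x. tensor A A x (unity A))"
  by (auto intro!: linear_onI simp: tensor_add_right tensor_scl_right tensor_add_left tensor_scl_left)

lemma comul_P_linear: "linear_on A (tensor_alg A A) (comul_P A RR)"
  unfolding comul_P_def Let_def tens_inv_RR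
  by (rule linear_on_comp[OF linear_on_comp[OF linear_tensor_one(1) T.linear_mul_left[OF UU_in]] T.linear_mul_right[OF RR_in]])

lemma comul_H_linear: "linear_on A (tensor_alg A A) (comul_H A RR)"
  unfolding comul_H_def Let_def tens_inv_RR
  by (rule linear_on_comp[OF linear_on_comp[OF linear_tensor_one(2) T.linear_mul_left[OF RR_in]] T.linear_mul_right[OF UU_in]])

lemma comul_P_unity: "comul_P A RR (unity A) = tensor A A (unity A) (unity A)"
  unfolding comul_P_def Let_def tens_inv_RR
  using T.mul_unity_right[OF UU_in] by (simp add: UU_RR)

lemma comul_P_mul:
  assumes "x \<in> carrier A" "y \<in> carrier A"
  shows "comul_P A RR (mul A x y) = mul (tensor_alg A A) (comul_P A RR x) (comul_P A RR y)"
proof -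
  let ?m = "mul (tensor_alg A A)" and ?x = "tensor A A (unity A) x" and ?y = "tensor A A (unity A) y"
  have xy: "?x \<in> carrier (tensor_alg A A)" "?y \<in> carrier (tensor_alg A A)"
    using assms by simp_all
  have "?m (?m (?m UU ?x) RR) (?m (?m UU ?y) RR) = ?m (?m UU ?x) (?m (?m RR UU) (?m ?y RR))"
    using xy by (simp only: T.mul_assoc RR_in UU_in T.mul_closed)
  also have "\<dots> = ?m (?m UU ?x) (?m ?y RR)"
    using T.mul_unity_left[of "?m ?y RR"] xy T.mul_closed[of ?y RR] by (simp add: RR_UU)
  also have "\<dots> = ?m (?m UU (?m ?x ?y)) RR"
    using xy by (simp only: T.mul_assoc RR_in UU_in T.mul_closed)
  also have "?m ?x ?y = tensor A A (unity A) (mul A x y)"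
    using assms by (simp add: AA.tensor_alg_mul)
  finally show ?thesis unfolding comul_P_def Let_def tens_inv_RR by (rule sym)
qed

lemma tensor_aa_eqD:
  assumes "(\<Sum>p\<in>I. \<Sum>q\<in>I. fun_scl (c p q) (tensor A A (a p) (a q))) = (\<Sum>p\<in>I. \<Sum>q\<in>I. fun_scl (d p q) (tensor A A (a p) (a q)))"
    "p \<in> I" "q \<in> I"
  shows "c p q = d p q"
  by (rule tensor_indep[OF k_space_axioms k_space_axioms fin fin a_indep a_indep _ _ assms]) simp_all

text \<open>Conjugation fixes 1, so the coproduct of 1 is \<open>1 \<otimes> 1\<close>; this is that
  equation in coordinates.\<close>

lemma u_mult:
  assumes "i \<in> I" "j \<in> I"
  shows "(\<Sum>l\<in>I. m i j l * u l) = u i * u j"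
proof -
  have "(\<Sum>p\<in>I. \<Sum>q\<in>I. fun_scl (\<Sum>l\<in>I. m p q l * u l) (tensor A A (a p) (a q))) = (\<Sum>l\<in>I. fun_scl (u l) (\<Delta>P l))"
    unfolding fs.scale_sum_left \<Delta>P_def fs.scale_sum_right
    by (subst sum_rotate3[symmetric]) (simp add: mult.commute)
  also have "\<dots> = comul_P A RR (unity A)"
    unfolding one_a
    by (subst linear_on_lincomb[OF comul_P_linear k_space_axioms k_space_tensor_alg]) (simp_all add: comul_P_a cong: sum.cong_simp)
  also have "\<dots> = tensor A A (\<Sum>i\<in>I. scl A (u i) (a i)) (\<Sum>i\<in>I. scl A (u i) (a i))"
    unfolding comul_P_unity by (simp only: one_a)
  also have "\<dots> = (\<Sum>p\<in>I. \<Sum>q\<in>I. fun_scl (u p * u q) (tensor A A (a p) (a q)))"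
    unfolding tensor_sum_left by (simp add: tensor_scl_left tensor_sum_right tensor_scl_right fs.scale_sum_right mult.commute)
  finally show ?thesis by (rule tensor_aa_eqD[OF _ assms])
qed

text \<open>The coproduct of P is multiplicative because it is a conjugation. Comparing both
  expansions of its value at \<open>a i a j\<close> in the independent tensors
  \<open>a p \<otimes> a q\<close> gives the scalar identity.\<close>

lemma compat:
  assumes "i \<in> I" "j \<in> I" "p \<in> I" "q \<in> I"
  shows "(\<Sum>l\<in>I. n i j l * m p q l) = (\<Sum>x\<in>I. \<Sum>y\<in>I. \<Sum>z\<in>I. \<Sum>w\<in>I. m x y i * m z w j * n x z p * n y w q)"
proof -
  let ?t = "\<lambda>p q. tensor A A (a p) (a q)"
  let ?c = "\<lambda>x y z w p q. m x y i * m z w j * n x z p * n y w q"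
  have "(\<Sum>p\<in>I. \<Sum>q\<in>I. fun_scl (\<Sum>l\<in>I. n i j l * m p q l) (?t p q)) = (\<Sum>l\<in>I. fun_scl (n i j l) (\<Delta>P l))"
    unfolding fs.scale_sum_left \<Delta>P_def fs.scale_sum_right
    by (subst sum_rotate3[symmetric]) simp
  also have "\<dots> = comul_P A RR (mul A (a i) (a j))"
    unfolding a_a[OF assms(1,2)]
    by (subst linear_on_lincomb[OF comul_P_linear k_space_axioms k_space_tensor_alg]) (simp_all add: comul_P_a cong: sum.cong_simp)
  also have "\<dots> = mul (tensor_alg A A) (\<Delta>P i) (\<Delta>P j)"
    using assms by (simp add: comul_P_mul comul_P_a)
  also have "\<dots> = (\<Sum>x\<in>I. \<Sum>y\<in>I. fun_scl (m x y i) (mul (tensor_alg A A) (?t x y) (\<Delta>P j)))"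
    by (simp add: \<Delta>P_def[of i] T.mul_sum_left T.mul_scl_left[simplified] cong: sum.cong_simp)
  also have "\<dots> = (\<Sum>x\<in>I. \<Sum>y\<in>I. \<Sum>z\<in>I. \<Sum>w\<in>I. fun_scl (m x y i * m z w j) (tensor A A (mul A (a x) (a z)) (mul A (a y) (a w))))"
    by (simp add: \<Delta>P_def T.mul_sum_right T.mul_scl_right[simplified] AA.tensor_alg_mul fs.scale_sum_right cong: sum.cong_simp)
  also have "\<dots> = (\<Sum>x\<in>I. \<Sum>y\<in>I. \<Sum>z\<in>I. \<Sum>w\<in>I. \<Sum>q\<in>I. \<Sum>p\<in>I. fun_scl (m x y i * (m z w j * (n y w q * n x z p))) (?t p q))"
    by (simp add: a_a tensor_sum_left tensor_sum_right tensor_scl_left tensor_scl_right fs.scale_sum_right mult.assoc cong: sum.cong_simp)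
  also have "\<dots> = (\<Sum>x\<in>I. \<Sum>y\<in>I. \<Sum>z\<in>I. \<Sum>w\<in>I. \<Sum>q\<in>I. \<Sum>p\<in>I. fun_scl (?c x y z w p q) (?t p q))"
    by (simp add: mult_ac)
  also have "\<dots> = (\<Sum>q\<in>I. \<Sum>x\<in>I. \<Sum>y\<in>I. \<Sum>z\<in>I. \<Sum>w\<in>I. \<Sum>p\<in>I. fun_scl (?c x y z w p q) (?t p q))"
    by (rule sum_rotate5[symmetric])
  also have "\<dots> = (\<Sum>p\<in>I. \<Sum>q\<in>I. \<Sum>x\<in>I. \<Sum>y\<in>I. \<Sum>z\<in>I. \<Sum>w\<in>I. fun_scl (?c x y z w p q) (?t p q))"
    by (subst sum.swap, rule sum.cong[OF refl], rule sum_rotate5[symmetric])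
  finally have "(\<Sum>p\<in>I. \<Sum>q\<in>I. fun_scl (\<Sum>l\<in>I. n i j l * m p q l) (?t p q)) =
      (\<Sum>p\<in>I. \<Sum>q\<in>I. fun_scl (\<Sum>x\<in>I. \<Sum>y\<in>I. \<Sum>z\<in>I. \<Sum>w\<in>I. ?c x y z w p q) (?t p q))"
    by (simp add: fs.scale_sum_left)
  then show ?thesis by (rule tensor_aa_eqD[OF _ assms(3,4)])
qed

end

section \<open>The opposite algebra, which exchanges P with H\<close>

definition opp :: "('k, 'a) kalg \<Rightarrow> ('k, 'a) kalg" where
  "opp A = A\<lparr>mul := \<lambda>x y. mul A y x\<rparr>"

lemma opp_simps [simp]: "carrier (opp A) = carrier A" "scl (opp A) = scl A" "unity (opp A) = unity A"
  "mul (opp A) x y = mul A y x"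
  by (simp_all add: opp_def)

lemma k_algebra_opp:
  fixes A :: "('k::field, 'a::ab_group_add) kalg"
  assumes "k_algebra A"
  shows "k_algebra (opp A)"
proof -
  interpret k_algebra A by fact
  show ?thesis
    using k_space_axioms bilinear
    by (intro k_algebraI) (auto simp: k_space_def mul_assoc bilinear_on_def linear_on_def)
qed

text \<open>Renaming of indices for \<open>opp_coords\<close>: the left antipode identity of the
  flipped solution is the right one of the original, and conversely.\<close>

lemma s_sum_dual:
  fixes n m :: "'i \<Rightarrow> 'i \<Rightarrow> 'i \<Rightarrow> 'k::field"
  shows "(\<Sum>j\<in>I. \<Sum>k\<in>I. \<Sum>i\<in>I. n k j l * s k i * m i j q) = (\<Sum>j\<in>I. \<Sum>k\<in>I. \<Sum>i\<in>I. m j k q * s i j * n i k l)"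
    and "(\<Sum>j\<in>I. \<Sum>k\<in>I. \<Sum>i\<in>I. n k j l * s j i * m k i q) = (\<Sum>j\<in>I. \<Sum>k\<in>I. \<Sum>i\<in>I. m j k q * s i k * n j i l)"
proof -
  have "(\<Sum>j\<in>I. \<Sum>k\<in>I. \<Sum>i\<in>I. n k j l * s k i * m i j q) = (\<Sum>i\<in>I. \<Sum>j\<in>I. \<Sum>k\<in>I. n k j l * s k i * m i j q)"
    by (rule sum_rotate3[symmetric])
  then show "(\<Sum>j\<in>I. \<Sum>k\<in>I. \<Sum>i\<in>I. n k j l * s k i * m i j q) = (\<Sum>j\<in>I. \<Sum>k\<in>I. \<Sum>i\<in>I. m j k q * s i j * n i k l)"
    by (simp add: mult_ac)
  have "(\<Sum>j\<in>I. \<Sum>k\<in>I. \<Sum>i\<in>I. n k j l * s j i * m k i q) = (\<Sum>k\<in>I. \<Sum>i\<in>I. \<Sum>j\<in>I. n k j l * s j i * m k i q)"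
    by (rule sum_rotate3)
  then show "(\<Sum>j\<in>I. \<Sum>k\<in>I. \<Sum>i\<in>I. n k j l * s j i * m k i q) = (\<Sum>j\<in>I. \<Sum>k\<in>I. \<Sum>i\<in>I. m j k q * s i k * n j i l)"
    by (simp add: mult_ac)
qed

text \<open>Flipping the legs of \<open>R\<close> gives a solution over the opposite algebra.\<close>

lemma (in pentagon_coords) opp_coords:
  "pentagon_coords (opp A) I b a (\<lambda>i j. m j i) (\<lambda>i j. n j i) e u (\<lambda>i j. s j i)"
  unfolding pentagon_coords_def pentagon_coords_axioms_def
proof (intro conjI allI impI)
  show "k_algebra (opp A)" by (rule k_algebra_opp[OF k_algebra_axioms])
  show "indep_fam (opp A) I b" "indep_fam (opp A) I a"
    using a_indep b_indep by (simp_all add: indep_fam_def)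
  show "mul (opp A) (b l) (a p) = (\<Sum>i\<in>I. \<Sum>j\<in>I. \<Sum>k\<in>I. scl (opp A) (n k j l * m j i p) (mul (opp A) (a i) (b k)))"
    if "l \<in> I" "p \<in> I" for l p
  proof -
    have "(\<Sum>i\<in>I. \<Sum>j\<in>I. \<Sum>k\<in>I. scl A (m j k p * n i j l) (mul A (b i) (a k))) =
        (\<Sum>j\<in>I. \<Sum>k\<in>I. \<Sum>i\<in>I. scl A (m j k p * n i j l) (mul A (b i) (a k)))"
      by (rule sum_rotate3)
    also have "\<dots> = (\<Sum>k\<in>I. \<Sum>j\<in>I. \<Sum>i\<in>I. scl A (m j k p * n i j l) (mul A (b i) (a k)))"
      by (rule sum.swap)
    finally show ?thesis using that by (simp add: a_b mult.commute)
  qed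
  show "(\<Sum>j\<in>I. \<Sum>k\<in>I. \<Sum>i\<in>I. n k j l * s j i * m k i q) = u l * e q" if "l \<in> I" "q \<in> I" for l q
    unfolding s_sum_dual(2) s_right[OF that(2,1)] by (rule mult.commute)
  show "(\<Sum>j\<in>I. \<Sum>k\<in>I. \<Sum>i\<in>I. n k j l * s k i * m i j q) = u l * e q" if "l \<in> I" "q \<in> I" for l q
    unfolding s_sum_dual(1) s_left[OF that(2,1)] by (rule mult.commute)
qed (use fin nontrivial a_a b_b one_a one_b Sa_Sa Sb_Sb in simp_all)

context pentagon_coords
begin

interpretation op: pentagon_coords "opp A" I b a "\<lambda>i j. m j i" "\<lambda>i j. n j i" e u "\<lambda>i j. s j i"
  by (rule opp_coords)

lemma m_assoc: "\<lbrakk>i \<in> I; j \<in> I; k \<in> I; l \<in> I\<rbrakk> \<Longrightarrow> (\<Sum>p\<in>I. m i j p * m p k l) = (\<Sum>p\<in>I. m j k p * m i p l)"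
  using op.n_assoc[of k j i l] by simp

lemma m_unit:
  assumes "j \<in> I" "l \<in> I"
  shows "(\<Sum>i\<in>I. e i * m i j l) = (if j = l then 1 else 0)"
    and "(\<Sum>i\<in>I. e i * m j i l) = (if j = l then 1 else 0)"
  using op.n_unit[OF assms] by simp_all

lemma e_mult: "\<lbrakk>i \<in> I; j \<in> I\<rbrakk> \<Longrightarrow> (\<Sum>l\<in>I. n i j l * e l) = e i * e j"
  using op.u_mult[of j i] by simp

text \<open>By \<open>e_mult\<close> the counit is multiplicative on P, so its value at 1 is
  idempotent on each \<open>e j\<close>; some \<open>e j\<close> is nonzero because
  \<open>1 = \<Sum> e_j b_j\<close> and 1 is not 0.\<close>

lemma u_e: "(\<Sum>i\<in>I. u i * e i) = 1"
proof -
  obtain j where j: "j \<in> I" "e j \<noteq> 0"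
  proof (rule ccontr)
    assume "\<not> thesis"
    then have "\<forall>j\<in>I. e j = 0" using that by blast
    then show False using nontrivial one_b by simp
  qed
  have "(\<Sum>i\<in>I. u i * e i) * e j = (\<Sum>i\<in>I. u i * (\<Sum>l\<in>I. n i j l * e l))"
    using j by (simp add: e_mult sum_distrib_right mult.assoc cong: sum.cong_simp)
  also have "\<dots> = (\<Sum>l\<in>I. (\<Sum>i\<in>I. u i * n i j l) * e l)"
    by (simp add: sum_distrib_left sum_distrib_right mult.assoc) (rule sum.swap)
  also have "\<dots> = e j"
    using j fin by (simp add: n_unit if_distrib[where f = "\<lambda>c. c * _"] cong: if_cong sum.cong_simp)
  finally show ?thesis using j by simp
qed

sublocale datum: hopf_datum I n m u e s
  by unfold_locales (use fin n_assoc m_assoc n_unit m_unit compat e_mult u_mult u_e s_left s_right in simp_all)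

lemma RR_lift:
  assumes "k_space U" "bilinear_on A A U \<beta>"
  shows "tensor_lift A A \<beta> RR = (\<Sum>i\<in>I. \<beta> (a i) (b i))"
  unfolding RR_def by (rule tensor_lift_sum_tensor[OF k_space_axioms k_space_axioms assms]) simp_all

text \<open>Prescribing the values of a functional on one family of legs realises every combination
  of the other family. Thus the coefficient spaces are the full spans of \<open>a\<close> and
  \<open>b\<close>.\<close>

lemma dual_interpolation:
  assumes "indep_fam A I v" "\<And>i. i \<in> I \<Longrightarrow> v i \<in> carrier A"
  obtains \<phi> where "\<phi> \<in> carrier (dual A)" "\<And>i. i \<in> I \<Longrightarrow> \<phi> (v i) = c i"
proof -
  obtain \<psi> where \<psi>: "\<And>i. \<psi> i \<in> carrier (dual A)"
    "\<And>i j. i \<in> I \<Longrightarrow> j \<in> I \<Longrightarrow> v j \<in> carrier A \<Longrightarrow> \<psi> i (v j) = (if i = j then 1 else 0)"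
    using dual_functionals[OF k_space_axioms fin assms(1)] by blast
  show thesis
  proof (rule that[of "\<Sum>i\<in>I. fun_scl (c i) (\<psi> i)"])
    show "(\<Sum>i\<in>I. fun_scl (c i) (\<psi> i)) \<in> carrier (dual A)"
      using k_space.sum_closed[OF k_space_dual] k_space.scl_closed[OF k_space_dual] \<psi>(1)
      by (metis (no_types, lifting) scl_dual)
    show "(\<Sum>i\<in>I. fun_scl (c i) (\<psi> i)) (v j) = c j" if "j \<in> I" for j
      using that fin assms(2) by (simp add: sum_fun_apply \<psi>(2) if_distrib[where f = "\<lambda>c. _ * c"]
        cong: if_cong sum.cong_simp)
  qed
qed

lemma left_coeff_RR: "left_coeff A RR = lspan A I a"
proof -
  have lift: "tensor_lift A A (\<lambda>a b. scl A (\<phi> b) a) RR = (\<Sum>i\<in>I. scl A (\<phi> (b i)) (a i))" if "\<phi> \<in> carrier (dual A)" for \<phi>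
    by (rule RR_lift[OF k_space_axioms bilinear_on_slice_right[OF that k_space_axioms]])
  have "(\<Sum>i\<in>I. scl A (c i) (a i)) \<in> left_coeff A RR" for c
  proof -
    obtain \<phi> where \<phi>: "\<phi> \<in> carrier (dual A)" "\<And>i. i \<in> I \<Longrightarrow> \<phi> (b i) = c i"
      using dual_interpolation[OF b_indep b_closed] by blast
    then have "(\<Sum>i\<in>I. scl A (c i) (a i)) = tensor_lift A A (\<lambda>a b. scl A (\<phi> b) a) RR"
      by (simp add: lift)
    with \<phi>(1) show ?thesis unfolding left_coeff_def by blast
  qed
  then show ?thesis
    using lift by (auto simp: left_coeff_def lspan_def)
qed

lemma right_coeff_RR: "right_coeff A RR = lspan A I b"
proof -
  have lift: "tensor_lift A A (\<lambda>a b. scl A (\<phi> a) b) RR = (\<Sum>i\<in>I. scl A (\<phi> (a i)) (b i))" if "\<phi> \<in> carrier (dual A)" for \<phi>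
    by (rule RR_lift[OF k_space_axioms bilinear_on_slice_left[OF that k_space_axioms]])
  have "(\<Sum>i\<in>I. scl A (c i) (b i)) \<in> right_coeff A RR" for c
  proof -
    obtain \<phi> where \<phi>: "\<phi> \<in> carrier (dual A)" "\<And>i. i \<in> I \<Longrightarrow> \<phi> (a i) = c i"
      using dual_interpolation[OF a_indep a_closed] by blast
    then have "(\<Sum>i\<in>I. scl A (c i) (b i)) = tensor_lift A A (\<lambda>a b. scl A (\<phi> a) b) RR"
      by (simp add: lift)
    with \<phi>(1) show ?thesis unfolding right_coeff_def by blast
  qed
  then show ?thesis
    using lift by (auto simp: right_coeff_def lspan_def)
qed

lemma subalgebra_P: "subalgebra A (left_coeff A RR)"
  using lspan_mul_closed[of I a] a_a lspanI[of A _ a I] lspan_subset[of I a] subspace_lspan[of I a] lspanI[of A u a I]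
  by (auto simp: subalgebra_def left_coeff_RR one_a)

lemma subalgebra_H: "subalgebra A (right_coeff A RR)"
  using lspan_mul_closed[of I b] b_b lspanI[of A _ b I] lspan_subset[of I b] subspace_lspan[of I b] lspanI[of A e b I]
  by (auto simp: subalgebra_def right_coeff_RR one_b)

lemma alg_P_simps [simp]: "carrier (alg_P A R) = left_coeff A R" "scl (alg_P A R) = scl A"
  "mul (alg_P A R) = mul A" "unity (alg_P A R) = unity A"
  by (simp_all add: alg_P_def)

lemma alg_H_simps [simp]: "carrier (alg_H A R) = right_coeff A R" "scl (alg_H A R) = scl A"
  "mul (alg_H A R) = mul A" "unity (alg_H A R) = unity A"
  by (simp_all add: alg_H_def)

lemma k_algebra_P: "k_algebra (alg_P A RR)"
  by (rule subalgebra_k_algebra[OF subalgebra_P]) simp_all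

lemma k_algebra_H: "k_algebra (alg_H A RR)"
  by (rule subalgebra_k_algebra[OF subalgebra_H]) simp_all

lemma basis_P: "basis_fam (alg_P A RR) I a"
  by (rule basis_fam_lspan[OF _ _ fin a_indep]) (simp_all add: left_coeff_RR)

lemma basis_H: "basis_fam (alg_H A RR) I b"
  by (rule basis_fam_lspan[OF _ _ fin b_indep]) (simp_all add: right_coeff_RR)

lemma a_in_P [simp]: "i \<in> I \<Longrightarrow> a i \<in> left_coeff A RR" and b_in_H [simp]: "i \<in> I \<Longrightarrow> b i \<in> right_coeff A RR"
  using basis_P basis_H by (auto simp: basis_fam_def)

lemma P_subset: "left_coeff A RR \<subseteq> carrier A" and H_subset: "right_coeff A RR \<subseteq> carrier A"
  using subalgebra_P subalgebra_H by (auto simp: subalgebra_def)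

lemma tensor_PH: "tensor (alg_P A R) (alg_P A R) = tensor A A" "tensor (alg_H A R) (alg_H A R) = tensor A A"
  "tensor (alg_P A R) (alg_H A R) = tensor A A"
  by (auto intro!: tensor_cong)

text \<open>\<open>comul_P\<close> is defined with values in \<open>A \<otimes> A\<close>. That it
  lands in \<open>P \<otimes> P\<close> is seen on the basis, where it equals
  \<open>\<Delta>P l\<close>.\<close>

theorem hopf_P_coords: "hopf_coords I n m u e s (hopf_P A RR) a"
  unfolding hopf_P_def
proof (rule hopf_of_coords[OF datum.hopf_datum_axioms _ basis_P])
  show "k_space (alg_P A RR)" using k_algebra_P by (rule k_algebra.axioms)
  show "bilinear_on (alg_P A RR) (alg_P A RR) (alg_P A RR) (mul (alg_P A RR))"
    by (rule k_algebra.bilinear[OF k_algebra_P])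
  show "linear_on (alg_P A RR) (tensor_space (alg_P A RR) (alg_P A RR)) (comul_P A RR)"
  proof (rule linear_onI)
    fix x assume "x \<in> carrier (alg_P A RR)"
    then obtain c where x: "x = (\<Sum>i\<in>I. scl A (c i) (a i))"
      by (auto simp: left_coeff_RR elim!: lspanE)
    have "comul_P A RR x = (\<Sum>l\<in>I. fun_scl (c l) (\<Delta>P l))"
      unfolding x by (subst linear_on_lincomb[OF comul_P_linear k_space_axioms k_space_tensor_alg])
        (simp_all add: comul_P_a cong: sum.cong_simp)
    moreover have "\<Delta>P l \<in> carrier (tensor_space (alg_P A RR) (alg_P A RR))" for l
      unfolding \<Delta>P_def tensor_PH(1)[of RR, symmetric] by simp
    ultimately show "comul_P A RR x \<in> carrier (tensor_space (alg_P A RR) (alg_P A RR))" by simp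
  qed (use linear_onD(2,3)[OF comul_P_linear] P_subset in \<open>auto simp: subset_iff\<close>)
qed (simp_all add: a_a one_a comul_P_a \<Delta>P_def tensor_PH)

theorem hopf_H_coords: "hopf_coords I m n e u (\<lambda>i j. s j i) (hopf_H A RR) b"
  unfolding hopf_H_def
proof (rule hopf_of_coords[OF datum.dual_datum _ basis_H])
  show "k_space (alg_H A RR)" using k_algebra_H by (rule k_algebra.axioms)
  show "bilinear_on (alg_H A RR) (alg_H A RR) (alg_H A RR) (mul (alg_H A RR))"
    by (rule k_algebra.bilinear[OF k_algebra_H])
  show "linear_on (alg_H A RR) (tensor_space (alg_H A RR) (alg_H A RR)) (comul_H A RR)"
  proof (rule linear_onI)
    fix x assume "x \<in> carrier (alg_H A RR)"
    then obtain c where x: "x = (\<Sum>i\<in>I. scl A (c i) (b i))"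
      by (auto simp: right_coeff_RR elim!: lspanE)
    have "comul_H A RR x = (\<Sum>l\<in>I. fun_scl (c l) (\<Delta>H l))"
      unfolding x by (subst linear_on_lincomb[OF comul_H_linear k_space_axioms k_space_tensor_alg])
        (simp_all add: comul_H_b cong: sum.cong_simp)
    moreover have "\<Delta>H l \<in> carrier (tensor_space (alg_H A RR) (alg_H A RR))" for l
      unfolding \<Delta>H_def tensor_PH(2)[of RR, symmetric] by simp
    ultimately show "comul_H A RR x \<in> carrier (tensor_space (alg_H A RR) (alg_H A RR))" by simp
  qed (use linear_onD(2,3)[OF comul_H_linear] H_subset in \<open>auto simp: subset_iff\<close>)
qed (simp_all add: b_b one_b comul_H_b \<Delta>H_def tensor_PH)

end

lemma (in k_space) lspan_eq_span: "finite I \<Longrightarrow> lspan V I v = vs.span (v ` I)"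
proof
  assume I: "finite I"
  show "lspan V I v \<subseteq> vs.span (v ` I)"
    by (rule subsetI, erule lspanE) (auto intro!: vs.span_sum vs.span_scale intro: vs.span_base)
  show "vs.span (v ` I) \<subseteq> lspan V I v"
    using I by (intro vs.span_minimal subspace_lspan) (auto intro: lspan_base)
qed

lemma (in k_space) fin_dim_lspan:
  assumes "carrier W = lspan V I v" "scl W = scl V" "finite I"
  shows "fin_dim W"
  unfolding fin_dim_def using assms lspan_base[of I _ v] lspan_eq_span[of I v]
  by (intro exI[of _ "v ` I"]) auto

context pentagon_coords
begin

interpretation op: pentagon_coords "opp A" I b a "\<lambda>i j. m j i" "\<lambda>i j. n j i" e u "\<lambda>i j. s j i"
  by (rule opp_coords)

lemma Sb_Sb': "\<lbrakk>i \<in> I; j \<in> I\<rbrakk> \<Longrightarrow> mul A (Sb j) (Sb i) = (\<Sum>l\<in>I. scl A (m i j l) (Sb l))"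
  using Sb_Sb unfolding Sb_def .

lemma Sa_Sa': "\<lbrakk>i \<in> I; j \<in> I\<rbrakk> \<Longrightarrow> mul A (Sa j) (Sa i) = (\<Sum>l\<in>I. scl A (n i j l) (Sa l))"
  using Sa_Sa unfolding Sa_def .

lemma comb_in_P [simp]: "(\<Sum>k\<in>I. scl A (c k) (a k)) \<in> left_coeff A RR"
  by (simp add: left_coeff_RR lspanI)

text \<open>The antipode of H fixes 1. Its value \<open>?w\<close> at 1 is a left unit for every
  \<open>Sb j\<close> by antimultiplicativity, hence for the antipode sums \<open>u l\<close> times
  1 written with \<open>Sb\<close> on the left; weighting these by \<open>e l\<close> produces 1
  itself by \<open>u_e\<close>.\<close>

lemma Sb_unity: "(\<Sum>k\<in>I. scl A (e k) (Sb k)) = unity A"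
proof -
  let ?w = "\<Sum>k\<in>I. scl A (e k) (Sb k)"
  have opSa: "op.Sa k = Sb k" for k by (simp add: op.Sa_def Sb_def)
  have b_Sb: "(\<Sum>j\<in>I. \<Sum>k\<in>I. scl A (n k j l) (mul A (Sb k) (b j))) = scl A (u l) (unity A)" if "l \<in> I" for l
    using op.a_Sa[OF that] by (simp add: opSa)
  have "mul A ?w (Sb j) = Sb j" if j: "j \<in> I" for j
  proof -
    have "mul A ?w (Sb j) = (\<Sum>k\<in>I. scl A (e k) (\<Sum>l\<in>I. scl A (m j k l) (Sb l)))"
      using j by (simp add: mul_sum_left mul_scl_left Sb_Sb' cong: sum.cong_simp)
    also have "\<dots> = Sb j" using j by (simp add: swap_comb m_unit delta_comb cong: sum.cong_simp)
    finally show ?thesis .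
  qed
  then have wb: "mul A ?w (scl A (u l) (unity A)) = scl A (u l) (unity A)" if "l \<in> I" for l
    using that unfolding b_Sb[OF that, symmetric]
    by (simp add: mul_sum_right mul_scl_right mul_assoc[symmetric] cong: sum.cong_simp)
  have "mul A ?w (\<Sum>l\<in>I. scl A (e l) (scl A (u l) (unity A))) = (\<Sum>l\<in>I. scl A (e l) (scl A (u l) (unity A)))"
  proof -
    have "mul A ?w (scl A (e l) (scl A (u l) (unity A))) = scl A (e l) (scl A (u l) (unity A))" if "l \<in> I" for l
      using mul_scl_right[of ?w "scl A (u l) (unity A)" "e l"] wb[OF that] by simp
    then show ?thesis by (subst mul_sum_right) simp_all
  qed
  moreover have "(\<Sum>l\<in>I. scl A (e l) (scl A (u l) (unity A))) = unity A"
    using u_e by (simp add: vs.scale_sum_left[symmetric] mult.commute)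
  ultimately show ?thesis by simp
qed

text \<open>\<open>R\<close> is the inverse of \<open>R\<^sup>-\<^sup>1 = \<Sum>\<^sub>i a\<^sub>i \<otimes> Sb\<^sub>i\<close>, which lies in the finite dimensional algebra
  \<open>P \<otimes> S(H)\<close>; hence \<open>R \<in> P \<otimes> S(H)\<close> and the antipode of \<open>H\<close> is surjective.\<close>

lemma s_invertible:
  obtains t where "\<And>i k. i \<in> I \<Longrightarrow> k \<in> I \<Longrightarrow> (\<Sum>j\<in>I. t i j * s j k) = (if i = k then 1 else 0)"
    "\<And>i k. i \<in> I \<Longrightarrow> k \<in> I \<Longrightarrow> (\<Sum>j\<in>I. s i j * t j k) = (if i = k then 1 else 0)"
proof -
  let ?v = "\<lambda>(i, j). tensor A A (a i) (Sb j)"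
  \<comment> \<open>The span \<open>?S\<close> is \<open>P \<otimes> S(H)\<close>, in which the
    inverse \<open>UU\<close> lies by \<open>UU_eq\<close>.\<close>
  let ?S = "lspan (tensor_alg A A) (I \<times> I) ?v"
  let ?V = "(tensor_alg A A)\<lparr>carrier := ?S\<rparr>"
  have fin2: "finite (I \<times> I)" using fin by simp
  have sub: "fs.subspace ?S" using T.subspace_lspan[of "I \<times> I" ?v] by simp
  have vin: "tensor A A (a i) (Sb j) \<in> ?S" if "i \<in> I" "j \<in> I" for i j
    using T.lspan_base[OF fin2, of "(i, j)" ?v] that by simp
  have S: "?S \<subseteq> carrier (tensor_alg A A)"
    by (rule T.lspan_subset) auto
  have "RR \<in> carrier ?V"
  proof (rule T.inverse_in_subspace[where X = UU])
    show "k_space ?V" by (rule T.k_space_lspan[of _ "I \<times> I" ?v]) simp_all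
    show "fin_dim ?V" by (rule T.fin_dim_lspan[of _ "I \<times> I" ?v]) (simp_all add: fin)
    show "mul (tensor_alg A A) RR UU = unity (tensor_alg A A)" by (simp add: RR_UU)
    have "tensor A A (unity A) (unity A) = (\<Sum>i\<in>I. \<Sum>j\<in>I. fun_scl (u i * e j) (tensor A A (a i) (Sb j)))"
      by (subst one_a, subst Sb_unity[symmetric], subst tensor_sum_left)
        (simp add: tensor_sum_right tensor_scl_left tensor_scl_right fs.scale_sum_right mult.commute)
    also have "\<dots> \<in> ?S"
      by (intro fs.subspace_sum[OF sub] fs.subspace_scale[OF sub] vin)
    finally show "unity (tensor_alg A A) \<in> carrier ?V" by simp
    fix Z assume "Z \<in> carrier ?V"
    then obtain c where Z: "Z = (\<Sum>p\<in>I \<times> I. fun_scl (c p) (?v p))"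
      by (auto elim!: lspanE)
    have base: "mul (tensor_alg A A) UU (?v p) \<in> ?S" if p: "p \<in> I \<times> I" for p
    proof -
      obtain k l where kl: "p = (k, l)" "k \<in> I" "l \<in> I" using p by auto
      \<comment> \<open>\<open>?S\<close> is stable under left multiplication by \<open>UU\<close>:
        P is closed under products, and the order reversal of \<open>Sb\<close> stays within the
        span.\<close>
      have "mul (tensor_alg A A) UU (?v p) = (\<Sum>i\<in>I. tensor A A (mul A (a i) (a k)) (mul A (Sb i) (Sb l)))"
        using kl by (simp add: UU_eq T.mul_sum_left AA.tensor_alg_mul cong: sum.cong_simp)
      also have "\<dots> = (\<Sum>i\<in>I. \<Sum>q\<in>I. \<Sum>p\<in>I. fun_scl (m l i q * n i k p) (tensor A A (a p) (Sb q)))"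
        using kl by (simp add: a_a Sb_Sb' tensor_sum_left tensor_sum_right tensor_scl_left tensor_scl_right
            fs.scale_sum_right cong: sum.cong_simp)
      also have "\<dots> \<in> ?S"
        by (intro fs.subspace_sum[OF sub] fs.subspace_scale[OF sub] vin)
      finally show ?thesis .
    qed
    have "mul (tensor_alg A A) UU Z = (\<Sum>p\<in>I \<times> I. fun_scl (c p) (mul (tensor_alg A A) UU (?v p)))"
      unfolding Z by (subst T.mul_sum_right) (auto simp: T.mul_scl_right[simplified] intro!: sum.cong)
    also have "\<dots> \<in> ?S"
      by (intro fs.subspace_sum[OF sub] fs.subspace_scale[OF sub] base)
    finally show "mul (tensor_alg A A) UU Z \<in> carrier ?V" by simp
  qed (use S in auto)
  then obtain c where "RR = (\<Sum>p\<in>I \<times> I. fun_scl (c p) (?v p))"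
    by (auto elim!: lspanE)
  then have "(\<Sum>i\<in>I. tensor A A (a i) (b i)) = (\<Sum>i\<in>I. tensor A A (a i) (\<Sum>j\<in>I. scl A (c (i, j)) (Sb j)))"
    by (simp add: RR_def sum.cartesian_product case_prod_beta tensor_sum_right tensor_scl_right)
  \<comment> \<open>Comparing the coefficients of \<open>a i\<close> shows that \<open>b i\<close>
    is a combination of the \<open>Sb j\<close>; the coefficients form a left inverse of the matrix
    \<open>s\<close>.\<close>
  then have b: "b i = (\<Sum>j\<in>I. scl A (c (i, j)) (Sb j))" if "i \<in> I" for i
    using that by (intro tensor_indep_left[OF k_space_axioms k_space_axioms fin a_indep]) simp_all
  have cs: "(\<Sum>j\<in>I. c (i, j) * s j k) = (if i = k then 1 else 0)" if "i \<in> I" "k \<in> I" for i k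
  proof -
    have "(\<Sum>k\<in>I. scl A (\<Sum>j\<in>I. c (i, j) * s j k) (b k)) = (\<Sum>k\<in>I. scl A (if i = k then 1 else 0) (b k))"
      using that b[OF that(1)] by (simp add: delta_comb Sb_def swap_comb)
    from indep_fam_eqD[OF b_indep this that(2)] show ?thesis .
  qed
  show thesis
  proof (rule that[of "\<lambda>i j. c (i, j)"])
    fix i k assume ik: "i \<in> I" "k \<in> I"
    show "(\<Sum>j\<in>I. c (i, j) * s j k) = (if i = k then 1 else 0)" by (rule cs[OF ik])
    show "(\<Sum>j\<in>I. s i j * c (j, k)) = (if i = k then 1 else 0)"
      by (rule left_inverse_imp_right_inverse[where c = "\<lambda>i j. c (i, j)", OF _ basis_H cs ik])
        (rule k_algebra.axioms[OF k_algebra_H])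
  qed
qed

end

section \<open>The inverse antipode and the element \<omega>\<close>

locale pentagon_coords_inv = pentagon_coords A I a b n m u e s
  for A :: "('k::field, 'a::ab_group_add) kalg" and I :: "'i set" and a b n m u e s +
  fixes t :: "'i \<Rightarrow> 'i \<Rightarrow> 'k"
  assumes t_s: "\<lbrakk>i \<in> I; k \<in> I\<rbrakk> \<Longrightarrow> (\<Sum>j\<in>I. t i j * s j k) = (if i = k then 1 else 0)"
    and s_t: "\<lbrakk>i \<in> I; k \<in> I\<rbrakk> \<Longrightarrow> (\<Sum>j\<in>I. s i j * t j k) = (if i = k then 1 else 0)"
begin

definition \<sigma> where "\<sigma> i = (\<Sum>k\<in>I. scl A (t k i) (a k))"
definition \<omega> where "\<omega> = (\<Sum>i\<in>I. mul A (b i) (\<sigma> i))"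

lemma \<sigma>_closed [simp]: "\<sigma> i \<in> carrier A"
  by (simp add: \<sigma>_def)

lemma \<omega>_closed [simp]: "\<omega> \<in> carrier A"
  by (simp add: \<omega>_def)

text \<open>\<open>\<sigma> i\<close> is the image of \<open>a i\<close> under the inverse of the antipode of \<open>P\<close>.\<close>

lemma inverse_antipode:
  obtains f where "linear_on (alg_P A RR) (alg_P A RR) f" "\<And>i. i \<in> I \<Longrightarrow> f (a i) = \<sigma> i"
    "\<And>i. i \<in> I \<Longrightarrow> f (Sa i) = a i" "f (unity A) = unity A"
    "\<And>x y. x \<in> left_coeff A RR \<Longrightarrow> y \<in> left_coeff A RR \<Longrightarrow> f (mul A x y) = mul A (f y) (f x)"
proof -
  interpret P: k_algebra "alg_P A RR" by (rule k_algebra_P)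
  note sp = P.k_space_axioms
  obtain f where f: "linear_on (alg_P A RR) (alg_P A RR) f" "\<And>i. i \<in> I \<Longrightarrow> f (a i) = \<sigma> i"
    by (rule linear_extension[OF sp sp basis_P, of \<sigma>]) (simp add: \<sigma>_def, blast)
  obtain g where g: "linear_on (alg_P A RR) (alg_P A RR) g" "\<And>i. i \<in> I \<Longrightarrow> g (a i) = Sa i"
    by (rule linear_extension[OF sp sp basis_P, of Sa]) (simp add: Sa_def, blast)
  have f_comb: "f (\<Sum>i\<in>I. scl A (c i) (a i)) = (\<Sum>i\<in>I. scl A (c i) (\<sigma> i))" for c
    using linear_on_lincomb[OF f(1) sp sp, of I a c] by (simp add: f(2) cong: sum.cong_simp)
  have g_comb: "g (\<Sum>i\<in>I. scl A (c i) (a i)) = (\<Sum>i\<in>I. scl A (c i) (Sa i))" for c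
    using linear_on_lincomb[OF g(1) sp sp, of I a c] by (simp add: g(2) cong: sum.cong_simp)
  have f_closed: "f x \<in> left_coeff A RR" and g_closed: "g x \<in> left_coeff A RR" if "x \<in> left_coeff A RR" for x
    using linear_onD(1)[OF f(1)] linear_onD(1)[OF g(1)] that by auto
  have f_Sa: "f (Sa i) = a i" if "i \<in> I" for i
  proof -
    have "(\<Sum>k\<in>I. t p k * s k i) = (if i = p then 1 else 0)" if "p \<in> I" for p
      using t_s[OF that \<open>i \<in> I\<close>] by auto
    then show ?thesis
      using that unfolding Sa_def f_comb \<sigma>_def swap_comb by (simp add: delta_comb mult.commute cong: sum.cong_simp)
  qed
  have g_\<sigma>: "g (\<sigma> i) = a i" if "i \<in> I" for i
  proof -
    have "(\<Sum>k\<in>I. s p k * t k i) = (if i = p then 1 else 0)" if "p \<in> I" for p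
      using s_t[OF that \<open>i \<in> I\<close>] by auto
    then show ?thesis
      using that unfolding \<sigma>_def g_comb Sa_def swap_comb by (simp add: delta_comb mult.commute cong: sum.cong_simp)
  qed
  have lid: "linear_on (alg_P A RR) (alg_P A RR) (\<lambda>x. x)" by (simp add: linear_on_def)
  have fg: "f (g x) = x" and gf: "g (f x) = x" if "x \<in> left_coeff A RR" for x
    using linear_on_eq_basis[OF linear_on_comp[OF g(1) f(1)] lid sp sp basis_P, of x]
      linear_on_eq_basis[OF linear_on_comp[OF f(1) g(1)] lid sp sp basis_P, of x] that
    by (simp_all add: f(2) g(2) f_Sa g_\<sigma>)
  have P_mul: "mul A x y \<in> left_coeff A RR" if "x \<in> left_coeff A RR" "y \<in> left_coeff A RR" for x y
    using P.mul_closed that by simp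
  have g_mul: "g (mul A x y) = mul A (g y) (g x)" if xy: "x \<in> left_coeff A RR" "y \<in> left_coeff A RR" for x y
  proof (rule bilinear_eq_basis[where f = "\<lambda>x y. g (mul A x y)" and g = "\<lambda>x y. mul A (g y) (g x)"
        and V = "alg_P A RR" and W = "alg_P A RR" and U = "alg_P A RR", OF _ _ _ _ sp sp sp basis_P basis_P])
    fix z assume z: "z \<in> carrier (alg_P A RR)"
    then have gz: "g z \<in> carrier (alg_P A RR)" using g_closed by simp
    show "linear_on (alg_P A RR) (alg_P A RR) (\<lambda>x. g (mul A x z))" "linear_on (alg_P A RR) (alg_P A RR) (\<lambda>x. g (mul A z x))"
      using linear_on_comp[OF P.linear_mul_right[OF z] g(1)] linear_on_comp[OF P.linear_mul_left[OF z] g(1)] by simp_all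
    show "linear_on (alg_P A RR) (alg_P A RR) (\<lambda>x. mul A (g z) (g x))" "linear_on (alg_P A RR) (alg_P A RR) (\<lambda>x. mul A (g x) (g z))"
      using linear_on_comp[OF g(1) P.linear_mul_right[OF gz]] linear_on_comp[OF g(1) P.linear_mul_left[OF gz]] by simp_all
  next
    show "g (mul A (a i) (a j)) = mul A (g (a j)) (g (a i))" if "i \<in> I" "j \<in> I" for i j
      using that by (simp add: a_a g_comb g(2) Sa_Sa')
  qed (use xy in simp_all)
  have f_mul: "f (mul A x y) = mul A (f y) (f x)" if xy: "x \<in> left_coeff A RR" "y \<in> left_coeff A RR" for x y
  proof -
    have "f (mul A x y) = f (mul A (g (f x)) (g (f y)))" using xy by (simp add: gf)
    also have "\<dots> = f (g (mul A (f y) (f x)))" using xy by (simp add: g_mul f_closed)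
    also have "\<dots> = mul A (f y) (f x)" using xy by (simp add: fg f_closed P_mul)
    finally show ?thesis .
  qed
  have oneP: "unity A \<in> left_coeff A RR" using P.unity_closed by simp
  \<comment> \<open>Antimultiplicativity turns \<open>f(1) f(g(1))\<close> into
    \<open>f(g(1) 1)\<close>, which is 1 because \<open>f\<close> inverts \<open>g\<close>.\<close>
  have "f (unity A) = mul A (f (unity A)) (f (g (unity A)))"
    using fg[OF oneP] f_closed[OF oneP] P_subset by (simp add: subset_iff)
  also have "\<dots> = f (mul A (g (unity A)) (unity A))"
    using oneP g_closed by (simp add: f_mul)
  also have "\<dots> = unity A"
    using g_closed[OF oneP] P_subset fg[OF oneP] by (simp add: subset_iff)
  finally have "f (unity A) = unity A" .
  with that f f_Sa f_mul show thesis by blast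
qed

text \<open>Images of \<open>a_a\<close>, \<open>Sa_a\<close> and \<open>a_Sa\<close> under the
  inverse antipode. It reverses products, so the last two become antipode equations with the factors
  of the coproduct in the opposite order.\<close>

lemma \<sigma>_\<sigma>: "\<lbrakk>i \<in> I; j \<in> I\<rbrakk> \<Longrightarrow> mul A (\<sigma> j) (\<sigma> i) = (\<Sum>l\<in>I. scl A (n i j l) (\<sigma> l))"
  and \<sigma>_a: "l \<in> I \<Longrightarrow> (\<Sum>j\<in>I. \<Sum>k\<in>I. scl A (m j k l) (mul A (\<sigma> k) (a j))) = scl A (e l) (unity A)"
  and a_\<sigma>: "l \<in> I \<Longrightarrow> (\<Sum>j\<in>I. \<Sum>k\<in>I. scl A (m j k l) (mul A (a k) (\<sigma> j))) = scl A (e l) (unity A)"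
proof -
  interpret P: k_algebra "alg_P A RR" by (rule k_algebra_P)
  note sp = P.k_space_axioms
  obtain f where f: "linear_on (alg_P A RR) (alg_P A RR) f" "\<And>i. i \<in> I \<Longrightarrow> f (a i) = \<sigma> i"
    "\<And>i. i \<in> I \<Longrightarrow> f (Sa i) = a i" "f (unity A) = unity A"
    "\<And>x y. x \<in> left_coeff A RR \<Longrightarrow> y \<in> left_coeff A RR \<Longrightarrow> f (mul A x y) = mul A (f y) (f x)"
    using inverse_antipode by blast
  have f_comb: "f (\<Sum>i\<in>J. scl A (c i) (x i)) = (\<Sum>i\<in>J. scl A (c i) (f (x i)))"
    if "\<And>i. i \<in> J \<Longrightarrow> x i \<in> left_coeff A RR" for J :: "'i set" and c x
    using linear_on_lincomb[OF f(1) sp sp, of J x c] that by simp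
  have f_sum: "f (\<Sum>i\<in>J. x i) = (\<Sum>i\<in>J. f (x i))"
    if "\<And>i. i \<in> J \<Longrightarrow> x i \<in> left_coeff A RR" for J :: "'i set" and x
    using linear_on_sum[OF f(1) sp sp, of J x] that by simp
  have P_mul: "mul A x y \<in> left_coeff A RR" if "x \<in> left_coeff A RR" "y \<in> left_coeff A RR" for x y
    using P.mul_closed that by simp
  have P_scl: "scl A c x \<in> left_coeff A RR" if "x \<in> left_coeff A RR" for c x
    using P.scl_closed[of x c] that by simp
  have P_sum: "(\<Sum>i\<in>J. x i) \<in> left_coeff A RR" if "\<And>i. i \<in> J \<Longrightarrow> x i \<in> left_coeff A RR" for J :: "'i set" and x
    using P.sum_closed[of J x] that by simp
  have SaP: "Sa i \<in> left_coeff A RR" for i by (simp add: Sa_def)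
  have oneP: "unity A \<in> left_coeff A RR" using P.unity_closed by simp
  show "mul A (\<sigma> j) (\<sigma> i) = (\<Sum>l\<in>I. scl A (n i j l) (\<sigma> l))" if "i \<in> I" "j \<in> I"
    using that f(5)[of "a i" "a j"] by (simp add: a_a f_comb f(2) cong: sum.cong_simp)
  have f1: "f (scl A c (unity A)) = scl A c (unity A)" for c
    using linear_onD(3)[OF f(1), of "unity A" c] oneP by (simp add: f(4))
  have f_scl: "f (scl A c x) = scl A c (f x)" if "x \<in> left_coeff A RR" for c x
    using linear_onD(3)[OF f(1), of x c] that by simp
  have ff: "f (\<Sum>j\<in>I. \<Sum>k\<in>I. scl A (c j k) (mul A (x j k) (y j k))) = (\<Sum>j\<in>I. \<Sum>k\<in>I. scl A (c j k) (mul A (f (y j k)) (f (x j k))))"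
    if "\<And>j k. j \<in> I \<Longrightarrow> k \<in> I \<Longrightarrow> x j k \<in> left_coeff A RR" "\<And>j k. j \<in> I \<Longrightarrow> k \<in> I \<Longrightarrow> y j k \<in> left_coeff A RR" for c x y
    using that by (simp add: f_sum P_sum P_scl P_mul f_scl f(5) cong: sum.cong_simp)
  show "(\<Sum>j\<in>I. \<Sum>k\<in>I. scl A (m j k l) (mul A (\<sigma> k) (a j))) = scl A (e l) (unity A)" if "l \<in> I"
    using arg_cong[OF Sa_a[OF that], of f] that by (simp add: ff SaP f1 f(2,3) cong: sum.cong_simp)
  show "(\<Sum>j\<in>I. \<Sum>k\<in>I. scl A (m j k l) (mul A (a k) (\<sigma> j))) = scl A (e l) (unity A)" if "l \<in> I"
    using arg_cong[OF a_Sa[OF that], of f] that by (simp add: ff SaP f1 f(2,3) cong: sum.cong_simp)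
qed

text \<open>Moving \<open>a l\<close> past \<open>b p\<close> by \<open>a_b\<close> and recombining
  with \<open>\<sigma>_\<sigma>\<close> leaves \<open>b i\<close>, then the sum
  \<open>a_\<sigma>\<close> for \<open>a l\<close>, then \<open>\<sigma> i\<close>. The middle part
  collapses to \<open>e l\<close>.\<close>

lemma a_\<omega>: 
  assumes l: "l \<in> I"
  shows "mul A (a l) \<omega> = scl A (e l) \<omega>"
proof -
  have "mul A (a l) \<omega> = (\<Sum>p\<in>I. mul A (mul A (a l) (b p)) (\<sigma> p))"
    using l by (simp add: \<omega>_def mul_sum_right mul_assoc cong: sum.cong_simp)
  also have "\<dots> = (\<Sum>p\<in>I. \<Sum>i\<in>I. \<Sum>j\<in>I. \<Sum>k\<in>I. scl A (m j k l * n i j p) (mul A (mul A (b i) (a k)) (\<sigma> p)))"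
    using l by (simp add: a_b mul_sum_left mul_scl_left cong: sum.cong_simp)
  also have "\<dots> = (\<Sum>i\<in>I. \<Sum>j\<in>I. \<Sum>k\<in>I. \<Sum>p\<in>I. scl A (m j k l * n i j p) (mul A (mul A (b i) (a k)) (\<sigma> p)))"
    by (rule sum_rotate4)
  also have "\<dots> = (\<Sum>i\<in>I. \<Sum>j\<in>I. \<Sum>k\<in>I. scl A (m j k l) (mul A (mul A (b i) (a k)) (mul A (\<sigma> j) (\<sigma> i))))"
    by (simp add: \<sigma>_\<sigma> mul_sum_right mul_scl_right vs.scale_sum_right cong: sum.cong_simp)
  also have "\<dots> = (\<Sum>i\<in>I. mul A (b i) (mul A (\<Sum>j\<in>I. \<Sum>k\<in>I. scl A (m j k l) (mul A (a k) (\<sigma> j))) (\<sigma> i)))"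
    by (simp add: mul_sum_left mul_scl_left mul_sum_right mul_scl_right mul_assoc cong: sum.cong_simp)
  also have "\<dots> = scl A (e l) \<omega>"
    using l by (simp add: a_\<sigma> \<omega>_def mul_scl_left mul_scl_right vs.scale_sum_right cong: sum.cong_simp)
  finally show ?thesis .
qed

text \<open>The product \<open>b j b i\<close> becomes a coproduct of the \<open>a l\<close>; its
  factors meet as \<open>\<sigma> i a j\<close> and collapse to \<open>e l\<close> by
  \<open>\<sigma>_a\<close>, leaving \<open>\<Sum> e_l b_l = 1\<close>.\<close>

lemma b_\<omega>_a: "(\<Sum>j\<in>I. mul A (b j) (mul A \<omega> (a j))) = unity A"
proof -
  have "(\<Sum>j\<in>I. mul A (b j) (mul A \<omega> (a j))) = (\<Sum>j\<in>I. \<Sum>i\<in>I. mul A (mul A (b j) (b i)) (mul A (\<sigma> i) (a j)))"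
    by (simp add: \<omega>_def mul_sum_left mul_sum_right mul_assoc cong: sum.cong_simp)
  also have "\<dots> = (\<Sum>j\<in>I. \<Sum>i\<in>I. \<Sum>l\<in>I. scl A (m j i l) (mul A (b l) (mul A (\<sigma> i) (a j))))"
    by (simp add: b_b mul_sum_left mul_scl_left cong: sum.cong_simp)
  also have "\<dots> = (\<Sum>l\<in>I. \<Sum>j\<in>I. \<Sum>i\<in>I. scl A (m j i l) (mul A (b l) (mul A (\<sigma> i) (a j))))"
    by (rule sum_rotate3[symmetric])
  also have "\<dots> = (\<Sum>l\<in>I. mul A (b l) (\<Sum>j\<in>I. \<Sum>i\<in>I. scl A (m j i l) (mul A (\<sigma> i) (a j))))"
    by (simp add: mul_sum_right mul_scl_right cong: sum.cong_simp)
  also have "\<dots> = unity A"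
    by (simp add: \<sigma>_a mul_scl_right one_b[symmetric] cong: sum.cong_simp)
  finally show ?thesis .
qed

lemma opp_inv: "pentagon_coords_inv (opp A) I b a (\<lambda>i j. m j i) (\<lambda>i j. n j i) e u (\<lambda>i j. s j i) (\<lambda>i j. t j i)"
proof -
  interpret op: pentagon_coords "opp A" I b a "\<lambda>i j. m j i" "\<lambda>i j. n j i" e u "\<lambda>i j. s j i"
    by (rule opp_coords)
  show ?thesis
    using s_t t_s by unfold_locales (auto simp: mult.commute)
qed

end

context pentagon_coords_inv
begin

interpretation op: pentagon_coords_inv "opp A" I b a "\<lambda>i j. m j i" "\<lambda>i j. n j i" e u "\<lambda>i j. s j i" "\<lambda>i j. t j i"
  by (rule opp_inv)

text \<open>The element \<omega> coincides with its counterpart for the flipped solution, since both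
  are the sum of \<open>t i k\<close> times \<open>b k a i\<close>. Hence this is
  \<open>a_\<omega>\<close> over the opposite algebra.\<close>

lemma \<omega>_b: "l \<in> I \<Longrightarrow> mul A \<omega> (b l) = scl A (u l) \<omega>"
proof -
  have "op.\<omega> = (\<Sum>i\<in>I. \<Sum>k\<in>I. scl A (t i k) (mul A (b k) (a i)))"
    by (simp add: op.\<omega>_def op.\<sigma>_def mul_sum_left mul_scl_left cong: sum.cong_simp)
  also have "\<dots> = (\<Sum>k\<in>I. \<Sum>i\<in>I. scl A (t i k) (mul A (b k) (a i)))"
    by (rule sum.swap)
  also have "\<dots> = \<omega>"
    by (simp add: \<omega>_def \<sigma>_def mul_sum_right mul_scl_right cong: sum.cong_simp)
  finally show "l \<in> I \<Longrightarrow> mul A \<omega> (b l) = scl A (u l) \<omega>"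
    using op.a_\<omega>[of l] by simp
qed

lemma \<omega>_nonzero: "\<omega> \<noteq> 0"
  using b_\<omega>_a nontrivial by auto

text \<open>The relation behind the matrix units. By \<open>a_b\<close> the factor from H is brought
  next to the left \<omega> and the factor from P next to the right one; both turn into scalars, and
  the unit laws of \<open>m\<close> and \<open>n\<close> leave the Kronecker delta.\<close>

lemma \<omega>_a_b_\<omega>:
  assumes ij: "i \<in> I" "j \<in> I"
  shows "mul A (mul A \<omega> (mul A (a i) (b j))) \<omega> = scl A (if i = j then 1 else 0) \<omega>"
proof -
  \<comment> \<open>Insert \<open>1 = \<Sum> b_j \<omega> a_j\<close> after \<omega>, absorb
    \<open>b j\<close> as \<open>u j\<close>, and recombine the \<open>a j\<close> into 1.\<close>
  have \<omega>\<omega>: "mul A \<omega> \<omega> = \<omega>"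
  proof -
    have "mul A \<omega> (unity A) = (\<Sum>j\<in>I. scl A (u j) (mul A \<omega> (mul A \<omega> (a j))))"
      by (subst b_\<omega>_a[symmetric]) (simp add: mul_sum_right mul_assoc[symmetric] \<omega>_b mul_scl_left cong: sum.cong_simp)
    also have "\<dots> = mul A \<omega> (mul A \<omega> (unity A))"
      by (subst one_a) (simp add: mul_sum_right mul_scl_right cong: sum.cong_simp)
    finally show ?thesis by simp
  qed
  have "mul A (mul A \<omega> (mul A (a i) (b j))) \<omega> =
      (\<Sum>x\<in>I. \<Sum>q\<in>I. \<Sum>k\<in>I. scl A (m q k i * n x q j) (mul A (mul A \<omega> (b x)) (mul A (a k) \<omega>)))"
    using ij by (simp add: a_b mul_sum_left mul_sum_right mul_scl_left mul_scl_right mul_assoc cong: sum.cong_simp)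
  also have "\<dots> = (\<Sum>x\<in>I. \<Sum>q\<in>I. \<Sum>k\<in>I. scl A ((u x * n x q j) * (e k * m q k i)) \<omega>)"
    by (simp add: \<omega>_b a_\<omega> mul_scl_left mul_scl_right \<omega>\<omega> mult_ac cong: sum.cong_simp)
  also have "\<dots> = scl A (\<Sum>x\<in>I. \<Sum>q\<in>I. \<Sum>k\<in>I. (u x * n x q j) * (e k * m q k i)) \<omega>"
    by (simp add: vs.scale_sum_left)
  also have "(\<Sum>x\<in>I. \<Sum>q\<in>I. \<Sum>k\<in>I. (u x * n x q j) * (e k * m q k i)) = (\<Sum>x\<in>I. u x * n x i j)"
    using ij fin by (simp add: sum_distrib_left[symmetric] m_unit if_distrib[where f = "\<lambda>c. _ * c"] cong: if_cong sum.cong_simp)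
  also have "\<dots> = (if i = j then 1 else 0)"
    using ij by (simp add: n_unit)
  finally show ?thesis .
qed

lemma ba_indep: "indep_fam A (I \<times> I) (\<lambda>(j, i). mul A (b j) (a i))"
proof -
  let ?v = "\<lambda>(j, i). mul A (b j) (a i)" and ?w = "\<lambda>(j, i). mul A (mul A (b j) \<omega>) (a i)"
  have fin2: "finite (I \<times> I)" using fin by simp
  have v_in: "mul A (b j) (a i) \<in> lspan A (I \<times> I) ?v" if "i \<in> I" "j \<in> I" for i j
    using lspan_base[OF fin2, of "(j, i)" ?v] that by simp
  have "mul A (mul A (b j) \<omega>) (a i) \<in> lspan A (I \<times> I) ?v" if "i \<in> I" "j \<in> I" for i j
  proof -
    \<comment> \<open>\<omega> is itself a combination of products \<open>b p a q\<close>, so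
      closure of H and P under multiplication keeps the matrix units in the span of the
      \<open>b j a i\<close>.\<close>
    have "mul A (mul A (b j) \<omega>) (a i) = (\<Sum>p\<in>I. \<Sum>q\<in>I. scl A (t q p) (mul A (mul A (b j) (b p)) (mul A (a q) (a i))))"
      using that by (simp add: \<omega>_def \<sigma>_def mul_sum_left mul_sum_right mul_scl_left mul_scl_right mul_assoc cong: sum.cong_simp)
    also have "\<dots> = (\<Sum>p\<in>I. \<Sum>q\<in>I. scl A (t q p) (\<Sum>x\<in>I. scl A (n q i x) (\<Sum>y\<in>I. scl A (m j p y) (mul A (b y) (a x)))))"
      using that by (simp add: a_a b_b mul_sum_left mul_sum_right mul_scl_left mul_scl_right cong: sum.cong_simp)
    also have "\<dots> \<in> lspan A (I \<times> I) ?v"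
      by (intro vs.subspace_sum[OF subspace_lspan] vs.subspace_scale[OF subspace_lspan] v_in)
    finally show ?thesis .
  qed
  then have w_span: "?w ` (I \<times> I) \<subseteq> vs.span (?v ` (I \<times> I))"
    using lspan_eq_span[OF fin2, of ?v] by auto
  have w_indep: "indep_fam A (I \<times> I) ?w"
    unfolding indep_fam_def
  proof (intro allI impI ballI)
    fix c r assume c: "(\<Sum>p\<in>I \<times> I. scl A (c p) (?w p)) = 0" and r: "r \<in> I \<times> I"
    obtain p q where pq: "r = (p, q)" "p \<in> I" "q \<in> I" using r by auto
    \<comment> \<open>Multiplying by \<open>\<omega> a_p\<close> on the left and
      \<open>b_q \<omega>\<close> on the right kills every matrix unit but the one with index
      \<open>(p, q)\<close>.\<close>
    let ?l = "mul A \<omega> (a p)" and ?r = "mul A (b q) \<omega>"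
    have 1: "mul A (mul A ?l (mul A (mul A (b j) \<omega>) (a i))) ?r = (if p = j \<and> i = q then \<omega> else 0)"
      if "i \<in> I" "j \<in> I" for i j
    proof -
      have "mul A (mul A ?l (mul A (mul A (b j) \<omega>) (a i))) ?r =
          mul A (mul A (mul A \<omega> (mul A (a p) (b j))) \<omega>) (mul A (mul A (a i) (b q)) \<omega>)"
        using that pq by (simp add: mul_assoc)
      also have "\<dots> = scl A (if p = j then 1 else 0) (mul A (mul A \<omega> (mul A (a i) (b q))) \<omega>)"
        unfolding \<omega>_a_b_\<omega>[OF pq(2) that(2)] using that pq mul_assoc[of \<omega> "mul A (a i) (b q)" \<omega>]
        by (subst mul_scl_left) simp_all
      finally show ?thesis using that pq by (simp add: \<omega>_a_b_\<omega>)
    qed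
    have "0 = mul A (mul A ?l (\<Sum>s\<in>I \<times> I. scl A (c s) (?w s))) ?r"
      using pq by (simp add: c)
    also have "\<dots> = (\<Sum>s\<in>I \<times> I. scl A (c s) (mul A (mul A ?l (?w s)) ?r))"
      using pq by (subst mul_sum_right, simp, force, subst mul_sum_left) (auto simp: mul_scl_left mul_scl_right intro!: sum.cong)
    also have "\<dots> = (\<Sum>s\<in>I \<times> I. if r = s then scl A (c r) \<omega> else 0)"
      using pq by (intro sum.cong refl) (auto simp: 1 split: if_splits)
    also have "\<dots> = scl A (c r) \<omega>"
      using r fin2 by simp
    finally show "c r = 0" using \<omega>_nonzero by simp
  qed
  then have w: "inj_on ?w (I \<times> I)" "vs.independent (?w ` (I \<times> I))"
    using indep_fam_iff[OF fin2] by auto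
  \<comment> \<open>Counting: an independent spanning part \<open>B\<close> of the products must be
    at least as large as the independent family of matrix units. Hence the products are pairwise
    distinct and \<open>B\<close> contains all of them.\<close>
  obtain B where B: "B \<subseteq> ?v ` (I \<times> I)" "vs.independent B" "?v ` (I \<times> I) \<subseteq> vs.span B"
    by (rule vs.maximal_independent_subset)
  have fB: "finite B" using B(1) fin2 finite_subset by blast
  have "vs.span (?v ` (I \<times> I)) \<subseteq> vs.span B"
    using B(3) by (rule vs.span_minimal) simp
  then have "card (?w ` (I \<times> I)) \<le> card B"
    using vs.independent_span_bound[OF fB w(2)] w_span by blast
  then have "card (I \<times> I) \<le> card B" using w(1) by (simp add: card_image)
  moreover have "card B \<le> card (?v ` (I \<times> I))" "card (?v ` (I \<times> I)) \<le> card (I \<times> I)"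
    using B(1) fin2 card_mono[of "?v ` (I \<times> I)" B] card_image_le[OF fin2, of ?v] by auto
  ultimately have "card (?v ` (I \<times> I)) = card (I \<times> I)" "card B = card (?v ` (I \<times> I))" by linarith+
  then have "inj_on ?v (I \<times> I)" "B = ?v ` (I \<times> I)"
    using eq_card_imp_inj_on[OF fin2, of ?v] card_subset_eq[OF finite_imageI[OF fin2] B(1)] by blast+
  then show ?thesis
    using B(2) indep_fam_iff[OF fin2] by blast
qed

end

section \<open>Module structures\<close>

text \<open>For a fixed tensor the lift is a finite sum of values of the bilinear map, so it
  inherits linearity in any further parameter.\<close>

lemma linear_on_tensor_lift_param:
  assumes "k_space V" "k_space W" "k_space U"
    and \<beta>: "\<And>z. z \<in> carrier Z \<Longrightarrow> bilinear_on V W U (\<beta> z)"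
    and lin: "\<And>v w. v \<in> carrier V \<Longrightarrow> w \<in> carrier W \<Longrightarrow> linear_on Z U (\<lambda>z. \<beta> z v w)"
    and Z: "k_space Z" and T: "T \<in> carrier (tensor_space V W)"
  shows "linear_on Z U (\<lambda>z. tensor_lift V W (\<beta> z) T)"
proof -
  interpret Z: k_space Z by fact
  obtain N :: nat and x y where xy: "\<And>i. i < N \<Longrightarrow> x i \<in> carrier V" "\<And>i. i < N \<Longrightarrow> y i \<in> carrier W"
    "T = (\<Sum>i<N. tensor V W (x i) (y i))"
    using tensor_sum_family[OF T assms(1)] by blast
  have "tensor_lift V W (\<beta> z) T = (\<Sum>i<N. \<beta> z (x i) (y i))" if "z \<in> carrier Z" for z
    unfolding xy(3) using xy(1,2) by (intro tensor_lift_sum_tensor[OF assms(1-3) \<beta>[OF that]]) auto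
  moreover have "linear_on Z U (\<lambda>z. \<Sum>i<N. \<beta> z (x i) (y i))"
    using xy(1,2) lin by (intro linear_on_sum_fun assms(3)) auto
  ultimately show ?thesis
    by (simp add: linear_on_def Pi_iff)
qed

text \<open>The module laws and equivariance are formal and are checked on pure tensors. The
  substance is the bijectivity premise, which the splitting of A supplies.\<close>

lemma right_module_iso_mul:
  fixes P :: "('k::field, 'b::ab_group_add) kalg" and Z :: "('k, 'b) kspace" and B :: "('k, 'b) kalg"
  assumes A: "k_algebra B" and P: "k_algebra P" "carrier P \<subseteq> carrier B" "scl P = scl B" "mul P = mul B" "unity P = unity B"
    and Z: "k_space Z" "carrier Z \<subseteq> carrier B" "scl Z = scl B"
    and bij: "bij_betw (tensor_lift Z P (mul B)) (carrier (tensor_space Z P)) (carrier B)"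
  shows "right_module_iso P (tensor_space Z P) (\<lambda>t y. tensor_lift Z P (\<lambda>a x. tensor Z P a (mul B x y)) t)
    B (mul B) (tensor_lift Z P (mul B))"
proof -
  interpret B: k_algebra B by fact
  interpret P: k_algebra P by fact
  interpret Z: k_space Z by fact
  let ?M = "tensor_space Z P" and ?act = "\<lambda>t y. tensor_lift Z P (\<lambda>a x. tensor Z P a (mul B x y)) t"
  note sP = P.k_space_axioms and sZ = Z.k_space_axioms and sB = B.k_space_axioms
  have PB: "x \<in> carrier B" if "x \<in> carrier P" for x using that P(2) by blast
  have ZB: "x \<in> carrier B" if "x \<in> carrier Z" for x using that Z(2) by blast
  have Pm: "mul B x y \<in> carrier P" if "x \<in> carrier P" "y \<in> carrier P" for x y
    using P.mul_closed[OF that] P(4) by simp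
  have b: "bilinear_on Z P ?M (\<lambda>a x. tensor Z P a (mul B x y))" if y: "y \<in> carrier P" for y
    using Pm y P.mul_add_left[OF y] P.mul_scl_left[OF _ y]
    by (auto intro!: bilinear_onI linear_onI simp: P(4) tensor_add_left tensor_add_right tensor_scl_left tensor_scl_right)
  have lin1: "linear_on ?M ?M (\<lambda>t. ?act t y)" if "y \<in> carrier P" for y
    by (rule linear_on_tensor_lift[OF sZ sP k_space_tensor_space b[OF that]])
  have act: "?act (tensor Z P a x) y = tensor Z P a (mul B x y)" if "a \<in> carrier Z" "x \<in> carrier P" "y \<in> carrier P" for a x y
    by (rule tensor_lift_tensor[OF sZ sP k_space_tensor_space b[OF that(3)] that(1,2)])
  have lin2: "linear_on P ?M (?act t)" if t: "t \<in> carrier ?M" for t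
  proof (rule linear_on_tensor_lift_param[OF sZ sP k_space_tensor_space b _ sP t])
    fix v w assume vw: "v \<in> carrier Z" "w \<in> carrier P"
    show "linear_on P ?M (\<lambda>z. tensor Z P v (mul B w z))"
      using vw Pm P.mul_add_right[OF vw(2)] P.mul_scl_right[OF vw(2)]
      by (auto intro!: linear_onI simp: P(4) tensor_add_right tensor_scl_right)
  qed
  have bm: "bilinear_on Z P B (mul B)"
    by (rule bilinear_on_subspace[OF B.bilinear Z(2) P(2) Z(3) P(3)])
  note linF = linear_on_tensor_lift[OF sZ sP sB bm] and F = tensor_lift_tensor[OF sZ sP sB bm]
  have act_closed: "?act t y \<in> carrier ?M" if "t \<in> carrier ?M" "y \<in> carrier P" for t y
    using linear_onD(1)[OF lin1] that by blast
  have lid: "linear_on ?M ?M (\<lambda>t. t)" by (simp add: linear_on_def)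
  have unit: "?act t (unity P) = t" if "t \<in> carrier ?M" for t
    by (rule linear_on_tensor_eq[where f = "\<lambda>t. ?act t (unity P)" and g = "\<lambda>t. t", OF lin1[OF P.unity_closed] lid sZ k_space_tensor_space _ that])
      (use P.unity_closed in \<open>simp add: act PB P(5)\<close>)
  have assoc: "?act t (mul P x y) = ?act (?act t x) y" if "t \<in> carrier ?M" "x \<in> carrier P" "y \<in> carrier P" for t x y
    by (rule linear_on_tensor_eq[where f = "\<lambda>t. ?act t (mul P x y)" and g = "\<lambda>t. ?act (?act t x) y",
          OF lin1[OF P.mul_closed[OF that(2,3)]] linear_on_comp[OF lin1[OF that(2)] lin1[OF that(3)]] sZ k_space_tensor_space _ that(1)])
      (use that in \<open>simp add: act Pm P(4) B.mul_assoc PB\<close>)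
  have M: "right_module P ?M ?act"
    using P(1) k_space_tensor_space lin1 lin2 unit assoc
    by (auto simp: right_module_def intro!: bilinear_onI)
  have BM: "right_module P B (mul B)"
    using P(1) sB bilinear_on_subspace[OF B.bilinear subset_refl P(2) refl P(3)] PB
    by (simp add: right_module_def P(4,5) B.mul_assoc)
  have hom: "tensor_lift Z P (mul B) (?act t x) = mul B (tensor_lift Z P (mul B) t) x"
    if "t \<in> carrier ?M" "x \<in> carrier P" for t x
    by (rule linear_on_tensor_eq[where f = "\<lambda>t. tensor_lift Z P (mul B) (?act t x)" and g = "\<lambda>t. mul B (tensor_lift Z P (mul B) t) x",
          OF linear_on_comp[OF lin1[OF that(2)] linF] linear_on_comp[OF linF B.linear_mul_right[OF PB[OF that(2)]]] sZ sB _ that(1)])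
      (use that in \<open>simp add: act F Pm PB ZB B.mul_assoc\<close>)
  show ?thesis
    using M BM linF bij hom by (simp add: right_module_iso_def)
qed

lemma left_module_iso_mul:
  fixes P :: "('k::field, 'b::ab_group_add) kalg" and Z :: "('k, 'b) kspace" and B :: "('k, 'b) kalg"
  assumes A: "k_algebra B" and P: "k_algebra P" "carrier P \<subseteq> carrier B" "scl P = scl B" "mul P = mul B" "unity P = unity B"
    and Z: "k_space Z" "carrier Z \<subseteq> carrier B" "scl Z = scl B"
    and bij: "bij_betw (tensor_lift P Z (mul B)) (carrier (tensor_space P Z)) (carrier B)"
  shows "left_module_iso P (tensor_space P Z) (\<lambda>y t. tensor_lift P Z (\<lambda>h a. tensor P Z (mul B y h) a) t)
    B (mul B) (tensor_lift P Z (mul B))"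
proof -
  interpret B: k_algebra B by fact
  interpret P: k_algebra P by fact
  interpret Z: k_space Z by fact
  let ?M = "tensor_space P Z" and ?act = "\<lambda>y t. tensor_lift P Z (\<lambda>h a. tensor P Z (mul B y h) a) t"
  note sP = P.k_space_axioms and sZ = Z.k_space_axioms and sB = B.k_space_axioms
  have PB: "x \<in> carrier B" if "x \<in> carrier P" for x using that P(2) by blast
  have ZB: "x \<in> carrier B" if "x \<in> carrier Z" for x using that Z(2) by blast
  have Pm: "mul B x y \<in> carrier P" if "x \<in> carrier P" "y \<in> carrier P" for x y
    using P.mul_closed[OF that] P(4) by simp
  have b: "bilinear_on P Z ?M (\<lambda>h a. tensor P Z (mul B y h) a)" if y: "y \<in> carrier P" for y
    using Pm y P.mul_add_right[OF y] P.mul_scl_right[OF y]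
    by (auto intro!: bilinear_onI linear_onI simp: P(4) tensor_add_left tensor_add_right tensor_scl_left tensor_scl_right)
  have lin1: "linear_on ?M ?M (?act y)" if "y \<in> carrier P" for y
    by (rule linear_on_tensor_lift[OF sP sZ k_space_tensor_space b[OF that]])
  have act: "?act y (tensor P Z x a) = tensor P Z (mul B y x) a" if "a \<in> carrier Z" "x \<in> carrier P" "y \<in> carrier P" for a x y
    by (rule tensor_lift_tensor[OF sP sZ k_space_tensor_space b[OF that(3)] that(2,1)])
  have lin2: "linear_on P ?M (\<lambda>y. ?act y t)" if t: "t \<in> carrier ?M" for t
  proof (rule linear_on_tensor_lift_param[OF sP sZ k_space_tensor_space b _ sP t])
    fix w v assume vw: "w \<in> carrier P" "v \<in> carrier Z"
    show "linear_on P ?M (\<lambda>z. tensor P Z (mul B z w) v)"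
      using vw Pm P.mul_add_left[OF vw(1)] P.mul_scl_left[OF _ vw(1)]
      by (auto intro!: linear_onI simp: P(4) tensor_add_left tensor_scl_left)
  qed
  have bm: "bilinear_on P Z B (mul B)"
    by (rule bilinear_on_subspace[OF B.bilinear P(2) Z(2) P(3) Z(3)])
  note linF = linear_on_tensor_lift[OF sP sZ sB bm] and F = tensor_lift_tensor[OF sP sZ sB bm]
  have act_closed: "?act y t \<in> carrier ?M" if "t \<in> carrier ?M" "y \<in> carrier P" for t y
    using linear_onD(1)[OF lin1] that by blast
  have lid: "linear_on ?M ?M (\<lambda>t. t)" by (simp add: linear_on_def)
  have unit: "?act (unity P) t = t" if "t \<in> carrier ?M" for t
    by (rule linear_on_tensor_eq[where f = "?act (unity P)" and g = "\<lambda>t. t", OF lin1[OF P.unity_closed] lid sP k_space_tensor_space _ that])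
      (use P.unity_closed in \<open>simp add: act PB P(5)\<close>)
  have assoc: "?act (mul P x y) t = ?act x (?act y t)" if "t \<in> carrier ?M" "x \<in> carrier P" "y \<in> carrier P" for t x y
    by (rule linear_on_tensor_eq[where f = "?act (mul P x y)" and g = "\<lambda>t. ?act x (?act y t)",
          OF lin1[OF P.mul_closed[OF that(2,3)]] linear_on_comp[OF lin1[OF that(3)] lin1[OF that(2)]] sP k_space_tensor_space _ that(1)])
      (use that in \<open>simp add: act Pm P(4) B.mul_assoc PB\<close>)
  have M: "left_module P ?M ?act"
    using P(1) k_space_tensor_space lin1 lin2 unit assoc
    by (auto simp: left_module_def intro!: bilinear_onI)
  have BM: "left_module P B (mul B)"
    using P(1) sB bilinear_on_subspace[OF B.bilinear P(2) subset_refl P(3) refl] PB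
    by (simp add: left_module_def P(4,5) B.mul_assoc)
  have hom: "tensor_lift P Z (mul B) (?act x t) = mul B x (tensor_lift P Z (mul B) t)"
    if "t \<in> carrier ?M" "x \<in> carrier P" for t x
    by (rule linear_on_tensor_eq[where f = "\<lambda>t. tensor_lift P Z (mul B) (?act x t)" and g = "\<lambda>t. mul B x (tensor_lift P Z (mul B) t)",
          OF linear_on_comp[OF lin1[OF that(2)] linF] linear_on_comp[OF linF B.linear_mul_left[OF PB[OF that(2)]]] sP sB _ that(1)])
      (use that in \<open>simp add: act F Pm PB ZB B.mul_assoc\<close>)
  show ?thesis
    using M BM linF bij hom by (simp add: left_module_iso_def)
qed

text \<open>The decomposition \<open>A \<cong> Z \<otimes> P\<close>, in terms of a basis \<open>p\<close> of \<open>P\<close>.\<close>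

locale module_splitting = A: k_space A + Z: k_space Z + P: k_space P
  for A :: "('k::field, 'a::ab_group_add) kalg" and Z :: "('k, 'a) kspace" and P :: "('k, 'a) kalg" +
  fixes I :: "'i set" and p :: "'i \<Rightarrow> 'a" and \<beta> :: "'a \<Rightarrow> 'a \<Rightarrow> 'a"
  assumes Z_sub: "carrier Z \<subseteq> carrier A" and Z_scl: "scl Z = scl A"
    and P_sub: "carrier P \<subseteq> carrier A" and P_scl: "scl P = scl A" and p_basis: "basis_fam P I p"
    and \<beta>_bilin: "bilinear_on A A A \<beta>"
    and ex: "x \<in> carrier A \<Longrightarrow> \<exists>z. (\<forall>i\<in>I. z i \<in> carrier Z) \<and> x = (\<Sum>i\<in>I. \<beta> (z i) (p i))"
    and un: "\<lbrakk>\<And>i. i \<in> I \<Longrightarrow> z i \<in> carrier Z; (\<Sum>i\<in>I. \<beta> (z i) (p i)) = 0; i \<in> I\<rbrakk> \<Longrightarrow> z i = 0"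
begin

lemma fin: "finite I" and p_in [simp]: "i \<in> I \<Longrightarrow> p i \<in> carrier A" and p_P [simp]: "i \<in> I \<Longrightarrow> p i \<in> carrier P"
  using p_basis P_sub by (auto simp: basis_fam_def)

lemma Z_in [simp]: "z \<in> carrier Z \<Longrightarrow> z \<in> carrier A"
  using Z_sub by blast

lemma \<beta>_comb_left:
  assumes "\<And>b. b \<in> G \<Longrightarrow> f b \<in> carrier A" "y \<in> carrier A"
  shows "\<beta> (\<Sum>b\<in>G. scl A (c b) (f b)) y = (\<Sum>b\<in>G. scl A (c b) (\<beta> (f b) y))"
  by (rule linear_on_lincomb[OF bilinear_onD(2)[OF \<beta>_bilin assms(2)] A.k_space_axioms A.k_space_axioms assms(1)])

lemma \<beta>_comb_right:
  assumes "x \<in> carrier A"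
  shows "\<beta> x (\<Sum>i\<in>I. scl A (c i) (p i)) = (\<Sum>i\<in>I. scl A (c i) (\<beta> x (p i)))"
  by (rule linear_on_lincomb[OF bilinear_onD(1)[OF \<beta>_bilin assms] A.k_space_axioms A.k_space_axioms]) simp

lemma \<beta>_zero: "x \<in> carrier A \<Longrightarrow> \<beta> x 0 = 0"
  by (rule linear_on_zero[OF bilinear_onD(1)[OF \<beta>_bilin] A.k_space_axioms A.k_space_axioms])

lemma Z_comb [simp]: "(\<And>b. b \<in> G \<Longrightarrow> f b \<in> carrier Z) \<Longrightarrow> (\<Sum>b\<in>G. scl A (c b) (f b)) \<in> carrier Z"
  using Z.sum_closed[of G "\<lambda>b. scl Z (c b) (f b)"] Z.scl_closed by (simp add: Z_scl)

text \<open>Grouping by \<open>p i\<close> gives coefficients in Z, which vanish by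
  \<open>un\<close>; independence of \<open>G\<close> then kills each scalar. \<open>G\<close> is a
  finite part of a possibly infinite basis of Z.\<close>

lemma pair_unique:
  assumes G: "finite G" "indep_fam A G (\<lambda>b. b)" "G \<subseteq> carrier Z"
    and eq: "(\<Sum>b\<in>G. \<Sum>i\<in>I. scl A (c b i) (\<beta> b (p i))) = 0" and "b \<in> G" "i \<in> I"
  shows "c b i = 0"
proof -
  have GZ: "b \<in> carrier Z" if "b \<in> G" for b using G(3) that by blast
  have "(\<Sum>i\<in>I. \<beta> (\<Sum>b\<in>G. scl A (c b i) b) (p i)) = (\<Sum>i\<in>I. \<Sum>b\<in>G. scl A (c b i) (\<beta> b (p i)))"
    using GZ by (intro sum.cong refl \<beta>_comb_left) auto
  also have "\<dots> = 0" using eq by (subst sum.swap) simp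
  finally have "(\<Sum>b\<in>G. scl A (c b i) b) = 0"
    using GZ \<open>i \<in> I\<close> by (intro un[where z = "\<lambda>i. \<Sum>b\<in>G. scl A (c b i) b"]) auto
  then show ?thesis by (rule indep_famD[OF G(2) _ \<open>b \<in> G\<close>])
qed

lemma kdim_eq:
  assumes "fin_dim A"
  shows "kdim A = kdim Z * card I"
proof -
  obtain C where C: "is_basis Z C" using Z.exists_basis by blast
  then have C': "C \<subseteq> carrier Z" "A.vs.independent C" by (auto simp: is_basis_def Z_scl)
  then have finC: "finite C" using A.finite_independent(1)[OF assms] Z_sub by blast
  have CZ: "c \<in> carrier Z" if "c \<in> C" for c using C'(1) that by blast
  have Cb: "basis_fam Z C (\<lambda>c. c)"
    using C Z.basis_fam_iff[OF finC, of "\<lambda>c. c"] by simp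
  have ind: "indep_fam A C (\<lambda>c. c)"
    using A.indep_fam_iff[OF finC, of "\<lambda>c. c"] C' by simp
  have "basis_fam A (C \<times> I) (\<lambda>(c, i). \<beta> c (p i))"
    unfolding basis_fam_def indep_fam_def
  proof (intro conjI allI impI ballI)
    show "(\<lambda>(c, i). \<beta> c (p i)) ` (C \<times> I) \<subseteq> carrier A"
      using CZ linear_onD(1)[OF bilinear_onD(1)[OF \<beta>_bilin]] by auto
    fix c r assume "(\<Sum>x\<in>C \<times> I. scl A (c x) (case x of (c, i) \<Rightarrow> \<beta> c (p i))) = 0" "r \<in> C \<times> I"
    then show "c r = 0"
      using pair_unique[OF finC ind C'(1), of "\<lambda>x y. c (x, y)" "fst r" "snd r"]
      by (auto simp: sum.cartesian_product case_prod_beta)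
  next
    fix x assume "x \<in> carrier A"
    then obtain z where z: "\<And>i. i \<in> I \<Longrightarrow> z i \<in> carrier Z" "x = (\<Sum>i\<in>I. \<beta> (z i) (p i))"
      using ex by blast
    have "\<forall>i. \<exists>c. i \<in> I \<longrightarrow> z i = (\<Sum>b\<in>C. scl A (c b) b)"
      using Z.basis_fam_coord[OF Cb z(1)] by (metis Z_scl)
    then obtain c where c: "\<And>i. i \<in> I \<Longrightarrow> z i = (\<Sum>b\<in>C. scl A (c i b) b)" by metis
    have "x = (\<Sum>i\<in>I. \<Sum>b\<in>C. scl A (c i b) (\<beta> b (p i)))"
      unfolding z(2) using CZ by (intro sum.cong refl) (simp add: c \<beta>_comb_left)
    also have "\<dots> = (\<Sum>r\<in>C \<times> I. scl A (c (snd r) (fst r)) (case r of (c, i) \<Rightarrow> \<beta> c (p i)))"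
      by (subst sum.swap) (simp add: sum.cartesian_product case_prod_beta)
    finally show "\<exists>c. x = (\<Sum>r\<in>C \<times> I. scl A (c r) (case r of (c, i) \<Rightarrow> \<beta> c (p i)))"
      by (rule exI[of _ "\<lambda>r. c (snd r) (fst r)"])
  qed (use fin finC in auto)
  then have "kdim A = card (C \<times> I)" by (rule A.kdim_basis_fam)
  moreover have "kdim Z = card C" by (rule Z.kdim_basis_fam[OF Cb])
  ultimately show ?thesis by (simp add: card_cartesian_product)
qed

text \<open>A vector space basis of Z is a module basis of A: expand the Z-components in that basis
  and regroup by basis vector, so that the \<open>p i\<close> assemble into coefficients in
  P.\<close>

lemma free:
  "\<exists>B\<subseteq>carrier A. \<forall>x\<in>carrier A. \<exists>!c. (\<forall>b\<in>B. c b \<in> carrier P) \<and> (\<forall>b. b \<notin> B \<longrightarrow> c b = 0) \<and>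
    finite {b. c b \<noteq> 0} \<and> x = (\<Sum>b | c b \<noteq> 0. \<beta> b (c b))"
proof -
  obtain B where B: "is_basis Z B" using Z.exists_basis by blast
  then have B': "B \<subseteq> carrier Z" "A.vs.independent B" "A.vs.span B = carrier Z" by (auto simp: is_basis_def Z_scl)
  have BZ: "b \<in> carrier Z" if "b \<in> B" for b using B'(1) that by blast
  have "\<exists>!c. (\<forall>b\<in>B. c b \<in> carrier P) \<and> (\<forall>b. b \<notin> B \<longrightarrow> c b = 0) \<and>
    finite {b. c b \<noteq> 0} \<and> x = (\<Sum>b | c b \<noteq> 0. \<beta> b (c b))" if x: "x \<in> carrier A" for x
  proof -
    obtain z where z: "\<And>i. i \<in> I \<Longrightarrow> z i \<in> carrier Z" "x = (\<Sum>i\<in>I. \<beta> (z i) (p i))"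
      using ex[OF x] by blast
    \<comment> \<open>\<open>r i\<close> are the coordinates of \<open>z i\<close>, and
      \<open>c b\<close> collects what stands next to \<open>b\<close>. As Z may be infinite
      dimensional, the finite set \<open>F\<close> of all occurring basis vectors replaces B in the
      sums.\<close>
    define r where "r i = A.vs.representation B (z i)" for i
    define c where "c b = (\<Sum>i\<in>I. scl A (r i b) (p i))" for b
    define F where "F = (\<Union>i\<in>I. {b. r i b \<noteq> 0})"
    have finF: "finite F" unfolding F_def r_def using fin A.vs.finite_representation by blast
    have FB: "F \<subseteq> B" unfolding F_def r_def using A.vs.representation_ne_zero by blast
    have cF: "{b. c b \<noteq> 0} \<subseteq> F"
    proof
      fix b assume b: "b \<in> {b. c b \<noteq> 0}"
      show "b \<in> F"
      proof (rule ccontr)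
        assume "b \<notin> F"
        then have "c b = 0" unfolding c_def F_def by (intro sum.neutral) auto
        then show False using b by simp
      qed
    qed
    have cP: "c b \<in> carrier P" for b
      unfolding c_def using P.sum_closed[of I "\<lambda>i. scl P (r i b) (p i)"] by (simp add: P_scl[symmetric])
    have zF: "z i = (\<Sum>b\<in>F. scl A (r i b) b)" if i: "i \<in> I" for i
    proof -
      have "z i = (\<Sum>b | r i b \<noteq> 0. scl A (r i b) b)"
        using A.vs.sum_nonzero_representation_eq[OF B'(2), of "z i"] z(1)[OF i] B'(3) by (simp add: r_def)
      also have "\<dots> = (\<Sum>b\<in>F. scl A (r i b) b)"
        using i finF by (intro sum.mono_neutral_left) (auto simp: F_def)
      finally show ?thesis .
    qed
    have "x = (\<Sum>i\<in>I. \<Sum>b\<in>F. scl A (r i b) (\<beta> b (p i)))"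
      unfolding z(2)
    proof (intro sum.cong refl)
      fix i assume i: "i \<in> I"
      show "\<beta> (z i) (p i) = (\<Sum>b\<in>F. scl A (r i b) (\<beta> b (p i)))"
        unfolding zF[OF i] using i FB BZ by (intro \<beta>_comb_left) auto
    qed
    also have "\<dots> = (\<Sum>b\<in>F. \<beta> b (c b))"
      unfolding c_def using FB BZ by (subst sum.swap) (intro sum.cong refl, subst \<beta>_comb_right, auto)
    also have "\<dots> = (\<Sum>b | c b \<noteq> 0. \<beta> b (c b))"
      using cF finF FB BZ by (intro sum.mono_neutral_right) (auto simp: \<beta>_zero subset_iff)
    finally have xc: "x = (\<Sum>b | c b \<noteq> 0. \<beta> b (c b))" .
    have fin_c: "finite {b. c b \<noteq> 0}" using cF finF by (rule finite_subset)
    show ?thesis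
    proof (rule ex1I[of _ c])
      show "(\<forall>b\<in>B. c b \<in> carrier P) \<and> (\<forall>b. b \<notin> B \<longrightarrow> c b = 0) \<and> finite {b. c b \<noteq> 0} \<and> x = (\<Sum>b | c b \<noteq> 0. \<beta> b (c b))"
        using cP xc fin_c cF FB by blast
      fix d assume d: "(\<forall>b\<in>B. d b \<in> carrier P) \<and> (\<forall>b. b \<notin> B \<longrightarrow> d b = 0) \<and> finite {b. d b \<noteq> 0} \<and> x = (\<Sum>b | d b \<noteq> 0. \<beta> b (d b))"
      \<comment> \<open>The common finite support on which the two coefficient families can be
        subtracted.\<close>
      define G where "G = {b. c b \<noteq> 0} \<union> {b. d b \<noteq> 0}"
      have finG: "finite G" using fin_c d by (simp add: G_def)
      have GB: "G \<subseteq> B" using cF FB d by (auto simp: G_def)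
      then have GZ: "G \<subseteq> carrier Z" using B'(1) by blast
      have ind: "indep_fam A G (\<lambda>b. b)"
        using A.indep_fam_iff[OF finG, of "\<lambda>b. b"] A.vs.independent_mono[OF B'(2) GB] by simp
      have "\<forall>b. \<exists>\<gamma>. b \<in> G \<longrightarrow> d b = (\<Sum>i\<in>I. scl A (\<gamma> i) (p i))"
        using P.basis_fam_coord[OF p_basis] d GB by (metis P_scl subsetD)
      then obtain \<gamma> where \<gamma>: "\<And>b. b \<in> G \<Longrightarrow> d b = (\<Sum>i\<in>I. scl A (\<gamma> b i) (p i))" by metis
      have xG: "x = (\<Sum>b\<in>G. \<beta> b (c b))"
        unfolding xc using finG GZ by (intro sum.mono_neutral_left) (auto simp: G_def \<beta>_zero subset_iff)
      have dG: "x = (\<Sum>b\<in>G. \<beta> b (d b))"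
      proof -
        have "(\<Sum>b | d b \<noteq> 0. \<beta> b (d b)) = (\<Sum>b\<in>G. \<beta> b (d b))"
          using finG GZ by (intro sum.mono_neutral_left) (auto simp: G_def \<beta>_zero subset_iff)
        then show ?thesis using d by simp
      qed
      have GA: "b \<in> carrier A" if "b \<in> G" for b using GZ that Z_sub by blast
      have "(\<Sum>b\<in>G. \<Sum>i\<in>I. scl A (r i b - \<gamma> b i) (\<beta> b (p i))) = (\<Sum>b\<in>G. \<beta> b (c b)) - (\<Sum>b\<in>G. \<beta> b (d b))"
        using GA by (simp add: c_def \<gamma> \<beta>_comb_right A.vs.scale_left_diff_distrib sum_subtractf cong: sum.cong_simp)
      also have "\<dots> = 0" using xG dG by simp
      finally have "r i b - \<gamma> b i = 0" if "b \<in> G" "i \<in> I" for b i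
        using pair_unique[OF finG ind GZ _ that, of "\<lambda>b i. r i b - \<gamma> b i"] by blast
      then have "d b = c b" if "b \<in> G" for b
        using that by (simp add: \<gamma> c_def cong: sum.cong_simp)
      moreover have "d b = c b" if "b \<notin> G" for b
        using that by (simp add: G_def)
      ultimately show "d = c" by blast
    qed
  qed
  then show ?thesis
    using B'(1) Z_sub by (intro exI[of _ B]) blast
qed

end

section \<open>The Heisenberg double\<close>

lemma hopf_of_simps [simp]: "carrier (hopf_of A \<Delta>) = carrier A" "scl (hopf_of A \<Delta>) = scl A"
  "mul (hopf_of A \<Delta>) = mul A" "unity (hopf_of A \<Delta>) = unity A"
  by (simp_all add: hopf_of_def Let_def)

lemma heisenberg_simps [simp]:
  "carrier (heisenberg L) = carrier (tensor_space L (dual_hopf L))" "scl (heisenberg L) = fun_scl"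
  "unity (heisenberg L) = tensor L (dual_hopf L) (unity L) (unity (dual_hopf L))"
  by (simp_all add: heisenberg_def Let_def)

lemma
  fixes V :: "('k::field, 'v::ab_group_add, 'm) kspace_scheme" and W :: "('k, 'w::ab_group_add, 'n) kspace_scheme"
  shows linear_tensor_left: "w \<in> carrier W \<Longrightarrow> linear_on V (tensor_space V W) (\<lambda>v. tensor V W v w)"
    and linear_tensor_right: "v \<in> carrier V \<Longrightarrow> linear_on W (tensor_space V W) (tensor V W v)"
  using bilinear_on_tensor[of V W] by (auto simp: bilinear_on_def)

context hopf_coords_dual
begin

abbreviation "D \<equiv> dual_hopf L"
abbreviation "LD \<equiv> tensor_space L D"

sublocale D: hopf_coords I m n e u "\<lambda>i j. s j i" D \<alpha>
  by (rule dual_coords)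

lemma dual_act_closed: "h \<in> carrier L \<Longrightarrow> \<psi> \<in> carrier (dual L) \<Longrightarrow> dual_act L h \<psi> \<in> carrier (dual L)"
  using linear_onD[OF linear_on_comp[OF mul_lin_right dualD(1)]]
  by (auto simp: dual_def dual_act_def linear_on_def mulL_closed alg.mul_add_left alg.mul_scl_left)

lemma dual_act_linear: "\<psi> \<in> carrier (dual L) \<Longrightarrow> linear_on L D (\<lambda>h. dual_act L h \<psi>)"
  "h \<in> carrier L \<Longrightarrow> linear_on D D (dual_act L h)"
  by (auto intro!: linear_onI simp: dual_act_closed)
    (auto simp: dual_act_def fun_eq_iff alg.mul_add_right alg.mul_scl_right
      linear_onD(2)[OF dualD(1)] linear_onD(3)[OF dualD(1)])

text \<open>The product of \<open>h # \<phi>\<close> and \<open>g # \<psi>\<close>, with arguments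
  ordered so that partial application gives the bilinear maps lifted in
  \<open>heis_mul_def\<close>.\<close>

definition heis_term where
  "heis_term h \<phi> g \<psi> = tensor_lift L L (\<lambda>h1 h2. tensor L D (mul L h2 g) (mul D \<phi> (dual_act L h1 \<psi>))) (comul L h)"

lemma heis_mul_def: "mul (heisenberg L) X Y = tensor_lift L D (\<lambda>h \<phi>. tensor_lift L D (heis_term h \<phi>) Y) X"
  by (simp add: heisenberg_def heis_term_def[abs_def] Let_def)

lemma heis_bilinear0:
  assumes "\<phi> \<in> carrier (dual L)" "g \<in> carrier L" "\<psi> \<in> carrier (dual L)"
  shows "bilinear_on L L LD (\<lambda>h1 h2. tensor L D (mul L h2 g) (mul D \<phi> (dual_act L h1 \<psi>)))"
proof (rule bilinear_onI)
  fix h assume h: "h \<in> carrier L"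
  show "linear_on L LD (\<lambda>h2. tensor L D (mul L h2 g) (mul D \<phi> (dual_act L h \<psi>)))"
    using assms h by (intro linear_on_comp[OF mul_lin_right[OF assms(2)] linear_tensor_left])
      (simp add: dual_mul_closed dual_act_closed)
  show "linear_on L LD (\<lambda>h1. tensor L D (mul L h g) (mul D \<phi> (dual_act L h1 \<psi>)))"
    using assms h by (intro linear_on_comp[OF linear_on_comp[OF dual_act_linear(1)[OF assms(3)] D.mul_lin_left] linear_tensor_right])
      (simp_all add: mulL_closed)
qed

lemma heis_term_linear:
  assumes "h \<in> carrier L" "\<phi> \<in> carrier (dual L)" "g \<in> carrier L" "\<psi> \<in> carrier (dual L)"
  shows "linear_on L LD (\<lambda>h. heis_term h \<phi> g \<psi>)" "linear_on D LD (\<lambda>\<phi>. heis_term h \<phi> g \<psi>)"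
    "linear_on L LD (\<lambda>g. heis_term h \<phi> g \<psi>)" "linear_on D LD (heis_term h \<phi> g)"
proof -
  note sT = k_space_tensor_space[of L D]
  have ch: "comul L h \<in> carrier (tensor_space L L)"
    by (rule linear_onD(1)[OF comul_lin assms(1)])
  show "linear_on L LD (\<lambda>h. heis_term h \<phi> g \<psi>)"
    unfolding heis_term_def by (rule lin_lift_comul[OF sT heis_bilinear0[OF assms(2-4)]])
  show "linear_on D LD (\<lambda>\<phi>. heis_term h \<phi> g \<psi>)"
    unfolding heis_term_def
  proof (rule linear_on_tensor_lift_param[OF space space sT _ _ D.space ch])
    fix v w assume vw: "v \<in> carrier L" "w \<in> carrier L"
    show "linear_on D LD (\<lambda>\<phi>. tensor L D (mul L w g) (mul D \<phi> (dual_act L v \<psi>)))"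
      using vw assms by (intro linear_on_comp[OF D.mul_lin_right linear_tensor_right])
        (simp_all add: dual_act_closed mulL_closed)
  qed (use assms in \<open>auto intro: heis_bilinear0\<close>)
  show "linear_on L LD (\<lambda>g. heis_term h \<phi> g \<psi>)"
    unfolding heis_term_def
  proof (rule linear_on_tensor_lift_param[OF space space sT _ _ space ch])
    fix v w assume vw: "v \<in> carrier L" "w \<in> carrier L"
    show "linear_on L LD (\<lambda>g. tensor L D (mul L w g) (mul D \<phi> (dual_act L v \<psi>)))"
      using vw assms by (intro linear_on_comp[OF mul_lin_left linear_tensor_left])
        (simp_all add: dual_act_closed dual_mul_closed)
  qed (use assms in \<open>auto intro: heis_bilinear0\<close>)
  show "linear_on D LD (heis_term h \<phi> g)"
    unfolding heis_term_def
  proof (rule linear_on_tensor_lift_param[OF space space sT _ _ D.space ch])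
    fix v w assume vw: "v \<in> carrier L" "w \<in> carrier L"
    show "linear_on D LD (\<lambda>\<psi>. tensor L D (mul L w g) (mul D \<phi> (dual_act L v \<psi>)))"
      using vw assms by (intro linear_on_comp[OF linear_on_comp[OF dual_act_linear(2) D.mul_lin_left] linear_tensor_right])
        (simp_all add: mulL_closed)
  qed (use assms in \<open>auto intro: heis_bilinear0\<close>)
qed

text \<open>\<open>heis_term_linear\<close> fixes all four arguments in their carriers, including
  the one rebound in the conclusion; the zero vector is supplied for that one.\<close>

lemma heis_term_bilinear:
  assumes "h \<in> carrier L" "\<phi> \<in> carrier (dual L)"
  shows "bilinear_on L D LD (heis_term h \<phi>)"
  using heis_term_linear(3)[OF assms sp.zero_closed] heis_term_linear(4)[OF assms _ k_space.zero_closed[OF k_space_dual]]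
  by (intro bilinear_onI) auto

lemma heis_outer_bilinear:
  assumes Y: "Y \<in> carrier LD"
  shows "bilinear_on L D LD (\<lambda>h \<phi>. tensor_lift L D (heis_term h \<phi>) Y)"
proof (rule bilinear_onI)
  fix h assume "h \<in> carrier L"
  then show "linear_on D LD (\<lambda>\<phi>. tensor_lift L D (heis_term h \<phi>) Y)"
    by (intro linear_on_tensor_lift_param[OF space D.space k_space_tensor_space _ _ D.space Y])
      (auto intro: heis_term_bilinear heis_term_linear(2)[OF _ k_space.zero_closed[OF k_space_dual]])
next
  fix \<phi> assume "\<phi> \<in> carrier D"
  then show "linear_on L LD (\<lambda>h. tensor_lift L D (heis_term h \<phi>) Y)"
    by (intro linear_on_tensor_lift_param[OF space D.space k_space_tensor_space _ _ space Y])
      (auto intro: heis_term_bilinear heis_term_linear(1)[OF sp.zero_closed])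
qed

lemma heis_mul_bilinear: "bilinear_on LD LD LD (mul (heisenberg L))"
proof (rule bilinear_onI)
  fix Y assume "Y \<in> carrier LD"
  then show "linear_on LD LD (\<lambda>X. mul (heisenberg L) X Y)"
    unfolding heis_mul_def by (intro linear_on_tensor_lift space D.space k_space_tensor_space heis_outer_bilinear)
next
  fix X assume X: "X \<in> carrier LD"
  show "linear_on LD LD (mul (heisenberg L) X)"
    unfolding heis_mul_def
  proof (rule linear_on_tensor_lift_param[OF space D.space k_space_tensor_space heis_outer_bilinear _ k_space_tensor_space X])
    fix v w assume "v \<in> carrier L" "w \<in> carrier D"
    then show "linear_on LD LD (tensor_lift L D (heis_term v w))"
      by (intro linear_on_tensor_lift space D.space k_space_tensor_space heis_term_bilinear) simp_all
  qed
qed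

lemma heis_mul_pure:
  assumes "h \<in> carrier L" "\<phi> \<in> carrier (dual L)" "g \<in> carrier L" "\<psi> \<in> carrier (dual L)"
  shows "mul (heisenberg L) (tensor L D h \<phi>) (tensor L D g \<psi>) = heis_term h \<phi> g \<psi>"
  using assms
  by (simp add: heis_mul_def tensor_lift_tensor[OF space D.space k_space_tensor_space heis_outer_bilinear]
      tensor_lift_tensor[OF space D.space k_space_tensor_space heis_term_bilinear])

lemma heis_mul_basis:
  assumes "i \<in> I" "j \<in> I" "k \<in> I" "l \<in> I"
  shows "mul (heisenberg L) (tensor L D (v i) (\<alpha> j)) (tensor L D (v k) (\<alpha> l)) =
    (\<Sum>p\<in>I. \<Sum>q\<in>I. fun_scl (m p q i) (tensor L D (mul L (v q) (v k)) (mul D (\<alpha> j) (dual_act L (v p) (\<alpha> l)))))"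
  using assms
  by (simp add: heis_mul_pure \<alpha>_closed heis_term_def lift_comul[OF k_space_tensor_space heis_bilinear0])

lemma basis_heis: "basis_fam LD (I \<times> I) (\<lambda>(i, j). tensor L D (v i) (\<alpha> j))"
  by (rule basis_fam_tensor[OF space D.space basis D.basis])

lemma dual_basis_props:
  assumes B: "is_basis L B"
  shows "finite B" "\<And>x. x \<in> B \<Longrightarrow> dual_basis L B x \<in> carrier (dual L)"
    "\<And>x. x \<in> carrier L \<Longrightarrow> x = (\<Sum>y\<in>B. scl L (dual_basis L B y x) y)"
proof -
  have B': "B \<subseteq> carrier L" "sp.vs.independent B" "sp.vs.span B = carrier L"
    using B by (auto simp: is_basis_def)
  show finB: "finite B"
    by (rule sp.finite_independent(1)[OF sp.kdim_basis_fam(2)[OF basis] B'(1,2)])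
  show "dual_basis L B x \<in> carrier (dual L)" if "x \<in> B" for x
    using B'(2,3) by (auto simp: dual_def dual_basis_def linear_on_def sp.vs.representation_add sp.vs.representation_scale)
  show "x = (\<Sum>y\<in>B. scl L (dual_basis L B y x) y)" if x: "x \<in> carrier L" for x
    using x B' finB by (simp add: dual_basis_def sp.vs.sum_representation_eq)
qed

end

section \<open>The theorem in coordinates\<close>

lemma fin_dim_subset_span:
  assumes W: "k_space W" and V: "k_space V" "scl W = scl V" "finite T" "carrier W \<subseteq> module.span (scl V) T"
  shows "fin_dim W \<and> kdim W \<le> card T"
proof -
  interpret W: k_space W by fact
  obtain C where C: "is_basis W C" using W.exists_basis by blast
  then have C': "C \<subseteq> carrier W" "W.vs.independent C" "W.vs.span C = carrier W"
    by (auto simp: is_basis_def)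
  have fC: "finite C \<and> card C \<le> card T"
    using W.vs.independent_span_bound[OF V(3) C'(2)] C'(1) V(2,4) by auto
  then have "basis_fam W C (\<lambda>c. c)"
    using C W.basis_fam_iff[of C "\<lambda>c. c"] by simp
  from W.kdim_basis_fam[OF this] fC show ?thesis by simp
qed

context pentagon_coords
begin

text \<open>The span of the \<open>b j a i\<close> is closed under multiplication because
  \<open>a_b\<close> reorders an \<open>a\<close> before a \<open>b\<close>. It contains P and H
  since 1 is a combination of either family.\<close>

lemma generated: "fin_dim (generated_PH A RR) \<and> kdim (generated_PH A RR) \<le> card I ^ 2"
proof -
  let ?v = "\<lambda>(j, i). mul A (b j) (a i)"
  let ?S = "lspan A (I \<times> I) ?v"
  have fin2: "finite (I \<times> I)" using fin by simp
  have v_in: "mul A (b j) (a i) \<in> ?S" if "i \<in> I" "j \<in> I" for i j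
    using lspan_base[OF fin2, of "(j, i)" ?v] that by simp
  have bbaa: "mul A (mul A (b j) (b x)) (mul A (a y) (a i)) \<in> ?S" if "i \<in> I" "j \<in> I" "x \<in> I" "y \<in> I" for i j x y
  proof -
    have "mul A (mul A (b j) (b x)) (mul A (a y) (a i)) =
        (\<Sum>q\<in>I. scl A (n y i q) (\<Sum>p\<in>I. scl A (m j x p) (mul A (b p) (a q))))"
      using that by (simp add: a_a b_b mul_sum_left mul_sum_right mul_scl_left mul_scl_right cong: sum.cong_simp)
    also have "\<dots> \<in> ?S"
      by (intro vs.subspace_sum[OF subspace_lspan] vs.subspace_scale[OF subspace_lspan] v_in)
    finally show ?thesis .
  qed
  have vv: "mul A (mul A (b j) (a i)) (mul A (b l) (a k)) \<in> ?S" if "i \<in> I" "j \<in> I" "k \<in> I" "l \<in> I" for i j k l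
  proof -
    have "mul A (mul A (b j) (a i)) (mul A (b l) (a k)) = mul A (mul A (b j) (mul A (a i) (b l))) (a k)"
      using that by (simp add: mul_assoc)
    also have "\<dots> = (\<Sum>x\<in>I. \<Sum>p\<in>I. \<Sum>q\<in>I. scl A (m p q i * n x p l) (mul A (mul A (b j) (b x)) (mul A (a q) (a k))))"
      using that by (simp add: a_b mul_sum_left mul_sum_right mul_scl_left mul_scl_right mul_assoc cong: sum.cong_simp)
    also have "\<dots> \<in> ?S"
      using that by (intro vs.subspace_sum[OF subspace_lspan] vs.subspace_scale[OF subspace_lspan] bbaa)
    finally show ?thesis .
  qed
  have bS: "b j \<in> ?S" if "j \<in> I" for j
  proof -
    have "b j = (\<Sum>i\<in>I. scl A (u i) (mul A (b j) (a i)))"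
      using that one_a mul_unity_right[of "b j"] by (simp add: mul_sum_right mul_scl_right cong: sum.cong_simp)
    also have "\<dots> \<in> ?S"
      using that by (intro vs.subspace_sum[OF subspace_lspan] vs.subspace_scale[OF subspace_lspan] v_in)
    finally show ?thesis .
  qed
  have aS: "a i \<in> ?S" if "i \<in> I" for i
  proof -
    have "a i = (\<Sum>j\<in>I. scl A (e j) (mul A (b j) (a i)))"
      using that one_b mul_unity_left[of "a i"] by (simp add: mul_sum_left mul_scl_left cong: sum.cong_simp)
    also have "\<dots> \<in> ?S"
      using that by (intro vs.subspace_sum[OF subspace_lspan] vs.subspace_scale[OF subspace_lspan] v_in)
    finally show ?thesis .
  qed
  have comb: "(\<Sum>i\<in>I. scl A (c i) (x i)) \<in> ?S" if "\<And>i. i \<in> I \<Longrightarrow> x i \<in> ?S" for c x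
    using that by (intro vs.subspace_sum[OF subspace_lspan] vs.subspace_scale[OF subspace_lspan])
  have sub: "subalgebra A ?S"
    unfolding subalgebra_def
  proof (intro conjI ballI)
    show "?S \<subseteq> carrier A" by (rule lspan_subset) auto
    show "unity A \<in> ?S" unfolding one_a by (rule comb) (rule aS)
    show "mul A x y \<in> ?S" if "x \<in> ?S" "y \<in> ?S" for x y
      by (rule lspan_mul_closed[OF _ _ that]) (auto intro: vv)
  qed (rule subspace_lspan)
  have "right_coeff A RR \<union> left_coeff A RR \<subseteq> ?S"
    using comb[OF aS] comb[OF bS] by (auto simp: right_coeff_RR left_coeff_RR elim!: lspanE)
  then have gen_sub: "carrier (generated_PH A RR) \<subseteq> ?S"
    using sub by (simp add: generated_PH_def hull_minimal)
  have "vs.subspace (carrier (generated_PH A RR))"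
    unfolding generated_PH_def hull_def by (auto simp: subalgebra_def intro!: vs.subspace_Inter)
  then have "k_space (generated_PH A RR)"
    using vector_space by (simp add: k_space_def generated_PH_def)
  then have "fin_dim (generated_PH A RR) \<and> kdim (generated_PH A RR) \<le> card (?v ` (I \<times> I))"
    using gen_sub lspan_eq_span[OF fin2, of ?v] fin2
    by (intro fin_dim_subset_span[OF _ k_space_axioms]) (simp_all add: generated_PH_def)
  moreover have "card (?v ` (I \<times> I)) \<le> card I ^ 2"
    using card_image_le[OF fin2, of ?v] by (simp add: card_cartesian_product power2_eq_square)
  ultimately show ?thesis by linarith
qed

lemma hopf_P_simps [simp]: "carrier (hopf_P A R) = left_coeff A R" "scl (hopf_P A R) = scl A"
  "mul (hopf_P A R) = mul A" "unity (hopf_P A R) = unity A"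
  by (simp_all add: hopf_P_def)

lemma hopf_H_simps [simp]: "carrier (hopf_H A R) = right_coeff A R" "scl (hopf_H A R) = scl A"
  "mul (hopf_H A R) = mul A" "unity (hopf_H A R) = unity A"
  by (simp_all add: hopf_H_def)

text \<open>A dual basis fixed by choice, making it a constant that can parametrise the sublocale
  below.\<close>

definition \<alpha> where "\<alpha> = (SOME \<alpha>. (\<forall>i. \<alpha> i \<in> carrier (dual (hopf_P A RR))) \<and>
  (\<forall>i\<in>I. \<forall>j\<in>I. \<alpha> i (a j) = (if i = j then 1 else 0)))"

sublocale P: hopf_coords_dual I n m u e s "hopf_P A RR" a \<alpha>
proof -
  interpret P: hopf_coords I n m u e s "hopf_P A RR" a by (rule hopf_P_coords)
  have "\<exists>\<alpha>. (\<forall>i. \<alpha> i \<in> carrier (dual (hopf_P A RR))) \<and> (\<forall>i\<in>I. \<forall>j\<in>I. \<alpha> i (a j) = (if i = j then 1 else 0))"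
    using dual_functionals[OF P.space fin P.v_indep] by (metis P.v_closed)
  from someI_ex[OF this, folded \<alpha>_def]
  show "hopf_coords_dual I n m u e s (hopf_P A RR) a \<alpha>"
    by unfold_locales auto
qed

lemma dual_P: "dual (hopf_P A RR) = dual (alg_P A RR)"
  by (rule dual_cong) simp_all

text \<open>By \<open>tensor_PH\<close> the sum defining \<open>RR\<close> is already a sum of
  tensors over P and H, so functionals defined on P alone may be paired with it.\<close>

lemma RR_lift_PH:
  assumes "k_space U" "bilinear_on (alg_P A RR) (alg_H A RR) U \<beta>"
  shows "tensor_lift (alg_P A RR) (alg_H A RR) \<beta> RR = (\<Sum>i\<in>I. \<beta> (a i) (b i))"
proof -
  have "tensor_lift (alg_P A RR) (alg_H A RR) \<beta> (\<Sum>i\<in>I. tensor (alg_P A RR) (alg_H A RR) (a i) (b i)) = (\<Sum>i\<in>I. \<beta> (a i) (b i))"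
    using k_algebra.axioms(1)[OF k_algebra_P] k_algebra.axioms(1)[OF k_algebra_H]
    by (intro tensor_lift_sum_tensor[OF _ _ assms]) simp_all
  then show ?thesis by (simp only: tensor_PH(3) RR_def[symmetric])
qed

lemma coeff_map_eq:
  assumes "\<phi> \<in> carrier (dual (hopf_P A RR))"
  shows "coeff_map A RR \<phi> = (\<Sum>r\<in>I. scl A (\<phi> (a r)) (b r))"
  unfolding coeff_map_def
  using bilinear_on_slice_left[OF assms[unfolded dual_P] k_algebra.axioms(1)[OF k_algebra_H]]
  by (intro RR_lift_PH[OF k_algebra.axioms(1)[OF k_algebra_H]]) simp

lemma coeff_map_\<alpha>: "i \<in> I \<Longrightarrow> coeff_map A RR (\<alpha> i) = b i"
  using delta_comb[of i b] by (simp add: coeff_map_eq P.\<alpha>_closed P.\<alpha>_v cong: sum.cong_simp)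

lemma comb_in_H [simp]: "(\<Sum>k\<in>I. scl A (c k) (b k)) \<in> right_coeff A RR"
  by (simp add: right_coeff_RR lspanI)

lemma coeff_map_linear: "linear_on (dual_hopf (hopf_P A RR)) (hopf_H A RR) (coeff_map A RR)"
  by (rule linear_onI)
    (simp_all add: coeff_map_eq P.dual_add_closed P.dual_scl_closed vs.scale_left_distrib sum.distrib vs.scale_sum_right)

text \<open>The map sends \<open>\<alpha> i\<close> to \<open>b i\<close>, and both bases have the
  transposed datum: one by duality, the other by the construction of H.\<close>

theorem coeff_map_iso: "hopf_iso (dual_hopf (hopf_P A RR)) (hopf_H A RR) (coeff_map A RR)"
  by (rule hopf_coords_iso[OF P.dual_coords hopf_H_coords coeff_map_linear]) (rule coeff_map_\<alpha>)

lemma coeff_map_hom: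
  "\<phi> \<in> carrier (dual (hopf_P A RR)) \<Longrightarrow> \<psi> \<in> carrier (dual (hopf_P A RR)) \<Longrightarrow>
    coeff_map A RR (mul (dual_hopf (hopf_P A RR)) \<phi> \<psi>) = mul A (coeff_map A RR \<phi>) (coeff_map A RR \<psi>)"
  "coeff_map A RR (unity (dual_hopf (hopf_P A RR))) = unity A"
  using coeff_map_iso by (simp_all add: hopf_iso_def hopf_hom_def alg_hom_def)

lemma coeff_map_closed: "\<phi> \<in> carrier (dual (hopf_P A RR)) \<Longrightarrow> coeff_map A RR \<phi> \<in> carrier A"
  by (simp add: coeff_map_eq)

lemma P_in [simp]: "x \<in> left_coeff A RR \<Longrightarrow> x \<in> carrier A"
  using P_subset by blast

lemma H_in [simp]: "x \<in> right_coeff A RR \<Longrightarrow> x \<in> carrier A"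
  using H_subset by blast

abbreviation "F \<equiv> heisenberg_map A RR"

text \<open>Factoring through \<open>coeff_map\<close> lets its multiplicativity handle the dual
  component in \<open>F_mul\<close>.\<close>

lemma F_eq: "F = tensor_lift (hopf_P A RR) (dual_hopf (hopf_P A RR)) (\<lambda>x \<phi>. mul A (coeff_map A RR \<phi>) x)"
  unfolding heisenberg_map_def
proof (rule tensor_lift_cong)
  fix x \<phi> assume x: "x \<in> carrier (hopf_P A RR)" and \<phi>: "\<phi> \<in> carrier (dual_hopf (hopf_P A RR))"
  have x': "x \<in> carrier A" using x by simp
  note lin = linear_onD[OF dualD(1)[of \<phi> "hopf_P A RR"]]
  have bl: "bilinear_on (alg_P A RR) (alg_H A RR) A (\<lambda>a b. scl A (\<phi> a) (mul A b x))"
    using x' \<phi> by (intro bilinear_onI linear_onI)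
      (auto simp: lin[simplified] mul_add_left mul_scl_left vs.scale_left_distrib vs.scale_right_distrib mult.commute)
  have "tensor_lift (alg_P A RR) (alg_H A RR) (\<lambda>a b. scl A (\<phi> a) (mul A b x)) RR =
      (\<Sum>r\<in>I. scl A (\<phi> (a r)) (mul A (b r) x))"
    by (rule RR_lift_PH[OF k_space_axioms bl])
  also have "\<dots> = mul A (coeff_map A RR \<phi>) x"
    using x' \<phi> by (simp add: coeff_map_eq mul_sum_left mul_scl_left cong: sum.cong_simp)
  finally show "tensor_lift (alg_P A RR) (alg_H A RR) (\<lambda>a b. scl A (\<phi> a) (mul A b x)) RR = mul A (coeff_map A RR \<phi>) x" .
qed simp_all

lemma F_bilinear: "bilinear_on (hopf_P A RR) (dual_hopf (hopf_P A RR)) A (\<lambda>x \<phi>. mul A (coeff_map A RR \<phi>) x)"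
  using linear_onD[OF coeff_map_linear]
  by (intro bilinear_onI linear_onI) (auto simp: mul_add_left mul_add_right mul_scl_left mul_scl_right coeff_map_closed)

lemma F_linear: "linear_on P.LD A F"
  unfolding F_eq by (rule linear_on_tensor_lift[OF P.space P.D.space k_space_axioms F_bilinear])

lemma F_pure:
  assumes "x \<in> left_coeff A RR" "\<phi> \<in> carrier (dual (hopf_P A RR))"
  shows "F (tensor (hopf_P A RR) P.D x \<phi>) = mul A (coeff_map A RR \<phi>) x"
  unfolding F_eq using assms by (intro tensor_lift_tensor[OF P.space P.D.space k_space_axioms F_bilinear]) simp_all

lemma F_basis: "i \<in> I \<Longrightarrow> j \<in> I \<Longrightarrow> F (tensor (hopf_P A RR) P.D (a i) (\<alpha> j)) = mul A (b j) (a i)"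
  by (simp add: F_pure P.\<alpha>_closed coeff_map_\<alpha>)

text \<open>On basis elements the claim is the exchange of \<open>a i\<close> and \<open>b l\<close>
  in \<open>(b_j a_i)(b_l a_k)\<close>. The coefficient in \<open>a_b\<close> splits accordingly:
  \<open>m p q i\<close> is the coproduct of \<open>a i\<close>, and \<open>n x p l\<close> is the
  action of its first factor on \<open>\<alpha> l\<close>.\<close>

lemma F_mul:
  assumes X: "X \<in> carrier P.LD" and Y: "Y \<in> carrier P.LD"
  shows "F (mul (heisenberg (hopf_P A RR)) X Y) = mul A (F X) (F Y)"
proof (rule bilinear_eq_basis[where f = "\<lambda>X Y. F (mul (heisenberg (hopf_P A RR)) X Y)" and g = "\<lambda>X Y. mul A (F X) (F Y)" and U = A,
      OF _ _ _ _ k_space_tensor_space k_space_tensor_space k_space_axioms P.basis_heis P.basis_heis _ X Y])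
  fix Z assume Z: "Z \<in> carrier P.LD"
  have FZ: "F Z \<in> carrier A" by (rule linear_onD(1)[OF F_linear Z])
  show "linear_on P.LD A (\<lambda>X. F (mul (heisenberg (hopf_P A RR)) X Z))"
    by (rule linear_on_comp[OF bilinear_onD(2)[OF P.heis_mul_bilinear Z] F_linear])
  show "linear_on P.LD A (\<lambda>X. F (mul (heisenberg (hopf_P A RR)) Z X))"
    by (rule linear_on_comp[OF bilinear_onD(1)[OF P.heis_mul_bilinear Z] F_linear])
  show "linear_on P.LD A (\<lambda>X. mul A (F X) (F Z))"
    by (rule linear_on_comp[OF F_linear linear_mul_right[OF FZ]])
  show "linear_on P.LD A (\<lambda>X. mul A (F Z) (F X))"
    by (rule linear_on_comp[OF F_linear linear_mul_left[OF FZ]])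
next
  fix ij kl assume "ij \<in> I \<times> I" "kl \<in> I \<times> I"
  then obtain i j k l where ij: "ij = (i, j)" "kl = (k, l)" "i \<in> I" "j \<in> I" "k \<in> I" "l \<in> I" by auto
  let ?L = "hopf_P A RR"
  \<comment> \<open>The action evaluates \<open>\<alpha> l\<close> at \<open>a x a p\<close>, which
    is the coefficient \<open>n x p l\<close>.\<close>
  have act: "coeff_map A RR (dual_act ?L (a p) (\<alpha> l)) = (\<Sum>x\<in>I. scl A (n x p l) (b x))" if "p \<in> I" for p
  proof -
    have "dual_act ?L (a p) (\<alpha> l) (a x) = n x p l" if "x \<in> I" for x
      using that \<open>p \<in> I\<close> ij fin P.dual_comb[OF P.\<alpha>_closed[OF ij(6)], of "n x p"]
      by (simp add: dual_act_def a_a P.\<alpha>_v if_distrib[where f = "\<lambda>c. _ * c"] cong: if_cong sum.cong_simp)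
    then show ?thesis
      using that ij by (simp add: coeff_map_eq P.dual_act_closed P.\<alpha>_closed)
  qed
  have aqP: "mul A (a q) (a k) \<in> left_coeff A RR" if "q \<in> I" for q
    using that ij by (simp add: a_a)
  have "F (mul (heisenberg ?L) (tensor ?L P.D (a i) (\<alpha> j)) (tensor ?L P.D (a k) (\<alpha> l))) =
      (\<Sum>p\<in>I. \<Sum>q\<in>I. scl A (m p q i) (F (tensor ?L P.D (mul A (a q) (a k)) (mul P.D (\<alpha> j) (dual_act ?L (a p) (\<alpha> l))))))"
    using ij unfolding P.heis_mul_basis[OF ij(3-6)]
    by (simp add: linear_on_sum[OF F_linear k_space_tensor_space k_space_axioms] linear_onD(3)[OF F_linear, simplified]
      aqP P.dual_mul_closed P.dual_act_closed P.\<alpha>_closed cong: sum.cong_simp)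
  also have "\<dots> = (\<Sum>p\<in>I. \<Sum>q\<in>I. \<Sum>x\<in>I. scl A (m p q i * n x p l) (mul A (mul A (b j) (b x)) (mul A (a q) (a k))))"
    using ij by (simp add: F_pure aqP P.dual_mul_closed P.dual_act_closed P.\<alpha>_closed coeff_map_hom coeff_map_\<alpha> act
      mul_sum_left mul_sum_right mul_scl_left mul_scl_right vs.scale_sum_right cong: sum.cong_simp)
  also have "\<dots> = (\<Sum>x\<in>I. \<Sum>p\<in>I. \<Sum>q\<in>I. scl A (m p q i * n x p l) (mul A (mul A (b j) (b x)) (mul A (a q) (a k))))"
    by (rule sum_rotate3[symmetric])
  also have "\<dots> = mul A (mul A (b j) (mul A (a i) (b l))) (a k)"
    using ij by (simp add: a_b mul_sum_left mul_sum_right mul_scl_left mul_scl_right mul_assoc cong: sum.cong_simp)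
  also have "\<dots> = mul A (mul A (b j) (a i)) (mul A (b l) (a k))"
    using ij by (simp add: mul_assoc)
  finally show "F (mul (heisenberg ?L) (case ij of (i, j) \<Rightarrow> tensor ?L P.D (a i) (\<alpha> j)) (case kl of (i, j) \<Rightarrow> tensor ?L P.D (a i) (\<alpha> j))) =
      mul A (F (case ij of (i, j) \<Rightarrow> tensor ?L P.D (a i) (\<alpha> j))) (F (case kl of (i, j) \<Rightarrow> tensor ?L P.D (a i) (\<alpha> j)))"
    using ij by (simp add: F_basis)
qed

lemma unity_D: "unity P.D \<in> carrier (dual (hopf_P A RR))"
  using P.D.unityL_closed by simp

lemma unity_P: "unity A \<in> left_coeff A RR"
  using subalgebra_P by (simp add: subalgebra_def)

lemma F_unity: "F (unity (heisenberg (hopf_P A RR))) = unity A"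
  by (simp add: F_pure unity_D unity_P coeff_map_hom)

end

context pentagon_coords_inv
begin

lemma F_inj:
  assumes X: "X \<in> carrier P.LD" "F X = 0"
  shows "X = 0"
proof -
  obtain c where c: "X = (\<Sum>p\<in>I \<times> I. fun_scl (c p) (case p of (i, j) \<Rightarrow> tensor (hopf_P A RR) P.D (a i) (\<alpha> j)))"
    using k_space.basis_fam_coord[OF k_space_tensor_space P.basis_heis X(1)] by auto
  have X': "X = (\<Sum>i\<in>I. \<Sum>j\<in>I. fun_scl (c (i, j)) (tensor (hopf_P A RR) P.D (a i) (\<alpha> j)))"
    unfolding c by (simp add: sum.cartesian_product case_prod_beta)
  have "F X = (\<Sum>i\<in>I. \<Sum>j\<in>I. scl A (c (i, j)) (mul A (b j) (a i)))"
    unfolding X' by (simp add: linear_on_sum[OF F_linear k_space_tensor_space k_space_axioms]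
      linear_onD(3)[OF F_linear, simplified] P.\<alpha>_closed F_basis cong: sum.cong_simp)
  also have "\<dots> = (\<Sum>r\<in>I \<times> I. scl A (c (snd r, fst r)) (case r of (j, i) \<Rightarrow> mul A (b j) (a i)))"
    by (subst sum.swap) (simp add: sum.cartesian_product case_prod_beta)
  finally have "(\<Sum>r\<in>I \<times> I. scl A (c (snd r, fst r)) (case r of (j, i) \<Rightarrow> mul A (b j) (a i))) = 0"
    using X(2) by simp
  from indep_famD[OF ba_indep this] have "c (i, j) = 0" if "i \<in> I" "j \<in> I" for i j
    using that by fastforce
  then show ?thesis unfolding X' by simp
qed

lemma F_inj_on:
  assumes "X \<in> carrier P.LD" "Y \<in> carrier P.LD" "F X = F Y"
  shows "X = Y"
proof -
  have "X - Y \<in> carrier P.LD" by (rule k_space.diff_closed[OF k_space_tensor_space assms(1,2)])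
  moreover have "F (X - Y) = 0"
    using linear_on_diff[OF F_linear k_space_tensor_space k_space_axioms assms(1,2)] assms(3) by simp
  ultimately have "X - Y = 0" by (rule F_inj)
  then show ?thesis by (simp only: right_minus_eq)
qed

theorem k_algebra_heisenberg: "k_algebra (heisenberg (hopf_P A RR))"
proof (rule k_algebraI)
  let ?M = "mul (heisenberg (hopf_P A RR))"
  have M: "?M X Y \<in> carrier P.LD" if "X \<in> carrier P.LD" "Y \<in> carrier P.LD" for X Y
    by (rule linear_onD(1)[OF bilinear_onD(1)[OF P.heis_mul_bilinear that(1)] that(2)])
  have FX: "F X \<in> carrier A" if "X \<in> carrier P.LD" for X
    by (rule linear_onD(1)[OF F_linear that])
  have one: "unity (heisenberg (hopf_P A RR)) \<in> carrier P.LD"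
    by (simp add: unity_D unity_P)
  show "k_space (heisenberg (hopf_P A RR))"
    using k_space_tensor_space[of "hopf_P A RR" P.D] by (simp add: k_space_def)
  show "bilinear_on (heisenberg (hopf_P A RR)) (heisenberg (hopf_P A RR)) (heisenberg (hopf_P A RR)) ?M"
    using P.heis_mul_bilinear by (simp add: bilinear_on_def linear_on_def)
  show "unity (heisenberg (hopf_P A RR)) \<in> carrier (heisenberg (hopf_P A RR))" using one by simp
  fix X assume "X \<in> carrier (heisenberg (hopf_P A RR))"
  then have X: "X \<in> carrier P.LD" by simp
  show "?M (unity (heisenberg (hopf_P A RR))) X = X"
    using X one by (intro F_inj_on M X) (simp_all only: F_mul F_unity FX mul_unity_left)
  show "?M X (unity (heisenberg (hopf_P A RR))) = X"
    using X one by (intro F_inj_on M X) (simp_all only: F_mul F_unity FX mul_unity_right)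
  fix Y assume "Y \<in> carrier (heisenberg (hopf_P A RR))"
  then have Y: "Y \<in> carrier P.LD" by simp
  show "?M X Y \<in> carrier (heisenberg (hopf_P A RR))" using M[OF X Y] by simp
  fix Z assume "Z \<in> carrier (heisenberg (hopf_P A RR))"
  then have Z: "Z \<in> carrier P.LD" by simp
  show "?M (?M X Y) Z = ?M X (?M Y Z)"
    using X Y Z by (intro F_inj_on M) (simp_all add: F_mul FX M mul_assoc)
qed

end

section \<open>The canonical element and the invariants\<close>

context pentagon_coords
begin

theorem heisenberg_map_hom: "alg_hom (heisenberg (hopf_P A RR)) A F"
  using F_linear F_unity F_mul by (simp add: alg_hom_def linear_on_def)

text \<open>F turns the two legs into \<open>y\<close> and the image of its dual functional in H.
  Expanding the latter in \<open>b r\<close> and summing over B reconstructs \<open>a r\<close>,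
  whatever basis B was chosen.\<close>

theorem canonical:
  assumes B: "is_basis (hopf_P A RR) B"
  shows "RR = tensor_map (heisenberg (hopf_P A RR)) (heisenberg (hopf_P A RR)) A A F F
    (heisenberg_canonical (hopf_P A RR) B)"
proof -
  let ?L = "hopf_P A RR" and ?H = "heisenberg (hopf_P A RR)"
  have sH: "k_space ?H"
    using k_space_tensor_space[of ?L P.D] by (simp add: k_space_def)
  have linF: "linear_on ?H A F" using F_linear by (simp add: linear_on_def)
  have bl: "bilinear_on ?H ?H (tensor_space A A) (\<lambda>v w. tensor A A (F v) (F w))"
    using linear_onD[OF linF]
    by (auto intro!: bilinear_onI linear_onI simp: tensor_add_left tensor_add_right tensor_scl_left tensor_scl_right)
  have BP: "y \<in> left_coeff A RR" if "y \<in> B" for y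
    using B that by (auto simp: is_basis_def)
  note dB = P.dual_basis_props[OF B]
  have "tensor_map ?H ?H A A F F (heisenberg_canonical ?L B) =
      (\<Sum>y\<in>B. tensor A A (F (tensor ?L P.D y (unity P.D))) (F (tensor ?L P.D (unity ?L) (dual_basis ?L B y))))"
    unfolding tensor_map_def heisenberg_canonical_def Let_def
    using BP dB(2) by (intro tensor_lift_sum_tensor[OF sH sH k_space_tensor_space bl]) (simp_all add: unity_D unity_P)
  also have "\<dots> = (\<Sum>y\<in>B. tensor A A y (coeff_map A RR (dual_basis ?L B y)))"
    using BP dB(2) by (intro sum.cong refl) (simp add: F_pure unity_D unity_P coeff_map_hom coeff_map_closed)
  also have "\<dots> = (\<Sum>y\<in>B. \<Sum>r\<in>I. tensor A A (scl A (dual_basis ?L B y (a r)) y) (b r))"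
    using dB(2) by (intro sum.cong refl) (simp add: coeff_map_eq tensor_sum_right tensor_scl_right tensor_scl_left)
  also have "\<dots> = (\<Sum>r\<in>I. tensor A A (\<Sum>y\<in>B. scl A (dual_basis ?L B y (a r)) y) (b r))"
    unfolding tensor_sum_left by (rule sum.swap)
  also have "\<dots> = (\<Sum>r\<in>I. tensor A A (a r) (b r))"
    by (intro sum.cong refl) (simp add: dB(3)[simplified, symmetric])
  also have "\<dots> = RR" by (rule RR_def[symmetric])
  finally show ?thesis by (rule sym)
qed

text \<open>Write the 1 of the left leg as \<open>\<Sum> u_i a_i\<close> and compare the right legs
  at each \<open>a i\<close>. Invariance thus says that H acts on \<open>z\<close> from the right
  through its counit.\<close>

lemma right_invariants_iff:
  "z \<in> carrier (right_invariants A RR) \<longleftrightarrow> z \<in> carrier A \<and> (\<forall>i\<in>I. mul A z (b i) = scl A (u i) z)"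
proof -
  have 1: "mul (tensor_alg A A) (tensor A A (unity A) z) RR = (\<Sum>i\<in>I. tensor A A (a i) (mul A z (b i)))"
    if "z \<in> carrier A" for z
    using that by (simp add: RR_def T.mul_sum_right AA.tensor_alg_mul cong: sum.cong_simp)
  have 2: "tensor A A (unity A) z = (\<Sum>i\<in>I. tensor A A (a i) (scl A (u i) z))" for z
    by (subst one_a) (simp add: tensor_sum_left tensor_scl_left tensor_scl_right)
  show ?thesis
  proof (cases "z \<in> carrier A")
    case True
    then have "z \<in> carrier (right_invariants A RR) \<longleftrightarrow> (\<Sum>i\<in>I. tensor A A (a i) (mul A z (b i))) = (\<Sum>i\<in>I. tensor A A (a i) (scl A (u i) z))"
      unfolding 2[symmetric] 1[OF True, symmetric] by (simp add: right_invariants_def)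
    also have "\<dots> \<longleftrightarrow> (\<forall>i\<in>I. mul A z (b i) = scl A (u i) z)"
    proof
      assume eq: "(\<Sum>i\<in>I. tensor A A (a i) (mul A z (b i))) = (\<Sum>i\<in>I. tensor A A (a i) (scl A (u i) z))"
      show "\<forall>i\<in>I. mul A z (b i) = scl A (u i) z"
        using True by (intro ballI tensor_indep_left[OF k_space_axioms k_space_axioms fin a_indep _ _ _ eq]) simp_all
    qed simp
    finally show ?thesis using True by simp
  qed (simp add: right_invariants_def)
qed

lemma left_invariants_iff:
  "z \<in> carrier (left_invariants A RR) \<longleftrightarrow> z \<in> carrier A \<and> (\<forall>i\<in>I. mul A (a i) z = scl A (e i) z)"
proof -
  have 1: "mul (tensor_alg A A) RR (tensor A A z (unity A)) = (\<Sum>i\<in>I. tensor A A (mul A (a i) z) (b i))"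
    if "z \<in> carrier A" for z
    using that by (simp add: RR_def T.mul_sum_left AA.tensor_alg_mul cong: sum.cong_simp)
  have 2: "tensor A A z (unity A) = (\<Sum>i\<in>I. tensor A A (scl A (e i) z) (b i))" for z
    by (subst one_b) (simp add: tensor_sum_right tensor_scl_left tensor_scl_right)
  show ?thesis
  proof (cases "z \<in> carrier A")
    case True
    then have "z \<in> carrier (left_invariants A RR) \<longleftrightarrow> (\<Sum>i\<in>I. tensor A A (mul A (a i) z) (b i)) = (\<Sum>i\<in>I. tensor A A (scl A (e i) z) (b i))"
      unfolding 2[symmetric] 1[OF True, symmetric] by (simp add: left_invariants_def)
    also have "\<dots> \<longleftrightarrow> (\<forall>i\<in>I. mul A (a i) z = scl A (e i) z)"
    proof
      assume eq: "(\<Sum>i\<in>I. tensor A A (mul A (a i) z) (b i)) = (\<Sum>i\<in>I. tensor A A (scl A (e i) z) (b i))"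
      show "\<forall>i\<in>I. mul A (a i) z = scl A (e i) z"
        using True by (intro ballI tensor_indep_right[OF k_space_axioms k_space_axioms fin b_indep _ _ _ eq]) simp_all
    qed simp
    finally show ?thesis using True by simp
  qed (simp add: left_invariants_def)
qed

lemma scl_invariants [simp]: "scl (right_invariants A R) = scl A" "scl (left_invariants A R) = scl A"
  by (simp_all add: right_invariants_def left_invariants_def)

lemma k_space_right_invariants: "k_space (right_invariants A RR)"
proof -
  have "vs.subspace (carrier (right_invariants A RR))"
    by (rule vs.subspaceI) (auto simp: right_invariants_iff mul_add_left mul_scl_left vs.scale_right_distrib mult.commute)
  then show ?thesis using vector_space by (simp add: k_space_def)
qed

lemma k_space_left_invariants: "k_space (left_invariants A RR)"
proof -
  have "vs.subspace (carrier (left_invariants A RR))"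
    by (rule vs.subspaceI) (auto simp: left_invariants_iff mul_add_right mul_scl_right vs.scale_right_distrib mult.commute)
  then show ?thesis using vector_space by (simp add: k_space_def)
qed

end

section \<open>The splittings of A over P and over H\<close>

context pentagon_coords_inv
begin

text \<open>In \<open>z = z \<Sum> b_j \<omega> a_j\<close> the factors \<open>b j\<close> are
  absorbed by \<open>z\<close> as \<open>u j\<close>, and \<open>\<Sum> u_j a_j\<close> is
  1.\<close>

lemma right_invariant_\<omega>:
  assumes "z \<in> carrier (right_invariants A RR)"
  shows "mul A z \<omega> = z"
proof -
  have z: "z \<in> carrier A" "\<And>i. i \<in> I \<Longrightarrow> mul A z (b i) = scl A (u i) z"
    using assms by (auto simp: right_invariants_iff)
  have "z = mul A z (\<Sum>j\<in>I. mul A (b j) (mul A \<omega> (a j)))"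
    using z by (simp add: b_\<omega>_a)
  also have "\<dots> = (\<Sum>j\<in>I. scl A (u j) (mul A (mul A z \<omega>) (a j)))"
    using z by (simp add: mul_sum_right mul_assoc[symmetric] mul_scl_left cong: sum.cong_simp)
  also have "\<dots> = mul A (mul A z \<omega>) (unity A)"
    using z by (subst one_a) (simp add: mul_sum_right mul_scl_right cong: sum.cong_simp)
  finally show ?thesis using z by simp
qed

lemma left_invariant_\<omega>:
  assumes "z \<in> carrier (left_invariants A RR)"
  shows "mul A \<omega> z = z"
proof -
  have z: "z \<in> carrier A" "\<And>i. i \<in> I \<Longrightarrow> mul A (a i) z = scl A (e i) z"
    using assms by (auto simp: left_invariants_iff)
  have "z = mul A (\<Sum>j\<in>I. mul A (b j) (mul A \<omega> (a j))) z"
    using z by (simp add: b_\<omega>_a)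
  also have "\<dots> = (\<Sum>j\<in>I. scl A (e j) (mul A (b j) (mul A \<omega> z)))"
    using z by (simp add: mul_sum_left mul_assoc mul_scl_right cong: sum.cong_simp)
  also have "\<dots> = mul A (unity A) (mul A \<omega> z)"
    using z by (subst one_b) (simp add: mul_sum_left mul_scl_left cong: sum.cong_simp)
  finally show ?thesis using z by simp
qed

sublocale R: module_splitting A "right_invariants A RR" "alg_P A RR" I a "mul A"
proof -
  have "\<exists>z. (\<forall>i\<in>I. z i \<in> carrier (right_invariants A RR)) \<and> x = (\<Sum>i\<in>I. mul A (z i) (a i))" if x: "x \<in> carrier A" for x
  \<comment> \<open>The components are forced by inserting
    \<open>1 = \<Sum> b_i \<omega> a_i\<close> to the right of \<open>x\<close>; they are invariant
    by \<open>\<omega>_b\<close>.\<close>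
  proof (intro exI[of _ "\<lambda>i. mul A (mul A x (b i)) \<omega>"] conjI ballI)
    show "mul A (mul A x (b i)) \<omega> \<in> carrier (right_invariants A RR)" if "i \<in> I" for i
      using x that by (simp add: right_invariants_iff mul_assoc \<omega>_b mul_scl_right)
    have "x = mul A x (\<Sum>j\<in>I. mul A (b j) (mul A \<omega> (a j)))" using x by (simp add: b_\<omega>_a)
    then show "x = (\<Sum>i\<in>I. mul A (mul A (mul A x (b i)) \<omega>) (a i))"
      using x by (simp add: mul_sum_right mul_assoc cong: sum.cong_simp)
  qed
  moreover have "z j = 0" if z: "\<And>i. i \<in> I \<Longrightarrow> z i \<in> carrier (right_invariants A RR)"
    and 0: "(\<Sum>i\<in>I. mul A (z i) (a i)) = 0" and j: "j \<in> I" for z j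
  proof -
    have zA: "z i \<in> carrier A" if "i \<in> I" for i using z[OF that] by (simp add: right_invariants_iff)
    \<comment> \<open>Right multiplication by \<open>b_j \<omega>\<close> extracts the
      \<open>j\<close>-th component: write \<open>z_i = z_i \<omega>\<close> and apply the matrix
      unit relation.\<close>
    have 1: "mul A (mul A (z i) (a i)) (mul A (b j) \<omega>) = (if i = j then z j else 0)" if i: "i \<in> I" for i
    proof -
      have "mul A (mul A (z i) (a i)) (mul A (b j) \<omega>) = mul A (mul A (mul A (z i) \<omega>) (a i)) (mul A (b j) \<omega>)"
        using i z by (simp add: right_invariant_\<omega>)
      also have "\<dots> = mul A (z i) (mul A (mul A \<omega> (mul A (a i) (b j))) \<omega>)"
        using i j zA by (simp add: mul_assoc)
      also have "\<dots> = (if i = j then z j else 0)"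
        unfolding \<omega>_a_b_\<omega>[OF i j] using i j zA z by (simp add: right_invariant_\<omega>)
      finally show ?thesis .
    qed
    have "0 = mul A (\<Sum>i\<in>I. mul A (z i) (a i)) (mul A (b j) \<omega>)"
      using 0 j by simp
    also have "\<dots> = (\<Sum>i\<in>I. if i = j then z j else 0)"
      using zA j by (subst mul_sum_left) (simp_all add: 1 cong: sum.cong_simp)
    also have "\<dots> = z j" using j fin by simp
    finally show ?thesis by simp
  qed
  ultimately show "module_splitting A (right_invariants A RR) (alg_P A RR) I a (mul A)"
    unfolding module_splitting_def module_splitting_axioms_def
    using k_space_axioms k_space_right_invariants k_algebra.axioms(1)[OF k_algebra_P] basis_P bilinear
    by (auto simp: right_invariants_iff)
qed

sublocale L: module_splitting A "left_invariants A RR" "alg_H A RR" I b "\<lambda>z x. mul A x z"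
proof -
  have "\<exists>z. (\<forall>i\<in>I. z i \<in> carrier (left_invariants A RR)) \<and> x = (\<Sum>i\<in>I. mul A (b i) (z i))" if x: "x \<in> carrier A" for x
  \<comment> \<open>Here the decomposition of 1 is inserted to the left of \<open>x\<close>, and
    \<open>\<omega> a_j\<close> is the extracting factor below.\<close>
  proof (intro exI[of _ "\<lambda>i. mul A \<omega> (mul A (a i) x)"] conjI ballI)
    show "mul A \<omega> (mul A (a i) x) \<in> carrier (left_invariants A RR)" if "i \<in> I" for i
      using x that by (simp add: left_invariants_iff mul_assoc[symmetric] a_\<omega> mul_scl_left)
    have "x = mul A (\<Sum>j\<in>I. mul A (b j) (mul A \<omega> (a j))) x" using x by (simp add: b_\<omega>_a)
    then show "x = (\<Sum>i\<in>I. mul A (b i) (mul A \<omega> (mul A (a i) x)))"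
      using x by (simp add: mul_sum_left mul_assoc cong: sum.cong_simp)
  qed
  moreover have "z j = 0" if z: "\<And>i. i \<in> I \<Longrightarrow> z i \<in> carrier (left_invariants A RR)"
    and 0: "(\<Sum>i\<in>I. mul A (b i) (z i)) = 0" and j: "j \<in> I" for z j
  proof -
    have zA: "z i \<in> carrier A" if "i \<in> I" for i using z[OF that] by (simp add: left_invariants_iff)
    have 1: "mul A (mul A \<omega> (a j)) (mul A (b i) (z i)) = (if i = j then z j else 0)" if i: "i \<in> I" for i
    proof -
      have "mul A (mul A \<omega> (a j)) (mul A (b i) (z i)) = mul A (mul A \<omega> (a j)) (mul A (b i) (mul A \<omega> (z i)))"
        using i z by (simp add: left_invariant_\<omega>)
      also have "\<dots> = mul A (mul A (mul A \<omega> (mul A (a j) (b i))) \<omega>) (z i)"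
        using i j zA by (simp add: mul_assoc)
      also have "\<dots> = (if i = j then z j else 0)"
        unfolding \<omega>_a_b_\<omega>[OF j i] using i j zA z by (simp add: left_invariant_\<omega>)
      finally show ?thesis .
    qed
    have "0 = mul A (mul A \<omega> (a j)) (\<Sum>i\<in>I. mul A (b i) (z i))"
      using 0 j by simp
    also have "\<dots> = (\<Sum>i\<in>I. if i = j then z j else 0)"
      using zA j by (subst mul_sum_right) (simp_all add: 1 cong: sum.cong_simp)
    also have "\<dots> = z j" using j fin by simp
    finally show ?thesis by simp
  qed
  moreover have "bilinear_on A A A (\<lambda>z x. mul A x z)"
    using linear_mul_left linear_mul_right by (intro bilinear_onI)
  ultimately show "module_splitting A (left_invariants A RR) (alg_H A RR) I b (\<lambda>z x. mul A x z)"
    unfolding module_splitting_def module_splitting_axioms_def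
    using k_space_axioms k_space_left_invariants k_algebra.axioms(1)[OF k_algebra_H] basis_H
    by (auto simp: left_invariants_iff)
qed

text \<open>Every tensor has the form \<open>\<Sum> x_i \<otimes> a_i\<close>, so surjectivity and
  injectivity of multiplication are the existence and uniqueness clauses of the splitting.\<close>

theorem right_iso: "right_module_iso (alg_P A RR) (tensor_space (right_invariants A RR) (alg_P A RR))
    (\<lambda>t y. tensor_lift (right_invariants A RR) (alg_P A RR)
      (\<lambda>a x. tensor (right_invariants A RR) (alg_P A RR) a (mul A x y)) t)
    A (mul A) (tensor_lift (right_invariants A RR) (alg_P A RR) (mul A))"
proof (rule right_module_iso_mul[OF k_algebra_axioms k_algebra_P _ _ _ _ k_space_right_invariants R.Z_sub])
  let ?Z = "right_invariants A RR" and ?P = "alg_P A RR"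
  note sP = k_algebra.axioms(1)[OF k_algebra_P] and sZ = k_space_right_invariants
  have bm: "bilinear_on ?Z ?P A (mul A)"
    by (rule bilinear_on_subspace[OF bilinear R.Z_sub]) (simp_all add: P_subset)
  have F: "tensor_lift ?Z ?P (mul A) (\<Sum>i\<in>I. tensor ?Z ?P (z i) (a i)) = (\<Sum>i\<in>I. mul A (z i) (a i))"
    if "\<And>i. i \<in> I \<Longrightarrow> z i \<in> carrier ?Z" for z
    using that by (intro tensor_lift_sum_tensor[OF sZ sP k_space_axioms bm]) simp_all
  show "bij_betw (tensor_lift ?Z ?P (mul A)) (carrier (tensor_space ?Z ?P)) (carrier A)"
    unfolding bij_betw_def
  proof
    show "inj_on (tensor_lift ?Z ?P (mul A)) (carrier (tensor_space ?Z ?P))"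
    proof (rule inj_onI)
      fix X Y assume X: "X \<in> carrier (tensor_space ?Z ?P)" and Y: "Y \<in> carrier (tensor_space ?Z ?P)"
        and eq: "tensor_lift ?Z ?P (mul A) X = tensor_lift ?Z ?P (mul A) Y"
      obtain x where x: "\<And>i. i \<in> I \<Longrightarrow> x i \<in> carrier ?Z" "X = (\<Sum>i\<in>I. tensor ?Z ?P (x i) (a i))"
        using tensor_basis_decomp_right[OF sZ sP basis_P X] by blast
      obtain y where y: "\<And>i. i \<in> I \<Longrightarrow> y i \<in> carrier ?Z" "Y = (\<Sum>i\<in>I. tensor ?Z ?P (y i) (a i))"
        using tensor_basis_decomp_right[OF sZ sP basis_P Y] by blast
      have lr: "linear_on A A (\<lambda>z. mul A z (a i))" if "i \<in> I" for i
        using that by (simp add: linear_mul_right)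
      have "(\<Sum>i\<in>I. mul A (x i - y i) (a i)) = 0"
        using eq x y F[OF x(1)] F[OF y(1)]
        by (simp add: linear_on_diff[OF lr k_space_axioms k_space_axioms] sum_subtractf cong: sum.cong_simp)
      then have "x i - y i = 0" if "i \<in> I" for i
        using x(1) y(1) that by (intro R.un[where z = "\<lambda>i. x i - y i"] R.Z.diff_closed)
      then show "X = Y" unfolding x(2) y(2) by (intro sum.cong refl) simp
    qed
    show "tensor_lift ?Z ?P (mul A) ` carrier (tensor_space ?Z ?P) = carrier A"
    proof
      show "tensor_lift ?Z ?P (mul A) ` carrier (tensor_space ?Z ?P) \<subseteq> carrier A"
        using tensor_lift_closed[OF sZ sP k_space_axioms bm] by blast
      show "carrier A \<subseteq> tensor_lift ?Z ?P (mul A) ` carrier (tensor_space ?Z ?P)"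
      proof
        fix x assume "x \<in> carrier A"
        then obtain z where z: "\<And>i. i \<in> I \<Longrightarrow> z i \<in> carrier ?Z" "x = (\<Sum>i\<in>I. mul A (z i) (a i))"
          using R.ex by blast
        then have "x = tensor_lift ?Z ?P (mul A) (\<Sum>i\<in>I. tensor ?Z ?P (z i) (a i))"
          using F[OF z(1)] by simp
        moreover have "(\<Sum>i\<in>I. tensor ?Z ?P (z i) (a i)) \<in> carrier (tensor_space ?Z ?P)"
          using z(1) by simp
        ultimately show "x \<in> tensor_lift ?Z ?P (mul A) ` carrier (tensor_space ?Z ?P)" by blast
      qed
    qed
  qed
qed (simp_all add: P_subset)

theorem left_iso: "left_module_iso (alg_H A RR) (tensor_space (alg_H A RR) (left_invariants A RR))
    (\<lambda>y t. tensor_lift (alg_H A RR) (left_invariants A RR)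
      (\<lambda>h a. tensor (alg_H A RR) (left_invariants A RR) (mul A y h) a) t)
    A (mul A) (tensor_lift (alg_H A RR) (left_invariants A RR) (mul A))"
proof (rule left_module_iso_mul[OF k_algebra_axioms k_algebra_H _ _ _ _ k_space_left_invariants L.Z_sub])
  let ?Z = "left_invariants A RR" and ?P = "alg_H A RR"
  note sP = k_algebra.axioms(1)[OF k_algebra_H] and sZ = k_space_left_invariants
  have bm: "bilinear_on ?P ?Z A (mul A)"
    by (rule bilinear_on_subspace[OF bilinear _ L.Z_sub]) (simp_all add: H_subset)
  have F: "tensor_lift ?P ?Z (mul A) (\<Sum>i\<in>I. tensor ?P ?Z (b i) (z i)) = (\<Sum>i\<in>I. mul A (b i) (z i))"
    if "\<And>i. i \<in> I \<Longrightarrow> z i \<in> carrier ?Z" for z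
    using that by (intro tensor_lift_sum_tensor[OF sP sZ k_space_axioms bm]) simp_all
  show "bij_betw (tensor_lift ?P ?Z (mul A)) (carrier (tensor_space ?P ?Z)) (carrier A)"
    unfolding bij_betw_def
  proof
    show "inj_on (tensor_lift ?P ?Z (mul A)) (carrier (tensor_space ?P ?Z))"
    proof (rule inj_onI)
      fix X Y assume X: "X \<in> carrier (tensor_space ?P ?Z)" and Y: "Y \<in> carrier (tensor_space ?P ?Z)"
        and eq: "tensor_lift ?P ?Z (mul A) X = tensor_lift ?P ?Z (mul A) Y"
      obtain x where x: "\<And>i. i \<in> I \<Longrightarrow> x i \<in> carrier ?Z" "X = (\<Sum>i\<in>I. tensor ?P ?Z (b i) (x i))"
        using tensor_basis_decomp_left[OF sP sZ basis_H X] by blast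
      obtain y where y: "\<And>i. i \<in> I \<Longrightarrow> y i \<in> carrier ?Z" "Y = (\<Sum>i\<in>I. tensor ?P ?Z (b i) (y i))"
        using tensor_basis_decomp_left[OF sP sZ basis_H Y] by blast
      have "(\<Sum>i\<in>I. mul A (b i) (x i - y i)) = 0"
        using eq x y F[OF x(1)] F[OF y(1)]
        by (simp add: linear_on_diff[OF linear_mul_left k_space_axioms k_space_axioms] sum_subtractf cong: sum.cong_simp)
      then have "x i - y i = 0" if "i \<in> I" for i
        using x(1) y(1) that by (intro L.un[where z = "\<lambda>i. x i - y i"] L.Z.diff_closed)
      then show "X = Y" unfolding x(2) y(2) by (intro sum.cong refl) simp
    qed
    show "tensor_lift ?P ?Z (mul A) ` carrier (tensor_space ?P ?Z) = carrier A"
    proof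
      show "tensor_lift ?P ?Z (mul A) ` carrier (tensor_space ?P ?Z) \<subseteq> carrier A"
        using tensor_lift_closed[OF sP sZ k_space_axioms bm] by blast
      show "carrier A \<subseteq> tensor_lift ?P ?Z (mul A) ` carrier (tensor_space ?P ?Z)"
      proof
        fix x assume "x \<in> carrier A"
        then obtain z where z: "\<And>i. i \<in> I \<Longrightarrow> z i \<in> carrier ?Z" "x = (\<Sum>i\<in>I. mul A (b i) (z i))"
          using L.ex by blast
        then have "x = tensor_lift ?P ?Z (mul A) (\<Sum>i\<in>I. tensor ?P ?Z (b i) (z i))"
          using F[OF z(1)] by simp
        moreover have "(\<Sum>i\<in>I. tensor ?P ?Z (b i) (z i)) \<in> carrier (tensor_space ?P ?Z)"
          using z(1) by simp
        ultimately show "x \<in> tensor_lift ?P ?Z (mul A) ` carrier (tensor_space ?P ?Z)" by blast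
      qed
    qed
  qed
qed (simp_all add: H_subset)

theorem free_right: "free_right_module (alg_P A RR) A (mul A)"
  using right_iso R.free by (simp add: free_right_module_def right_module_iso_def)

theorem free_left: "free_left_module (alg_H A RR) A (mul A)"
  using left_iso L.free by (simp add: free_left_module_def left_module_iso_def)

theorem dimensions:
  assumes "fin_dim A"
  shows "kdim (alg_P A RR) = kdim (alg_H A RR)"
    "rat_of_nat (kdim (alg_H A RR)) = rat_of_nat (kdim A) / rat_of_nat (kdim (left_invariants A RR))"
    "rat_of_nat (kdim A) / rat_of_nat (kdim (left_invariants A RR)) =
      rat_of_nat (kdim A) / rat_of_nat (kdim (right_invariants A RR))"
proof -
  have P: "kdim (alg_P A RR) = card I" and H: "kdim (alg_H A RR) = card I"
    using k_space.kdim_basis_fam(1)[OF k_algebra.axioms(1)[OF k_algebra_P] basis_P]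
      k_space.kdim_basis_fam(1)[OF k_algebra.axioms(1)[OF k_algebra_H] basis_H] by simp_all
  show "kdim (alg_P A RR) = kdim (alg_H A RR)" by (simp add: P H)
  have r: "kdim A = kdim (right_invariants A RR) * card I" and l: "kdim A = kdim (left_invariants A RR) * card I"
    by (rule R.kdim_eq[OF assms] L.kdim_eq[OF assms])+
  \<comment> \<open>Since 1 is nonzero, so is the dimension of A; hence neither denominator is 0 and
    the quotients are genuine.\<close>
  have "kdim A \<noteq> 0"
  proof
    assume "kdim A = 0"
    obtain B where B: "basis_fam A B (\<lambda>b. b)" using fin_dim_basis_fam[OF assms] by blast
    then have "B = {}" using kdim_basis_fam(1)[OF B] \<open>kdim A = 0\<close> by (simp add: basis_fam_def)
    then show False using basis_fam_coord[OF B unity_closed] nontrivial by auto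
  qed
  then have nz: "kdim (right_invariants A RR) \<noteq> 0" "kdim (left_invariants A RR) \<noteq> 0" using l r by auto
  show "rat_of_nat (kdim (alg_H A RR)) = rat_of_nat (kdim A) / rat_of_nat (kdim (left_invariants A RR))"
    using nz unfolding H l by simp
  show "rat_of_nat (kdim A) / rat_of_nat (kdim (left_invariants A RR)) =
      rat_of_nat (kdim A) / rat_of_nat (kdim (right_invariants A RR))"
    using nz by (subst l, subst r) simp
qed

end

section \<open>From the pentagon equation to coordinates\<close>

text \<open>The first two equations solve the pentagon equation for a product of two legs; the last
  two are their inverses. In each left or right side with three factors one outer leg is contributed
  by a single factor, so slicing the other two legs yields a linear expression in that
  factor.\<close>

lemma (in k_algebra) pentagon_inverses:
  assumes closed: "r12 \<in> carrier A" "r13 \<in> carrier A" "r23 \<in> carrier A" "u12 \<in> carrier A" "u13 \<in> carrier A" "u23 \<in> carrier A"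
    and inv: "mul A r12 u12 = unity A" "mul A u12 r12 = unity A" "mul A u13 r13 = unity A"
      "mul A r13 u13 = unity A" "mul A r23 u23 = unity A" "mul A u23 r23 = unity A"
    and pentagon: "mul A (mul A r12 r13) r23 = mul A r23 r12"
  shows "mul A r12 r13 = mul A r23 (mul A r12 u23)" "mul A r13 r23 = mul A u12 (mul A r23 r12)"
    "mul A r23 (mul A u12 u23) = mul A u13 u12" "mul A u12 (mul A u23 r12) = mul A u23 u13"
proof -
  have cancel: "mul A r12 (mul A u12 x) = x" "mul A u12 (mul A r12 x) = x" "mul A u13 (mul A r13 x) = x"
    "mul A r13 (mul A u13 x) = x" "mul A r23 (mul A u23 x) = x" "mul A u23 (mul A r23 x) = x" if "x \<in> carrier A" for x
    using that closed inv by (simp_all add: mul_assoc[symmetric])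
  show n: "mul A r12 r13 = mul A r23 (mul A r12 u23)"
    using arg_cong[OF pentagon, of "\<lambda>x. mul A x u23"] closed by (simp add: mul_assoc inv)
  show m: "mul A r13 r23 = mul A u12 (mul A r23 r12)"
    using arg_cong[OF pentagon, of "mul A u12"] closed by (simp add: mul_assoc cancel)
  let ?X = "mul A r23 (mul A u12 u23)"
  have "?X = mul A (mul A u13 u12) (mul A (mul A r12 r13) ?X)"
    using closed by (simp add: mul_assoc cancel)
  also have "\<dots> = mul A u13 u12"
    unfolding n using closed by (simp add: mul_assoc cancel inv)
  finally show "?X = mul A u13 u12" .
  let ?Y = "mul A u12 (mul A u23 r12)"
  have "?Y = mul A (mul A u23 u13) (mul A (mul A r13 r23) ?Y)"
    using closed by (simp add: mul_assoc cancel)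
  also have "\<dots> = mul A u23 u13"
    unfolding m using closed by (simp add: mul_assoc cancel inv)
  finally show "?Y = mul A u23 u13" .
qed

section \<open>The threefold tensor product and the legs of R\<close>

locale tensor3 = k_algebra A for A :: "('k::field, 'a::ab_group_add) kalg"
begin

abbreviation "A2 \<equiv> tensor_alg A A"
abbreviation "A3 \<equiv> tensor_alg A A2"

sublocale AA: algebra_pair A A ..

sublocale T: k_algebra A2
  by (rule AA.k_algebra_tensor_alg)

sublocale AT: algebra_pair A A2 ..

sublocale T3: k_algebra A3
  by (rule AT.k_algebra_tensor_alg)

text \<open>Three families of legs over one index set: products then stay in this form, over the
  product of the index sets.\<close>

definition el :: "'i set \<Rightarrow> ('i \<Rightarrow> 'a) \<Rightarrow> ('i \<Rightarrow> 'a) \<Rightarrow> ('i \<Rightarrow> 'a) \<Rightarrow> _" where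
  "el I x y z = (\<Sum>i\<in>I. tensor A A2 (x i) (tensor A A (y i) (z i)))"

lemma el_closed:
  assumes "\<And>i. i \<in> I \<Longrightarrow> x i \<in> carrier A" "\<And>i. i \<in> I \<Longrightarrow> y i \<in> carrier A" "\<And>i. i \<in> I \<Longrightarrow> z i \<in> carrier A"
  shows "el I x y z \<in> carrier A3"
  using assms by (simp add: el_def)

lemma el_mul:
  assumes "\<And>i. i \<in> I \<Longrightarrow> x i \<in> carrier A" "\<And>i. i \<in> I \<Longrightarrow> y i \<in> carrier A" "\<And>i. i \<in> I \<Longrightarrow> z i \<in> carrier A"
    "\<And>i. i \<in> J \<Longrightarrow> x' i \<in> carrier A" "\<And>i. i \<in> J \<Longrightarrow> y' i \<in> carrier A" "\<And>i. i \<in> J \<Longrightarrow> z' i \<in> carrier A"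
  shows "mul A3 (el I x y z) (el J x' y' z') = el (I \<times> J) (\<lambda>p. mul A (x (fst p)) (x' (snd p)))
    (\<lambda>p. mul A (y (fst p)) (y' (snd p))) (\<lambda>p. mul A (z (fst p)) (z' (snd p)))"
proof -
  have "mul A3 (el I x y z) (el J x' y' z') = (\<Sum>i\<in>I. mul A3 (tensor A A2 (x i) (tensor A A (y i) (z i))) (el J x' y' z'))"
    unfolding el_def[of I] using assms el_closed[of J x' y' z'] by (intro T3.mul_sum_left) simp_all
  also have "\<dots> = (\<Sum>i\<in>I. \<Sum>j\<in>J. mul A3 (tensor A A2 (x i) (tensor A A (y i) (z i))) (tensor A A2 (x' j) (tensor A A (y' j) (z' j))))"
    unfolding el_def[of J] using assms by (intro sum.cong refl T3.mul_sum_right) simp_all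
  also have "\<dots> = (\<Sum>i\<in>I. \<Sum>j\<in>J. tensor A A2 (mul A (x i) (x' j)) (tensor A A (mul A (y i) (y' j)) (mul A (z i) (z' j))))"
    using assms by (intro sum.cong refl) (simp add: AT.tensor_alg_mul AA.tensor_alg_mul)
  finally show ?thesis by (simp add: el_def sum.cartesian_product case_prod_beta)
qed

text \<open>Used with maps that pair two of the three legs with functionals and return the remaining
  one.\<close>

definition slice where "slice \<beta> = tensor_lift A A2 (\<lambda>x T. tensor_lift A A (\<beta> x) T)"

lemma slice_el:
  assumes "\<And>x y. x \<in> carrier A \<Longrightarrow> y \<in> carrier A \<Longrightarrow> linear_on A A (\<lambda>z. \<beta> x y z)"
    and "\<And>x z. x \<in> carrier A \<Longrightarrow> z \<in> carrier A \<Longrightarrow> linear_on A A (\<lambda>y. \<beta> x y z)"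
    and "\<And>y z. y \<in> carrier A \<Longrightarrow> z \<in> carrier A \<Longrightarrow> linear_on A A (\<lambda>x. \<beta> x y z)"
    and "\<And>i. i \<in> I \<Longrightarrow> x i \<in> carrier A" "\<And>i. i \<in> I \<Longrightarrow> y i \<in> carrier A" "\<And>i. i \<in> I \<Longrightarrow> z i \<in> carrier A"
  shows "slice \<beta> (el I x y z) = (\<Sum>i\<in>I. \<beta> (x i) (y i) (z i))"
proof -
  note sA = k_space_axioms
  have b: "bilinear_on A A A (\<beta> x)" if "x \<in> carrier A" for x
    using assms(1,2) that by (intro bilinear_onI) auto
  have b': "bilinear_on A A2 A (\<lambda>x T. tensor_lift A A (\<beta> x) T)"
  proof (rule bilinear_onI)
    show "linear_on A2 A (tensor_lift A A (\<beta> x))" if "x \<in> carrier A" for x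
      using linear_on_tensor_lift[OF sA sA sA b[OF that]] by (simp add: linear_on_def)
    show "linear_on A A (\<lambda>x. tensor_lift A A (\<beta> x) T)" if "T \<in> carrier A2" for T
      using that by (intro linear_on_tensor_lift_param[OF sA sA sA b assms(3) sA]) simp_all
  qed
  have "slice \<beta> (el I x y z) = (\<Sum>i\<in>I. tensor_lift A A (\<beta> (x i)) (tensor A A (y i) (z i)))"
    unfolding el_def slice_def using assms(4-6) by (intro tensor_lift_sum_tensor[OF sA T.k_space_axioms sA b']) simp_all
  also have "\<dots> = (\<Sum>i\<in>I. \<beta> (x i) (y i) (z i))"
    using assms(4-6) by (intro sum.cong refl tensor_lift_tensor[OF sA sA sA b]) simp_all
  finally show ?thesis .
qed

lemma bilin_leg: "bilinear_on A A A3 (\<lambda>a b. tensor A A2 a (tensor A A b (unity A)))"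
  "bilinear_on A A A3 (\<lambda>a b. tensor A A2 a (tensor A A (unity A) b))"
  by (auto intro!: bilinear_onI linear_onI simp: tensor_add_left tensor_add_right tensor_scl_left tensor_scl_right
      tensor_scl_right[where W = A2, simplified])

lemma leg_el:
  assumes "X = (\<Sum>i\<in>I. tensor A A (x i) (y i))" "\<And>i. i \<in> I \<Longrightarrow> x i \<in> carrier A" "\<And>i. i \<in> I \<Longrightarrow> y i \<in> carrier A"
  shows "leg12 A X = el I x y (\<lambda>_. unity A)" "leg13 A X = el I x (\<lambda>_. unity A) y" "leg23 A X = el I (\<lambda>_. unity A) x y"
proof -
  show "leg12 A X = el I x y (\<lambda>_. unity A)" "leg13 A X = el I x (\<lambda>_. unity A) y"
    unfolding leg12_def leg13_def assms(1) el_def using assms(2,3)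
    by (intro tensor_lift_sum_tensor[OF k_space_axioms k_space_axioms T3.k_space_axioms bilin_leg(1)]
        tensor_lift_sum_tensor[OF k_space_axioms k_space_axioms T3.k_space_axioms bilin_leg(2)]; simp)+
  show "leg23 A X = el I (\<lambda>_. unity A) x y"
    by (simp add: leg23_def assms(1) el_def tensor_sum_right)
qed

text \<open>Each leg embedding is multiplicative and unital. For the first two this is seen by
  multiplying decompositions of \<open>X\<close> and \<open>Y\<close>.\<close>

lemma leg_inverse:
  assumes X: "X \<in> carrier A2" and Y: "Y \<in> carrier A2" and XY: "mul A2 X Y = unity A2"
  shows "mul A3 (leg12 A X) (leg12 A Y) = unity A3" "mul A3 (leg13 A X) (leg13 A Y) = unity A3"
    "mul A3 (leg23 A X) (leg23 A Y) = unity A3"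
proof -
  obtain N :: nat and x y where x: "\<And>i. i < N \<Longrightarrow> x i \<in> carrier A" "\<And>i. i < N \<Longrightarrow> y i \<in> carrier A"
    "X = (\<Sum>i<N. tensor A A (x i) (y i))"
    using tensor_sum_family[of X A A] X k_space_axioms by auto
  obtain M :: nat and z w where z: "\<And>i. i < M \<Longrightarrow> z i \<in> carrier A" "\<And>i. i < M \<Longrightarrow> w i \<in> carrier A"
    "Y = (\<Sum>i<M. tensor A A (z i) (w i))"
    using tensor_sum_family[of Y A A] Y k_space_axioms by auto
  let ?J = "{..<N} \<times> {..<M}"
  have "mul A2 X Y = (\<Sum>i<N. mul A2 (tensor A A (x i) (y i)) Y)"
    unfolding x(3) using x(1,2) Y by (intro T.mul_sum_left) simp_all
  also have "\<dots> = (\<Sum>i<N. \<Sum>j<M. mul A2 (tensor A A (x i) (y i)) (tensor A A (z j) (w j)))"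
    unfolding z(3) using x(1,2) z(1,2) by (intro sum.cong refl T.mul_sum_right) simp_all
  also have "\<dots> = (\<Sum>p\<in>?J. tensor A A (mul A (x (fst p)) (z (snd p))) (mul A (y (fst p)) (w (snd p))))"
    using x(1,2) z(1,2) by (simp add: AA.tensor_alg_mul sum.cartesian_product case_prod_beta cong: sum.cong_simp)
  finally have XY': "unity A2 = (\<Sum>p\<in>?J. tensor A A (mul A (x (fst p)) (z (snd p))) (mul A (y (fst p)) (w (snd p))))"
    using XY by simp
  \<comment> \<open>The unit as a sum over a one-point set, so that \<open>leg_el\<close> also
    computes its legs.\<close>
  have one: "unity A2 = (\<Sum>i\<in>{()}. tensor A A (unity A) (unity A))" by simp
  have one3: "el {()} (\<lambda>_. unity A) (\<lambda>_. unity A) (\<lambda>_. unity A) = unity A3" by (simp add: el_def)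
  note lx = leg_el[OF x(3)] and ly = leg_el[OF z(3)] and lxy = leg_el[OF XY'] and l1 = leg_el[OF one, unfolded one3]
  have "mul A3 (leg12 A X) (leg12 A Y) = leg12 A (unity A2)"
  proof -
    have "leg12 A X = el {..<N} x y (\<lambda>_. unity A)" "leg12 A Y = el {..<M} z w (\<lambda>_. unity A)"
      "leg12 A (unity A2) = el ?J (\<lambda>p. mul A (x (fst p)) (z (snd p))) (\<lambda>p. mul A (y (fst p)) (w (snd p))) (\<lambda>_. unity A)"
      using x(1,2) z(1,2) by (intro lx(1) ly(1) lxy(1); auto)+
    then show ?thesis using x(1,2) z(1,2) by (simp only:) (subst el_mul; auto)
  qed
  then show "mul A3 (leg12 A X) (leg12 A Y) = unity A3" using l1(1) by simp
  have "mul A3 (leg13 A X) (leg13 A Y) = leg13 A (unity A2)"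
  proof -
    have "leg13 A X = el {..<N} x (\<lambda>_. unity A) y" "leg13 A Y = el {..<M} z (\<lambda>_. unity A) w"
      "leg13 A (unity A2) = el ?J (\<lambda>p. mul A (x (fst p)) (z (snd p))) (\<lambda>_. unity A) (\<lambda>p. mul A (y (fst p)) (w (snd p)))"
      using x(1,2) z(1,2) by (intro lx(2) ly(2) lxy(2); auto)+
    then show ?thesis using x(1,2) z(1,2) by (simp only:) (subst el_mul; auto)
  qed
  then show "mul A3 (leg13 A X) (leg13 A Y) = unity A3" using l1(2) by simp
  show "mul A3 (leg23 A X) (leg23 A Y) = unity A3"
    using X Y XY by (simp add: leg23_def AT.tensor_alg_mul)
qed

end

text \<open>At this stage the inverse \<open>U\<close> is only known to lie in
  \<open>A \<otimes> A\<close>, so it has its own families \<open>c\<close>, \<open>d\<close> over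
  \<open>J\<close>; \<open>U_coords\<close> later brings it into
  \<open>P \<otimes> H\<close>.\<close>

locale pentagon_setup = tensor3 A for A :: "('k::field, 'a::ab_group_add) kalg" +
  fixes I J :: "nat set" and a b c d :: "nat \<Rightarrow> 'a" and u e :: "nat \<Rightarrow> 'k" and \<phi> \<chi> :: "nat \<Rightarrow> 'a \<Rightarrow> 'k" and R U
  assumes fin: "finite I" and finJ: "finite J"
    and a_closed [simp]: "i \<in> I \<Longrightarrow> a i \<in> carrier A" and b_closed [simp]: "i \<in> I \<Longrightarrow> b i \<in> carrier A"
    and c_closed [simp]: "i \<in> J \<Longrightarrow> c i \<in> carrier A" and d_closed [simp]: "i \<in> J \<Longrightarrow> d i \<in> carrier A"
    and a_indep: "indep_fam A I a" and b_indep: "indep_fam A I b"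
    and \<phi>_dual: "\<phi> i \<in> carrier (dual A)" and \<chi>_dual: "\<chi> i \<in> carrier (dual A)"
    and \<phi>_a: "\<lbrakk>i \<in> I; j \<in> I\<rbrakk> \<Longrightarrow> \<phi> i (a j) = (if i = j then 1 else 0)"
    and \<chi>_b: "\<lbrakk>i \<in> I; j \<in> I\<rbrakk> \<Longrightarrow> \<chi> i (b j) = (if i = j then 1 else 0)"
    and R: "R = (\<Sum>i\<in>I. tensor A A (a i) (b i))" and U: "U = (\<Sum>i\<in>J. tensor A A (c i) (d i))"
    and RU: "mul A2 R U = unity A2" and UR: "mul A2 U R = unity A2"
    and one_a: "unity A = (\<Sum>i\<in>I. scl A (u i) (a i))" and one_b: "unity A = (\<Sum>i\<in>I. scl A (e i) (b i))"
    and pent: "mul A3 (mul A3 (leg12 A R) (leg13 A R)) (leg23 A R) = mul A3 (leg23 A R) (leg12 A R)"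
begin

lemma R_closed: "R \<in> carrier A2" and U_closed: "U \<in> carrier A2"
  by (simp_all add: R U)

lemma R_el: "leg12 A R = el I a b (\<lambda>_. unity A)" "leg13 A R = el I a (\<lambda>_. unity A) b"
  "leg23 A R = el I (\<lambda>_. unity A) a b"
  by (rule leg_el[OF R]; simp)+

lemma U_el: "leg12 A U = el J c d (\<lambda>_. unity A)" "leg13 A U = el J c (\<lambda>_. unity A) d"
  "leg23 A U = el J (\<lambda>_. unity A) c d"
  by (rule leg_el[OF U]; simp)+

lemma leg_closed: "leg12 A R \<in> carrier A3" "leg13 A R \<in> carrier A3" "leg23 A R \<in> carrier A3"
  "leg12 A U \<in> carrier A3" "leg13 A U \<in> carrier A3" "leg23 A U \<in> carrier A3"
  by (simp_all only: R_el U_el) (intro el_closed; simp)+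

lemmas legs = T3.pentagon_inverses[OF leg_closed leg_inverse(1)[OF R_closed U_closed RU] leg_inverse(1)[OF U_closed R_closed UR]
  leg_inverse(2)[OF U_closed R_closed UR] leg_inverse(2)[OF R_closed U_closed RU]
  leg_inverse(3)[OF R_closed U_closed RU] leg_inverse(3)[OF U_closed R_closed UR] pent]

lemmas \<phi>_lin = linear_onD[OF dualD(1)[OF \<phi>_dual], simplified] and \<chi>_lin = linear_onD[OF dualD(1)[OF \<chi>_dual], simplified]

lemma \<phi>_comb: "q \<in> I \<Longrightarrow> \<phi> q (\<Sum>i\<in>I. scl A (x i) (a i)) = x q"
  using linear_on_lincomb[OF dualD(1)[OF \<phi>_dual] k_space_axioms k_space_ground, of I a q x] fin
  by (simp add: \<phi>_a if_distrib[where f = "\<lambda>c. _ * c"] cong: if_cong sum.cong_simp)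

lemma \<chi>_comb: "q \<in> I \<Longrightarrow> \<chi> q (\<Sum>i\<in>I. scl A (x i) (b i)) = x q"
  using linear_on_lincomb[OF dualD(1)[OF \<chi>_dual] k_space_axioms k_space_ground, of I b q x] fin
  by (simp add: \<chi>_b if_distrib[where f = "\<lambda>c. _ * c"] cong: if_cong sum.cong_simp)

text \<open>\<open>n i j l\<close> pairs \<open>R (b_l \<otimes> 1) U\<close> with
  \<open>\<chi> i\<close> and \<open>\<chi> j\<close>; \<open>m j k l\<close> pairs
  \<open>U (1 \<otimes> a_l) R\<close> with \<open>\<phi> j\<close> and \<open>\<phi> k\<close>.
  They are the coproduct coefficients of H and P.\<close>

definition n where "n i j l = (\<Sum>q\<in>I. \<Sum>r\<in>J. \<chi> i (mul A (a q) (mul A (b l) (c r))) * \<chi> j (mul A (b q) (d r)))"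
definition m where "m j k l = (\<Sum>r\<in>J. \<Sum>i\<in>I. \<phi> j (mul A (c r) (a i)) * \<phi> k (mul A (d r) (mul A (a l) (b i))))"

lemma sum_if2: "\<lbrakk>finite K; i \<in> K; j \<in> K\<rbrakk> \<Longrightarrow>
    (\<Sum>x\<in>K. \<Sum>y\<in>K. scl A ((if i = x then 1 else 0) * (if j = y then 1 else 0)) (f x y)) = f i j"
  by (simp add: if_distrib[where f = "\<lambda>c. scl A c _"] if_distrib[where f = "\<lambda>c. c * _"] if_distrib[where f = "\<lambda>c. _ * c"]
      cong: if_cong)

lemma slice12:
  assumes "\<And>p. p \<in> K \<Longrightarrow> x p \<in> carrier A" "\<And>p. p \<in> K \<Longrightarrow> y p \<in> carrier A" "\<And>p. p \<in> K \<Longrightarrow> z p \<in> carrier A"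
  shows "slice (\<lambda>x y z. scl A (\<phi> j x * \<phi> k y) z) (el K x y z) = (\<Sum>p\<in>K. scl A (\<phi> j (x p) * \<phi> k (y p)) (z p))"
  using assms by (intro slice_el)
    (auto intro!: linear_onI simp: \<phi>_lin vs.scale_left_distrib vs.scale_right_distrib algebra_simps)

lemma slice23:
  assumes "\<And>p. p \<in> K \<Longrightarrow> x p \<in> carrier A" "\<And>p. p \<in> K \<Longrightarrow> y p \<in> carrier A" "\<And>p. p \<in> K \<Longrightarrow> z p \<in> carrier A"
  shows "slice (\<lambda>x y z. scl A (\<chi> j y * \<chi> k z) x) (el K x y z) = (\<Sum>p\<in>K. scl A (\<chi> j (y p) * \<chi> k (z p)) (x p))"
  using assms by (intro slice_el)
    (auto intro!: linear_onI simp: \<chi>_lin vs.scale_left_distrib vs.scale_right_distrib algebra_simps)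

lemma slice13:
  assumes "\<And>p. p \<in> K \<Longrightarrow> x p \<in> carrier A" "\<And>p. p \<in> K \<Longrightarrow> y p \<in> carrier A" "\<And>p. p \<in> K \<Longrightarrow> z p \<in> carrier A"
  shows "slice (\<lambda>x y z. scl A (\<phi> j x * \<chi> k z) y) (el K x y z) = (\<Sum>p\<in>K. scl A (\<phi> j (x p) * \<chi> k (z p)) (y p))"
  using assms by (intro slice_el)
    (auto intro!: linear_onI simp: \<phi>_lin \<chi>_lin vs.scale_left_distrib vs.scale_right_distrib algebra_simps)

lemma sum_pairs: "sum f (K \<times> L) = (\<Sum>x\<in>K. \<Sum>y\<in>L. f (x, y))"
  by (simp add: sum.cartesian_product case_prod_beta)

text \<open>The slices of \<open>R\<^sup>2\<^sup>3 X\<^sup>1\<^sup>2 U\<^sup>2\<^sup>3\<close> and \<open>U\<^sup>1\<^sup>2 Y\<^sup>2\<^sup>3 R\<^sup>1\<^sup>2\<close> for \<open>X = \<Sum>\<^sub>l x\<^sub>l \<otimes> b\<^sub>l\<close> and \<open>Y = \<Sum>\<^sub>l a\<^sub>l \<otimes> x\<^sub>l\<close>.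
  With \<open>x = a, b\<close> they give the multiplication of \<open>P\<close> and \<open>H\<close>, and with \<open>x = Sa, Sb\<close> the
  antimultiplicativity of the antipodes.\<close>

lemma slice_n:
  assumes x: "\<And>l. l \<in> I \<Longrightarrow> x l \<in> carrier A"
    and eq: "mul A3 (leg23 A R) (mul A3 (el I x b (\<lambda>_. unity A)) (leg23 A U)) = mul A3 (el I y1 p1 q1) (el I y2 p2 q2)"
    and cl: "\<And>l. l \<in> I \<Longrightarrow> y1 l \<in> carrier A" "\<And>l. l \<in> I \<Longrightarrow> p1 l \<in> carrier A" "\<And>l. l \<in> I \<Longrightarrow> q1 l \<in> carrier A"
      "\<And>l. l \<in> I \<Longrightarrow> y2 l \<in> carrier A" "\<And>l. l \<in> I \<Longrightarrow> p2 l \<in> carrier A" "\<And>l. l \<in> I \<Longrightarrow> q2 l \<in> carrier A"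
  shows "(\<Sum>l\<in>I. scl A (n i j l) (x l)) =
    (\<Sum>k\<in>I. \<Sum>l\<in>I. scl A (\<chi> i (mul A (p1 k) (p2 l)) * \<chi> j (mul A (q1 k) (q2 l))) (mul A (y1 k) (y2 l)))"
proof -
  let ?s = "slice (\<lambda>x y z. scl A (\<chi> i y * \<chi> j z) x)"
  have "?s (mul A3 (leg23 A R) (mul A3 (el I x b (\<lambda>_. unity A)) (leg23 A U))) =
      (\<Sum>p\<in>I \<times> I \<times> J. scl A (\<chi> i (mul A (a (fst p)) (mul A (b (fst (snd p))) (c (snd (snd p))))) *
        \<chi> j (mul A (b (fst p)) (mul A (unity A) (d (snd (snd p)))))) (mul A (unity A) (mul A (x (fst (snd p))) (unity A))))"
  proof -
    have 1: "mul A3 (el I x b (\<lambda>_. unity A)) (leg23 A U) = el (I \<times> J) (\<lambda>p. mul A (x (fst p)) (unity A))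
        (\<lambda>p. mul A (b (fst p)) (c (snd p))) (\<lambda>p. mul A (unity A) (d (snd p)))"
      unfolding U_el by (rule el_mul) (simp_all add: x)
    have 2: "mul A3 (leg23 A R) (el (I \<times> J) (\<lambda>p. mul A (x (fst p)) (unity A))
        (\<lambda>p. mul A (b (fst p)) (c (snd p))) (\<lambda>p. mul A (unity A) (d (snd p)))) =
      el (I \<times> I \<times> J) (\<lambda>p. mul A (unity A) (mul A (x (fst (snd p))) (unity A)))
        (\<lambda>p. mul A (a (fst p)) (mul A (b (fst (snd p))) (c (snd (snd p)))))
        (\<lambda>p. mul A (b (fst p)) (mul A (unity A) (d (snd (snd p)))))"
      unfolding R_el by (rule el_mul) (auto simp: x)
    show ?thesis unfolding 1 2 by (rule slice23) (auto simp: x)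
  qed
  also have "\<dots> = (\<Sum>q\<in>I. \<Sum>l\<in>I. \<Sum>r\<in>J. scl A (\<chi> i (mul A (a q) (mul A (b l) (c r))) * \<chi> j (mul A (b q) (d r))) (x l))"
    by (simp add: sum_pairs x cong: sum.cong_simp)
  also have "\<dots> = (\<Sum>l\<in>I. \<Sum>q\<in>I. \<Sum>r\<in>J. scl A (\<chi> i (mul A (a q) (mul A (b l) (c r))) * \<chi> j (mul A (b q) (d r))) (x l))"
    by (rule sum.swap)
  also have "\<dots> = (\<Sum>l\<in>I. scl A (n i j l) (x l))"
    by (simp add: n_def vs.scale_sum_left)
  finally have 1: "?s (mul A3 (leg23 A R) (mul A3 (el I x b (\<lambda>_. unity A)) (leg23 A U))) = (\<Sum>l\<in>I. scl A (n i j l) (x l))" .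
  have "?s (mul A3 (el I y1 p1 q1) (el I y2 p2 q2)) =
      (\<Sum>p\<in>I \<times> I. scl A (\<chi> i (mul A (p1 (fst p)) (p2 (snd p))) * \<chi> j (mul A (q1 (fst p)) (q2 (snd p)))) (mul A (y1 (fst p)) (y2 (snd p))))"
  proof -
    have 1: "mul A3 (el I y1 p1 q1) (el I y2 p2 q2) = el (I \<times> I) (\<lambda>p. mul A (y1 (fst p)) (y2 (snd p)))
        (\<lambda>p. mul A (p1 (fst p)) (p2 (snd p))) (\<lambda>p. mul A (q1 (fst p)) (q2 (snd p)))"
      by (rule el_mul) (simp_all add: cl)
    show ?thesis unfolding 1 by (rule slice23) (auto simp: cl)
  qed
  then show ?thesis using 1 eq by (simp add: sum_pairs)
qed

lemma slice_m:
  assumes x: "\<And>l. l \<in> I \<Longrightarrow> x l \<in> carrier A"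
    and eq: "mul A3 (leg12 A U) (mul A3 (el I (\<lambda>_. unity A) a x) (leg12 A R)) = mul A3 (el I p1 q1 y1) (el I p2 q2 y2)"
    and cl: "\<And>l. l \<in> I \<Longrightarrow> y1 l \<in> carrier A" "\<And>l. l \<in> I \<Longrightarrow> p1 l \<in> carrier A" "\<And>l. l \<in> I \<Longrightarrow> q1 l \<in> carrier A"
      "\<And>l. l \<in> I \<Longrightarrow> y2 l \<in> carrier A" "\<And>l. l \<in> I \<Longrightarrow> p2 l \<in> carrier A" "\<And>l. l \<in> I \<Longrightarrow> q2 l \<in> carrier A"
  shows "(\<Sum>l\<in>I. scl A (m j k l) (x l)) =
    (\<Sum>p\<in>I. \<Sum>q\<in>I. scl A (\<phi> j (mul A (p1 p) (p2 q)) * \<phi> k (mul A (q1 p) (q2 q))) (mul A (y1 p) (y2 q)))"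
proof -
  let ?s = "slice (\<lambda>x y z. scl A (\<phi> j x * \<phi> k y) z)"
  have "?s (mul A3 (leg12 A U) (mul A3 (el I (\<lambda>_. unity A) a x) (leg12 A R))) =
      (\<Sum>p\<in>J \<times> I \<times> I. scl A (\<phi> j (mul A (c (fst p)) (mul A (unity A) (a (snd (snd p))))) *
        \<phi> k (mul A (d (fst p)) (mul A (a (fst (snd p))) (b (snd (snd p)))))) (mul A (unity A) (mul A (x (fst (snd p))) (unity A))))"
  proof -
    have 1: "mul A3 (el I (\<lambda>_. unity A) a x) (leg12 A R) = el (I \<times> I) (\<lambda>p. mul A (unity A) (a (snd p)))
        (\<lambda>p. mul A (a (fst p)) (b (snd p))) (\<lambda>p. mul A (x (fst p)) (unity A))"
      unfolding R_el by (rule el_mul) (simp_all add: x)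
    have 2: "mul A3 (leg12 A U) (el (I \<times> I) (\<lambda>p. mul A (unity A) (a (snd p)))
        (\<lambda>p. mul A (a (fst p)) (b (snd p))) (\<lambda>p. mul A (x (fst p)) (unity A))) =
      el (J \<times> I \<times> I) (\<lambda>p. mul A (c (fst p)) (mul A (unity A) (a (snd (snd p)))))
        (\<lambda>p. mul A (d (fst p)) (mul A (a (fst (snd p))) (b (snd (snd p)))))
        (\<lambda>p. mul A (unity A) (mul A (x (fst (snd p))) (unity A)))"
      unfolding U_el by (rule el_mul) (auto simp: x)
    show ?thesis unfolding 1 2 by (rule slice12) (auto simp: x)
  qed
  also have "\<dots> = (\<Sum>r\<in>J. \<Sum>l\<in>I. \<Sum>i\<in>I. scl A (\<phi> j (mul A (c r) (a i)) * \<phi> k (mul A (d r) (mul A (a l) (b i)))) (x l))"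
    by (simp add: sum_pairs x cong: sum.cong_simp)
  also have "\<dots> = (\<Sum>l\<in>I. \<Sum>r\<in>J. \<Sum>i\<in>I. scl A (\<phi> j (mul A (c r) (a i)) * \<phi> k (mul A (d r) (mul A (a l) (b i)))) (x l))"
    by (rule sum.swap)
  also have "\<dots> = (\<Sum>l\<in>I. scl A (m j k l) (x l))"
    by (simp add: m_def vs.scale_sum_left)
  finally have 1: "?s (mul A3 (leg12 A U) (mul A3 (el I (\<lambda>_. unity A) a x) (leg12 A R))) = (\<Sum>l\<in>I. scl A (m j k l) (x l))" .
  have "?s (mul A3 (el I p1 q1 y1) (el I p2 q2 y2)) =
      (\<Sum>p\<in>I \<times> I. scl A (\<phi> j (mul A (p1 (fst p)) (p2 (snd p))) * \<phi> k (mul A (q1 (fst p)) (q2 (snd p)))) (mul A (y1 (fst p)) (y2 (snd p))))"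
  proof -
    have 1: "mul A3 (el I p1 q1 y1) (el I p2 q2 y2) = el (I \<times> I) (\<lambda>p. mul A (p1 (fst p)) (p2 (snd p)))
        (\<lambda>p. mul A (q1 (fst p)) (q2 (snd p))) (\<lambda>p. mul A (y1 (fst p)) (y2 (snd p)))"
      by (rule el_mul) (simp_all add: cl)
    show ?thesis unfolding 1 by (rule slice12) (auto simp: cl)
  qed
  then show ?thesis using 1 eq by (simp add: sum_pairs)
qed

text \<open>In the slice of the first equation of \<open>legs\<close> the two right legs of R12 R13
  are \<open>b k\<close> and \<open>b l\<close>, so the dual functionals single out
  \<open>a i a j\<close>.\<close>

lemma a_a: "\<lbrakk>i \<in> I; j \<in> I\<rbrakk> \<Longrightarrow> mul A (a i) (a j) = (\<Sum>l\<in>I. scl A (n i j l) (a l))"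
  using slice_n[of a a b "\<lambda>_. unity A" a "\<lambda>_. unity A" b i j] legs(1) fin
  by (simp add: R_el(1,2) \<chi>_b sum_if2 cong: sum.cong_simp)

lemma b_b: "\<lbrakk>j \<in> I; k \<in> I\<rbrakk> \<Longrightarrow> mul A (b j) (b k) = (\<Sum>l\<in>I. scl A (m j k l) (b l))"
  using slice_m[of b a "\<lambda>_. unity A" b "\<lambda>_. unity A" a b j k] legs(2) fin
  by (simp add: R_el(2,3) \<phi>_a sum_if2 cong: sum.cong_simp)

text \<open>Pair the outer legs of the pentagon equation with \<open>\<phi> p\<close> and
  \<open>\<chi> l\<close>. R23 R12 leaves \<open>a l b p\<close>; on the other side the products in
  the outer legs are already known from \<open>a_a\<close> and \<open>b_b\<close>.\<close>

lemma a_b: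
  assumes "l \<in> I" "p \<in> I"
  shows "mul A (a l) (b p) = (\<Sum>i\<in>I. \<Sum>j\<in>I. \<Sum>k\<in>I. scl A (m j k l * n i j p) (mul A (b i) (a k)))"
proof -
  let ?s = "slice (\<lambda>x y z. scl A (\<phi> p x * \<chi> l z) y)"
  have "?s (mul A3 (leg23 A R) (leg12 A R)) =
      (\<Sum>q\<in>I \<times> I. scl A (\<phi> p (mul A (unity A) (a (snd q))) * \<chi> l (mul A (b (fst q)) (unity A))) (mul A (a (fst q)) (b (snd q))))"
  proof -
    have 1: "mul A3 (leg23 A R) (leg12 A R) = el (I \<times> I) (\<lambda>q. mul A (unity A) (a (snd q)))
        (\<lambda>q. mul A (a (fst q)) (b (snd q))) (\<lambda>q. mul A (b (fst q)) (unity A))"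
      unfolding R_el by (rule el_mul) simp_all
    show ?thesis unfolding 1 by (rule slice13) auto
  qed
  also have "\<dots> = mul A (a l) (b p)"
    using assms fin sum_if2[OF fin assms, of "\<lambda>x y. mul A (a x) (b y)"] by (simp add: sum_pairs \<phi>_a \<chi>_b mult.commute cong: sum.cong_simp)
  finally have 1: "?s (mul A3 (leg23 A R) (leg12 A R)) = mul A (a l) (b p)" .
  have "?s (mul A3 (mul A3 (leg12 A R) (leg13 A R)) (leg23 A R)) =
      (\<Sum>q\<in>(I \<times> I) \<times> I. scl A (\<phi> p (mul A (mul A (a (fst (fst q))) (a (snd (fst q)))) (unity A)) *
        \<chi> l (mul A (mul A (unity A) (b (snd (fst q)))) (b (snd q)))) (mul A (mul A (b (fst (fst q))) (unity A)) (a (snd q))))"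
  proof -
    have 1: "mul A3 (leg12 A R) (leg13 A R) = el (I \<times> I) (\<lambda>q. mul A (a (fst q)) (a (snd q)))
        (\<lambda>q. mul A (b (fst q)) (unity A)) (\<lambda>q. mul A (unity A) (b (snd q)))"
      unfolding R_el by (rule el_mul) simp_all
    have 2: "mul A3 (el (I \<times> I) (\<lambda>q. mul A (a (fst q)) (a (snd q)))
        (\<lambda>q. mul A (b (fst q)) (unity A)) (\<lambda>q. mul A (unity A) (b (snd q)))) (leg23 A R) =
      el ((I \<times> I) \<times> I) (\<lambda>q. mul A (mul A (a (fst (fst q))) (a (snd (fst q)))) (unity A))
        (\<lambda>q. mul A (mul A (b (fst (fst q))) (unity A)) (a (snd q)))
        (\<lambda>q. mul A (mul A (unity A) (b (snd (fst q)))) (b (snd q)))"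
      unfolding R_el by (rule el_mul) auto
    show ?thesis unfolding 1 2 by (rule slice13) auto
  qed
  also have "\<dots> = (\<Sum>i\<in>I. \<Sum>j\<in>I. \<Sum>k\<in>I. scl A (m j k l * n i j p) (mul A (b i) (a k)))"
    using assms by (simp add: sum_pairs a_a b_b \<phi>_comb \<chi>_comb mult.commute cong: sum.cong_simp)
  finally show ?thesis using 1 pent by simp
qed

text \<open>The span of the \<open>a i \<otimes> b j\<close> contains 1 and is stable under R by
  \<open>a_a\<close> and \<open>b_b\<close>, so it contains the inverse of R.\<close>

lemma U_coords:
  obtains s where "U = (\<Sum>k\<in>I. \<Sum>j\<in>I. fun_scl (s k j) (tensor A A (a k) (b j)))"
proof -
  let ?v = "\<lambda>(i, j). tensor A A (a i) (b j)"
  let ?S = "lspan A2 (I \<times> I) ?v"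
  let ?V = "A2\<lparr>carrier := ?S\<rparr>"
  have fin2: "finite (I \<times> I)" using fin by simp
  have sub: "fs.subspace ?S" using T.subspace_lspan[of "I \<times> I" ?v] by simp
  have vin: "tensor A A (a i) (b j) \<in> ?S" if "i \<in> I" "j \<in> I" for i j
    using T.lspan_base[OF fin2, of "(i, j)" ?v] that by simp
  have S: "?S \<subseteq> carrier A2"
    by (rule T.lspan_subset) auto
  have "U \<in> carrier ?V"
  proof (rule T.inverse_in_subspace[where X = R])
    show "k_space ?V" by (rule T.k_space_lspan[of _ "I \<times> I" ?v]) simp_all
    show "fin_dim ?V" by (rule T.fin_dim_lspan[of _ "I \<times> I" ?v]) (simp_all add: fin)
    have "tensor A A (unity A) (unity A) = (\<Sum>i\<in>I. tensor A A (scl A (u i) (a i)) (unity A))"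
      by (subst one_a, subst tensor_sum_left) simp
    also have "\<dots> = (\<Sum>i\<in>I. \<Sum>j\<in>I. fun_scl (u i * e j) (tensor A A (a i) (b j)))"
      by (subst one_b) (simp add: tensor_sum_right tensor_scl_left tensor_scl_right fs.scale_sum_right mult.commute)
    also have "\<dots> \<in> ?S"
      by (intro fs.subspace_sum[OF sub] fs.subspace_scale[OF sub] vin)
    finally show "unity A2 \<in> carrier ?V" by simp
    fix Z assume "Z \<in> carrier ?V"
    then obtain c where Z: "Z = (\<Sum>p\<in>I \<times> I. fun_scl (c p) (?v p))"
      by (auto elim!: lspanE)
    have base: "mul A2 R (?v p) \<in> ?S" if p: "p \<in> I \<times> I" for p
    proof -
      obtain k l where kl: "p = (k, l)" "k \<in> I" "l \<in> I" using p by auto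
      have "mul A2 R (?v p) = (\<Sum>i\<in>I. tensor A A (mul A (a i) (a k)) (mul A (b i) (b l)))"
        using kl by (simp add: R T.mul_sum_left AA.tensor_alg_mul cong: sum.cong_simp)
      also have "\<dots> = (\<Sum>i\<in>I. \<Sum>q\<in>I. \<Sum>p\<in>I. fun_scl (m i l q * n i k p) (tensor A A (a p) (b q)))"
        using kl by (simp add: a_a b_b tensor_sum_left tensor_sum_right tensor_scl_left tensor_scl_right
            fs.scale_sum_right cong: sum.cong_simp)
      also have "\<dots> \<in> ?S"
        by (intro fs.subspace_sum[OF sub] fs.subspace_scale[OF sub] vin)
      finally show ?thesis .
    qed
    have "mul A2 R Z = (\<Sum>p\<in>I \<times> I. fun_scl (c p) (mul A2 R (?v p)))"
      unfolding Z using R_closed by (subst T.mul_sum_right) (auto simp: T.mul_scl_right[simplified] intro!: sum.cong)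
    also have "\<dots> \<in> ?S"
      by (intro fs.subspace_sum[OF sub] fs.subspace_scale[OF sub] base)
    finally show "mul A2 R Z \<in> carrier ?V" by simp
  qed (use S R_closed U_closed UR in auto)
  then obtain c where "U = (\<Sum>p\<in>I \<times> I. fun_scl (c p) (?v p))"
    by (auto elim!: lspanE)
  then have "U = (\<Sum>k\<in>I. \<Sum>j\<in>I. fun_scl (c (k, j)) (tensor A A (a k) (b j)))"
    by (simp add: sum_pairs)
  then show thesis by (rule that)
qed

theorem coords:
  assumes nontrivial: "unity A \<noteq> 0"
  obtains s where "pentagon_coords A I a b n m u e s"
proof -
  obtain s where s: "U = (\<Sum>k\<in>I. \<Sum>j\<in>I. fun_scl (s k j) (tensor A A (a k) (b j)))"
    using U_coords by blast
  define Sa where "Sa i = (\<Sum>k\<in>I. scl A (s k i) (a k))" for i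
  define Sb where "Sb i = (\<Sum>k\<in>I. scl A (s i k) (b k))" for i
  have cl [simp]: "Sa i \<in> carrier A" "Sb i \<in> carrier A" for i by (simp_all add: Sa_def Sb_def)
  have Ub: "U = (\<Sum>i\<in>I. tensor A A (a i) (Sb i))"
    by (simp add: s Sb_def tensor_sum_right tensor_scl_right)
  have Ua: "U = (\<Sum>i\<in>I. tensor A A (Sa i) (b i))"
    unfolding s Sa_def by (simp add: tensor_sum_left tensor_scl_left) (rule sum.swap)
  \<comment> \<open>The third equation of \<open>legs\<close> has the shape of the first with
    \<open>Sa\<close> in place of \<open>a\<close>, but ends in U13 U12, whence the reversed
    order.\<close>
  have SaSa: "mul A (Sa j) (Sa i) = (\<Sum>l\<in>I. scl A (n i j l) (Sa l))" if ij: "i \<in> I" "j \<in> I" for i j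
  proof -
    have "(\<Sum>l\<in>I. scl A (n i j l) (Sa l)) = (\<Sum>x\<in>I. \<Sum>y\<in>I. scl A (\<chi> i (mul A (unity A) (b y)) * \<chi> j (mul A (b x) (unity A))) (mul A (Sa x) (Sa y)))"
    proof (rule slice_n)
      show "mul A3 (leg23 A R) (mul A3 (el I Sa b (\<lambda>_. unity A)) (leg23 A U)) =
          mul A3 (el I Sa (\<lambda>_. unity A) b) (el I Sa b (\<lambda>_. unity A))"
        using legs(3) by (simp add: leg_el(1,2)[OF Ua])
    qed simp_all
    then show ?thesis
      using ij sum_if2[OF fin ij(2,1), of "\<lambda>x y. mul A (Sa x) (Sa y)"] by (simp add: \<chi>_b mult.commute cong: sum.cong_simp)
  qed
  have SbSb: "mul A (Sb k) (Sb j) = (\<Sum>l\<in>I. scl A (m j k l) (Sb l))" if jk: "j \<in> I" "k \<in> I" for j k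
  proof -
    have "(\<Sum>l\<in>I. scl A (m j k l) (Sb l)) = (\<Sum>x\<in>I. \<Sum>y\<in>I. scl A (\<phi> j (mul A (unity A) (a y)) * \<phi> k (mul A (a x) (unity A))) (mul A (Sb x) (Sb y)))"
    proof (rule slice_m)
      show "mul A3 (leg12 A U) (mul A3 (el I (\<lambda>_. unity A) a Sb) (leg12 A R)) =
          mul A3 (el I (\<lambda>_. unity A) a Sb) (el I a (\<lambda>_. unity A) Sb)"
        using legs(4) by (simp add: leg_el(2,3)[OF Ub])
    qed simp_all
    then show ?thesis
      using jk sum_if2[OF fin jk(2,1), of "\<lambda>x y. mul A (Sb x) (Sb y)"] by (simp add: \<phi>_a mult.commute cong: sum.cong_simp)
  qed
  have pair: "bilinear_on A A (ground :: ('k, 'k) kalg) (\<lambda>x y. \<phi> q x * \<chi> l y)" for q l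
    by (intro bilinear_onI linear_onI) (auto simp: \<phi>_lin \<chi>_lin algebra_simps)
  \<comment> \<open>Pairing an equation of the form X Z = 1 with \<open>\<phi> q\<close> and
    \<open>\<chi> l\<close> gives one scalar identity, with right side the coordinates of
    \<open>1 \<otimes> 1\<close>. For U R = 1 and R U = 1 these are the two antipode laws.\<close>
  have pair_mul: "(\<Sum>j\<in>I. \<Sum>k\<in>I. \<phi> q (mul A (x j) (z k)) * \<chi> l (mul A (b j) (b k))) = e l * u q"
    if eq: "mul A2 (\<Sum>i\<in>I. tensor A A (x i) (b i)) (\<Sum>i\<in>I. tensor A A (z i) (b i)) = unity A2"
      and xz: "\<And>i. i \<in> I \<Longrightarrow> x i \<in> carrier A" "\<And>i. i \<in> I \<Longrightarrow> z i \<in> carrier A" and lq: "l \<in> I" "q \<in> I" for x z l q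
  proof -
    let ?s = "tensor_lift A A (\<lambda>x y. \<phi> q x * \<chi> l y)"
    have "mul A2 (\<Sum>i\<in>I. tensor A A (x i) (b i)) (\<Sum>i\<in>I. tensor A A (z i) (b i)) =
        (\<Sum>i\<in>I. mul A2 (tensor A A (x i) (b i)) (\<Sum>i\<in>I. tensor A A (z i) (b i)))"
      using xz by (intro T.mul_sum_left) simp_all
    also have "\<dots> = (\<Sum>i\<in>I. \<Sum>k\<in>I. tensor A A (mul A (x i) (z k)) (mul A (b i) (b k)))"
      using xz by (simp add: T.mul_sum_right AA.tensor_alg_mul cong: sum.cong_simp)
    also have "\<dots> = (\<Sum>p\<in>I \<times> I. tensor A A (mul A (x (fst p)) (z (snd p))) (mul A (b (fst p)) (b (snd p))))"
      by (simp add: sum_pairs)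
    finally have "?s (mul A2 (\<Sum>i\<in>I. tensor A A (x i) (b i)) (\<Sum>i\<in>I. tensor A A (z i) (b i))) =
        (\<Sum>p\<in>I \<times> I. \<phi> q (mul A (x (fst p)) (z (snd p))) * \<chi> l (mul A (b (fst p)) (b (snd p))))"
      using xz by (simp only:) (intro tensor_lift_sum_tensor[OF k_space_axioms k_space_axioms k_space_ground pair]; auto)
    moreover have "?s (tensor A A (unity A) (unity A)) = \<phi> q (unity A) * \<chi> l (unity A)"
      by (intro tensor_lift_tensor[OF k_space_axioms k_space_axioms k_space_ground pair]) simp_all
    moreover have "\<phi> q (unity A) = u q" using lq by (subst one_a) (rule \<phi>_comb)
    moreover have "\<chi> l (unity A) = e l" using lq by (subst one_b) (rule \<chi>_comb)
    ultimately show ?thesis using eq by (simp add: sum_pairs mult.commute)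
  qed
  have swap_comb: "(\<Sum>p\<in>I. scl A (c p) (\<Sum>l\<in>I. scl A (d p l) (v l))) = (\<Sum>l\<in>I. scl A (\<Sum>p\<in>I. c p * d p l) (v l))" for c d v
    by (simp add: vs.scale_sum_right vs.scale_sum_left) (rule sum.swap)
  have Sa_a: "mul A (Sa j) (a k) = (\<Sum>q\<in>I. scl A (\<Sum>i\<in>I. s i j * n i k q) (a q))"
    and a_Sa: "mul A (a k) (Sa j) = (\<Sum>q\<in>I. scl A (\<Sum>i\<in>I. s i j * n k i q) (a q))" if "j \<in> I" "k \<in> I" for j k
    using that by (simp_all add: Sa_def mul_sum_left mul_sum_right mul_scl_left mul_scl_right a_a swap_comb cong: sum.cong_simp)
  have "pentagon_coords A I a b n m u e s"
  proof unfold_locales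
    fix l q assume lq: "l \<in> I" "q \<in> I"
    have "(\<Sum>j\<in>I. \<Sum>k\<in>I. \<phi> q (mul A (Sa j) (a k)) * \<chi> l (mul A (b j) (b k))) = e l * u q"
      by (rule pair_mul[OF _ _ _ lq]) (use UR in \<open>simp_all add: Ua[symmetric] R[symmetric]\<close>)
    then show "(\<Sum>j\<in>I. \<Sum>k\<in>I. \<Sum>i\<in>I. m j k l * s i j * n i k q) = e l * u q"
      using lq by (simp add: Sa_a b_b \<phi>_comb \<chi>_comb sum_distrib_left sum_distrib_right mult_ac cong: sum.cong_simp)
    have "(\<Sum>j\<in>I. \<Sum>k\<in>I. \<phi> q (mul A (a j) (Sa k)) * \<chi> l (mul A (b j) (b k))) = e l * u q"
      by (rule pair_mul[OF _ _ _ lq]) (use RU in \<open>simp_all add: Ua[symmetric] R[symmetric]\<close>)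
    then show "(\<Sum>j\<in>I. \<Sum>k\<in>I. \<Sum>i\<in>I. m j k l * s i k * n j i q) = e l * u q"
      using lq by (simp add: a_Sa b_b \<phi>_comb \<chi>_comb sum_distrib_left sum_distrib_right mult_ac cong: sum.cong_simp)
  qed (use fin nontrivial a_indep b_indep a_a b_b one_a one_b a_b SaSa SbSb in \<open>simp_all add: Sa_def Sb_def\<close>)
  then show thesis by (rule that)
qed

end

section \<open>Decompositions of minimal length\<close>

lemma tensor_length_le:
  fixes x :: "'i \<Rightarrow> 'a::ab_group_add"
  assumes "finite K" "\<And>i. i \<in> K \<Longrightarrow> x i \<in> carrier A" "\<And>i. i \<in> K \<Longrightarrow> y i \<in> carrier A"
    "R = (\<Sum>i\<in>K. tensor A A (x i) (y i))"
  shows "tensor_length A R \<le> card K"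
proof -
  obtain xs where xs: "set xs = K" "distinct xs"
    using finite_distinct_list[OF assms(1)] by blast
  show ?thesis
    unfolding tensor_length_def
  proof (rule Least_le, rule exI[of _ "map (\<lambda>i. (x i, y i)) xs"], intro conjI)
    show "length (map (\<lambda>i. (x i, y i)) xs) = card K"
      using xs distinct_card by force
    show "set (map (\<lambda>i. (x i, y i)) xs) \<subseteq> carrier A \<times> carrier A"
      using xs(1) assms(2,3) by auto
    show "R = (\<Sum>(a, b)\<leftarrow>map (\<lambda>i. (x i, y i)) xs. tensor A A a b)"
      using sum.distinct_set_conv_list[OF xs(2), of "\<lambda>i. tensor A A (x i) (y i)"] xs(1) assms(4)
      by (simp add: o_def)
  qed
qed

lemma minimal_decomposition:
  fixes A :: "('k::field, 'a::ab_group_add) kalg"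
  assumes A: "k_space A" and R: "R \<in> carrier (tensor_space A A)"
  obtains a b where "\<And>i. i < tensor_length A R \<Longrightarrow> a i \<in> carrier A" "\<And>i. i < tensor_length A R \<Longrightarrow> b i \<in> carrier A"
    "R = (\<Sum>i<tensor_length A R. tensor A A (a i) (b i))"
    "indep_fam A {..<tensor_length A R} a" "indep_fam A {..<tensor_length A R} b"
proof -
  interpret k_space A by fact
  let ?P = "\<lambda>m. \<exists>ts. length ts = m \<and> set ts \<subseteq> carrier A \<times> carrier A \<and> R = (\<Sum>(a, b)\<leftarrow>ts. tensor A A a b)"
  have "\<exists>m. ?P m"
    using tensor_space_sum[OF A R] by metis
  from LeastI_ex[OF this] obtain ts where ts: "length ts = tensor_length A R" "set ts \<subseteq> carrier A \<times> carrier A"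
    "R = (\<Sum>(a, b)\<leftarrow>ts. tensor A A a b)"
    unfolding tensor_length_def by blast
  define N where "N = tensor_length A R"
  define a where "a i = fst (ts ! i)" for i
  define b where "b i = snd (ts ! i)" for i
  have ab: "a i \<in> carrier A" "b i \<in> carrier A" if "i < N" for i
  proof -
    have "ts ! i \<in> carrier A \<times> carrier A"
      using that ts(1) by (intro subsetD[OF ts(2)] nth_mem) (simp add: N_def)
    then show "a i \<in> carrier A" "b i \<in> carrier A"
      by (auto simp: a_def b_def mem_Times_iff)
  qed
  have Rab: "R = (\<Sum>i<N. tensor A A (a i) (b i))"
    using ts(1) by (simp add: ts(3) sum_list_sum_nth atLeast0LessThan case_prod_beta N_def a_def b_def)
  \<comment> \<open>A decomposition of the same length with a vanishing term would contradict
    minimality.\<close>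
  have short: False if "j < N" "R = (\<Sum>i<N. tensor A A (x i) (y i))" "tensor A A (x j) (y j) = 0"
    "\<And>i. i < N \<Longrightarrow> x i \<in> carrier A" "\<And>i. i < N \<Longrightarrow> y i \<in> carrier A" for j x y
  proof -
    have "R = (\<Sum>i\<in>{..<N} - {j}. tensor A A (x i) (y i))"
      using that(1-3) by (simp add: sum.remove[of "{..<N}" j])
    then have "N \<le> card ({..<N} - {j})"
      using that(4,5) unfolding N_def by (intro tensor_length_le) auto
    then show False using that(1) by simp
  qed
  have div: "(\<Sum>i<N. scl A (c i / c j) (x i)) = 0" if "(\<Sum>i<N. scl A (c i) (x i)) = 0" for c x and j :: nat
  proof -
    have "(\<Sum>i<N. scl A (c i / c j) (x i)) = scl A (1 / c j) (\<Sum>i<N. scl A (c i) (x i))"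
      by (simp add: vs.scale_sum_right)
    then show ?thesis using that by simp
  qed
  have ia: "indep_fam A {..<N} a"
    unfolding indep_fam_def
  proof (intro allI impI ballI, rule ccontr)
    fix c j assume c: "(\<Sum>i<N. scl A (c i) (a i)) = 0" and j: "j \<in> {..<N}" "c j \<noteq> 0"
    \<comment> \<open>A relation among the \<open>a i\<close>, normalised at \<open>j\<close>,
      allows subtracting a tensor that is 0; the correction makes the \<open>j\<close>-th right leg
      vanish.\<close>
    have "(\<Sum>i<N. tensor A A (a i) (b i - scl A (c i / c j) (b j))) = R - tensor A A (\<Sum>i<N. scl A (c i / c j) (a i)) (b j)"
      unfolding Rab tensor_sum_left by (simp add: tensor_diff_right tensor_scl_left tensor_scl_right sum_subtractf)
    then have "R = (\<Sum>i<N. tensor A A (a i) (b i - scl A (c i / c j) (b j)))"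
      by (simp add: div[OF c] tensor_zero_left)
    then show False
      using j ab by (intro short[where j = j and x = a and y = "\<lambda>i. b i - scl A (c i / c j) (b j)"]) (auto simp: tensor_zero_right)
  qed
  have ib: "indep_fam A {..<N} b"
    unfolding indep_fam_def
  proof (intro allI impI ballI, rule ccontr)
    fix c j assume c: "(\<Sum>i<N. scl A (c i) (b i)) = 0" and j: "j \<in> {..<N}" "c j \<noteq> 0"
    have "(\<Sum>i<N. tensor A A (a i - scl A (c i / c j) (a j)) (b i)) = R - tensor A A (a j) (\<Sum>i<N. scl A (c i / c j) (b i))"
      unfolding Rab tensor_sum_right by (simp add: tensor_diff_left tensor_scl_left tensor_scl_right sum_subtractf)
    then have "R = (\<Sum>i<N. tensor A A (a i - scl A (c i / c j) (a j)) (b i))"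
      by (simp add: div[OF c] tensor_zero_right)
    then show False
      using j ab by (intro short[where j = j and x = "\<lambda>i. a i - scl A (c i / c j) (a j)" and y = b]) (auto simp: tensor_zero_left)
  qed
  show thesis
    using ab Rab ia ib unfolding N_def by (intro that)
qed

lemma pentagon_coordinates:
  fixes A :: "('k::field, 'a::ab_group_add) kalg"
  assumes A: "k_algebra A" and R: "R \<in> carrier (tensor_alg A A)" "R \<noteq> 0"
    and unit: "R \<in> Units (mult_monoid (tensor_alg A A))" and unitary: "unitary A R" and pent: "pentagon A R"
  obtains a b n m u e s where "pentagon_coords A {..<tensor_length A R} a b n m u e s"
    "R = (\<Sum>i<tensor_length A R. tensor A A (a i) (b i))"
proof -
  interpret tensor3 A by (rule tensor3.intro[OF A])
  define N where "N = tensor_length A R"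
  obtain a b where ab: "\<And>i. i < N \<Longrightarrow> a i \<in> carrier A" "\<And>i. i < N \<Longrightarrow> b i \<in> carrier A"
    "R = (\<Sum>i<N. tensor A A (a i) (b i))" "indep_fam A {..<N} a" "indep_fam A {..<N} b"
    using minimal_decomposition[OF k_space_axioms, of R] R(1) unfolding N_def by auto
  define U where "U = tens_inv A R"
  have U: "U \<in> carrier A2" "mul A2 R U = unity A2" "mul A2 U R = unity A2"
    using monoid.Units_inv_closed[OF T.monoid unit] monoid.Units_r_inv[OF T.monoid unit]
      monoid.Units_l_inv[OF T.monoid unit] by (simp_all add: U_def tens_inv_def)
  obtain M :: nat and c d where cd: "\<And>i. i < M \<Longrightarrow> c i \<in> carrier A" "\<And>i. i < M \<Longrightarrow> d i \<in> carrier A"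
    "U = (\<Sum>i<M. tensor A A (c i) (d i))"
    using tensor_sum_family[of U A A] U(1) k_space_axioms by auto
  obtain \<phi> where \<phi>: "\<And>i. \<phi> i \<in> carrier (dual A)"
    "\<And>i j. i \<in> {..<N} \<Longrightarrow> j \<in> {..<N} \<Longrightarrow> a j \<in> carrier A \<Longrightarrow> \<phi> i (a j) = (if i = j then 1 else 0)"
    using dual_functionals[OF k_space_axioms finite_lessThan ab(4)] by blast
  obtain \<chi> where \<chi>: "\<And>i. \<chi> i \<in> carrier (dual A)"
    "\<And>i j. i \<in> {..<N} \<Longrightarrow> j \<in> {..<N} \<Longrightarrow> b j \<in> carrier A \<Longrightarrow> \<chi> i (b j) = (if i = j then 1 else 0)"
    using dual_functionals[OF k_space_axioms finite_lessThan ab(5)] by blast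
  \<comment> \<open>Unitarity supplies the coordinates of 1: a functional producing 1 as a left
    coefficient has values at the \<open>b i\<close> that serve as \<open>u i\<close>.\<close>
  obtain \<psi> where \<psi>: "\<psi> \<in> carrier (dual A)" "unity A = tensor_lift A A (\<lambda>a b. scl A (\<psi> b) a) R"
    using unitary by (auto simp: unitary_def left_coeff_def)
  have one_a: "unity A = (\<Sum>i<N. scl A (\<psi> (b i)) (a i))"
    unfolding \<psi>(2) ab(3) using ab(1,2)
    by (intro tensor_lift_sum_tensor[OF k_space_axioms k_space_axioms k_space_axioms bilinear_on_slice_right[OF \<psi>(1) k_space_axioms]]) simp_all
  obtain \<xi> where \<xi>: "\<xi> \<in> carrier (dual A)" "unity A = tensor_lift A A (\<lambda>a b. scl A (\<xi> a) b) R"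
    using unitary by (auto simp: unitary_def right_coeff_def)
  have one_b: "unity A = (\<Sum>i<N. scl A (\<xi> (a i)) (b i))"
    unfolding \<xi>(2) ab(3) using ab(1,2)
    by (intro tensor_lift_sum_tensor[OF k_space_axioms k_space_axioms k_space_axioms bilinear_on_slice_left[OF \<xi>(1) k_space_axioms]]) simp_all
  have nontrivial: "unity A \<noteq> 0"
  proof
    assume "unity A = 0"
    then have "unity A2 = 0" by (simp add: tensor_zero_left)
    then have "R = 0" using T.mul_unity_right[of R] T.mul_zero_right[of R] R(1) by simp
    then show False using R(2) by simp
  qed
  interpret pentagon_setup A "{..<N}" "{..<M}" a b c d "\<lambda>i. \<psi> (b i)" "\<lambda>i. \<xi> (a i)" \<phi> \<chi> R U
  proof unfold_locales
    show "mul A3 (mul A3 (leg12 A R) (leg13 A R)) (leg23 A R) = mul A3 (leg23 A R) (leg12 A R)"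
      using pent by (simp add: pentagon_def Let_def)
  qed (use ab cd \<phi> \<chi> U one_a one_b in simp_all)
  show thesis
    by (rule coords[OF nontrivial]) (rule that[folded N_def, OF _ ab(3)])
qed

section \<open>Functoriality and the theorem\<close>

text \<open>An algebra isomorphism preserves all defining relations with the same scalars, so the
  two Hopf algebras share their datum.\<close>

lemma (in pentagon_coords) transport:
  fixes B :: "('k, 'b::ab_group_add) kalg"
  assumes B: "k_algebra B" and f: "alg_iso A B f"
  shows "pentagon_coords B I (\<lambda>i. f (a i)) (\<lambda>i. f (b i)) n m u e s"
    and "pentagon_coords.RR B I (\<lambda>i. f (a i)) (\<lambda>i. f (b i)) = tensor_map A A B B f f RR"
proof -
  interpret B: k_algebra B by (rule B)
  have lin: "linear_on A B f" and one: "f (unity A) = unity B" and inj: "inj_on f (carrier A)"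
    and fm: "\<And>x y. x \<in> carrier A \<Longrightarrow> y \<in> carrier A \<Longrightarrow> f (mul A x y) = mul B (f x) (f y)"
    using f by (auto simp: alg_iso_def alg_hom_def bij_betw_def)
  have comb: "f (\<Sum>i\<in>K. scl A (c i) (x i)) = (\<Sum>i\<in>K. scl B (c i) (f (x i)))"
    if "\<And>i. i \<in> K \<Longrightarrow> x i \<in> carrier A" for K :: "'i set" and c x
    using linear_on_lincomb[OF lin k_space_axioms B.k_space_axioms] that by blast
  have fsum: "f (\<Sum>i\<in>K. x i) = (\<Sum>i\<in>K. f (x i))" if "\<And>i. i \<in> K \<Longrightarrow> x i \<in> carrier A" for K :: "'i set" and x
    using linear_on_sum[OF lin k_space_axioms B.k_space_axioms] that by blast
  have f0: "f 0 = 0" by (rule linear_on_zero[OF lin k_space_axioms B.k_space_axioms])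
  have fz: "x = 0" if "x \<in> carrier A" "f x = 0" for x
    using inj that f0 by (metis inj_on_eq_iff zero_closed)
  have indep: "indep_fam B I (\<lambda>i. f (v i))" if v: "indep_fam A I v" "\<And>i. i \<in> I \<Longrightarrow> v i \<in> carrier A" for v
    unfolding indep_fam_def
  proof (intro allI impI)
    fix c assume "(\<Sum>i\<in>I. scl B (c i) (f (v i))) = 0"
    then have "(\<Sum>i\<in>I. scl A (c i) (v i)) = 0"
      using v(2) by (intro fz) (simp_all add: comb)
    then show "\<forall>i\<in>I. c i = 0" using v(1) by (auto simp: indep_fam_def)
  qed
  show "pentagon_coords B I (\<lambda>i. f (a i)) (\<lambda>i. f (b i)) n m u e s"
  proof unfold_locales
    show "unity B \<noteq> 0" using nontrivial fz one unity_closed by metis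
    show "indep_fam B I (\<lambda>i. f (a i))" "indep_fam B I (\<lambda>i. f (b i))"
      by (rule indep[OF a_indep] indep[OF b_indep]; simp)+
    show "f (a i) \<in> carrier B" "f (b i) \<in> carrier B" if "i \<in> I" for i
      using that linear_onD(1)[OF lin] by simp_all
    show "mul B (f (a i)) (f (a j)) = (\<Sum>l\<in>I. scl B (n i j l) (f (a l)))" if "i \<in> I" "j \<in> I" for i j
      using that by (simp add: fm[symmetric] a_a comb)
    show "mul B (f (b i)) (f (b j)) = (\<Sum>l\<in>I. scl B (m i j l) (f (b l)))" if "i \<in> I" "j \<in> I" for i j
      using that by (simp add: fm[symmetric] b_b comb)
    show "unity B = (\<Sum>i\<in>I. scl B (u i) (f (a i)))"
      unfolding one[symmetric] by (subst one_a) (simp add: comb)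
    show "unity B = (\<Sum>i\<in>I. scl B (e i) (f (b i)))"
      unfolding one[symmetric] by (subst one_b) (simp add: comb)
    show "mul B (f (a l)) (f (b p)) = (\<Sum>i\<in>I. \<Sum>j\<in>I. \<Sum>k\<in>I. scl B (m j k l * n i j p) (mul B (f (b i)) (f (a k))))"
      if "l \<in> I" "p \<in> I" for l p
      using that by (simp add: fm[symmetric] a_b fsum linear_onD(3)[OF lin] cong: sum.cong_simp)
    have Sa: "(\<Sum>k\<in>I. scl B (s k j) (f (a k))) = f (Sa j)" for j
      unfolding Sa_def by (simp add: comb)
    have Sb: "(\<Sum>k\<in>I. scl B (s j k) (f (b k))) = f (Sb j)" for j
      unfolding Sb_def by (simp add: comb)
    show "mul B (\<Sum>k\<in>I. scl B (s k j) (f (a k))) (\<Sum>k\<in>I. scl B (s k i) (f (a k))) =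
        (\<Sum>l\<in>I. scl B (n i j l) (\<Sum>k\<in>I. scl B (s k l) (f (a k))))" if "i \<in> I" "j \<in> I" for i j
      unfolding Sa using that by (simp add: fm[symmetric] Sa_Sa' comb)
    show "mul B (\<Sum>k\<in>I. scl B (s j k) (f (b k))) (\<Sum>k\<in>I. scl B (s i k) (f (b k))) =
        (\<Sum>l\<in>I. scl B (m i j l) (\<Sum>k\<in>I. scl B (s l k) (f (b k))))" if "i \<in> I" "j \<in> I" for i j
      unfolding Sb using that by (simp add: fm[symmetric] Sb_Sb' comb)
  qed (use fin s_left s_right in simp_all)
  then interpret C: pentagon_coords B I "\<lambda>i. f (a i)" "\<lambda>i. f (b i)" n m u e s .
  have bl: "bilinear_on A A (tensor_space B B) (\<lambda>v w. tensor B B (f v) (f w))"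
    using linear_onD[OF lin]
    by (auto intro!: bilinear_onI linear_onI simp: tensor_add_left tensor_add_right tensor_scl_left tensor_scl_right)
  show "C.RR = tensor_map A A B B f f RR"
    unfolding tensor_map_def C.RR_def by (rule RR_lift[OF k_space_tensor_space bl, symmetric])
qed

lemma (in pentagon_coords) hopf_P_isomorphic:
  fixes B :: "('k, 'b::ab_group_add) kalg"
  assumes B: "k_algebra B" and f: "alg_iso A B f"
  shows "hopf_isomorphic (hopf_P A RR) (hopf_P B (tensor_map A A B B f f RR))"
proof -
  interpret C: pentagon_coords B I "\<lambda>i. f (a i)" "\<lambda>i. f (b i)" n m u e s
    by (rule transport(1)[OF B f])
  obtain g where g: "linear_on (hopf_P A RR) (hopf_P B C.RR) g" "\<And>i. i \<in> I \<Longrightarrow> g (a i) = f (a i)"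
    by (rule linear_extension[OF P.space C.P.space P.basis, where w = "\<lambda>i. f (a i)"]) (rule C.P.v_closed, assumption, blast)
  have "hopf_iso (hopf_P A RR) (hopf_P B C.RR) g"
    by (rule hopf_coords_iso[OF hopf_P_coords C.hopf_P_coords g(1)]) (rule g(2))
  then show ?thesis
    unfolding hopf_isomorphic_def transport(2)[OF B f] by blast
qed

text \<open>Conjugating R by \<open>w \<otimes> w\<close> amounts to applying the inner automorphism
  of \<open>w\<close> to both legs.\<close>

lemma (in pentagon_coords) hopf_P_conj:
  assumes w: "w \<in> Units (mult_monoid A)"
  shows "hopf_isomorphic (hopf_P A RR) (hopf_P A (conj_tens A w RR))"
proof -
  define v where "v = inv\<^bsub>mult_monoid A\<^esub> w"
  have v: "w \<in> carrier A" "v \<in> carrier A" "mul A w v = unity A" "mul A v w = unity A"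
    using monoid.Units_inv_closed[OF monoid w] monoid.Units_r_inv[OF monoid w] monoid.Units_l_inv[OF monoid w]
      monoid.Units_closed[OF monoid w] by (simp_all add: v_def)
  have wv: "mul A w (mul A v x) = x" "mul A v (mul A w x) = x" if "x \<in> carrier A" for x
    using v that by (simp_all add: mul_assoc[symmetric])
  define f where "f x = mul A (mul A w x) v" for x
  have lin: "linear_on A A f"
    unfolding f_def by (rule linear_on_comp[OF linear_mul_left[OF v(1)] linear_mul_right[OF v(2)]])
  have bij: "bij_betw f (carrier A) (carrier A)"
    by (rule bij_betwI[where g = "\<lambda>x. mul A (mul A v x) w"]) (use v in \<open>auto simp: f_def mul_assoc wv\<close>)
  have iso: "alg_iso A A f"
    using lin bij v by (auto simp: alg_iso_def alg_hom_def f_def mul_assoc wv)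
  interpret C: pentagon_coords A I "\<lambda>i. f (a i)" "\<lambda>i. f (b i)" n m u e s
    by (rule transport(1)[OF k_algebra_axioms iso])
  have inv: "tens_inv A (tensor A A w w) = tensor A A v v"
    unfolding tens_inv_def
    by (rule monoid.inv_unique'[OF T.monoid, symmetric]) (simp_all add: v AA.tensor_alg_mul)
  have "conj_tens A w RR = C.RR"
    unfolding conj_tens_def Let_def inv C.RR_def RR_def
    using v by (simp add: T.mul_sum_left T.mul_sum_right AA.tensor_alg_mul f_def cong: sum.cong_simp)
  then have "conj_tens A w RR = tensor_map A A A A f f RR"
    unfolding transport(2)[OF k_algebra_axioms iso] .
  then show ?thesis using hopf_P_isomorphic[OF k_algebra_axioms iso] by simp
qed

theorem theorem2p1:
  fixes A :: "('k::field, 'a::ab_group_add) kalg"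
    and R :: "('a \<Rightarrow> 'a \<Rightarrow> 'k) \<Rightarrow> 'k"
  assumes "k_algebra A"
    and "R \<in> carrier (tensor_alg A A)"
    and "R \<noteq> 0"
    and "R \<in> Units (mult_monoid (tensor_alg A A))"
    and "unitary A R"
    and "pentagon A R"
  shows
    "(subalgebra A (left_coeff A R) \<and> subalgebra A (right_coeff A R) \<and>
      hopf_algebra (hopf_P A R) \<and> hopf_algebra (hopf_H A R) \<and>
      fin_dim (generated_PH A R) \<and> kdim (generated_PH A R) \<le> (tensor_length A R)^2)
   \<and> hopf_iso (dual_hopf (hopf_P A R)) (hopf_H A R) (coeff_map A R)
   \<and> (k_algebra (heisenberg (hopf_P A R)) \<and>
      alg_hom (heisenberg (hopf_P A R)) A (heisenberg_map A R) \<and>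
      (\<forall>B. is_basis (hopf_P A R) B \<longrightarrow>
         R = tensor_map (heisenberg (hopf_P A R)) (heisenberg (hopf_P A R)) A A
               (heisenberg_map A R) (heisenberg_map A R)
               (heisenberg_canonical (hopf_P A R) B)))
   \<and> (right_module_iso (alg_P A R)
        (tensor_space (right_invariants A R) (alg_P A R))
        (\<lambda>t y. tensor_lift (right_invariants A R) (alg_P A R)
                 (\<lambda>a x. tensor (right_invariants A R) (alg_P A R) a (mul A x y)) t)
        A (mul A)
        (tensor_lift (right_invariants A R) (alg_P A R) (mul A)) \<and>
      left_module_iso (alg_H A R)
        (tensor_space (alg_H A R) (left_invariants A R))
        (\<lambda>y t. tensor_lift (alg_H A R) (left_invariants A R)
                 (\<lambda>h a. tensor (alg_H A R) (left_invariants A R) (mul A y h) a) t)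
        A (mul A)
        (tensor_lift (alg_H A R) (left_invariants A R) (mul A)) \<and>
      free_right_module (alg_P A R) A (mul A) \<and>
      free_left_module (alg_H A R) A (mul A) \<and>
      (fin_dim A \<longrightarrow>
         kdim (alg_P A R) = kdim (alg_H A R) \<and>
         rat_of_nat (kdim (alg_H A R)) = rat_of_nat (kdim A) / rat_of_nat (kdim (left_invariants A R)) \<and>
         rat_of_nat (kdim A) / rat_of_nat (kdim (left_invariants A R)) =
           rat_of_nat (kdim A) / rat_of_nat (kdim (right_invariants A R))))
   \<and> ((\<forall>(B :: ('k, 'b::ab_group_add) kalg) f. k_algebra B \<and> alg_iso A B f \<longrightarrow>
         hopf_isomorphic (hopf_P A R) (hopf_P B (tensor_map A A B B f f R))) \<and>
      (\<forall>u \<in> Units (mult_monoid A). hopf_isomorphic (hopf_P A R) (hopf_P A (conj_tens A u R))))"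
proof -
  \<comment> \<open>The index set has exactly \<open>tensor_length A R\<close> elements, which is
    where the bound on the dimension of the generated subalgebra comes from.\<close>
  obtain a b n m u e s where C: "pentagon_coords A {..<tensor_length A R} a b n m u e s"
    and R: "R = (\<Sum>i<tensor_length A R. tensor A A (a i) (b i))"
    using pentagon_coordinates[OF assms] by blast
  interpret C: pentagon_coords A "{..<tensor_length A R}" a b n m u e s by (rule C)
  obtain t where "\<And>i k. i \<in> {..<tensor_length A R} \<Longrightarrow> k \<in> {..<tensor_length A R} \<Longrightarrow>
      (\<Sum>j<tensor_length A R. t i j * s j k) = (if i = k then 1 else 0)"
    "\<And>i k. i \<in> {..<tensor_length A R} \<Longrightarrow> k \<in> {..<tensor_length A R} \<Longrightarrow>
      (\<Sum>j<tensor_length A R. s i j * t j k) = (if i = k then 1 else 0)"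
    using C.s_invertible by blast
  then interpret C: pentagon_coords_inv A "{..<tensor_length A R}" a b n m u e s t
    by unfold_locales
  have RR: "C.RR = R" unfolding C.RR_def by (rule R[symmetric])
  show ?thesis
    using C.subalgebra_P C.subalgebra_H C.P.is_hopf hopf_coords.is_hopf[OF C.hopf_H_coords] C.generated
      C.coeff_map_iso C.k_algebra_heisenberg C.heisenberg_map_hom C.canonical C.right_iso C.left_iso
      C.free_right C.free_left C.dimensions C.hopf_P_isomorphic C.hopf_P_conj
    unfolding RR card_lessThan by (intro conjI allI ballI impI) blast+
qed

end
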